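(* Let $H$, $H_h$ ($h>0$) and $\gamma$ be the operators and the exponent arising from admissible data $(\varphi_0,\psi_0,V,G_0)$. Let $\mu>0$ be such that $(-\infty,-\mu]\subseteq\rho(H)\cap\rho(H_h)$ for all $h>0$. Then there exist $C>0$ and $h_0>0$ such that $$\mathrm d_{\mathrm H}\bigl(\sigma((H_h+\mu I_h)^{-1}),\,\sigma((H+\mu I)^{-1})\bigr)\le C h^\gamma,\qquad 0<h\le h_0 .$$
   Context: $\mathrm d_{\mathrm H}(X,Y)$ is the Hausdorff distance between compact non-empty sets $X,Y\subset\mathbf C$; $\sigma(\cdot)$ and $\rho(\cdot)$ denote spectrum and resolvent set. Spaces and Fourier transforms. Fix $d\ge1$. $\mathcal H=L^2(\mathbf R^d)$, with inner product $\langle\cdot,\cdot\rangle$ linear in the second argument and identity $I$. For $h>0$, $\mathcal H_h=\ell^2(h\mathbf Z^d)$ is the space of $u_h\colon\mathbf Z^d\to\mathbf C$ with norm $\|u_h\|=(h^d\sum_{n\in\mathbf Z^d}|u_h(n)|^2)^{1/2}<\infty$, with identity $I_h$. $\hat f(\xi)=(\mathcal F f)(\xi)=(2\pi)^{-d/2}\int_{\mathbf R^d} e^{-ix\cdot\xi}f(x)\,dx$ is the unitary Fourier transform. With $\mathbf T_h^d=[-\pi/h,\pi/h]^d$, the unitary discrete Fourier transform $\mathsf F_h\colon\mathcal H_h\to L^2(\mathbf T_h^d)$ is $(\mathsf F_hu_h)(\xi)=\frac{h^d}{(2\pi)^{d/2}}\sum_{n\in\mathbf Z^d}u_h(n)e^{-ihn\cdot\xi}$.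 Riesz sequences. Sequences $\{u_k\},\{v_k\}$ indexed by $\mathbf Z^d$ in a Hilbert space are biorthogonal if $\langle u_k,v_n\rangle=\delta_{k,n}$. $\{u_k\}$ is a Riesz sequence if there are $A,B>0$ with $A\sum|c_k|^2\le\|\sum c_ku_k\|^2\le B\sum|c_k|^2$ for all $\{c_k\}\in\ell^2(\mathbf Z^d)$. Admissible data $(\varphi_0,\psi_0,V,G_0)$ means all of the following. (a) $\varphi_0,\psi_0\in\mathcal H$; the sequences $\{\varphi_0(\cdot-k)\}_{k\in\mathbf Z^d}$ and $\{\psi_0(\cdot-k)\}_{k\in\mathbf Z^d}$ are biorthogonal Riesz sequences in $\mathcal H$; $\hat\varphi_0,\hat\psi_0$ are essentially bounded and supported in $[-3\pi/2,3\pi/2]^d$; and there is $c_0>0$ with $|\hat\varphi_0(\xi)|\ge c_0$ and $|\hat\psi_0(\xi)|\ge c_0$ for $\xi\in[-\pi/2,\pi/2]^d$. (b) $V\colon\mathbf R^d\to\mathbf R$ is bounded and Hölder continuous with exponent $\theta\in(0,1]$. If $V\not\equiv0$, there are $\tau>d$ and $C'>0$ with $|\psi_0(x)|\le C'(1+|x|)^{-\tau}$ for all $x\in\mathbf R^d$, and $\theta'$ is defined by $\frac1{\theta'}=\frac1\theta+\frac1{\tau-d}$. (c) $G_0\colon\mathbf R^d\to\mathbf R$ satisfies one of: (i) (parameters $\alpha,\beta$) $\alpha>\frac12$, $\beta>-\frac12$, $\alpha\le1+\beta<2\alpha\le3+\beta$; $G_0\in C^1(\mathbf R^d)$ is real-valued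 and non-negative; $G_0(0)=0$; there are $c>0$, $c_0>0$ with $G_0(\xi)\ge c|\xi|^\alpha$ for $|\xi|\ge c_0$; for some $c'>0$, $|\nabla G_0(\xi)|\le c'|\xi|^\beta$ for all $\xi$; $G_0(\xi_1,\dots,\xi_d)=G_0(|\xi_1|,\dots,|\xi_d|)$ for all $\xi$. (ii) (parameters $\alpha,\tilde\beta$) $\frac12<\alpha\le1$, $\tilde\beta\ge0$, $1+\tilde\beta<2\alpha$; $G_0(\xi)=|\xi|^\alpha+\widetilde G_0(\xi)$ with $\widetilde G_0\in C^1(\mathbf R^d)$ real-valued and non-negative; $\widetilde G_0(0)=0$; there are $c>0$, $c_0>0$ with $|\nabla\widetilde G_0(\xi)|\le c|\xi|^{\tilde\beta}$ for $|\xi|\ge c_0$; $\widetilde G_0(\xi_1,\dots,\xi_d)=\widetilde G_0(|\xi_1|,\dots,|\xi_d|)$ for all $\xi$. (iii) $G_0(\xi)=|\xi|^\alpha$ with $0<\alpha\le1$. The exponent is $\gamma=\min\{2\alpha-1,2\alpha-\beta-1,\theta'\}$ in case (i), $\gamma=\min\{2\alpha-\tilde\beta-1,\theta'\}$ in case (ii), $\gamma=\min\{\alpha,\theta'\}$ in case (iii), with $\theta'$ omitted if $V\equiv0$. Operators. $G_{0,h}(\xi)=G_0(\frac2h\sin(\frac h2\xi_1),\dots,\frac2h\sin(\frac h2\xi_d))$; $H_0=\mathcal F^*G_0(\cdot)\mathcal F$ on $\mathcal H$ with domain $\{f:G_0\hat f\in L^2\}$; $H_{0,h}=\mathsf F_h^*G_{0,h}(\cdot)\mathsf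 F_h$ on $\mathcal H_h$ ($G(\cdot)$ denotes multiplication by $G$). $V$ acts by multiplication, $V_h$ is multiplication by $V_h(k)=V(hk)$, $k\in\mathbf Z^d$. $H=H_0+V$ (self-adjoint, domain that of $H_0$) and $H_h=H_{0,h}+V_h$ (bounded, self-adjoint). Such $\mu$ exist since $H_0,H_{0,h}\ge0$ and $V$ is bounded. *)

theory Defs
  imports "HOL-Analysis.Analysis"
begin

section \<open>The Hilbert space of square-integrable functions over a measure\<close>

text \<open>Elements of \<open>L\<^sup>2(M)\<close> are represented by functions; two functions represent the same
  element iff they agree almost everywhere. All notions below respect this identification.\<close>

definition L2 :: "'a measure \<Rightarrow> ('a \<Rightarrow> complex) set" where
  "L2 M = {f \<in> borel_measurable M. integrable M (\<lambda>x. (cmod (f x))\<^sup>2)}"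

definition L2_norm :: "'a measure \<Rightarrow> ('a \<Rightarrow> complex) \<Rightarrow> real" where
  "L2_norm M f = sqrt (\<integral>x. (cmod (f x))\<^sup>2 \<partial>M)"

definition L2_inner :: "'a measure \<Rightarrow> ('a \<Rightarrow> complex) \<Rightarrow> ('a \<Rightarrow> complex) \<Rightarrow> complex" where
  "L2_inner M f g = (\<integral>x. cnj (f x) * g x \<partial>M)"

definition L2_tendsto ::
  "'a measure \<Rightarrow> 'i filter \<Rightarrow> ('i \<Rightarrow> 'a \<Rightarrow> complex) \<Rightarrow> ('a \<Rightarrow> complex) \<Rightarrow> bool" where
  "L2_tendsto M F u f \<longleftrightarrow>
     f \<in> L2 M \<and> (\<forall>\<^sub>F i in F. u i \<in> L2 M) \<and>
     ((\<lambda>i. L2_norm M (\<lambda>x. u i x - f x)) \<longlongrightarrow> 0) F"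

definition L2_has_sum ::
  "'a measure \<Rightarrow> ('k \<Rightarrow> 'a \<Rightarrow> complex) \<Rightarrow> ('a \<Rightarrow> complex) \<Rightarrow> bool" where
  "L2_has_sum M u f \<longleftrightarrow>
     L2_tendsto M (finite_subsets_at_top UNIV) (\<lambda>A x. \<Sum>k\<in>A. u k x) f"

definition biorthogonal ::
  "'a measure \<Rightarrow> ('k \<Rightarrow> 'a \<Rightarrow> complex) \<Rightarrow> ('k \<Rightarrow> 'a \<Rightarrow> complex) \<Rightarrow> bool" where
  "biorthogonal M u v \<longleftrightarrow> (\<forall>k n. L2_inner M (u k) (v n) = (if k = n then 1 else 0))"

definition riesz_sequence :: "'a measure \<Rightarrow> ('k \<Rightarrow> 'a \<Rightarrow> complex) \<Rightarrow> bool" where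
  "riesz_sequence M u \<longleftrightarrow> (\<forall>k. u k \<in> L2 M) \<and>
     (\<exists>A>0. \<exists>B>0. \<forall>c :: 'k \<Rightarrow> complex.
        (\<lambda>k. (cmod (c k))\<^sup>2) summable_on UNIV \<longrightarrow>
        (\<exists>s. L2_has_sum M (\<lambda>k x. c k * u k x) s \<and>
             A * (\<Sum>\<^sub>\<infinity>k. (cmod (c k))\<^sup>2) \<le> (L2_norm M s)\<^sup>2 \<and>
             (L2_norm M s)\<^sup>2 \<le> B * (\<Sum>\<^sub>\<infinity>k. (cmod (c k))\<^sup>2)))"


section \<open>Operators, resolvent set and spectrum\<close>

text \<open>A (possibly unbounded) operator in \<open>L\<^sup>2(M)\<close> is given by its graph, pulled back to
  representatives: a set of pairs \<open>(f, T f)\<close> closed under changing both components on null sets.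
  The composition \<open>T\<close> after \<open>S\<close> is \<open>S O T\<close>, and the inverse is the converse relation.\<close>

type_synonym 'a operator = "(('a \<Rightarrow> complex) \<times> ('a \<Rightarrow> complex)) set"

text \<open>Multiplication by \<open>a\<close> on its maximal domain; \<open>mult_op M (\<lambda>_. z)\<close> is \<open>z I\<close>.\<close>

definition mult_op :: "'a measure \<Rightarrow> ('a \<Rightarrow> complex) \<Rightarrow> 'a operator" where
  "mult_op M a = {(f, g). f \<in> L2 M \<and> g \<in> L2 M \<and> (AE x in M. g x = a x * f x)}"

definition op_plus :: "'a operator \<Rightarrow> 'a operator \<Rightarrow> 'a operator" where
  "op_plus S T = {(f, \<lambda>x. g x + k x) | f g k. (f, g) \<in> S \<and> (f, k) \<in> T}"

definition bounded_everywhere :: "'a measure \<Rightarrow> 'a operator \<Rightarrow> bool" where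
  "bounded_everywhere M T \<longleftrightarrow>
     (\<forall>f \<in> L2 M. \<exists>g. (f, g) \<in> T) \<and>
     (\<forall>f g g'. (f, g) \<in> T \<longrightarrow> (f, g') \<in> T \<longrightarrow> (AE x in M. g x = g' x)) \<and>
     (\<exists>K. \<forall>(f, g) \<in> T. L2_norm M g \<le> K * L2_norm M f)"

text \<open>\<open>T - z I\<close> is a bijection of the domain of \<open>T\<close> onto \<open>L\<^sup>2(M)\<close> with bounded inverse.\<close>

definition resolvent_set :: "'a measure \<Rightarrow> 'a operator \<Rightarrow> complex set" where
  "resolvent_set M T =
     {z. bounded_everywhere M ((op_plus T (mult_op M (\<lambda>_. - z)))\<inverse>)}"

definition spectrum :: "'a measure \<Rightarrow> 'a operator \<Rightarrow> complex set" where
  "spectrum M T = - resolvent_set M T"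

definition shifted_inverse :: "'a measure \<Rightarrow> 'a operator \<Rightarrow> real \<Rightarrow> 'a operator" where
  "shifted_inverse M T \<mu> = (op_plus T (mult_op M (\<lambda>_. complex_of_real \<mu>)))\<inverse>"

text \<open>Intended for compact non-empty sets, where the suprema and infima are those of
  bounded non-empty sets.\<close>

definition hausdorff_dist :: "'a::metric_space set \<Rightarrow> 'a set \<Rightarrow> real" where
  "hausdorff_dist X Y = max (SUP x\<in>X. infdist x Y) (SUP y\<in>Y. infdist y X)"


section \<open>Spaces and Fourier transforms\<close>

definition vec_of_int :: "int ^ 'n \<Rightarrow> real ^ 'n" where
  "vec_of_int k = (\<chi> i. real_of_int (k $ i))"

definition cube :: "real \<Rightarrow> (real ^ 'n) set" where
  "cube r = cbox (\<chi> i. - r) (\<chi> i. r)"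

text \<open>\<open>L2 (grid_measure h)\<close> is \<open>\<ell>\<^sup>2(h \<int>\<^sup>d)\<close>: every grid point has mass \<open>h\<^sup>d\<close>.\<close>

definition grid_measure :: "real \<Rightarrow> (int ^ 'n) measure" where
  "grid_measure h = density (count_space UNIV) (\<lambda>_. ennreal (h ^ CARD('n)))"

lemma L2_grid_measure:
  fixes u :: "int ^ 'n \<Rightarrow> complex"
  assumes "h > 0"
  shows "u \<in> L2 (grid_measure h) \<longleftrightarrow> (\<lambda>n. (cmod (u n))\<^sup>2) summable_on UNIV"
    and "L2_norm (grid_measure h) u = sqrt (h ^ CARD('n) * (\<Sum>\<^sub>\<infinity>n. (cmod (u n))\<^sup>2))"
proof -
  let ?q = "\<lambda>n. (cmod (u n))\<^sup>2" and ?N = "count_space (UNIV :: (int ^ 'n) set)"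
  have h: "h ^ CARD('n) > 0"
    using assms by simp
  have int: "integrable ?N ?q \<longleftrightarrow> ?q summable_on UNIV"
    using abs_summable_equivalent[of ?q UNIV] by (simp add: abs_summable_on_def)
  have "integrable (grid_measure h) ?q \<longleftrightarrow> integrable ?N (\<lambda>n. h ^ CARD('n) *\<^sub>R ?q n)"
    unfolding grid_measure_def using h by (intro integrable_density) auto
  also have "\<dots> \<longleftrightarrow> integrable ?N ?q"
    using assms by simp
  finally show "u \<in> L2 (grid_measure h) \<longleftrightarrow> ?q summable_on UNIV"
    using int by (simp add: L2_def grid_measure_def)
  have "integral\<^sup>L ?N ?q = (\<Sum>\<^sub>\<infinity>n. ?q n)"
  proof (cases "?q summable_on UNIV")
    case True
    then show ?thesis
      using infsetsum_infsum[of ?q UNIV] abs_summable_equivalent[of ?q UNIV]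
      by (simp add: infsetsum_def)
  next
    case False
    then show ?thesis
      using int by (simp add: not_integrable_integral_eq infsum_not_exists)
  qed
  moreover have "integral\<^sup>L (grid_measure h) ?q = integral\<^sup>L ?N (\<lambda>n. h ^ CARD('n) *\<^sub>R ?q n)"
    unfolding grid_measure_def using h by (intro integral_density) auto
  ultimately show "L2_norm (grid_measure h) u = sqrt (h ^ CARD('n) * (\<Sum>\<^sub>\<infinity>n. ?q n))"
    by (simp add: L2_norm_def)
qed

definition torus_measure :: "real \<Rightarrow> (real ^ 'n) measure" where
  "torus_measure h = restrict_space lborel (cube (pi / h))"

definition fourier_integral :: "(real ^ 'n \<Rightarrow> complex) \<Rightarrow> real ^ 'n \<Rightarrow> complex" where
  "fourier_integral f \<xi> =
     complex_of_real ((2 * pi) powr (- real CARD('n) / 2)) *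
     (\<integral>x. cis (- (x \<bullet> \<xi>)) * f x \<partial>lborel)"

text \<open>The graph of the unitary Fourier transform: the continuous extension to \<open>L\<^sup>2\<close> of the
  Fourier integral on \<open>L\<^sup>1 \<inter> L\<^sup>2\<close>.\<close>

definition fourier :: "(real ^ 'n) operator" where
  "fourier = {(f, g). \<exists>\<phi> :: nat \<Rightarrow> real ^ 'n \<Rightarrow> complex.
     (\<forall>n. integrable lborel (\<phi> n)) \<and>
     L2_tendsto lborel sequentially \<phi> f \<and>
     L2_tendsto lborel sequentially (\<lambda>n. fourier_integral (\<phi> n)) g}"

text \<open>The graph of the discrete Fourier transform. Its defining series converges in
  \<open>L\<^sup>2\<close> of the torus, in general not pointwise.\<close>

definition discrete_fourier ::
  "real \<Rightarrow> ((int ^ 'n \<Rightarrow> complex) \<times> (real ^ 'n \<Rightarrow> complex)) set" where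
  "discrete_fourier h = {(u, g). u \<in> L2 (grid_measure h) \<and>
     L2_has_sum (torus_measure h)
       (\<lambda>n \<xi>. complex_of_real (h ^ CARD('n) / (2 * pi) powr (real CARD('n) / 2)) *
               (u n * cis (- (h * (vec_of_int n \<bullet> \<xi>))))) g}"


section \<open>The operators\<close>

text \<open>Both Fourier transforms are unitary, so their adjoints are their inverses.\<close>

definition H0_op :: "(real ^ 'n \<Rightarrow> real) \<Rightarrow> (real ^ 'n) operator" where
  "H0_op G0 = fourier O mult_op lborel (\<lambda>\<xi>. complex_of_real (G0 \<xi>)) O fourier\<inverse>"

definition H_op :: "(real ^ 'n \<Rightarrow> real) \<Rightarrow> (real ^ 'n \<Rightarrow> real) \<Rightarrow> (real ^ 'n) operator" where
  "H_op G0 V = op_plus (H0_op G0) (mult_op lborel (\<lambda>x. complex_of_real (V x)))"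

definition discrete_symbol :: "(real ^ 'n \<Rightarrow> real) \<Rightarrow> real \<Rightarrow> real ^ 'n \<Rightarrow> real" where
  "discrete_symbol G0 h \<xi> = G0 (\<chi> i. 2 / h * sin (h / 2 * \<xi> $ i))"

definition H0h_op :: "(real ^ 'n \<Rightarrow> real) \<Rightarrow> real \<Rightarrow> (int ^ 'n) operator" where
  "H0h_op G0 h =
     discrete_fourier h
     O mult_op (torus_measure h) (\<lambda>\<xi>. complex_of_real (discrete_symbol G0 h \<xi>))
     O (discrete_fourier h)\<inverse>"

definition Hh_op ::
  "(real ^ 'n \<Rightarrow> real) \<Rightarrow> (real ^ 'n \<Rightarrow> real) \<Rightarrow> real \<Rightarrow> (int ^ 'n) operator" where
  "Hh_op G0 V h =
     op_plus (H0h_op G0 h)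
       (mult_op (grid_measure h) (\<lambda>k. complex_of_real (V (h *\<^sub>R vec_of_int k))))"


section \<open>Admissible data\<close>

text \<open>Bounds on Fourier transforms hold almost everywhere, these being elements of \<open>L\<^sup>2\<close>.\<close>

definition admissible_generators ::
  "(real ^ 'n \<Rightarrow> complex) \<Rightarrow> (real ^ 'n \<Rightarrow> complex) \<Rightarrow> bool" where
  "admissible_generators \<phi>0 \<psi>0 \<longleftrightarrow>
     \<phi>0 \<in> L2 lborel \<and> \<psi>0 \<in> L2 lborel \<and>
     riesz_sequence lborel (\<lambda>(k :: int ^ 'n) x. \<phi>0 (x - vec_of_int k)) \<and>
     riesz_sequence lborel (\<lambda>(k :: int ^ 'n) x. \<psi>0 (x - vec_of_int k)) \<and>
     biorthogonal lborel (\<lambda>(k :: int ^ 'n) x. \<phi>0 (x - vec_of_int k))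
                         (\<lambda>(k :: int ^ 'n) x. \<psi>0 (x - vec_of_int k)) \<and>
     (\<exists>\<phi>h \<psi>h. (\<phi>0, \<phi>h) \<in> fourier \<and> (\<psi>0, \<psi>h) \<in> fourier \<and>
        (\<exists>B. AE \<xi> in lborel. cmod (\<phi>h \<xi>) \<le> B \<and> cmod (\<psi>h \<xi>) \<le> B) \<and>
        (AE \<xi> in lborel. \<xi> \<notin> cube (3 * pi / 2) \<longrightarrow> \<phi>h \<xi> = 0 \<and> \<psi>h \<xi> = 0) \<and>
        (\<exists>c0>0. AE \<xi> in lborel. \<xi> \<in> cube (pi / 2) \<longrightarrow>
           c0 \<le> cmod (\<phi>h \<xi>) \<and> c0 \<le> cmod (\<psi>h \<xi>)))"

definition admissible_potential ::
  "real \<Rightarrow> real \<Rightarrow> (real ^ 'n \<Rightarrow> complex) \<Rightarrow> (real ^ 'n \<Rightarrow> real) \<Rightarrow> bool" where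
  "admissible_potential \<theta> \<tau> \<psi>0 V \<longleftrightarrow>
     bounded (range V) \<and> 0 < \<theta> \<and> \<theta> \<le> 1 \<and>
     (\<exists>K. \<forall>x y. \<bar>V x - V y\<bar> \<le> K * norm (x - y) powr \<theta>) \<and>
     (V \<noteq> (\<lambda>_. 0) \<longrightarrow>
        real CARD('n) < \<tau> \<and>
        (\<exists>C'>0. \<forall>x. cmod (\<psi>0 x) \<le> C' * (1 + norm x) powr (- \<tau>)))"

definition is_C1_gradient :: "('a::real_inner \<Rightarrow> real) \<Rightarrow> ('a \<Rightarrow> 'a) \<Rightarrow> bool" where
  "is_C1_gradient G g \<longleftrightarrow> (\<forall>\<xi>. GDERIV G \<xi> :> g \<xi>) \<and> continuous_on UNIV g"

definition abs_symmetric :: "(real ^ 'n \<Rightarrow> real) \<Rightarrow> bool" where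
  "abs_symmetric G \<longleftrightarrow> (\<forall>\<xi>. G \<xi> = G (\<chi> i. \<bar>\<xi> $ i\<bar>))"

text \<open>The three classes of symbols with their parameters:
  \<open>Case_i \<alpha> \<beta>\<close>, \<open>Case_ii \<alpha> \<beta>'\<close> (with \<open>\<beta>'\<close> the exponent for the \<open>C\<^sup>1\<close> part) and \<open>Case_iii \<alpha>\<close>.\<close>

datatype symbol_class = Case_i real real | Case_ii real real | Case_iii real

text \<open>In \<open>Case_i\<close> the gradient bound at the origin is left out, since \<open>0 powr \<beta> = 0\<close> also for
  \<open>\<beta> \<le> 0\<close>. Nothing is lost: the origin is a minimum of \<open>G0\<close>, so the gradient vanishes there.\<close>

fun admissible_symbol :: "symbol_class \<Rightarrow> (real ^ 'n \<Rightarrow> real) \<Rightarrow> bool" where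
  "admissible_symbol (Case_i \<alpha> \<beta>) G0 \<longleftrightarrow>
     \<alpha> > 1/2 \<and> \<beta> > -1/2 \<and> \<alpha> \<le> 1 + \<beta> \<and> 1 + \<beta> < 2 * \<alpha> \<and> 2 * \<alpha> \<le> 3 + \<beta> \<and>
     (\<forall>\<xi>. 0 \<le> G0 \<xi>) \<and> G0 0 = 0 \<and>
     (\<exists>c>0. \<exists>c0>0. \<forall>\<xi>. c0 \<le> norm \<xi> \<longrightarrow> c * norm \<xi> powr \<alpha> \<le> G0 \<xi>) \<and>
     (\<exists>g. is_C1_gradient G0 g \<and>
        (\<exists>c'>0. \<forall>\<xi>. \<xi> \<noteq> 0 \<longrightarrow> norm (g \<xi>) \<le> c' * norm \<xi> powr \<beta>)) \<and>
     abs_symmetric G0"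
| "admissible_symbol (Case_ii \<alpha> \<beta>') G0 \<longleftrightarrow>
     1/2 < \<alpha> \<and> \<alpha> \<le> 1 \<and> 0 \<le> \<beta>' \<and> 1 + \<beta>' < 2 * \<alpha> \<and>
     (\<exists>G1. (\<forall>\<xi>. G0 \<xi> = norm \<xi> powr \<alpha> + G1 \<xi>) \<and>
        (\<forall>\<xi>. 0 \<le> G1 \<xi>) \<and> G1 0 = 0 \<and>
        (\<exists>g. is_C1_gradient G1 g \<and>
           (\<exists>c>0. \<exists>c0>0. \<forall>\<xi>. c0 \<le> norm \<xi> \<longrightarrow> norm (g \<xi>) \<le> c * norm \<xi> powr \<beta>')) \<and>
        abs_symmetric G1)"
| "admissible_symbol (Case_iii \<alpha>) G0 \<longleftrightarrow>
     0 < \<alpha> \<and> \<alpha> \<le> 1 \<and> (\<forall>\<xi>. G0 \<xi> = norm \<xi> powr \<alpha>)"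

definition admissible_data ::
  "symbol_class \<Rightarrow> real \<Rightarrow> real \<Rightarrow> (real ^ 'n \<Rightarrow> complex) \<Rightarrow> (real ^ 'n \<Rightarrow> complex) \<Rightarrow>
   (real ^ 'n \<Rightarrow> real) \<Rightarrow> (real ^ 'n \<Rightarrow> real) \<Rightarrow> bool" where
  "admissible_data p \<theta> \<tau> \<phi>0 \<psi>0 V G0 \<longleftrightarrow>
     admissible_generators \<phi>0 \<psi>0 \<and> admissible_potential \<theta> \<tau> \<psi>0 V \<and> admissible_symbol p G0"

fun symbol_exponent :: "symbol_class \<Rightarrow> real" where
  "symbol_exponent (Case_i \<alpha> \<beta>) = min (2 * \<alpha> - 1) (2 * \<alpha> - \<beta> - 1)"
| "symbol_exponent (Case_ii \<alpha> \<beta>') = 2 * \<alpha> - \<beta>' - 1"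
| "symbol_exponent (Case_iii \<alpha>) = \<alpha>"

text \<open>The solution \<open>\<theta>'\<close> of \<open>1 / \<theta>' = 1 / \<theta> + 1 / (\<tau> - d)\<close>.\<close>

definition potential_exponent :: "nat \<Rightarrow> real \<Rightarrow> real \<Rightarrow> real" where
  "potential_exponent d \<theta> \<tau> = 1 / (1 / \<theta> + 1 / (\<tau> - real d))"

definition rate_exponent :: "symbol_class \<Rightarrow> real \<Rightarrow> real \<Rightarrow> (real ^ 'n \<Rightarrow> real) \<Rightarrow> real" where
  "rate_exponent p \<theta> \<tau> V =
     (if V = (\<lambda>_. 0) then symbol_exponent p
      else min (symbol_exponent p) (potential_exponent CARD('n) \<theta> \<tau>))"

end

theory Submission
  imports Defs "HOL-Probability.Sinc_Integral"
begin

text \<open>Write \<open>R\<close> and \<open>R\<^sub>h\<close> for the two resolvents. The spectra do not depend on the generators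
  \<open>\<phi>0\<close>, \<open>\<psi>0\<close>, so any isometry \<open>J\<close> of the grid space into \<open>L\<^sup>2(\<real>\<^sup>d)\<close> may serve to compare them. If
  \<open>V = 0\<close>, let \<open>J\<close> identify the discrete Fourier transform with the Fourier transform on the torus,
  extended by zero. Otherwise the rate is at most 1, and piecewise constant interpolation is good
  enough: on the torus it multiplies the transform by a product of sinc factors
  \<open>m = 1 + O((h |\<xi>|)\<^sup>2)\<close>. Estimating the quadratic forms on the Fourier side gives
  \<open>J R\<^sub>h - R J = O(h\<^sup>\<gamma>)\<close>, so an approximate eigenvector \<open>w\<close> of \<open>R\<^sub>h\<close> yields the approximate
  eigenvector \<open>J w\<close> of \<open>R\<close>.

  Conversely let \<open>f\<close> be an approximate eigenvector of \<open>R\<close> for \<open>l\<close>. If \<open>l = O(h\<^sup>\<gamma>)\<close>, then \<open>l\<close> is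
  near the point of the spectrum of \<open>R\<^sub>h\<close> that high frequencies produce close to zero. Otherwise
  \<open>f\<close> has little mass at high frequencies and hence overlaps with \<open>J u\<close> for some \<open>u\<close> of norm at
  most that of \<open>f\<close>. Were \<open>l\<close> far from the spectrum of \<open>R\<^sub>h\<close>, one could write \<open>u = (R\<^sub>h - l) w\<close> with
  \<open>w\<close> small, and \<open>\<langle>J u, f\<rangle> = \<langle>(J R\<^sub>h - R J) w, f\<rangle> + \<langle>J w, (R - l) f\<rangle>\<close> would be too small.\<close>

section \<open>Square-integrable functions\<close>

text \<open>The symbols differ by a term that grows like (1 + |xi|^\<alpha>)^2, too large for one
  resolvent to absorb. Hence \<open>core_estimate\<close> tests the difference from both sides: for
  u = R_h w and \<phi> = R g it bounds <g, J u> - <\<phi>, J w>, where \<phi> carries a factor 1 /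
  (1 + G) and u a factor 1 / (1 + G_h), up to the bounded potential. The choice g = J u - R J w then
  makes the tested quantity the squared norm of g. The two embeddings answer to the rate. Step
  functions spill the share 1 - m^2 of the mass at each frequency out of the torus, an amplitude of
  order h |xi|, so they give first order at best; this suffices for V other than 0, when the rate is
  at most \<theta>. For V = 0 rates up to 2 occur, and the sharp cutoff spills nothing. Grid cells
  also prove Plancherel: the transform of a cell is an exponential times a product of sincs, and
  these are orthogonal because the transform of sinc^2, a hat function, vanishes at the relevant
  nonzero integers.\<close>

lemma L2_D:
  assumes "f \<in> L2 M"
  shows "f \<in> borel_measurable M" "integrable M (\<lambda>x. (cmod (f x))\<^sup>2)"
  using assms by (auto simp: L2_def)

lemma borel_measurable_cnj [measurable (raw)]:
  "f \<in> borel_measurable M \<Longrightarrow> (\<lambda>x. cnj (f x)) \<in> borel_measurable M"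
  by (rule borel_measurable_continuous_on[where f = cnj]) (auto intro: continuous_intros)

lemma L2_bound:
  assumes "f \<in> L2 M" "g \<in> borel_measurable M" "AE x in M. cmod (g x) \<le> K * cmod (f x)"
  shows "g \<in> L2 M"
proof -
  have int: "integrable M (\<lambda>x. K\<^sup>2 * (cmod (f x))\<^sup>2)"
    using L2_D[OF assms(1)] by simp
  have le: "AE x in M. norm ((cmod (g x))\<^sup>2) \<le> norm (K\<^sup>2 * (cmod (f x))\<^sup>2)"
    using assms(3)
  proof eventually_elim
    case (elim x)
    then have "(cmod (g x))\<^sup>2 \<le> (K * cmod (f x))\<^sup>2" by (intro power_mono) auto
    then show ?case by (simp add: power_mult_distrib)
  qed
  have "(\<lambda>x. (cmod (g x))\<^sup>2) \<in> borel_measurable M"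
    using assms(2) by measurable
  from Bochner_Integration.integrable_bound[OF int this le]
  have "integrable M (\<lambda>x. (cmod (g x))\<^sup>2)" .
  then show ?thesis using assms by (simp add: L2_def)
qed

lemma L2_scale: "f \<in> L2 M \<Longrightarrow> (\<lambda>x. c * f x) \<in> L2 M"
  by (rule L2_bound[where K = "cmod c"]) (auto simp: norm_mult dest: L2_D)

lemma L2_cnj: "f \<in> L2 M \<Longrightarrow> (\<lambda>x. cnj (f x)) \<in> L2 M"
  by (rule L2_bound[where K = 1]) (auto dest: L2_D)

lemma L2_zero: "(\<lambda>x. 0) \<in> L2 M"
  by (simp add: L2_def)

lemma cmod_add_sq_le: "(cmod (a + b))\<^sup>2 \<le> 2 * (cmod a)\<^sup>2 + 2 * (cmod b)\<^sup>2"
proof -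
  have "(cmod (a + b))\<^sup>2 \<le> (cmod a + cmod b)\<^sup>2"
    by (intro power_mono norm_triangle_ineq) auto
  also have "\<dots> \<le> 2 * (cmod a)\<^sup>2 + 2 * (cmod b)\<^sup>2"
    using sum_squares_bound[of "cmod a" "cmod b"] by (simp add: power2_sum)
  finally show ?thesis .
qed

lemma L2_add:
  assumes "f \<in> L2 M" "g \<in> L2 M"
  shows "(\<lambda>x. f x + g x) \<in> L2 M"
proof -
  have "integrable M (\<lambda>x. 2 * (cmod (f x))\<^sup>2 + 2 * (cmod (g x))\<^sup>2)"
    using L2_D[OF assms(1)] L2_D[OF assms(2)] by simp
  then have "integrable M (\<lambda>x. (cmod (f x + g x))\<^sup>2)"
    by (rule Bochner_Integration.integrable_bound)
       (use L2_D(1)[OF assms(1)] L2_D(1)[OF assms(2)] cmod_add_sq_le in \<open>auto simp: borel_measurable_add\<close>)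
  then show ?thesis
    using L2_D(1)[OF assms(1)] L2_D(1)[OF assms(2)] by (simp add: L2_def borel_measurable_add)
qed

lemma L2_uminus: "f \<in> L2 M \<Longrightarrow> (\<lambda>x. - f x) \<in> L2 M"
  using L2_scale[of f M "-1"] by simp

lemma L2_diff: "f \<in> L2 M \<Longrightarrow> g \<in> L2 M \<Longrightarrow> (\<lambda>x. f x - g x) \<in> L2 M"
  using L2_add[of f M "\<lambda>x. - g x"] L2_uminus[of g M] by simp

lemma L2_sum: "(\<And>i. i \<in> A \<Longrightarrow> f i \<in> L2 M) \<Longrightarrow> (\<lambda>x. \<Sum>i\<in>A. f i x) \<in> L2 M"
  by (induction A rule: infinite_finite_induct) (auto simp: L2_zero L2_add)

lemmas L2_intros = L2_zero L2_scale L2_cnj L2_add L2_diff L2_uminus L2_sum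

lemma L2_cong_AE:
  assumes "f \<in> L2 M" "g \<in> borel_measurable M" "AE x in M. g x = f x"
  shows "g \<in> L2 M"
  by (rule L2_bound[where K = 1, OF assms(1,2)]) (use assms(3) in auto)

section \<open>Norm, inner product and the Cauchy-Schwarz inequality\<close>

lemma L2_norm_nonneg [simp]: "0 \<le> L2_norm M f"
  by (simp add: L2_norm_def)

lemma L2_norm_sq: "(L2_norm M f)\<^sup>2 = (\<integral>x. (cmod (f x))\<^sup>2 \<partial>M)"
  by (simp add: L2_norm_def)

lemma L2_norm_zero [simp]: "L2_norm M (\<lambda>x. 0) = 0"
  by (simp add: L2_norm_def)

lemma L2_norm_cong_AE:
  assumes "f \<in> borel_measurable M" "g \<in> borel_measurable M" "AE x in M. f x = g x"
  shows "L2_norm M f = L2_norm M g"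
  unfolding L2_norm_def using assms by (intro arg_cong[where f = sqrt] integral_cong_AE) auto

lemma L2_norm_cong_L2:
  "f \<in> L2 M \<Longrightarrow> g \<in> L2 M \<Longrightarrow> AE x in M. f x = g x \<Longrightarrow> L2_norm M f = L2_norm M g"
  by (rule L2_norm_cong_AE) (auto dest: L2_D)

lemma L2_inner_cong_AE:
  assumes "f \<in> borel_measurable M" "g \<in> borel_measurable M"
    "f' \<in> borel_measurable M" "g' \<in> borel_measurable M"
    "AE x in M. f x = f' x" "AE x in M. g x = g' x"
  shows "L2_inner M f g = L2_inner M f' g'"
  unfolding L2_inner_def
proof (rule integral_cong_AE)
  note [measurable] = assms(1-4)
  show "(\<lambda>x. cnj (f x) * g x) \<in> borel_measurable M" "(\<lambda>x. cnj (f' x) * g' x) \<in> borel_measurable M"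
    by measurable
  show "AE x in M. cnj (f x) * g x = cnj (f' x) * g' x"
    using assms(5,6) by eventually_elim simp
qed

lemma L2_norm_eq_0:
  assumes "f \<in> L2 M"
  shows "L2_norm M f = 0 \<longleftrightarrow> (AE x in M. f x = 0)"
  using integral_nonneg_eq_0_iff_AE[of M "\<lambda>x. (cmod (f x))\<^sup>2"] L2_D[OF assms]
  by (simp add: L2_norm_def)

lemma L2_norm_mono_AE:
  assumes "f \<in> borel_measurable M" "g \<in> L2 M" "AE x in M. cmod (f x) \<le> cmod (g x)"
  shows "L2_norm M f \<le> L2_norm M g"
  unfolding L2_norm_def
proof (intro real_sqrt_le_mono integral_mono_AE)
  show "integrable M (\<lambda>x. (cmod (f x))\<^sup>2)"
    using L2_bound[where K = 1, OF assms(2,1)] assms(3) by (auto simp: L2_def)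
  show "AE x in M. (cmod (f x))\<^sup>2 \<le> (cmod (g x))\<^sup>2"
    using assms(3) by eventually_elim (simp add: power_mono)
qed (use assms in \<open>auto simp: L2_def\<close>)

lemma L2_norm_scale [simp]: "L2_norm M (\<lambda>x. c * f x) = cmod c * L2_norm M f"
  by (simp add: L2_norm_def norm_mult power_mult_distrib real_sqrt_mult)

lemma L2_norm_uminus [simp]: "L2_norm M (\<lambda>x. - f x) = L2_norm M f"
  by (simp add: L2_norm_def)

lemma L2_norm_minus_commute: "L2_norm M (\<lambda>x. f x - g x) = L2_norm M (\<lambda>x. g x - f x)"
  by (simp add: L2_norm_def norm_minus_commute)

lemma L2_norm_cnj [simp]: "L2_norm M (\<lambda>x. cnj (f x)) = L2_norm M f"
  by (simp add: L2_norm_def)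

lemma integrable_L2_mult:
  assumes "f \<in> L2 M" "g \<in> L2 M"
  shows "integrable M (\<lambda>x. f x * g x)"
proof -
  have "integrable M (\<lambda>x. (cmod (f x))\<^sup>2 + (cmod (g x))\<^sup>2)"
    using L2_D[OF assms(1)] L2_D[OF assms(2)] by simp
  then show ?thesis
  proof (rule Bochner_Integration.integrable_bound)
    have "cmod (f x) * cmod (g x) \<le> (cmod (f x))\<^sup>2 + (cmod (g x))\<^sup>2" for x
    proof -
      have "0 \<le> cmod (f x) * cmod (g x)" by simp
      then show ?thesis
        using sum_squares_bound[of "cmod (f x)" "cmod (g x)"] by linarith
    qed
    then show "AE x in M. cmod (f x * g x) \<le> norm ((cmod (f x))\<^sup>2 + (cmod (g x))\<^sup>2)"
      by (simp add: norm_mult)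
    show "(\<lambda>x. f x * g x) \<in> borel_measurable M"
      using L2_D(1)[OF assms(1)] L2_D(1)[OF assms(2)] by measurable
  qed
qed

lemmas integrable_cnj_L2_mult = integrable_L2_mult[OF L2_cnj]

lemma L2_inner_add_right:
  "f \<in> L2 M \<Longrightarrow> g \<in> L2 M \<Longrightarrow> k \<in> L2 M \<Longrightarrow>
   L2_inner M f (\<lambda>x. g x + k x) = L2_inner M f g + L2_inner M f k"
  by (simp add: L2_inner_def distrib_left integrable_cnj_L2_mult)

lemma L2_inner_add_left:
  "f \<in> L2 M \<Longrightarrow> g \<in> L2 M \<Longrightarrow> k \<in> L2 M \<Longrightarrow>
   L2_inner M (\<lambda>x. f x + g x) k = L2_inner M f k + L2_inner M g k"
  by (simp add: L2_inner_def distrib_right integrable_cnj_L2_mult)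

lemma L2_inner_diff_right:
  "f \<in> L2 M \<Longrightarrow> g \<in> L2 M \<Longrightarrow> k \<in> L2 M \<Longrightarrow>
   L2_inner M f (\<lambda>x. g x - k x) = L2_inner M f g - L2_inner M f k"
  by (simp add: L2_inner_def right_diff_distrib integrable_cnj_L2_mult)

lemma L2_inner_diff_left:
  "f \<in> L2 M \<Longrightarrow> g \<in> L2 M \<Longrightarrow> k \<in> L2 M \<Longrightarrow>
   L2_inner M (\<lambda>x. f x - g x) k = L2_inner M f k - L2_inner M g k"
  by (simp add: L2_inner_def left_diff_distrib integrable_cnj_L2_mult)

lemma L2_inner_scale_right [simp]: "L2_inner M f (\<lambda>x. c * g x) = c * L2_inner M f g"
  unfolding L2_inner_def by (subst integral_mult_right_zero[symmetric]) (simp add: mult_ac)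

lemma L2_inner_scale_left [simp]: "L2_inner M (\<lambda>x. c * f x) g = cnj c * L2_inner M f g"
  unfolding L2_inner_def by (subst integral_mult_right_zero[symmetric]) (simp add: mult_ac)

lemma L2_inner_cnj: "cnj (L2_inner M f g) = L2_inner M g f"
proof -
  have "cnj (L2_inner M f g) = (\<integral>x. cnj (cnj (f x) * g x) \<partial>M)"
    unfolding L2_inner_def by (rule Bochner_Integration.integral_cnj[symmetric])
  then show ?thesis by (simp add: L2_inner_def mult.commute)
qed

lemma L2_inner_self: "L2_inner M f f = of_real ((L2_norm M f)\<^sup>2)"
  unfolding L2_inner_def L2_norm_sq
  by (subst integral_complex_of_real[symmetric]) (simp add: complex_norm_square[symmetric] mult.commute)

lemma L2_inner_sum_right:
  "f \<in> L2 M \<Longrightarrow> (\<And>i. i \<in> A \<Longrightarrow> g i \<in> L2 M) \<Longrightarrow>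
   L2_inner M f (\<lambda>x. \<Sum>i\<in>A. g i x) = (\<Sum>i\<in>A. L2_inner M f (g i))"
  by (simp add: L2_inner_def sum_distrib_left integrable_cnj_L2_mult Bochner_Integration.integral_sum)

lemma L2_norm_add_sq:
  assumes "f \<in> L2 M" "g \<in> L2 M"
  shows "(L2_norm M (\<lambda>x. f x + g x))\<^sup>2 =
    (L2_norm M f)\<^sup>2 + 2 * Re (L2_inner M f g) + (L2_norm M g)\<^sup>2"
proof -
  have "complex_of_real ((L2_norm M (\<lambda>x. f x + g x))\<^sup>2) =
     of_real ((L2_norm M f)\<^sup>2) + (L2_inner M f g + cnj (L2_inner M f g)) + of_real ((L2_norm M g)\<^sup>2)"
    by (simp add: L2_inner_self[symmetric] L2_inner_add_left L2_inner_add_right assms L2_add L2_inner_cnj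
      del: of_real_power)
  also have "L2_inner M f g + cnj (L2_inner M f g) = of_real (2 * Re (L2_inner M f g))"
    by (rule complex_add_cnj)
  finally show ?thesis
    by (simp only: of_real_add[symmetric] of_real_eq_iff)
qed

lemma L2_norm_diff_sq:
  assumes "f \<in> L2 M" "g \<in> L2 M"
  shows "(L2_norm M (\<lambda>x. f x - g x))\<^sup>2 =
    (L2_norm M f)\<^sup>2 - 2 * Re (L2_inner M f g) + (L2_norm M g)\<^sup>2"
  using L2_norm_add_sq[OF assms(1) L2_uminus[OF assms(2)]]
    L2_inner_scale_right[of M f "-1" g] by simp

text \<open>Weighted arithmetic-geometric mean inequality with the optimal weight t = |g| / |f|.
  Both norms are enlarged by e > 0 so that t is well defined and positive also when a norm vanishes;
  then e tends to 0.\<close>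

lemma integral_mult_le_sqrt:
  assumes "f \<in> L2 M" "g \<in> L2 M"
  shows "(\<integral>x. cmod (f x) * cmod (g x) \<partial>M) \<le> L2_norm M f * L2_norm M g"
proof -
  let ?a = "L2_norm M f" and ?b = "L2_norm M g"
  have int: "integrable M (\<lambda>x. cmod (f x) * cmod (g x))"
    using integrable_norm[OF integrable_L2_mult[OF assms]] by (simp add: norm_mult)
  have *: "(\<integral>x. cmod (f x) * cmod (g x) \<partial>M) \<le> (?a + e) * (?b + e)" if e: "e > 0" for e
  proof -
    define t where "t = (?b + e) / (?a + e)"
    have pos: "?a + e > 0" "?b + e > 0" using e by (auto intro: add_nonneg_pos)
    then have t: "t > 0" by (simp add: t_def)
    have am: "a * b \<le> (t * a\<^sup>2 + b\<^sup>2 / t) / 2" for a b :: real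
    proof -
      have "0 \<le> (t * a - b)\<^sup>2 / t" using t by simp
      also have "\<dots> = t * a\<^sup>2 - 2 * (a * b) + b\<^sup>2 / t"
        using t by (simp add: power2_eq_square field_simps)
      finally show ?thesis by simp
    qed
    have "(\<integral>x. cmod (f x) * cmod (g x) \<partial>M)
        \<le> (\<integral>x. (t * (cmod (f x))\<^sup>2 + (cmod (g x))\<^sup>2 / t) / 2 \<partial>M)"
      using L2_D[OF assms(1)] L2_D[OF assms(2)] by (intro integral_mono int am) auto
    also have "\<dots> = (t * ?a\<^sup>2 + ?b\<^sup>2 / t) / 2"
      using L2_D[OF assms(1)] L2_D[OF assms(2)] by (simp add: L2_norm_sq)
    also have "\<dots> \<le> (t * (?a + e)\<^sup>2 + (?b + e)\<^sup>2 / t) / 2"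
      using t e by (intro divide_right_mono add_mono mult_left_mono power_mono) auto
    also have "t * (?a + e)\<^sup>2 = (?a + e) * (?b + e)"
      using pos(1) by (simp add: t_def power2_eq_square)
    also have "(?b + e)\<^sup>2 / t = (?a + e) * (?b + e)"
      using pos(2) by (simp add: t_def power2_eq_square)
    finally show ?thesis by simp
  qed
  have "((\<lambda>e. (?a + e) * (?b + e)) \<longlongrightarrow> (?a + 0) * (?b + 0)) (at_right 0)"
    by (intro tendsto_intros)
  moreover have "\<forall>\<^sub>F e in at_right 0. (\<integral>x. cmod (f x) * cmod (g x) \<partial>M) \<le> (?a + e) * (?b + e)"
    using * by (auto intro: eventually_at_right_less[THEN eventually_mono])
  ultimately show ?thesis
    by (auto dest: tendsto_lowerbound)
qed

lemma L2_cauchy_schwarz: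
  assumes "f \<in> L2 M" "g \<in> L2 M"
  shows "cmod (L2_inner M f g) \<le> L2_norm M f * L2_norm M g"
proof -
  have "cmod (L2_inner M f g) \<le> (\<integral>x. cmod (cnj (f x) * g x) \<partial>M)"
    unfolding L2_inner_def by (rule integral_norm_bound)
  also have "\<dots> \<le> L2_norm M f * L2_norm M g"
    using integral_mult_le_sqrt[OF assms] by (simp add: norm_mult)
  finally show ?thesis .
qed

lemma L2_norm_triangle:
  assumes "f \<in> L2 M" "g \<in> L2 M"
  shows "L2_norm M (\<lambda>x. f x + g x) \<le> L2_norm M f + L2_norm M g"
proof (rule power2_le_imp_le)
  have "Re (L2_inner M f g) \<le> L2_norm M f * L2_norm M g"
    using L2_cauchy_schwarz[OF assms] complex_Re_le_cmod order_trans by blast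
  then show "(L2_norm M (\<lambda>x. f x + g x))\<^sup>2 \<le> (L2_norm M f + L2_norm M g)\<^sup>2"
    by (simp add: L2_norm_add_sq[OF assms] power2_sum)
qed simp

lemma L2_norm_triangle_diff:
  assumes "f \<in> L2 M" "g \<in> L2 M"
  shows "L2_norm M (\<lambda>x. f x - g x) \<le> L2_norm M f + L2_norm M g"
  using L2_norm_triangle[OF assms(1) L2_uminus[OF assms(2)]] by simp

lemma L2_norm_triangle3:
  assumes "f \<in> L2 M" "g \<in> L2 M" "k \<in> L2 M"
  shows "L2_norm M (\<lambda>x. f x - k x) \<le> L2_norm M (\<lambda>x. f x - g x) + L2_norm M (\<lambda>x. g x - k x)"
  using L2_norm_triangle[OF L2_diff[OF assms(1,2)] L2_diff[OF assms(2,3)]] by simp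

lemma L2_norm_reverse_triangle:
  assumes "f \<in> L2 M" "g \<in> L2 M"
  shows "\<bar>L2_norm M f - L2_norm M g\<bar> \<le> L2_norm M (\<lambda>x. f x - g x)"
  using L2_norm_triangle[OF L2_diff[OF assms] assms(2)]
    L2_norm_triangle[OF L2_diff[OF assms(2,1)] assms(1)]
  by (simp add: L2_norm_minus_commute[of M g f])

lemma L2_norm_sum_le:
  "(\<And>i. i \<in> A \<Longrightarrow> f i \<in> L2 M) \<Longrightarrow> L2_norm M (\<lambda>x. \<Sum>i\<in>A. f i x) \<le> (\<Sum>i\<in>A. L2_norm M (f i))"
proof (induction A rule: infinite_finite_induct)
  case (insert a A)
  have "L2_norm M (\<lambda>x. f a x + (\<Sum>i\<in>A. f i x)) \<le> L2_norm M (f a) + L2_norm M (\<lambda>x. \<Sum>i\<in>A. f i x)"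
    using insert.prems by (intro L2_norm_triangle L2_sum) auto
  then show ?case using insert by (simp add: insert.IH order_trans)
qed auto

text \<open>Norm bounds survive almost everywhere convergence. This serves where a limit is known
  only pointwise: in \<open>L2_complete\<close> and for Fourier integrals.\<close>

lemma L2_fatou:
  fixes w :: "nat \<Rightarrow> 'a \<Rightarrow> complex"
  assumes w: "\<And>k. w k \<in> L2 M" and b: "\<And>k. L2_norm M (w k) \<le> e"
    and m: "v \<in> borel_measurable M" and lim: "AE x in M. (\<lambda>k. w k x) \<longlonglongrightarrow> v x"
  shows "v \<in> L2 M" "L2_norm M v \<le> e"
proof -
  have e: "e \<ge> 0" using b[of 0] L2_norm_nonneg[of M "w 0"] by linarith
  have [measurable]: "w k \<in> borel_measurable M" for k using w by (auto simp: L2_def)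
  have "(\<integral>\<^sup>+x. ennreal ((cmod (v x))\<^sup>2) \<partial>M) = (\<integral>\<^sup>+x. liminf (\<lambda>k. ennreal ((cmod (w k x))\<^sup>2)) \<partial>M)"
  proof (rule nn_integral_cong_AE)
    show "AE x in M. ennreal ((cmod (v x))\<^sup>2) = liminf (\<lambda>k. ennreal ((cmod (w k x))\<^sup>2))"
      using lim
    proof eventually_elim
      case (elim x)
      then have "(\<lambda>k. ennreal ((cmod (w k x))\<^sup>2)) \<longlonglongrightarrow> ennreal ((cmod (v x))\<^sup>2)"
        by (intro tendsto_ennrealI tendsto_intros)
      from lim_imp_Liminf[OF sequentially_bot this] show ?case by (rule sym)
    qed
  qed
  also have "\<dots> \<le> liminf (\<lambda>k. \<integral>\<^sup>+x. ennreal ((cmod (w k x))\<^sup>2) \<partial>M)"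
    by (rule nn_integral_liminf) measurable
  also have "\<dots> \<le> ennreal (e\<^sup>2)"
  proof -
    have "(\<integral>\<^sup>+x. ennreal ((cmod (w k x))\<^sup>2) \<partial>M) \<le> ennreal (e\<^sup>2)" for k
    proof -
      have "(\<integral>\<^sup>+x. ennreal ((cmod (w k x))\<^sup>2) \<partial>M) = ennreal ((L2_norm M (w k))\<^sup>2)"
        unfolding L2_norm_sq using L2_D(2)[OF w[of k]] by (intro nn_integral_eq_integral) auto
      also have "\<dots> \<le> ennreal (e\<^sup>2)"
        by (intro ennreal_leI power_mono b) simp
      finally show ?thesis .
    qed
    then have "liminf (\<lambda>k. \<integral>\<^sup>+x. ennreal ((cmod (w k x))\<^sup>2) \<partial>M) \<le> liminf (\<lambda>k::nat. ennreal (e\<^sup>2))"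
      by (intro Liminf_mono always_eventually) auto
    then show ?thesis by (simp add: Liminf_const)
  qed
  finally have *: "(\<integral>\<^sup>+x. ennreal ((cmod (v x))\<^sup>2) \<partial>M) \<le> ennreal (e\<^sup>2)" .
  then have int: "integrable M (\<lambda>x. (cmod (v x))\<^sup>2)"
    using m by (intro integrableI_nonneg) (auto simp: le_less_trans ennreal_less_top)
  then show L: "v \<in> L2 M" using m by (simp add: L2_def)
  have "ennreal ((L2_norm M v)\<^sup>2) \<le> ennreal (e\<^sup>2)"
    unfolding L2_norm_sq using * int by (subst nn_integral_eq_integral[symmetric]) auto
  then have "(L2_norm M v)\<^sup>2 \<le> e\<^sup>2" by (simp add: ennreal_le_iff)
  then show "L2_norm M v \<le> e"
    using e by (rule power2_le_imp_le)
qed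

text \<open>Riesz-Fischer. A subsequence whose k-th increment has norm at most (1/2)^k converges
  almost everywhere, because its increments are almost everywhere absolutely summable; Fatou then
  gives norm convergence of the whole sequence to the pointwise limit.\<close>

lemma L2_complete:
  fixes u :: "nat \<Rightarrow> 'a \<Rightarrow> complex"
  assumes u: "\<And>n. u n \<in> L2 M"
    and Cau: "\<And>e. e > 0 \<Longrightarrow> \<exists>N. \<forall>m\<ge>N. \<forall>n\<ge>N. L2_norm M (\<lambda>x. u m x - u n x) < e"
  shows "\<exists>f. f \<in> L2 M \<and> (\<lambda>n. L2_norm M (\<lambda>x. u n x - f x)) \<longlonglongrightarrow> 0"
proof -
  have [measurable]: "u k \<in> borel_measurable M" for k using u by (auto simp: L2_def)
  obtain N where N: "\<And>e m n. e > 0 \<Longrightarrow> m \<ge> N e \<Longrightarrow> n \<ge> N e \<Longrightarrow> L2_norm M (\<lambda>x. u m x - u n x) < e"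
    using Cau by metis
  \<comment> \<open>\<open>Suc p\<close> makes the indices strictly increasing; \<open>N\<close>
    keeps all later terms within the required power of 1/2 of each other.\<close>
  define r where "r = rec_nat (N 1) (\<lambda>k p. max (Suc p) (N ((1/2)^Suc k)))"
  have r_Suc: "r (Suc k) = max (Suc (r k)) (N ((1/2)^Suc k))" for k
    by (simp add: r_def)
  have sm: "strict_mono r" by (auto simp: strict_mono_Suc_iff r_Suc less_max_iff_disj)
  have rN: "r k \<ge> N ((1/2)^k)" for k
    by (cases k) (simp_all add: r_Suc, simp add: r_def)
  define v where "v k = u (r k)" for k
  have [measurable]: "v k \<in> borel_measurable M" for k by (simp add: v_def)
  have vL: "v k \<in> L2 M" for k using u by (simp add: v_def)
  define d where "d k x = v (Suc k) x - v k x" for k x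
  have [measurable]: "d k \<in> borel_measurable M" for k unfolding d_def[abs_def] by measurable
  have dL: "d k \<in> L2 M" for k unfolding d_def[abs_def] by (intro L2_intros vL)
  have dn: "L2_norm M (d k) \<le> (1/2)^k" for k
  proof -
    have "r (Suc k) \<ge> N ((1/2)^k)" using rN[of k] r_Suc[of k] by linarith
    then show ?thesis
      using N[of "(1/2)^k" "r (Suc k)" "r k"] rN[of k] by (simp add: d_def[abs_def] v_def)
  qed
  define S where "S k x = (\<Sum>i<k. cmod (d i x))" for k x
  have SL: "(\<lambda>x. complex_of_real (S k x)) \<in> L2 M" for k
    unfolding S_def of_real_sum by (intro L2_sum L2_bound[where K = 1, OF dL]) auto
  have Sn: "L2_norm M (\<lambda>x. complex_of_real (S k x)) \<le> 2" for k
  proof -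
    have "L2_norm M (\<lambda>x. complex_of_real (S k x)) \<le> (\<Sum>i<k. L2_norm M (\<lambda>x. complex_of_real (cmod (d i x))))"
      unfolding S_def of_real_sum by (intro L2_norm_sum_le L2_bound[where K = 1, OF dL]) auto
    also have "\<dots> = (\<Sum>i<k. L2_norm M (d i))"
      by (simp add: L2_norm_def)
    also have "\<dots> \<le> (\<Sum>i<k. (1/2)^i)" by (intro sum_mono dn)
    also have "\<dots> \<le> 2" by (subst geometric_sum) auto
    finally show ?thesis .
  qed
  \<comment> \<open>Monotone convergence: the partial sums of |d i| have norm at most 2, so their
    supremum is finite almost everywhere.\<close>
  have "(\<integral>\<^sup>+x. (SUP k. ennreal ((S k x)\<^sup>2)) \<partial>M) = (SUP k. \<integral>\<^sup>+x. ennreal ((S k x)\<^sup>2) \<partial>M)"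
  proof (rule nn_integral_monotone_convergence_SUP)
    show "incseq (\<lambda>k x. ennreal ((S k x)\<^sup>2))"
      unfolding incseq_def le_fun_def S_def
      by (auto intro!: ennreal_leI power_mono sum_mono2 sum_nonneg)
    show "(\<lambda>x. ennreal ((S k x)\<^sup>2)) \<in> borel_measurable M" for k
      unfolding S_def by measurable
  qed
  also have "\<dots> \<le> ennreal 4"
  proof (rule SUP_least)
    fix k
    have "(\<integral>\<^sup>+x. ennreal ((S k x)\<^sup>2) \<partial>M) = ennreal ((L2_norm M (\<lambda>x. complex_of_real (S k x)))\<^sup>2)"
      unfolding L2_norm_sq using L2_D(2)[OF SL[of k]]
      by (subst nn_integral_eq_integral[symmetric]) auto
    also have "\<dots> \<le> ennreal (2\<^sup>2)" by (intro ennreal_leI power_mono Sn) simp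
    finally show "(\<integral>\<^sup>+x. ennreal ((S k x)\<^sup>2) \<partial>M) \<le> ennreal 4" by simp
  qed
  finally have "(\<integral>\<^sup>+x. (SUP k. ennreal ((S k x)\<^sup>2)) \<partial>M) < \<infinity>"
    by (simp add: le_less_trans ennreal_less_top)
  moreover have "(\<lambda>x. SUP k. ennreal ((S k x)\<^sup>2)) \<in> borel_measurable M"
    unfolding S_def by measurable
  ultimately have "AE x in M. (SUP k. ennreal ((S k x)\<^sup>2)) \<noteq> \<infinity>"
    by (intro nn_integral_noteq_infinite) auto
  then have conv: "AE x in M. convergent (\<lambda>k. v k x)"
  proof eventually_elim
    case (elim x)
    then obtain B where B: "(SUP k. ennreal ((S k x)\<^sup>2)) = ennreal B" "B \<ge> 0"
      by (cases "(SUP k. ennreal ((S k x)\<^sup>2))") auto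
    have "summable (\<lambda>i. cmod (d i x))"
    proof (rule summableI_nonneg_bounded)
      fix n
      have "ennreal ((S n x)\<^sup>2) \<le> ennreal B" using B(1) by (metis SUP_upper UNIV_I)
      then have "(S n x)\<^sup>2 \<le> B" using B(2) by simp
      then show "(\<Sum>i<n. cmod (d i x)) \<le> sqrt B"
        unfolding S_def by (rule real_le_rsqrt)
    qed auto
    then have "summable (\<lambda>i. d i x)" by (rule summable_norm_cancel)
    then have "convergent (\<lambda>n. \<Sum>i<n. d i x)" by (simp add: summable_iff_convergent)
    moreover have "(\<Sum>i<n. d i x) = v n x - v 0 x" for n
      unfolding d_def by (rule sum_lessThan_telescope)
    ultimately have "convergent (\<lambda>n. v n x - v 0 x)" by simp
    then have "convergent (\<lambda>n. (v n x - v 0 x) + v 0 x)"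
      by (intro convergent_add convergent_const)
    then show ?case by simp
  qed
  define f where "f x = lim (\<lambda>k. v k x)" for x
  have [measurable]: "f \<in> borel_measurable M" unfolding f_def[abs_def] by measurable
  have lim: "AE x in M. (\<lambda>k. v k x) \<longlonglongrightarrow> f x"
    using conv by eventually_elim (simp add: f_def convergent_LIMSEQ_iff)
  \<comment> \<open>For fixed n the differences of u n and the subsequence are small in norm and
    converge pointwise to u n - f, so Fatou bounds the latter.\<close>
  have main: "(\<lambda>x. u n x - f x) \<in> L2 M \<and> L2_norm M (\<lambda>x. u n x - f x) \<le> e" if e: "e > 0" and n: "n \<ge> N e" for n e
  proof -
    define w where "w k x = u n x - v (k + N e) x" for k x
    have "w k \<in> L2 M" for k unfolding w_def[abs_def] by (intro L2_intros u vL)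
    moreover have "L2_norm M (w k) \<le> e" for k
    proof -
      have "r (k + N e) \<ge> N e" using seq_suble[OF sm, of "k + N e"] by linarith
      then show ?thesis using N[OF e n, of "r (k + N e)"] by (simp add: w_def[abs_def] v_def)
    qed
    moreover have "AE x in M. (\<lambda>k. w k x) \<longlonglongrightarrow> u n x - f x"
      using lim unfolding w_def
      by eventually_elim (intro tendsto_intros LIMSEQ_ignore_initial_segment)
    ultimately show ?thesis using L2_fatou[of w M e "\<lambda>x. u n x - f x"] by simp
  qed
  have "(\<lambda>x. u (N 1) x - (u (N 1) x - f x)) \<in> L2 M"
    by (rule L2_diff[OF u conjunct1[OF main[of 1 "N 1"]]]) auto
  then have fL: "f \<in> L2 M" by simp
  moreover have "(\<lambda>n. L2_norm M (\<lambda>x. u n x - f x)) \<longlonglongrightarrow> 0"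
  proof (rule LIMSEQ_I)
    fix e :: real assume e: "e > 0"
    show "\<exists>no. \<forall>n\<ge>no. norm (L2_norm M (\<lambda>x. u n x - f x) - 0) < e"
      using main[of "e/2"] e by (intro exI[of _ "N (e/2)"]) (force intro: le_less_trans)
  qed
  ultimately show ?thesis by blast
qed

lemma L2_geometric_convergent:
  fixes u :: "nat \<Rightarrow> 'a \<Rightarrow> complex"
  assumes u: "\<And>n. u n \<in> L2 M" and r: "0 \<le> r" "r < 1"
    and step: "\<And>n. L2_norm M (\<lambda>x. u (Suc n) x - u n x) \<le> D * r ^ n"
  shows "\<exists>f. f \<in> L2 M \<and> (\<lambda>n. L2_norm M (\<lambda>x. u n x - f x)) \<longlonglongrightarrow> 0"
proof (rule L2_complete[OF u])
  fix e :: real assume e: "e > 0"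
  have D: "D \<ge> 0" using step[of 0] L2_norm_nonneg[of M "\<lambda>x. u (Suc 0) x - u 0 x"]
    by (simp del: L2_norm_nonneg)
  have far: "L2_norm M (\<lambda>x. u (n + k) x - u n x) \<le> D * r ^ n / (1 - r)" for n k
  proof -
    have "L2_norm M (\<lambda>x. u (n + k) x - u n x) \<le> D * r ^ n * (\<Sum>i<k. r ^ i)"
    proof (induction k)
      case (Suc k)
      have "L2_norm M (\<lambda>x. u (n + Suc k) x - u n x)
          \<le> L2_norm M (\<lambda>x. u (Suc (n + k)) x - u (n + k) x) + L2_norm M (\<lambda>x. u (n + k) x - u n x)"
        using L2_norm_triangle3[OF u[of "Suc (n + k)"] u[of "n + k"] u[of n]] by simp
      also have "\<dots> \<le> D * r ^ (n + k) + D * r ^ n * (\<Sum>i<k. r ^ i)"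
        by (intro add_mono step Suc.IH)
      also have "\<dots> = D * r ^ n * (\<Sum>i<Suc k. r ^ i)"
        by (simp add: power_add algebra_simps)
      finally show ?case .
    qed simp
    also have "(\<Sum>i<k. r ^ i) \<le> 1 / (1 - r)"
      using r by (subst geometric_sum) (auto simp: field_simps intro: mult_left_le_one_le)
    finally show ?thesis using D r by (simp add: mult_left_mono)
  qed
  have "(\<lambda>n. D * r ^ n / (1 - r)) \<longlonglongrightarrow> D * 0 / (1 - r)"
    using r by (intro tendsto_intros LIMSEQ_realpow_zero) auto
  then have "\<forall>\<^sub>F n in sequentially. D * r ^ n / (1 - r) < e"
    using e by (intro order_tendstoD(2)) auto
  then obtain N where N: "\<And>n. n \<ge> N \<Longrightarrow> D * r ^ n / (1 - r) < e"
    by (auto simp: eventually_sequentially)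
  have "L2_norm M (\<lambda>x. u m x - u n x) < e" if "m \<ge> N" "n \<ge> N" for m n
  proof (cases "n \<le> m")
    case True
    then obtain k where "m = n + k" by (auto simp: le_iff_add)
    then show ?thesis using far[of n k] N[OF that(2)] by simp
  next
    case False
    then have "m \<le> n" by simp
    then obtain k where "n = m + k" by (auto simp: le_iff_add)
    then show ?thesis
      using far[of m k] N[OF that(1)] L2_norm_minus_commute[of M "u m" "u n"] by simp
  qed
  then show "\<exists>N. \<forall>m\<ge>N. \<forall>n\<ge>N. L2_norm M (\<lambda>x. u m x - u n x) < e" by blast
qed

section \<open>Bounded symmetric operators\<close>

definition shift :: "(('a \<Rightarrow> complex) \<Rightarrow> 'a \<Rightarrow> complex) \<Rightarrow> complex \<Rightarrow> ('a \<Rightarrow> complex) \<Rightarrow> 'a \<Rightarrow> complex"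
  where "shift t z f = (\<lambda>x. t f x - z * f x)"

text \<open>The map t acts on representatives and will be an arbitrary choice from a graph
  (\<open>graph_fun\<close>). Such a choice is additive only up to null sets, and this much is
  derived from symmetry.\<close>

locale bounded_symmetric =
  fixes M :: "'a measure" and t :: "('a \<Rightarrow> complex) \<Rightarrow> 'a \<Rightarrow> complex" and K :: real
  assumes L2_t: "f \<in> L2 M \<Longrightarrow> t f \<in> L2 M"
    and norm_t: "f \<in> L2 M \<Longrightarrow> L2_norm M (t f) \<le> K * L2_norm M f"
    and sym_t: "f \<in> L2 M \<Longrightarrow> g \<in> L2 M \<Longrightarrow> L2_inner M f (t g) = L2_inner M (t f) g"
begin

lemma L2_shift: "f \<in> L2 M \<Longrightarrow> shift t z f \<in> L2 M"
  unfolding shift_def by (intro L2_intros L2_t)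

lemma shift_adj:
  assumes "f \<in> L2 M" "g \<in> L2 M"
  shows "L2_inner M f (shift t z g) = L2_inner M (shift t (cnj z) f) g"
  unfolding shift_def
  by (simp add: L2_inner_diff_left L2_inner_diff_right assms L2_t L2_scale sym_t)

text \<open>Linearity holds only up to null sets, \<open>t\<close> acting on representatives.\<close>

lemma t_linear_AE:
  assumes f: "f \<in> L2 M" and g: "g \<in> L2 M"
  shows "AE x in M. t (\<lambda>y. f y + c * g y) x = t f x + c * t g x"
proof -
  define w where "w x = t (\<lambda>y. f y + c * g y) x - (t f x + c * t g x)" for x
  have w: "w \<in> L2 M" unfolding w_def[abs_def] by (intro L2_intros L2_t f g)
  note tw = L2_t[OF w]
  \<comment> \<open>w is tested against itself: symmetry moves t to the other factor, where the
    inner product is linear.\<close>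
  have "L2_inner M w w = 0"
  proof -
    have "L2_inner M w w = L2_inner M w (t (\<lambda>y. f y + c * g y)) - L2_inner M w (\<lambda>x. t f x + c * t g x)"
      by (subst (2) w_def[abs_def]) (intro L2_inner_diff_right w L2_intros L2_t f g)
    also have "L2_inner M w (t (\<lambda>y. f y + c * g y)) = L2_inner M (t w) (\<lambda>y. f y + c * g y)"
      by (intro sym_t w L2_intros f g)
    also have "\<dots> = L2_inner M (t w) f + c * L2_inner M (t w) g"
      by (simp add: L2_inner_add_right tw f g L2_scale)
    also have "L2_inner M w (\<lambda>x. t f x + c * t g x) = L2_inner M w (t f) + c * L2_inner M w (t g)"
      by (simp add: L2_inner_add_right w L2_t f g L2_scale)
    finally show ?thesis by (simp add: sym_t w f g)
  qed
  then have "L2_norm M w = 0" by (simp add: L2_inner_self)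
  then have "AE x in M. w x = 0" using L2_norm_eq_0[OF w] by simp
  then show ?thesis by eventually_elim (simp add: w_def)
qed

lemma shift_diff_AE:
  assumes f: "f \<in> L2 M" and g: "g \<in> L2 M"
  shows "AE x in M. shift t z (\<lambda>y. f y - c * g y) x = shift t z f x - c * shift t z g x"
  using t_linear_AE[OF f g, of "- c"]
  by eventually_elim (simp add: shift_def algebra_simps)

text \<open>Boundedness sends a function of norm 0 to a function of norm 0; this is applied to the
  difference.\<close>

lemma shift_cong_AE:
  assumes f: "f \<in> L2 M" and g: "g \<in> L2 M" and eq: "AE x in M. f x = g x"
  shows "AE x in M. shift t z f x = shift t z g x"
proof -
  have d: "(\<lambda>x. f x - g x) \<in> L2 M" by (intro L2_intros f g)
  have "L2_norm M (\<lambda>x. f x - g x) = 0"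
    using L2_norm_eq_0[OF d] eq by auto
  then have "L2_norm M (t (\<lambda>x. f x - g x)) = 0"
    using norm_t[OF d] by (simp add: antisym)
  then have "AE x in M. t (\<lambda>x. f x - g x) x = 0"
    using L2_norm_eq_0[OF L2_t[OF d]] by simp
  with t_linear_AE[OF f g, of "-1"] eq show ?thesis
    by (eventually_elim) (simp add: shift_def)
qed

lemma norm_shift_le:
  assumes f: "f \<in> L2 M"
  shows "L2_norm M (shift t z f) \<le> (K + cmod z) * L2_norm M f"
proof -
  have "L2_norm M (shift t z f) \<le> L2_norm M (t f) + L2_norm M (\<lambda>x. z * f x)"
    unfolding shift_def by (intro L2_norm_triangle_diff L2_t L2_scale f)
  then show ?thesis using norm_t[OF f] by (simp add: algebra_simps)
qed

lemma inner_t_real: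
  assumes f: "f \<in> L2 M"
  shows "Im (L2_inner M (t f) f) = 0"
proof -
  have "cnj (L2_inner M (t f) f) = L2_inner M (t f) f"
    by (simp add: L2_inner_cnj sym_t f)
  then show ?thesis by (simp add: complex_eq_iff)
qed

text \<open>t - z is normal: since <t f, f> is real, the squared norm depends on z only through Re z
  and |z|.\<close>

lemma norm_shift_cnj:
  assumes f: "f \<in> L2 M"
  shows "L2_norm M (shift t (cnj z) f) = L2_norm M (shift t z f)"
proof -
  have "(L2_norm M (shift t z f))\<^sup>2 =
    (L2_norm M (t f))\<^sup>2 - 2 * (Re z * Re (L2_inner M (t f) f)) + (cmod z * L2_norm M f)\<^sup>2" for z
    unfolding shift_def
    by (simp add: L2_norm_diff_sq L2_t L2_scale f inner_t_real)
  from this[of z] this[of "cnj z"]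
  have "(L2_norm M (shift t (cnj z) f))\<^sup>2 = (L2_norm M (shift t z f))\<^sup>2" by simp
  then show ?thesis by simp
qed

text \<open>As <t f, f> is real, the imaginary part of <f, (t - z) f> is - Im z |f|^2. Non-real z
  thus satisfy the lower bound that characterizes the resolvent set.\<close>

lemma norm_shift_ge_Im:
  assumes f: "f \<in> L2 M"
  shows "\<bar>Im z\<bar> * L2_norm M f \<le> L2_norm M (shift t z f)"
proof (cases "L2_norm M f = 0")
  case False
  have "L2_inner M f (shift t z f) = L2_inner M (t f) f - z * of_real ((L2_norm M f)\<^sup>2)"
    unfolding shift_def
    by (simp add: L2_inner_diff_right L2_t L2_scale f sym_t L2_inner_self)
  then have "Im (L2_inner M f (shift t z f)) = - (Im z * (L2_norm M f)\<^sup>2)"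
    by (simp add: inner_t_real f)
  then have "\<bar>Im z\<bar> * (L2_norm M f)\<^sup>2 \<le> cmod (L2_inner M f (shift t z f))"
    using abs_Im_le_cmod[of "L2_inner M f (shift t z f)"] by (simp add: abs_mult)
  also have "\<dots> \<le> L2_norm M f * L2_norm M (shift t z f)"
    by (intro L2_cauchy_schwarz f L2_shift)
  finally have "L2_norm M f * (\<bar>Im z\<bar> * L2_norm M f) \<le> L2_norm M f * L2_norm M (shift t z f)"
    by (simp add: power2_eq_square mult_ac)
  moreover have "L2_norm M f > 0" using False L2_norm_nonneg[of M f] by linarith
  ultimately show ?thesis by simp
qed simp

text \<open>Solves \<open>S\<^sup>* S x = S\<^sup>* g\<close> for \<open>S = t - z\<close> by Banach iteration with \<open>x \<mapsto> x - c S\<^sup>*(S x - g)\<close>.\<close>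

lemma shift_surj:
  assumes m: "m > 0" and lower: "\<And>f. f \<in> L2 M \<Longrightarrow> m * L2_norm M f \<le> L2_norm M (shift t z f)"
    and g: "g \<in> L2 M"
  shows "\<exists>f. f \<in> L2 M \<and> (AE x in M. shift t z f x = g x)"
proof -
  define L where "L = \<bar>K\<bar> + cmod z + 1"
  have L: "L > 0" by (simp add: L_def add_nonneg_pos)
  \<comment> \<open>Since the adjoint is bounded by L, this step size turns |d|^2 - 2 c |S d|^2 +
    c^2 |S' (S d)|^2 into at most |d|^2 - c |S d|^2, where S' is the adjoint of S.\<close>
  define c where "c = 1 / L\<^sup>2"
  have c: "c > 0" "c * L\<^sup>2 = 1" using L by (simp_all add: c_def)
  let ?S = "shift t z" and ?S' = "shift t (cnj z)"
  have upper: "L2_norm M (shift t w f) \<le> L * L2_norm M f" if "f \<in> L2 M" "cmod w = cmod z" for f w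
  proof -
    have "L2_norm M (shift t w f) \<le> (K + cmod w) * L2_norm M f" by (rule norm_shift_le[OF that(1)])
    also have "\<dots> \<le> L * L2_norm M f" using that by (intro mult_right_mono) (auto simp: L_def)
    finally show ?thesis .
  qed
  have lower': "m * L2_norm M f \<le> L2_norm M (?S' f)" if "f \<in> L2 M" for f
    using lower[OF that] norm_shift_cnj[OF that, of z] by simp
  \<comment> \<open>1 - c m^2 can be negative only when every element of L2 has norm 0, as then
    every m is a lower bound; the maximum keeps the square root meaningful.\<close>
  define q where "q = max 0 (1 - c * m\<^sup>2)"
  have q: "0 \<le> q" "q < 1" using c m by (auto simp: q_def)
  define \<Phi> where "\<Phi> f = (\<lambda>x. f x - of_real c * (?S' (?S f) x - ?S' g x))" for f
  have \<Phi>L: "\<Phi> f \<in> L2 M" if "f \<in> L2 M" for f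
    unfolding \<Phi>_def by (intro L2_intros L2_shift that g)
  have contr: "L2_norm M (\<lambda>x. \<Phi> f x - \<Phi> f' x) \<le> sqrt q * L2_norm M (\<lambda>x. f x - f' x)"
    if f: "f \<in> L2 M" and f': "f' \<in> L2 M" for f f'
  proof (rule power2_le_imp_le)
    define d where "d x = f x - f' x" for x
    define e where "e x = ?S' (?S f) x - ?S' (?S f') x" for x
    have d: "d \<in> L2 M" unfolding d_def[abs_def] by (intro L2_intros f f')
    have e: "e \<in> L2 M" unfolding e_def[abs_def] by (intro L2_intros L2_shift f f')
    have Sd: "AE x in M. ?S d x = ?S f x - ?S f' x"
      using shift_diff_AE[OF f f', of z 1] by (simp add: d_def[abs_def])
    have e1: "AE x in M. ?S' (\<lambda>x. ?S f x - ?S f' x) x = e x"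
      using shift_diff_AE[OF L2_shift[OF f, of z] L2_shift[OF f', of z], of "cnj z" 1] by (simp add: e_def)
    have e2: "AE x in M. ?S' (?S d) x = ?S' (\<lambda>x. ?S f x - ?S f' x) x"
      by (intro shift_cong_AE L2_shift L2_diff d f f' Sd)
    have eq: "AE x in M. ?S' (?S d) x = e x" using e1 e2 by eventually_elim simp
    have meas: "?S' (?S d) \<in> borel_measurable M" "d \<in> borel_measurable M" "e \<in> borel_measurable M"
      using L2_shift[OF L2_shift[OF d]] d e by (auto simp: L2_def)
    have "L2_inner M d e = L2_inner M d (?S' (?S d))"
      using eq meas by (intro L2_inner_cong_AE) auto
    also have "\<dots> = L2_inner M (?S d) (?S d)"
      using shift_adj[OF d L2_shift[OF d, of z], of "cnj z"] by simp
    finally have de: "Re (L2_inner M d e) = (L2_norm M (?S d))\<^sup>2" by (simp add: L2_inner_self)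
    have "L2_norm M e = L2_norm M (?S' (?S d))"
      using eq meas by (intro L2_norm_cong_AE) auto
    also have "\<dots> \<le> L * L2_norm M (?S d)" by (intro upper L2_shift d) simp
    finally have "(L2_norm M e)\<^sup>2 \<le> (L * L2_norm M (?S d))\<^sup>2" by (intro power_mono) auto
    then have "c\<^sup>2 * (L2_norm M e)\<^sup>2 \<le> c\<^sup>2 * (L * L2_norm M (?S d))\<^sup>2" by (intro mult_left_mono) auto
    also have "\<dots> = c * (c * L\<^sup>2) * (L2_norm M (?S d))\<^sup>2" by (simp add: power2_eq_square mult_ac)
    finally have ne: "c\<^sup>2 * (L2_norm M e)\<^sup>2 \<le> c * (L2_norm M (?S d))\<^sup>2" using c by simp
    have low: "m\<^sup>2 * (L2_norm M d)\<^sup>2 \<le> (L2_norm M (?S d))\<^sup>2"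
      using power_mono[OF lower[OF d], of 2] m by (simp add: power_mult_distrib)
    have "(\<lambda>x. \<Phi> f x - \<Phi> f' x) = (\<lambda>x. d x - of_real c * e x)"
      by (auto simp: \<Phi>_def d_def e_def algebra_simps)
    then have "(L2_norm M (\<lambda>x. \<Phi> f x - \<Phi> f' x))\<^sup>2 =
        (L2_norm M d)\<^sup>2 - 2 * (c * (L2_norm M (?S d))\<^sup>2) + c\<^sup>2 * (L2_norm M e)\<^sup>2"
      using c by (simp add: L2_norm_diff_sq d e L2_scale de power_mult_distrib)
    also have "\<dots> \<le> (L2_norm M d)\<^sup>2 - c * (L2_norm M (?S d))\<^sup>2" using ne by simp
    also have "\<dots> \<le> (L2_norm M d)\<^sup>2 - c * (m\<^sup>2 * (L2_norm M d)\<^sup>2)"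
      using low c by (simp add: mult_left_mono)
    also have "\<dots> = (1 - c * m\<^sup>2) * (L2_norm M d)\<^sup>2" by (simp add: algebra_simps)
    also have "\<dots> \<le> q * (L2_norm M d)\<^sup>2" by (intro mult_right_mono) (auto simp: q_def)
    also have "\<dots> = (sqrt q * L2_norm M d)\<^sup>2" using q by (simp add: power_mult_distrib)
    finally show "(L2_norm M (\<lambda>x. \<Phi> f x - \<Phi> f' x))\<^sup>2 \<le> (sqrt q * L2_norm M (\<lambda>x. f x - f' x))\<^sup>2"
      by (simp add: d_def[abs_def])
  qed (use q in simp)
  define u where "u n = (\<Phi> ^^ n) (\<lambda>x. 0)" for n
  have u_Suc: "u (Suc n) = \<Phi> (u n)" for n by (simp add: u_def)
  have uL: "u n \<in> L2 M" for n
    by (induction n) (auto simp: u_def L2_zero \<Phi>L)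
  have step: "L2_norm M (\<lambda>x. u (Suc n) x - u n x) \<le> L2_norm M (\<lambda>x. u (Suc 0) x - u 0 x) * sqrt q ^ n" for n
  proof (induction n)
    case (Suc n)
    have "L2_norm M (\<lambda>x. u (Suc (Suc n)) x - u (Suc n) x) \<le> sqrt q * L2_norm M (\<lambda>x. u (Suc n) x - u n x)"
      using contr[OF uL uL, of "Suc n" n] by (simp add: u_Suc)
    also have "\<dots> \<le> sqrt q * (L2_norm M (\<lambda>x. u (Suc 0) x - u 0 x) * sqrt q ^ n)"
      using q by (intro mult_left_mono Suc.IH) auto
    finally show ?case by (simp add: mult_ac)
  qed simp
  have "sqrt q < 1" using q by simp
  with L2_geometric_convergent[where u = u, OF uL _ _ step] q
  obtain f where f: "f \<in> L2 M" and lim: "(\<lambda>n. L2_norm M (\<lambda>x. u n x - f x)) \<longlonglongrightarrow> 0"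
    by auto
  have est: "L2_norm M (\<lambda>x. ?S f x - g x) \<le>
      L * L2_norm M (\<lambda>x. u n x - f x) + L2_norm M (\<lambda>x. u (Suc 0) x - u 0 x) * sqrt q ^ n / (c * m)" for n
  proof -
    have "L2_norm M (\<lambda>x. ?S f x - g x) \<le>
        L2_norm M (\<lambda>x. ?S f x - ?S (u n) x) + L2_norm M (\<lambda>x. ?S (u n) x - g x)"
      by (intro L2_norm_triangle3 L2_shift f g uL)
    also have "L2_norm M (\<lambda>x. ?S f x - ?S (u n) x) = L2_norm M (\<lambda>x. ?S (u n) x - ?S f x)"
      by (rule L2_norm_minus_commute)
    also have "\<dots> = L2_norm M (?S (\<lambda>x. u n x - f x))"
      using shift_diff_AE[OF uL[of n] f, of z 1]
      by (intro L2_norm_cong_L2 L2_diff L2_shift uL f) auto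
    also have "\<dots> \<le> L * L2_norm M (\<lambda>x. u n x - f x)"
      by (intro upper L2_diff uL f) simp
    also have "L2_norm M (\<lambda>x. ?S (u n) x - g x) \<le>
        L2_norm M (\<lambda>x. u (Suc 0) x - u 0 x) * sqrt q ^ n / (c * m)"
    proof -
      have d: "(\<lambda>x. ?S (u n) x - g x) \<in> L2 M" by (intro L2_intros L2_shift uL g)
      \<comment> \<open>The adjoint is bounded below as well, so the residual S (u n) - g is
        controlled by its image under the adjoint, which up to sign is the next increment divided by
        c.\<close>
      have "m * L2_norm M (\<lambda>x. ?S (u n) x - g x) \<le> L2_norm M (?S' (\<lambda>x. ?S (u n) x - g x))"
        by (rule lower'[OF d])
      also have "\<dots> = L2_norm M (\<lambda>x. ?S' (?S (u n)) x - ?S' g x)"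
        using shift_diff_AE[OF L2_shift[OF uL[of n], of z] g, of "cnj z" 1]
        by (intro L2_norm_cong_L2 L2_diff L2_shift uL g) auto
      also have "\<dots> = L2_norm M (\<lambda>x. u (Suc n) x - u n x) / c"
        using L2_norm_scale[of M "- of_real c" "\<lambda>x. ?S' (?S (u n)) x - ?S' g x"] c
        by (simp add: u_Suc \<Phi>_def)
      also have "\<dots> \<le> L2_norm M (\<lambda>x. u (Suc 0) x - u 0 x) * sqrt q ^ n / c"
        using step[of n] c by (intro divide_right_mono) auto
      finally show ?thesis using c m by (simp add: field_simps)
    qed
    finally show ?thesis by simp
  qed
  have "(\<lambda>n. L * L2_norm M (\<lambda>x. u n x - f x) + L2_norm M (\<lambda>x. u (Suc 0) x - u 0 x) * sqrt q ^ n / (c * m))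
      \<longlonglongrightarrow> L * 0 + L2_norm M (\<lambda>x. u (Suc 0) x - u 0 x) * 0 / (c * m)"
    using q c m by (intro tendsto_intros lim LIMSEQ_realpow_zero) auto
  then have "L2_norm M (\<lambda>x. ?S f x - g x) \<le> 0"
    using est by (intro LIMSEQ_le_const[where X = "\<lambda>n. L * L2_norm M (\<lambda>x. u n x - f x) + L2_norm M (\<lambda>x. u (Suc 0) x - u 0 x) * sqrt q ^ n / (c * m)"]) auto
  then have "L2_norm M (\<lambda>x. ?S f x - g x) = 0" by (simp add: antisym)
  then have "AE x in M. ?S f x - g x = 0"
    using L2_norm_eq_0[OF L2_diff[OF L2_shift[OF f] g]] by simp
  then show ?thesis using f by auto
qed

definition approx_eigenvalue :: "real \<Rightarrow> bool" where
  "approx_eigenvalue l \<longleftrightarrow> (\<forall>\<delta>>0. \<exists>f \<in> L2 M. 0 < L2_norm M f \<and>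
     L2_norm M (shift t (of_real l) f) \<le> \<delta> * L2_norm M f)"

text \<open>With \<open>m\<close> the infimum of \<open>\<parallel>S f\<parallel> / \<parallel>f\<parallel>\<close> for \<open>S = t - l\<close>, the operator \<open>P = S\<^sup>2 - m\<^sup>2\<close> is
  non-negative, so \<open>\<parallel>P f\<parallel>\<^sup>2 \<le> L\<^sup>2 \<langle>f, P f\<rangle>\<close>; hence \<open>(S - m)(S + m)\<close> is not bounded below.\<close>

lemma approx_eigenvalue_near:
  assumes f0: "f0 \<in> L2 M" "0 < L2_norm M f0"
    and small: "L2_norm M (shift t (of_real l) f0) \<le> e * L2_norm M f0"
  shows "\<exists>x. approx_eigenvalue x \<and> \<bar>x - l\<bar> \<le> e"
proof -
  let ?S = "shift t (of_real l)"
  define A where "A = {L2_norm M (?S f) / L2_norm M f | f. f \<in> L2 M \<and> 0 < L2_norm M f}"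
  define m where "m = Inf A"
  have bdd: "bdd_below A" by (rule bdd_belowI[of _ 0]) (auto simp: A_def)
  have inA: "L2_norm M (?S f0) / L2_norm M f0 \<in> A" using f0 by (auto simp: A_def)
  have m0: "m \<ge> 0" unfolding m_def using inA by (intro cInf_greatest) (auto simp: A_def)
  have "m \<le> L2_norm M (?S f0) / L2_norm M f0" unfolding m_def by (rule cInf_lower[OF inA bdd])
  also have "\<dots> \<le> e" using small f0 by (simp add: field_simps)
  finally have me: "m \<le> e" .
  have low: "m * L2_norm M f \<le> L2_norm M (?S f)" if f: "f \<in> L2 M" for f
  proof (cases "L2_norm M f = 0")
    case False
    then have pos: "L2_norm M f > 0" using L2_norm_nonneg[of M f] by linarith
    then have "m \<le> L2_norm M (?S f) / L2_norm M f"
      unfolding m_def using f by (intro cInf_lower bdd) (auto simp: A_def)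
    then show ?thesis using pos by (simp add: field_simps)
  qed simp
  define L where "L = \<bar>K\<bar> + \<bar>l\<bar> + 1"
  have L: "L > 0" by (simp add: L_def add_nonneg_pos)
  have upper: "L2_norm M (?S f) \<le> L * L2_norm M f" if "f \<in> L2 M" for f
  proof -
    have "L2_norm M (?S f) \<le> (K + \<bar>l\<bar>) * L2_norm M f" using norm_shift_le[OF that, of "of_real l"] by simp
    also have "\<dots> \<le> L * L2_norm M f" using that by (intro mult_right_mono) (auto simp: L_def)
    finally show ?thesis .
  qed
  define P where "P f = (\<lambda>x. ?S (?S f) x - of_real (m\<^sup>2) * f x)" for f
  have PL: "P f \<in> L2 M" if "f \<in> L2 M" for f
    unfolding P_def by (intro L2_intros L2_shift that)
  \<comment> \<open>Cauchy-Schwarz for the non-negative form of P, obtained by applying the lower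
    bound \<open>low\<close> to f - s P f with s = 1 / L^2.\<close>
  have Pbound: "(L2_norm M (P f))\<^sup>2 \<le> L\<^sup>2 * ((L2_norm M (?S f))\<^sup>2 - m\<^sup>2 * (L2_norm M f)\<^sup>2)" if f: "f \<in> L2 M" for f
  proof -
    define s where "s = 1 / L\<^sup>2"
    have s: "s > 0" "s * L\<^sup>2 = 1" using L by (simp_all add: s_def)
    let ?p = "P f"
    note p = PL[OF f]
    have k: "(\<lambda>x. f x - of_real s * ?p x) \<in> L2 M" by (intro L2_intros f p)
    have "L2_norm M (?S (\<lambda>x. f x - of_real s * ?p x)) = L2_norm M (\<lambda>x. ?S f x - of_real s * ?S ?p x)"
      by (intro L2_norm_cong_L2 L2_diff L2_scale L2_shift shift_diff_AE f p)
    then have "(m * L2_norm M (\<lambda>x. f x - of_real s * ?p x))\<^sup>2 \<le> (L2_norm M (\<lambda>x. ?S f x - of_real s * ?S ?p x))\<^sup>2"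
      using low[OF k] m0 by (intro power_mono) auto
    then have 1: "m\<^sup>2 * ((L2_norm M f)\<^sup>2 - 2 * (s * Re (L2_inner M f ?p)) + s\<^sup>2 * (L2_norm M ?p)\<^sup>2)
        \<le> (L2_norm M (?S f))\<^sup>2 - 2 * (s * Re (L2_inner M (?S f) (?S ?p))) + s\<^sup>2 * (L2_norm M (?S ?p))\<^sup>2"
      by (simp add: L2_norm_diff_sq f p L2_shift L2_scale power_mult_distrib)
    have "L2_inner M ?p ?p = L2_inner M (?S (?S f)) ?p - of_real (m\<^sup>2) * L2_inner M f ?p"
      by (subst P_def) (simp add: L2_inner_diff_left L2_shift f p L2_scale)
    also have "L2_inner M (?S (?S f)) ?p = L2_inner M (?S f) (?S ?p)"
      using shift_adj[OF L2_shift[OF f, of "of_real l"] p, of "of_real l"] by simp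
    finally have 2: "Re (L2_inner M (?S f) (?S ?p)) - m\<^sup>2 * Re (L2_inner M f ?p) = (L2_norm M ?p)\<^sup>2"
      by (simp add: L2_inner_self complex_eq_iff del: of_real_power)
    have "s\<^sup>2 * (L2_norm M (?S ?p))\<^sup>2 \<le> s\<^sup>2 * (L * L2_norm M ?p)\<^sup>2"
      by (intro mult_left_mono power_mono upper p) auto
    also have "\<dots> = s * (s * L\<^sup>2) * (L2_norm M ?p)\<^sup>2" by (simp add: power2_eq_square mult_ac)
    finally have 3: "s\<^sup>2 * (L2_norm M (?S ?p))\<^sup>2 \<le> s * (L2_norm M ?p)\<^sup>2" using s by simp
    have 4: "0 \<le> m\<^sup>2 * (s\<^sup>2 * (L2_norm M ?p)\<^sup>2)" by simp
    have aux: "s * Q \<le> S - m2 * F"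
      if "m2 * (F - 2 * (s * B) + T) \<le> S - 2 * (s * A) + W" "A - m2 * B = Q" "W \<le> s * Q" "0 \<le> m2 * T"
      for m2 F B T S A W Q :: real
    proof -
      have "s * A = s * Q + s * (m2 * B)" by (simp add: that(2)[symmetric] algebra_simps)
      moreover have "m2 * (F - 2 * (s * B) + T) = m2 * F - 2 * (s * (m2 * B)) + m2 * T"
        by (simp add: algebra_simps)
      ultimately show ?thesis using that by linarith
    qed
    have "s * (L2_norm M ?p)\<^sup>2 \<le> (L2_norm M (?S f))\<^sup>2 - m\<^sup>2 * (L2_norm M f)\<^sup>2"
      by (rule aux[OF 1 2 3 4])
    then have "L\<^sup>2 * (s * (L2_norm M ?p)\<^sup>2) \<le> L\<^sup>2 * ((L2_norm M (?S f))\<^sup>2 - m\<^sup>2 * (L2_norm M f)\<^sup>2)"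
      by (intro mult_left_mono) auto
    then show ?thesis using s by (simp add: mult_ac mult.assoc[symmetric])
  qed
  have either: "\<exists>x\<in>{l + m, l - m}. \<exists>f\<in>L2 M. 0 < L2_norm M f \<and> L2_norm M (shift t (of_real x) f) \<le> \<delta> * L2_norm M f"
    if \<delta>: "\<delta> > 0" for \<delta>
  proof -
    \<comment> \<open>A margin n is sought for which a function with |S f| < (m + n) |f| satisfies
      |P f| <= \<delta>^2 |f|.\<close>
    have "((\<lambda>n. L\<^sup>2 * ((m + n)\<^sup>2 - m\<^sup>2)) \<longlongrightarrow> L\<^sup>2 * ((m + 0)\<^sup>2 - m\<^sup>2)) (at_right 0)"
      by (intro tendsto_intros)
    then have "\<forall>\<^sub>F n in at_right 0. L\<^sup>2 * ((m + n)\<^sup>2 - m\<^sup>2) < (\<delta>\<^sup>2)\<^sup>2"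
      using \<delta> by (intro order_tendstoD(2)) auto
    then have "\<forall>\<^sub>F n in at_right 0. 0 < n \<and> L\<^sup>2 * ((m + n)\<^sup>2 - m\<^sup>2) < (\<delta>\<^sup>2)\<^sup>2"
      by (intro eventually_conj eventually_at_right_less) auto
    then obtain n where n: "n > 0" "L\<^sup>2 * ((m + n)\<^sup>2 - m\<^sup>2) < (\<delta>\<^sup>2)\<^sup>2"
      using eventually_happens[of _ "at_right (0::real)"] by (auto simp: trivial_limit_at_right_real)
    have "\<exists>a\<in>A. a < m + n"
      using n inA cInf_lessD[of A "m + n"] by (auto simp: m_def)
    then obtain f where f: "f \<in> L2 M" "0 < L2_norm M f" "L2_norm M (?S f) / L2_norm M f < m + n"
      by (auto simp: A_def)
    then have "L2_norm M (?S f) \<le> (m + n) * L2_norm M f" by (simp add: field_simps)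
    then have "(L2_norm M (?S f))\<^sup>2 \<le> ((m + n) * L2_norm M f)\<^sup>2" by (intro power_mono) auto
    then have "L\<^sup>2 * ((L2_norm M (?S f))\<^sup>2 - m\<^sup>2 * (L2_norm M f)\<^sup>2) \<le>
        L\<^sup>2 * ((m + n)\<^sup>2 * (L2_norm M f)\<^sup>2 - m\<^sup>2 * (L2_norm M f)\<^sup>2)"
      by (intro mult_left_mono) (auto simp: power_mult_distrib)
    also have "\<dots> = L\<^sup>2 * ((m + n)\<^sup>2 - m\<^sup>2) * (L2_norm M f)\<^sup>2" by (simp add: algebra_simps)
    also have "\<dots> \<le> (\<delta>\<^sup>2)\<^sup>2 * (L2_norm M f)\<^sup>2" using n by (intro mult_right_mono) auto
    finally have "(L2_norm M (P f))\<^sup>2 \<le> (\<delta>\<^sup>2 * L2_norm M f)\<^sup>2"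
      using Pbound[OF f(1)] by (simp add: power_mult_distrib)
    then have Pf: "L2_norm M (P f) \<le> \<delta>\<^sup>2 * L2_norm M f" by (rule power2_le_imp_le) simp
    \<comment> \<open>g = (S + m) f. Either g is small, and f is an approximate eigenvector for l -
      m, or (S - m) g = P f is small compared with g, and g is one for l + m.\<close>
    define g where "g = shift t (of_real (l - m)) f"
    have g: "g \<in> L2 M" unfolding g_def by (rule L2_shift[OF f(1)])
    show ?thesis
    proof (cases "L2_norm M g \<le> \<delta> * L2_norm M f")
      case True
      then show ?thesis using f by (auto simp: g_def)
    next
      case False
      then have gpos: "L2_norm M g > \<delta> * L2_norm M f" by simp
      have eq: "g = (\<lambda>x. ?S f x - of_real (- m) * f x)"
        by (auto simp: g_def shift_def algebra_simps)
      have "AE x in M. shift t (of_real (l + m)) g x = P f x"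
        using shift_diff_AE[OF L2_shift[OF f(1), of "of_real l"] f(1), of "of_real l" "of_real (- m)"]
        unfolding eq[symmetric]
      proof eventually_elim
        case (elim x)
        have gx: "g x = ?S f x + of_real m * f x" by (simp add: eq)
        have "shift t (of_real (l + m)) g x = ?S g x - of_real m * g x"
          by (simp add: shift_def algebra_simps)
        also have "\<dots> = ?S (?S f) x + of_real m * ?S f x - of_real m * (?S f x + of_real m * f x)"
          unfolding elim gx by simp
        also have "\<dots> = P f x" by (simp add: P_def power2_eq_square algebra_simps)
        finally show ?case .
      qed
      then have "L2_norm M (shift t (of_real (l + m)) g) = L2_norm M (P f)"
        by (intro L2_norm_cong_L2 L2_shift g PL f(1))
      also have "\<dots> \<le> \<delta> * (\<delta> * L2_norm M f)" using Pf by (simp add: power2_eq_square mult_ac)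
      also have "\<dots> \<le> \<delta> * L2_norm M g" using gpos \<delta> by (intro mult_left_mono) auto
      finally have "L2_norm M (shift t (of_real (l + m)) g) \<le> \<delta> * L2_norm M g" .
      moreover have "0 < L2_norm M g" using gpos f(2) \<delta> by (meson less_trans mult_pos_pos)
      ultimately show ?thesis using g by auto
    qed
  qed
  \<comment> \<open>Which of the two points works may depend on the tolerance. If both failed, with
    tolerances d1 and d2, then neither would work for \<open>min d1 d2\<close>, against
    \<open>either\<close>.\<close>
  have "approx_eigenvalue (l + m) \<or> approx_eigenvalue (l - m)"
  proof (rule ccontr)
    assume "\<not> ?thesis"
    then obtain d1 d2 where d: "d1 > 0" "d2 > 0"
      and n1: "\<And>f. f \<in> L2 M \<Longrightarrow> 0 < L2_norm M f \<Longrightarrow> \<not> L2_norm M (shift t (of_real (l + m)) f) \<le> d1 * L2_norm M f"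
      and n2: "\<And>f. f \<in> L2 M \<Longrightarrow> 0 < L2_norm M f \<Longrightarrow> \<not> L2_norm M (shift t (of_real (l - m)) f) \<le> d2 * L2_norm M f"
      unfolding approx_eigenvalue_def by blast
    obtain x f where xf: "x \<in> {l + m, l - m}" "f \<in> L2 M" "0 < L2_norm M f"
      "L2_norm M (shift t (of_real x) f) \<le> min d1 d2 * L2_norm M f"
      using either[of "min d1 d2"] d unfolding min_less_iff_conj by blast
    have "min d1 d2 * L2_norm M f \<le> d1 * L2_norm M f" "min d1 d2 * L2_norm M f \<le> d2 * L2_norm M f"
      by (intro mult_right_mono; simp)+
    then have "L2_norm M (shift t (of_real x) f) \<le> d1 * L2_norm M f"
      "L2_norm M (shift t (of_real x) f) \<le> d2 * L2_norm M f"
      using xf(4) by linarith+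
    with xf(1) n1[OF xf(2,3)] n2[OF xf(2,3)] show False by blast
  qed
  then show ?thesis using me m0 by (auto intro: exI[of _ "l + m"] exI[of _ "l - m"])
qed

end

section \<open>Spectrum of a bounded symmetric operator given by its graph\<close>

definition bounded_symmetric_graph :: "'a measure \<Rightarrow> 'a operator \<Rightarrow> bool" where
  "bounded_symmetric_graph M T \<longleftrightarrow> T \<subseteq> L2 M \<times> L2 M \<and> bounded_everywhere M T \<and>
     (\<forall>(f, g) \<in> T. \<forall>(f', g') \<in> T. L2_inner M f g' = L2_inner M g f')"

definition graph_fun :: "'a operator \<Rightarrow> ('a \<Rightarrow> complex) \<Rightarrow> 'a \<Rightarrow> complex" where
  "graph_fun T f = (SOME g. (f, g) \<in> T)"

context
  fixes M :: "'a measure" and T :: "'a operator"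
  assumes T: "bounded_symmetric_graph M T"
begin

lemma graph_fun: "f \<in> L2 M \<Longrightarrow> (f, graph_fun T f) \<in> T"
  using T unfolding bounded_symmetric_graph_def bounded_everywhere_def graph_fun_def
  by (blast intro: someI_ex[of "\<lambda>g. (f, g) \<in> T"])

lemma graph_L2: "(f, g) \<in> T \<Longrightarrow> f \<in> L2 M" "(f, g) \<in> T \<Longrightarrow> g \<in> L2 M"
  using T unfolding bounded_symmetric_graph_def by auto

lemma graph_fun_AE: "(f, g) \<in> T \<Longrightarrow> AE x in M. g x = graph_fun T f x"
  using T graph_fun[OF graph_L2(1), of f g]
  unfolding bounded_symmetric_graph_def bounded_everywhere_def by blast

lemma graph_bound: "\<exists>K. \<forall>(f, g) \<in> T. L2_norm M g \<le> K * L2_norm M f"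
  using T unfolding bounded_symmetric_graph_def bounded_everywhere_def by blast

definition "graph_norm = (SOME K. \<forall>(f, g) \<in> T. L2_norm M g \<le> K * L2_norm M f)"

interpretation t: bounded_symmetric M "graph_fun T" graph_norm
proof
  fix f g assume f: "f \<in> L2 M"
  show "graph_fun T f \<in> L2 M" by (rule graph_L2(2)[OF graph_fun[OF f]])
  show "L2_norm M (graph_fun T f) \<le> graph_norm * L2_norm M f"
    using someI_ex[OF graph_bound] graph_fun[OF f] unfolding graph_norm_def by auto
  assume g: "g \<in> L2 M"
  show "L2_inner M f (graph_fun T g) = L2_inner M (graph_fun T f) g"
    using T graph_fun[OF f] graph_fun[OF g] unfolding bounded_symmetric_graph_def by auto
qed

lemma bounded_symmetric_graph_fun: "bounded_symmetric M (graph_fun T) graph_norm"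
  by (rule t.bounded_symmetric_axioms)

lemma in_shifted_graphD:
  assumes "(f, g) \<in> op_plus T (mult_op M (\<lambda>_. - z))"
  shows "f \<in> L2 M" "g \<in> L2 M" "AE x in M. g x = shift (graph_fun T) z f x"
proof -
  obtain g0 k where gk: "g = (\<lambda>x. g0 x + k x)" "(f, g0) \<in> T" "k \<in> L2 M" "AE x in M. k x = - z * f x"
    using assms unfolding op_plus_def mult_op_def by auto
  show "f \<in> L2 M" "g \<in> L2 M" using gk graph_L2[OF gk(2)] by (auto intro: L2_add)
  show "AE x in M. g x = shift (graph_fun T) z f x"
    using gk(4) graph_fun_AE[OF gk(2)] by eventually_elim (simp add: gk(1) shift_def)
qed

text \<open>The null-set discrepancy between g and the chosen representative is put into the
  multiplication part of the sum, whose graph is closed under such changes.\<close>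

lemma in_shifted_graphI:
  assumes f: "f \<in> L2 M" and g: "g \<in> L2 M" and eq: "AE x in M. shift (graph_fun T) z f x = g x"
  shows "(f, g) \<in> op_plus T (mult_op M (\<lambda>_. - z))"
proof -
  let ?k = "\<lambda>x. g x - graph_fun T f x"
  have "(f, ?k) \<in> mult_op M (\<lambda>_. - z)"
  proof -
    have "AE x in M. ?k x = - z * f x"
      using eq by eventually_elim (simp add: shift_def algebra_simps)
    then show ?thesis unfolding mult_op_def using f L2_diff[OF g t.L2_t[OF f]] by simp
  qed
  moreover have "g = (\<lambda>x. graph_fun T f x + ?k x)" by simp
  ultimately show ?thesis
    unfolding op_plus_def using graph_fun[OF f]
    by (intro CollectI exI[of _ f] exI[of _ "graph_fun T f"] exI[of _ ?k] conjI) auto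
qed

text \<open>For a symmetric operator the lower bound already yields surjectivity, by
  \<open>shift_surj\<close>; uniqueness and boundedness of the inverse follow from it
  directly.\<close>

lemma resolvent_setI:
  assumes m: "m > 0" and lower: "\<And>f. f \<in> L2 M \<Longrightarrow> m * L2_norm M f \<le> L2_norm M (shift (graph_fun T) z f)"
  shows "z \<in> resolvent_set M T"
  unfolding resolvent_set_def bounded_everywhere_def mem_Collect_eq
proof (intro conjI ballI allI impI)
  fix g assume "g \<in> L2 M"
  then show "\<exists>f. (g, f) \<in> (op_plus T (mult_op M (\<lambda>_. - z)))\<inverse>"
    using t.shift_surj[OF m lower] in_shifted_graphI by blast
next
  fix g f f'
  assume "(g, f) \<in> (op_plus T (mult_op M (\<lambda>_. - z)))\<inverse>" "(g, f') \<in> (op_plus T (mult_op M (\<lambda>_. - z)))\<inverse>"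
  then have 1: "(f, g) \<in> op_plus T (mult_op M (\<lambda>_. - z))" and 2: "(f', g) \<in> op_plus T (mult_op M (\<lambda>_. - z))"
    by auto
  note f = in_shifted_graphD[OF 1] and f' = in_shifted_graphD[OF 2]
  have d: "(\<lambda>x. f x - f' x) \<in> L2 M" by (intro L2_diff f f')
  have "AE x in M. shift (graph_fun T) z (\<lambda>x. f x - f' x) x = 0"
    using f(3) f'(3) t.shift_diff_AE[OF f(1) f'(1), of z 1] by eventually_elim simp
  then have "L2_norm M (shift (graph_fun T) z (\<lambda>x. f x - f' x)) = 0"
    using L2_norm_eq_0[OF t.L2_shift[OF d]] by simp
  then have "L2_norm M (\<lambda>x. f x - f' x) = 0"
    using lower[OF d] m by (simp add: mult_le_0_iff antisym)
  then show "AE x in M. f x = f' x"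
    using L2_norm_eq_0[OF d] by simp
next
  have "\<forall>(g, f) \<in> (op_plus T (mult_op M (\<lambda>_. - z)))\<inverse>. L2_norm M f \<le> (1 / m) * L2_norm M g"
  proof clarify
    fix g f assume "(f, g) \<in> op_plus T (mult_op M (\<lambda>_. - z))"
    note f = in_shifted_graphD[OF this]
    have "L2_norm M g = L2_norm M (shift (graph_fun T) z f)"
      using f by (intro L2_norm_cong_L2 t.L2_shift)
    then show "L2_norm M f \<le> (1 / m) * L2_norm M g"
      using lower[OF f(1)] m by (simp add: field_simps)
  qed
  then show "\<exists>K. \<forall>(g, f) \<in> (op_plus T (mult_op M (\<lambda>_. - z)))\<inverse>. L2_norm M f \<le> K * L2_norm M g"
    by blast
qed

lemma resolvent_setD:
  assumes "z \<in> resolvent_set M T"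
  shows "\<exists>m>0. \<forall>f \<in> L2 M. m * L2_norm M f \<le> L2_norm M (shift (graph_fun T) z f)"
proof -
  obtain K where K: "\<And>f g. (f, g) \<in> op_plus T (mult_op M (\<lambda>_. - z)) \<Longrightarrow> L2_norm M f \<le> K * L2_norm M g"
    using assms unfolding resolvent_set_def bounded_everywhere_def by fastforce
  \<comment> \<open>K may be zero or negative, so a positive bound is made from it before
    inverting.\<close>
  have "1 / (\<bar>K\<bar> + 1) * L2_norm M f \<le> L2_norm M (shift (graph_fun T) z f)" if f: "f \<in> L2 M" for f
  proof -
    have "L2_norm M f \<le> K * L2_norm M (shift (graph_fun T) z f)"
      by (intro K in_shifted_graphI f t.L2_shift) auto
    also have "\<dots> \<le> (\<bar>K\<bar> + 1) * L2_norm M (shift (graph_fun T) z f)"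
      by (intro mult_right_mono) auto
    finally show ?thesis by (simp add: field_simps)
  qed
  then show ?thesis by (intro exI[of _ "1 / (\<bar>K\<bar> + 1)"]) auto
qed

text \<open>Contraposition of \<open>resolvent_setI\<close>. The constant |Im z| forces z to be
  real, since \<open>norm_shift_ge_Im\<close> provides that lower bound; the constant \<delta> gives
  the approximate eigenvector.\<close>

lemma spectrum_approx_eigenvalue:
  assumes "z \<in> spectrum M T"
  shows "Im z = 0"
    and "\<delta> > 0 \<Longrightarrow> \<exists>f \<in> L2 M. 0 < L2_norm M f \<and> L2_norm M (shift (graph_fun T) z f) \<le> \<delta> * L2_norm M f"
proof -
  have no: "\<not> (\<forall>f \<in> L2 M. m * L2_norm M f \<le> L2_norm M (shift (graph_fun T) z f))" if "m > 0" for m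
    using resolvent_setI[OF that] assms by (auto simp: spectrum_def)
  show "Im z = 0"
    using no[of "\<bar>Im z\<bar>"] t.norm_shift_ge_Im by auto
  assume "\<delta> > 0"
  from no[OF this] obtain f where f: "f \<in> L2 M" "L2_norm M (shift (graph_fun T) z f) < \<delta> * L2_norm M f"
    by (auto simp: not_le)
  have "0 \<le> L2_norm M (shift (graph_fun T) z f)" by simp
  with f \<open>\<delta> > 0\<close> have "0 < L2_norm M f" by (smt (verit) zero_less_mult_pos)
  with f show "\<exists>f \<in> L2 M. 0 < L2_norm M f \<and> L2_norm M (shift (graph_fun T) z f) \<le> \<delta> * L2_norm M f"
    by (auto intro: less_imp_le)
qed

text \<open>\<open>approx_eigenvalue_near\<close> supplies an approximate eigenvalue within e, and
  approximate eigenvectors rule out any lower bound there. In this way residual estimates become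
  statements on the spectrum, in both directions of the comparison.\<close>

lemma spectrum_near:
  assumes "f \<in> L2 M" "0 < L2_norm M f"
    and "L2_norm M (shift (graph_fun T) (of_real l) f) \<le> e * L2_norm M f"
  shows "\<exists>x. complex_of_real x \<in> spectrum M T \<and> \<bar>x - l\<bar> \<le> e"
proof -
  obtain x where x: "t.approx_eigenvalue x" "\<bar>x - l\<bar> \<le> e"
    using t.approx_eigenvalue_near[OF assms] by blast
  have "complex_of_real x \<notin> resolvent_set M T"
  proof
    assume "complex_of_real x \<in> resolvent_set M T"
    then obtain m where m: "m > 0"
      "\<And>f. f \<in> L2 M \<Longrightarrow> m * L2_norm M f \<le> L2_norm M (shift (graph_fun T) (of_real x) f)"
      using resolvent_setD by blast
    obtain f where f: "f \<in> L2 M" "0 < L2_norm M f"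
      "L2_norm M (shift (graph_fun T) (of_real x) f) \<le> (m / 2) * L2_norm M f"
      using x(1) m(1) unfolding t.approx_eigenvalue_def by (meson half_gt_zero)
    then have "m * L2_norm M f \<le> (m / 2) * L2_norm M f" using m(2)[OF f(1)] by linarith
    then show False using f(2) m(1) by simp
  qed
  then show ?thesis using x by (auto simp: spectrum_def)
qed

end

section \<open>Fourier transforms of grid cells\<close>

lemma bij_betw_axis_Basis: "bij_betw (\<lambda>i. axis i (1::real)) (UNIV :: 'n::finite set) Basis"
  by (auto simp: bij_betw_def inj_on_def axis_eq_axis Basis_vec_def)

text \<open>Lebesgue measure on vectors is the image of the product measure indexed by
  \<open>Basis\<close>; \<open>ix\<close> recovers the coordinate index of a basis vector, so that
  Fubini for finite products applies.\<close>

lemma integral_prod_lborel_vec: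
  fixes f :: "'n::finite \<Rightarrow> real \<Rightarrow> complex"
  assumes f: "\<And>i. integrable lborel (f i)"
  shows "integrable lborel (\<lambda>x :: real ^ 'n. \<Prod>i\<in>UNIV. f i (x $ i))"
    and "(\<integral>x. (\<Prod>i\<in>UNIV. f i (x $ i)) \<partial>(lborel :: (real ^ 'n) measure)) = (\<Prod>i\<in>UNIV. \<integral>x. f i x \<partial>lborel)"
proof -
  interpret P: product_sigma_finite "\<lambda>_ :: real ^ 'n. lborel :: real measure"
    by (simp add: product_sigma_finite_def sigma_finite_lborel)
  let ?M = "Pi\<^sub>M (Basis :: (real ^ 'n) set) (\<lambda>_. lborel :: real measure)"
  let ?T = "\<lambda>g. (\<Sum>b\<in>Basis. g b *\<^sub>R b) :: real ^ 'n"
  define ix where "ix = inv (\<lambda>i::'n. axis i (1::real))"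
  have inj: "inj (\<lambda>i::'n. axis i (1::real))" by (auto simp: inj_on_def axis_eq_axis)
  have ix: "ix (axis i 1) = i" for i unfolding ix_def by (rule inv_f_f[OF inj])
  have [measurable]: "f i \<in> borel_measurable borel" for i
    using borel_measurable_integrable[OF f[of i]] by simp
  have comp: "?T g $ i = g (axis i 1)" for g i
  proof -
    have "?T g $ i = ?T g \<bullet> axis i 1" by (simp add: inner_axis)
    also have "\<dots> = g (axis i 1)"
      by (subst inner_sum_left_Basis) (auto simp: Basis_vec_def)
    finally show ?thesis .
  qed
  have eq: "(\<Prod>i\<in>UNIV. f i (?T g $ i)) = (\<Prod>b\<in>Basis. f (ix b) (g b))" for g
    by (subst prod.reindex_bij_betw[OF bij_betw_axis_Basis, symmetric]) (simp only: comp ix)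
  have meas: "(\<lambda>x :: real ^ 'n. \<Prod>i\<in>UNIV. f i (x $ i)) \<in> borel_measurable borel"
    by measurable
  have T: "?T \<in> ?M \<rightarrow>\<^sub>M borel" by measurable
  have "integrable ?M (\<lambda>g. \<Prod>b\<in>Basis. f (ix b) (g b))"
    by (intro P.product_integrable_prod f) auto
  then show "integrable lborel (\<lambda>x :: real ^ 'n. \<Prod>i\<in>UNIV. f i (x $ i))"
    by (subst lborel_eq, subst integrable_distr_eq[OF T meas]) (simp only: eq)
  have "(\<integral>x. (\<Prod>i\<in>UNIV. f i (x $ i)) \<partial>(lborel :: (real ^ 'n) measure))
      = (\<integral>g. (\<Prod>b\<in>Basis. f (ix b) (g b)) \<partial>?M)"
    by (subst lborel_eq, subst integral_distr[OF T meas]) (simp only: eq)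
  also have "\<dots> = (\<Prod>b\<in>Basis. \<integral>x. f (ix b) x \<partial>lborel)"
    by (intro P.product_integral_prod f) auto
  also have "\<dots> = (\<Prod>i\<in>UNIV. \<integral>x. f i x \<partial>lborel)"
    by (subst prod.reindex_bij_betw[OF bij_betw_axis_Basis, symmetric]) (simp add: ix)
  finally show "(\<integral>x. (\<Prod>i\<in>UNIV. f i (x $ i)) \<partial>(lborel :: (real ^ 'n) measure)) = (\<Prod>i\<in>UNIV. \<integral>x. f i x \<partial>lborel)" .
qed

text \<open>Integration by parts suggests the primitive: sin^2 x / x^2 integrates to - sin^2 x / x
  plus the integral of sin (2 x) / x. At 0 the difference quotient of sin y sinc y is (sinc y)^2,
  which tends to 1.\<close>

lemma DERIV_sin_sinc:
  "((\<lambda>x. Si (2 * x) - sin x * sinc x) has_real_derivative (sinc x)\<^sup>2) (at x)"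
proof (cases "x = 0")
  case True
  have 1: "((\<lambda>x. Si (2 * x)) has_real_derivative 2) (at 0)"
  proof -
    have "((\<lambda>x. Si (2 * x)) has_real_derivative sinc (2 * 0) * 2) (at 0)"
      by (rule DERIV_chain2[OF DERIV_Si]) (auto intro!: derivative_eq_intros)
    then show ?thesis by simp
  qed
  have "((\<lambda>y. sinc y * sinc y) \<longlongrightarrow> sinc 0 * sinc 0) (at 0)"
    using isCont_sinc[of 0] unfolding isCont_def by (rule tendsto_mult) (use isCont_sinc[of 0] in \<open>simp add: isCont_def\<close>)
  then have "((\<lambda>y. sinc y * sinc y) \<longlongrightarrow> 1) (at 0)" by simp
  moreover have "\<forall>\<^sub>F y in at 0. (sin y * sinc y - sin 0 * sinc 0) / (y - 0) = sinc y * sinc y"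
    by (auto simp: eventually_at_filter)
  ultimately have 2: "((\<lambda>y. sin y * sinc y) has_real_derivative 1) (at 0)"
    unfolding has_field_derivative_iff by (simp add: tendsto_cong)
  show ?thesis using DERIV_diff[OF 1 2] True by simp
next
  case False
  have 1: "((\<lambda>x. Si (2 * x)) has_real_derivative sinc (2 * x) * 2) (at x)"
    by (rule DERIV_chain2[OF DERIV_Si]) (auto intro!: derivative_eq_intros)
  have 2: "((\<lambda>y. sin y * (sin y / y)) has_real_derivative
      (cos x * (sin x / x) + sin x * ((cos x * x - sin x) / x\<^sup>2))) (at x)"
    using False by (auto intro!: derivative_eq_intros simp: power2_eq_square field_simps)
  have ev: "\<forall>\<^sub>F y in nhds x. sin y * sinc y = sin y * (sin y / y)"
    using t1_space_nhds[OF False] by (auto elim!: eventually_mono)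
  have 3: "((\<lambda>y. sin y * sinc y) has_real_derivative
      (cos x * (sin x / x) + sin x * ((cos x * x - sin x) / x\<^sup>2))) (at x)"
    using 2 DERIV_cong_ev[OF refl ev refl] by simp
  have "sinc (2 * x) * 2 - (cos x * (sin x / x) + sin x * ((cos x * x - sin x) / x\<^sup>2)) = (sinc x)\<^sup>2"
  proof -
    have "sinc (2 * x) * 2 = 2 * sin x * cos x / x"
      using False by (simp add: sin_double)
    then show ?thesis using False by (simp add: power2_eq_square field_simps)
  qed
  then show ?thesis using DERIV_diff[OF 1 3] by simp
qed

lemma has_bochner_integral_sinc_sq: "has_bochner_integral lborel (\<lambda>x. (sinc x)\<^sup>2) pi"
proof -
  have lim: "((\<lambda>x. Si (2 * x) - sin x * sinc x) \<longlongrightarrow> pi / 2 - 0) at_top"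
  proof (intro tendsto_diff)
    show "((\<lambda>x. Si (2 * x)) \<longlongrightarrow> pi / 2) at_top"
      by (rule filterlim_compose[OF Si_at_top])
         (auto intro!: filterlim_tendsto_pos_mult_at_top[OF tendsto_const] filterlim_ident)
    show "((\<lambda>x. sin x * sinc x) \<longlongrightarrow> 0) at_top"
    proof (rule Lim_null_comparison)
      show "\<forall>\<^sub>F x in at_top. norm (sin x * sinc x) \<le> 1 / x"
        using eventually_gt_at_top[of 0]
      proof eventually_elim
        case (elim x)
        have "\<bar>sin x\<bar> * \<bar>sin x\<bar> \<le> 1 * 1" by (intro mult_mono) auto
        then show ?case using elim by (simp add: abs_mult divide_right_mono)
      qed
      show "((\<lambda>x::real. 1 / x) \<longlongrightarrow> 0) at_top"
        by (intro tendsto_divide_0[OF tendsto_const] filterlim_at_top_imp_at_infinity filterlim_ident)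
    qed
  qed
  have "(\<integral>\<^sup>+x. ennreal ((sinc x)\<^sup>2) * indicator {0..} x \<partial>lborel) = ennreal (pi / 2 - 0 - (Si (2 * 0) - sin 0 * sinc 0))"
    by (rule nn_integral_FTC_atLeast[OF _ DERIV_sin_sinc _ lim]) auto
  also have "Si (2 * 0) = 0" by (simp add: Si_def zero_ereal_def)
  finally have "(\<integral>\<^sup>+x. ennreal ((sinc x)\<^sup>2) * indicator {0..} x \<partial>lborel) = ennreal (pi / 2)" by simp
  then have "has_bochner_integral lborel (\<lambda>x. indicator {0..} x *\<^sub>R (sinc x)\<^sup>2) (pi / 2)"
    by (intro has_bochner_integral_nn_integral)
       (auto simp: indicator_def ennreal_mult'' mult.commute intro!: nn_integral_cong elim!: back_subst[of "\<lambda>x. x = _"])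
  from has_bochner_integral_even_function[OF this] show ?thesis by simp
qed

lemma has_bochner_integral_scaled_sinc_sq:
  "has_bochner_integral lborel (\<lambda>x. (a * sinc (a * x))\<^sup>2) (pi * \<bar>a\<bar>)"
proof (cases "a = 0")
  case False
  have "has_bochner_integral lborel (\<lambda>x. (sinc (0 + a * x))\<^sup>2) (pi /\<^sub>R \<bar>a\<bar>)"
    using lborel_has_bochner_integral_real_affine_iff[OF False, of "\<lambda>x. (sinc x)\<^sup>2" pi 0]
      has_bochner_integral_sinc_sq by simp
  then have "has_bochner_integral lborel (\<lambda>x. a\<^sup>2 * (sinc (0 + a * x))\<^sup>2) (a\<^sup>2 * (pi /\<^sub>R \<bar>a\<bar>))"
    by (intro has_bochner_integral_mult_right)
  then have "has_bochner_integral lborel (\<lambda>x. a\<^sup>2 * (sinc (a * x))\<^sup>2) (a\<^sup>2 * (pi /\<^sub>R \<bar>a\<bar>))"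
    by (simp only: add_0_left)
  moreover have "a\<^sup>2 * (pi /\<^sub>R \<bar>a\<bar>) = pi * \<bar>a\<bar>"
    using False by (simp add: power2_eq_square field_simps abs_if)
  ultimately show ?thesis by (simp only: power_mult_distrib)
qed (simp add: has_bochner_integral_zero)

text \<open>Writing sin^2 through the cosine of the double angle reduces this to the addition
  theorem. Integrated with \<open>has_bochner_integral_scaled_sinc_sq\<close>, the right-hand side
  gives pi (- |a| + |a + 1| / 2 + |a - 1| / 2), a hat function of a.\<close>

lemma sinc_sq_cos:
  "(sinc x)\<^sup>2 * cos (2 * (a * x)) =
     - (a * sinc (a * x))\<^sup>2 + ((a + 1) * sinc ((a + 1) * x))\<^sup>2 / 2 + ((a - 1) * sinc ((a - 1) * x))\<^sup>2 / 2"
proof (cases "x = 0")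
  case False
  have s: "(b * sinc (b * x))\<^sup>2 = (1 - cos (2 * (b * x))) / (2 * x\<^sup>2)" for b
    using False cos_double_sin[of "b * x"] by (cases "b = 0") (auto simp: power_divide)
  have c: "cos (2 * ((a + 1) * x)) + cos (2 * ((a - 1) * x)) = 2 * cos (2 * (a * x)) * cos (2 * x)"
    using cos_add[of "2 * (a * x)" "2 * x"] cos_diff[of "2 * (a * x)" "2 * x"]
    by (simp add: algebra_simps)
  have "(sinc x)\<^sup>2 = (1 - cos (2 * x)) / (2 * x\<^sup>2)" using s[of 1] by (simp only: mult_1_left)
  moreover have "(1 - D) / q * C = - ((1 - C) / q) + (1 - P) / q / 2 + (1 - R) / q / 2"
    if "P + R = 2 * C * D" for P R C D q :: real
  proof -
    have "(P + R) / (2 * q) = C * D / q" by (simp add: that)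
    then show ?thesis by (simp add: diff_divide_distrib add_divide_distrib algebra_simps)
  qed
  note this[OF c]
  ultimately show ?thesis
    unfolding s by (simp only:)
qed (simp add: power2_eq_square field_simps)

text \<open>The cosine part is pi times the hat function at n, which is 1 at 0 and vanishes at all
  other integers; the sine part is odd.\<close>

lemma has_bochner_integral_sinc_sq_cis:
  fixes n :: int
  shows "has_bochner_integral lborel (\<lambda>x. complex_of_real ((sinc x)\<^sup>2) * cis (2 * (real_of_int n * x)))
    (if n = 0 then complex_of_real pi else 0)"
proof -
  let ?c = "\<lambda>x. (sinc x)\<^sup>2 * cos (2 * (real_of_int n * x))" and ?s = "\<lambda>x. (sinc x)\<^sup>2 * sin (2 * (real_of_int n * x))"
  have "has_bochner_integral lborel ?c (- (pi * \<bar>real_of_int n\<bar>) + pi * \<bar>real_of_int n + 1\<bar> / 2 + pi * \<bar>real_of_int n - 1\<bar> / 2)"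
    unfolding sinc_sq_cos
    by (intro has_bochner_integral_add has_bochner_integral_minus has_bochner_integral_divide
        has_bochner_integral_scaled_sinc_sq)
  moreover have "- (pi * \<bar>real_of_int n\<bar>) + pi * \<bar>real_of_int n + 1\<bar> / 2 + pi * \<bar>real_of_int n - 1\<bar> / 2 = (if n = 0 then pi else 0)"
  proof -
    have "real_of_int n \<le> - 1 \<or> n = 0 \<or> 1 \<le> real_of_int n" by linarith
    then show ?thesis
    proof (elim disjE)
      assume a: "real_of_int n \<le> - 1"
      then have "\<bar>real_of_int n\<bar> = - n" "\<bar>real_of_int n + 1\<bar> = - (n + 1)" "\<bar>real_of_int n - 1\<bar> = - (n - 1)" "n \<noteq> 0"
        by auto
      then show ?thesis by (simp add: field_simps)
    next
      assume a: "1 \<le> real_of_int n"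
      then have "\<bar>real_of_int n\<bar> = n" "\<bar>real_of_int n + 1\<bar> = n + 1" "\<bar>real_of_int n - 1\<bar> = n - 1" "n \<noteq> 0"
        by auto
      then show ?thesis by (simp add: field_simps)
    qed simp
  qed
  ultimately have c: "has_bochner_integral lborel ?c (if n = 0 then pi else 0)" by simp
  have si: "integrable lborel ?s"
  proof (rule Bochner_Integration.integrable_bound)
    show "integrable lborel (\<lambda>x. (sinc x)\<^sup>2)" using has_bochner_integral_sinc_sq by (rule integrable.intros)
    have "\<bar>(sinc x)\<^sup>2 * sin (2 * (real_of_int n * x))\<bar> \<le> (sinc x)\<^sup>2 * 1" for x
      unfolding abs_mult by (intro mult_mono) auto
    then show "AE x in lborel. norm (?s x) \<le> norm ((sinc x)\<^sup>2)" by simp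
  qed measurable
  have "integral\<^sup>L lborel ?s = (\<integral>x. ?s (0 + (-1) * x) \<partial>lborel)"
    using lborel_integral_real_affine[of "-1" ?s 0] by simp
  also have "\<dots> = (\<integral>x. - ?s x \<partial>lborel)" by (intro Bochner_Integration.integral_cong) auto
  finally have "integral\<^sup>L lborel ?s = 0" by simp
  with si have s: "has_bochner_integral lborel ?s 0" by (simp add: has_bochner_integral_iff)
  have "has_bochner_integral lborel (\<lambda>x. complex_of_real (?c x) + \<i> * complex_of_real (?s x))
      (complex_of_real (if n = 0 then pi else 0) + \<i> * complex_of_real 0)"
    by (intro has_bochner_integral_add has_bochner_integral_mult_right has_bochner_integral_of_real c s)
  moreover have "complex_of_real ((sinc x)\<^sup>2) * cis (2 * (real_of_int n * x)) =
      complex_of_real (?c x) + \<i> * complex_of_real (?s x)" for x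
    by (simp add: complex_eq_iff)
  ultimately show ?thesis by (simp split: if_splits)
qed

text \<open>The Fourier transform of the cell centred at 0, normalized to the value 1 at the origin.
  It is the factor between the discrete transform of a sequence and the transform of its step
  function.\<close>

definition cell_mult :: "real \<Rightarrow> real ^ 'n \<Rightarrow> real" where
  "cell_mult h \<xi> = (\<Prod>i\<in>UNIV. sinc (h / 2 * \<xi> $ i))"

text \<open>The discrete Fourier transform of the unit sequence at n. Its squared norm on the torus
  is the mass \<open>h ^ CARD('n)\<close> of a grid point.\<close>

definition dft_basis :: "real \<Rightarrow> int ^ 'n \<Rightarrow> real ^ 'n \<Rightarrow> complex" where
  "dft_basis h n \<xi> = complex_of_real (h ^ CARD('n) / (2 * pi) powr (real CARD('n) / 2)) *
     cis (- (h * (vec_of_int n \<bullet> \<xi>)))"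

text \<open>Index of the nearest grid point. The floor makes the cells half-open, so that they tile
  space without overlap; centring them at grid points makes \<open>cell_mult\<close> real.\<close>

definition grid_index :: "real \<Rightarrow> real ^ 'n \<Rightarrow> int ^ 'n" where
  "grid_index h x = (\<chi> i. \<lfloor>x $ i / h + 1 / 2\<rfloor>)"

definition grid_cell :: "real \<Rightarrow> int ^ 'n \<Rightarrow> (real ^ 'n) set" where
  "grid_cell h n = {x. grid_index h x = n}"

lemma cis_sum: "finite A \<Longrightarrow> cis (\<Sum>i\<in>A. f i) = (\<Prod>i\<in>A. cis (f i))"
  by (induction A rule: finite_induct) (auto simp: cis_mult[symmetric])

lemma cis_inner_prod: "cis (c * (x \<bullet> y)) = (\<Prod>i\<in>UNIV. cis (c * (x $ i * y $ i)))" for x y :: "real ^ 'n"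
  by (simp add: inner_vec_def sum_distrib_left cis_sum)

lemma two_pi_powr_sq: "((2 * pi) powr (real d / 2))\<^sup>2 = (2 * pi) ^ d"
proof -
  have "((2 * pi) powr (real d / 2))\<^sup>2 = (2 * pi) powr (real d / 2 + real d / 2)"
    unfolding power2_eq_square powr_add ..
  also have "\<dots> = (2 * pi) powr real d" by (simp only: field_sum_of_halves)
  also have "\<dots> = (2 * pi) ^ d" by (rule powr_realpow) simp
  finally show ?thesis .
qed

lemma borel_measurable_cell_mult [measurable]: "cell_mult h \<in> borel_measurable borel"
  unfolding cell_mult_def[abs_def] by measurable

lemma borel_measurable_cis [measurable (raw)]:
  "f \<in> borel_measurable M \<Longrightarrow> (\<lambda>x. cis (f x)) \<in> borel_measurable M"
  by (rule borel_measurable_continuous_on[where f = cis]) (auto intro!: continuous_intros)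

lemma borel_measurable_dft_basis [measurable]: "dft_basis h n \<in> borel_measurable borel"
  unfolding dft_basis_def[abs_def] by measurable

lemma norm_dft_basis: "h > 0 \<Longrightarrow> cmod (dft_basis h (n :: int ^ 'n) \<xi>) = h ^ CARD('n) / (2 * pi) powr (real CARD('n) / 2)"
  by (simp add: dft_basis_def norm_mult norm_divide norm_power)

lemma cnj_dft_basis_mult:
  "cnj (dft_basis h n \<xi>) * dft_basis h k \<xi> =
   complex_of_real ((h ^ CARD('n))\<^sup>2 / (2 * pi) ^ CARD('n)) *
   (\<Prod>i\<in>UNIV. cis (h * (real_of_int (n $ i - k $ i) * \<xi> $ i)))" for n :: "int ^ 'n"
proof -
  have "cnj (cis (- (h * (vec_of_int n \<bullet> \<xi>)))) * cis (- (h * (vec_of_int k \<bullet> \<xi>)))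
      = cis (h * ((vec_of_int n - vec_of_int k) \<bullet> \<xi>))"
    by (simp add: cis_cnj cis_mult inner_diff_left algebra_simps)
  also have "\<dots> = (\<Prod>i\<in>UNIV. cis (h * (real_of_int (n $ i - k $ i) * \<xi> $ i)))"
    by (simp add: cis_inner_prod vec_of_int_def)
  finally have e: "cnj (cis (- (h * (vec_of_int n \<bullet> \<xi>)))) * cis (- (h * (vec_of_int k \<bullet> \<xi>)))
      = (\<Prod>i\<in>UNIV. cis (h * (real_of_int (n $ i - k $ i) * \<xi> $ i)))" .
  have "cnj (dft_basis h n \<xi>) * dft_basis h k \<xi> =
    complex_of_real ((h ^ CARD('n) / (2 * pi) powr (real CARD('n) / 2))\<^sup>2) *
    (cnj (cis (- (h * (vec_of_int n \<bullet> \<xi>)))) * cis (- (h * (vec_of_int k \<bullet> \<xi>))))"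
    by (simp add: dft_basis_def power2_eq_square)
  then show ?thesis unfolding e power_divide two_pi_powr_sq .
qed

lemma integral_sinc_sq_cis:
  fixes n :: int and h :: real
  assumes h: "h > 0"
  shows "integrable lborel (\<lambda>x. complex_of_real ((sinc (h / 2 * x))\<^sup>2) * cis (h * (n * x)))"
    and "(\<integral>x. complex_of_real ((sinc (h / 2 * x))\<^sup>2) * cis (h * (n * x)) \<partial>lborel) =
      (if n = 0 then complex_of_real (2 * pi / h) else 0)"
proof -
  let ?f = "\<lambda>x. complex_of_real ((sinc x)\<^sup>2) * cis (2 * (real_of_int n * x))"
  have "has_bochner_integral lborel (\<lambda>x. ?f (0 + h / 2 * x)) ((if n = 0 then complex_of_real pi else 0) /\<^sub>R \<bar>h / 2\<bar>)"
    using has_bochner_integral_sinc_sq_cis[of n] h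
    by (subst lborel_has_bochner_integral_real_affine_iff[symmetric]) auto
  moreover have "2 * (real_of_int n * (h / 2 * x)) = h * (n * x)" for x :: real
    by simp
  moreover have "(if n = 0 then complex_of_real pi else 0) /\<^sub>R \<bar>h / 2\<bar> = (if n = 0 then complex_of_real (2 * pi / h) else 0)"
    using h by (simp add: scaleR_conv_of_real field_simps)
  ultimately have "has_bochner_integral lborel (\<lambda>x. complex_of_real ((sinc (h / 2 * x))\<^sup>2) * cis (h * (n * x)))
      (if n = 0 then complex_of_real (2 * pi / h) else 0)"
    by (simp only: add_0_left)
  then show "integrable lborel (\<lambda>x. complex_of_real ((sinc (h / 2 * x))\<^sup>2) * cis (h * (n * x)))"
    and "(\<integral>x. complex_of_real ((sinc (h / 2 * x))\<^sup>2) * cis (h * (n * x)) \<partial>lborel) =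
      (if n = 0 then complex_of_real (2 * pi / h) else 0)"
    by (auto simp: has_bochner_integral_iff)
qed

text \<open>Plancherel for cells: the values are the inner products of the cells themselves
  (\<open>cell_inner\<close>). The integral factors into one-dimensional integrals of sinc^2 against
  an exponential of integer frequency.\<close>

lemma cell_transform_inner:
  fixes n k :: "int ^ 'n"
  assumes h: "h > 0"
  shows "integrable lborel (\<lambda>\<xi>. cnj (cell_mult h \<xi> * dft_basis h n \<xi>) * (cell_mult h \<xi> * dft_basis h k \<xi>))"
    and "L2_inner lborel (\<lambda>\<xi>. cell_mult h \<xi> * dft_basis h n \<xi>) (\<lambda>\<xi>. cell_mult h \<xi> * dft_basis h k \<xi>) =
      complex_of_real (if n = k then h ^ CARD('n) else 0)"
proof -
  let ?C = "complex_of_real ((h ^ CARD('n))\<^sup>2 / (2 * pi) ^ CARD('n))"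
  let ?g = "\<lambda>i x. complex_of_real ((sinc (h / 2 * x))\<^sup>2) * cis (h * (real_of_int (n $ i - k $ i) * x))"
  have eq: "cnj (cell_mult h \<xi> * dft_basis h n \<xi>) * (cell_mult h \<xi> * dft_basis h k \<xi>) = ?C * (\<Prod>i\<in>UNIV. ?g i (\<xi> $ i))" for \<xi>
  proof -
    have "cnj (cell_mult h \<xi> * dft_basis h n \<xi>) * (cell_mult h \<xi> * dft_basis h k \<xi>) =
       complex_of_real ((cell_mult h \<xi>)\<^sup>2) * (cnj (dft_basis h n \<xi>) * dft_basis h k \<xi>)"
      by (simp add: power2_eq_square mult_ac)
    also have "\<dots> = ?C * (complex_of_real ((cell_mult h \<xi>)\<^sup>2) *
        (\<Prod>i\<in>UNIV. cis (h * (real_of_int (n $ i - k $ i) * \<xi> $ i))))"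
      unfolding cnj_dft_basis_mult by (simp only: mult_ac)
    also have "complex_of_real ((cell_mult h \<xi>)\<^sup>2) * (\<Prod>i\<in>UNIV. cis (h * (real_of_int (n $ i - k $ i) * \<xi> $ i)))
        = (\<Prod>i\<in>UNIV. ?g i (\<xi> $ i))"
      unfolding cell_mult_def prod_power_distrib of_real_prod prod.distrib ..
    finally show ?thesis .
  qed
  have int: "integrable lborel (?g i)" for i by (rule integral_sinc_sq_cis(1)[OF h])
  show "integrable lborel (\<lambda>\<xi>. cnj (cell_mult h \<xi> * dft_basis h n \<xi>) * (cell_mult h \<xi> * dft_basis h k \<xi>))"
    unfolding eq by (intro integrable_mult_right integral_prod_lborel_vec(1) int)
  have "L2_inner lborel (\<lambda>\<xi>. cell_mult h \<xi> * dft_basis h n \<xi>) (\<lambda>\<xi>. cell_mult h \<xi> * dft_basis h k \<xi>) =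
      ?C * (\<Prod>i\<in>UNIV. if n $ i - k $ i = 0 then complex_of_real (2 * pi / h) else 0)"
    unfolding L2_inner_def eq integral_mult_right_zero integral_prod_lborel_vec(2)[OF int]
      integral_sinc_sq_cis(2)[OF h] ..
  also have "\<dots> = complex_of_real (if n = k then h ^ CARD('n) else 0)"
  proof (cases "n = k")
    case True
    then show ?thesis using h by (simp add: power2_eq_square power_divide field_simps)
  next
    case False
    then obtain i where "n $ i \<noteq> k $ i" by (auto simp: vec_eq_iff)
    then have "(\<Prod>i\<in>UNIV. if n $ i - k $ i = 0 then complex_of_real (2 * pi / h) else 0) = 0"
      by (intro prod_zero) auto
    then show ?thesis using False by (simp only: mult_zero_right if_False of_real_0)
  qed
  finally show "L2_inner lborel (\<lambda>\<xi>. cell_mult h \<xi> * dft_basis h n \<xi>) (\<lambda>\<xi>. cell_mult h \<xi> * dft_basis h k \<xi>) =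
      complex_of_real (if n = k then h ^ CARD('n) else 0)" .
qed

text \<open>Serves twice: for the edge of a grid cell, and with an interval of length 2 pi / h for
  the orthogonality of the exponentials on the torus.\<close>

lemma integral_cis_interval:
  fixes c s h :: real
  assumes h: "h > 0"
  shows "(\<integral>x. indicator {c - h / 2..c + h / 2} x *\<^sub>R cis (- (x * s)) \<partial>lborel) = h * (sinc (h / 2 * s) * cis (- (c * s)))"
proof (cases "s = 0")
  case True
  have "(\<integral>x. indicator {c - h / 2..c + h / 2} x *\<^sub>R (1::complex) \<partial>lborel) = measure lborel {c - h / 2..c + h / 2} *\<^sub>R 1"
    by (subst integral_scaleR_left) (auto simp: emeasure_lborel_Icc_eq)
  then show ?thesis using True h by (simp add: scaleR_conv_of_real)
next
  case False
  let ?F = "\<lambda>x. \<i> * cis (- (x * s)) / s"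
  have "(\<integral>x. indicator {c - h / 2..c + h / 2} x *\<^sub>R cis (- (x * s)) \<partial>lborel) = ?F (c + h / 2) - ?F (c - h / 2)"
  proof (rule integral_FTC_atLeastAtMost)
    show "c - h / 2 \<le> c + h / 2" using h by simp
    show "continuous_on {c - h / 2..c + h / 2} (\<lambda>x. cis (- (x * s)))" by (intro continuous_intros)
    show "(?F has_vector_derivative cis (- (x * s))) (at x within {c - h / 2..c + h / 2})" for x
    proof -
      have "((\<lambda>x. cis (- (x * s))) has_vector_derivative (- s) *\<^sub>R (\<i> * cis (- (x * s)))) (at x within {c - h / 2..c + h / 2})"
      proof -
        have "((\<lambda>x. x *\<^sub>R (- \<i> * s)) has_vector_derivative 1 *\<^sub>R (- \<i> * s)) (at x within {c - h / 2..c + h / 2})"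
          by (rule bounded_linear.has_vector_derivative[OF bounded_linear_scaleR_left has_vector_derivative_id])
        from field_vector_diff_chain_within[OF this DERIV_subset[OF DERIV_exp subset_UNIV]]
        show ?thesis by (simp add: o_def cis_conv_exp scaleR_conv_of_real mult_ac)
      qed
      then have "(?F has_vector_derivative \<i> * ((- s) *\<^sub>R (\<i> * cis (- (x * s)))) / s) (at x within {c - h / 2..c + h / 2})"
        by (intro has_vector_derivative_divide has_vector_derivative_mult_right)
      then show ?thesis using False by (simp add: scaleR_conv_of_real)
    qed
  qed
  also have "\<dots> = h * (sinc (h / 2 * s) * cis (- (c * s)))"
  proof -
    have e: "cis (- ((c + h / 2) * s)) - cis (- ((c - h / 2) * s)) = cis (- (c * s)) * (- 2 * \<i> * sin (h / 2 * s))"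
    proof -
      have "cis (- ((c + h / 2) * s)) = cis (- (c * s)) * cis (- (h / 2 * s))"
        "cis (- ((c - h / 2) * s)) = cis (- (c * s)) * cis (h / 2 * s)"
        unfolding cis_mult by (simp_all add: algebra_simps)
      then have "cis (- ((c + h / 2) * s)) - cis (- ((c - h / 2) * s)) = cis (- (c * s)) * (cis (- (h / 2 * s)) - cis (h / 2 * s))"
        by (simp add: algebra_simps)
      also have "cis (- (h / 2 * s)) - cis (h / 2 * s) = - 2 * \<i> * sin (h / 2 * s)"
        by (simp add: complex_eq_iff)
      finally show ?thesis .
    qed
    have "?F (c + h / 2) - ?F (c - h / 2) = \<i> * (cis (- ((c + h / 2) * s)) - cis (- ((c - h / 2) * s))) / s"
      by (simp add: algebra_simps diff_divide_distrib)
    also have "\<dots> = h * (sinc (h / 2 * s) * cis (- (c * s)))"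
      unfolding e using False h by (simp add: field_simps)
    finally show ?thesis .
  qed
  finally show ?thesis .
qed

section \<open>The tiling of space by grid cells\<close>

lemma grid_index_eq_iff:
  assumes "h > 0"
  shows "grid_index h x = n \<longleftrightarrow> (\<forall>i. h * n $ i - h / 2 \<le> x $ i \<and> x $ i < h * n $ i + h / 2)"
proof -
  have "\<lfloor>x $ i / h + 1 / 2\<rfloor> = n $ i \<longleftrightarrow> h * n $ i - h / 2 \<le> x $ i \<and> x $ i < h * n $ i + h / 2" for i
    using assms by (simp add: floor_eq_iff field_simps)
  then show ?thesis by (simp add: grid_index_def vec_eq_iff)
qed

lemma grid_cell_eq:
  "h > 0 \<Longrightarrow> grid_cell h n = {x. \<forall>i. h * n $ i - h / 2 \<le> x $ i \<and> x $ i < h * n $ i + h / 2}"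
  by (simp add: grid_cell_def grid_index_eq_iff)

lemma sets_grid_cell [measurable]: "h > 0 \<Longrightarrow> grid_cell h n \<in> sets borel"
  unfolding grid_cell_eq by measurable

lemma countable_int_vec: "countable (UNIV :: (int ^ 'n) set)"
proof -
  have "countable (range (\<lambda>f. vec_lambda f :: int ^ 'n))"
    by (intro countable_image) simp
  then show ?thesis by (rule countable_subset[rotated]) (metis subsetI rangeI vec_nth_inverse)
qed

lemma measurable_grid_index: "h > 0 \<Longrightarrow> grid_index h \<in> lborel \<rightarrow>\<^sub>M count_space UNIV"
proof (rule measurable_count_space_eq2_countable[THEN iffD2])
  assume h: "h > 0"
  have "grid_index h -` {n} \<inter> space lborel \<in> sets lborel" for n :: "int ^ 'n"
    using sets_grid_cell[OF h, of n] by (simp add: grid_cell_def vimage_def)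
  then show "grid_index h \<in> space lborel \<rightarrow> UNIV \<and> (\<forall>a\<in>UNIV. grid_index h -` {a} \<inter> space lborel \<in> sets lborel)"
    by auto
qed

lemma emeasure_grid_cell:
  fixes n :: "int ^ 'n"
  assumes h: "h > 0"
  shows "emeasure lborel (grid_cell h n) = ennreal (h ^ CARD('n))"
proof -
  let ?a = "(\<chi> i. h * n $ i - h / 2) :: real ^ 'n" and ?b = "(\<chi> i. h * n $ i + h / 2) :: real ^ 'n"
  have le: "?a \<bullet> b \<le> ?b \<bullet> b" if "b \<in> Basis" for b
    using that h by (auto simp: Basis_vec_def inner_axis)
  have d: "(\<Prod>b\<in>Basis. (?b - ?a) \<bullet> b) = h ^ CARD('n)"
    by (subst prod.reindex_bij_betw[OF bij_betw_axis_Basis, symmetric]) (simp add: inner_axis)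
  \<comment> \<open>The half-open cell lies between the open and the closed box, which have the same
    volume.\<close>
  have "box ?a ?b \<subseteq> grid_cell h n" "grid_cell h n \<subseteq> cbox ?a ?b"
    using h by (auto simp: grid_cell_eq mem_box_cart less_imp_le)
  then have "emeasure lborel (box ?a ?b) \<le> emeasure lborel (grid_cell h n)"
    "emeasure lborel (grid_cell h n) \<le> emeasure lborel (cbox ?a ?b)"
    using h by (auto intro!: emeasure_mono)
  then show ?thesis
    using le d by (simp add: emeasure_lborel_box emeasure_lborel_cbox antisym)
qed

text \<open>Both measures give each index the volume of its cell. A step function is a composition
  with \<open>grid_index\<close>, so its integrals become sums by a change of variables, and step
  interpolation is isometric.\<close>

lemma distr_grid_index:
  assumes h: "h > 0"
  shows "distr lborel (count_space UNIV) (grid_index h) = (grid_measure h :: (int ^ 'n) measure)"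
proof (rule measure_eqI_countable[of _ UNIV])
  fix n :: "int ^ 'n"
  have "emeasure (distr lborel (count_space UNIV) (grid_index h)) {n} = emeasure lborel (grid_cell h n)"
    by (subst emeasure_distr[OF measurable_grid_index[OF h]]) (auto simp: grid_cell_def vimage_def)
  also have "\<dots> = emeasure (grid_measure h) {n}"
    unfolding grid_measure_def emeasure_grid_cell[OF h]
    by (subst emeasure_density) (auto simp: nn_integral_count_space_indicator[symmetric] nn_integral_count_space_finite mult.commute
        nn_integral_indicator_singleton)
  finally show "emeasure (distr lborel (count_space UNIV) (grid_index h)) {n} = emeasure (grid_measure h) {n}" .
qed (auto simp: grid_measure_def countable_int_vec)

lemma fourier_integral_cell:
  fixes n :: "int ^ 'n"
  assumes h: "h > 0"
  shows "fourier_integral (indicator (grid_cell h n)) \<xi> = cell_mult h \<xi> * dft_basis h n \<xi>"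
proof -
  let ?I = "\<lambda>i. {h * n $ i - h / 2..h * n $ i + h / 2}"
  let ?f = "\<lambda>i x. indicator (?I i) x *\<^sub>R cis (- (x * \<xi> $ i))"
  have int: "integrable lborel (?f i)" for i
    by (rule borel_integrable_compact) (auto intro!: continuous_intros)
  \<comment> \<open>The half-open cell and the closed box of \<open>integral_cis_interval\<close>
    differ only on hyperplanes.\<close>
  have "AE x in lborel. \<forall>i. x $ i \<noteq> h * n $ i + h / 2"
  proof -
    have "AE x in lborel. x $ i \<noteq> h * n $ i + h / 2" for i
    proof -
      have "{x :: real ^ 'n. axis i 1 \<bullet> x = h * n $ i + h / 2} \<in> null_sets lebesgue"
        using negligible_hyperplane[of "axis i 1 :: real ^ 'n"] by (simp add: negligible_iff_null_sets)
      then have "{x :: real ^ 'n. x $ i = h * n $ i + h / 2} \<in> null_sets lborel"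
        by (simp add: inner_axis' null_sets_completion_iff)
      from AE_not_in[OF this] show ?thesis by simp
    qed
    then show ?thesis by (simp add: AE_all_countable)
  qed
  then have "(\<integral>x. cis (- (x \<bullet> \<xi>)) * indicator (grid_cell h n) x \<partial>lborel) = (\<integral>x. (\<Prod>i\<in>UNIV. ?f i (x $ i)) \<partial>lborel)"
  proof (intro integral_cong_AE)
    show "(\<lambda>x. cis (- (x \<bullet> \<xi>)) * indicator (grid_cell h n) x) \<in> borel_measurable lborel"
      using sets_grid_cell[OF h, of n] by measurable
    show "(\<lambda>x. \<Prod>i\<in>UNIV. ?f i (x $ i)) \<in> borel_measurable lborel"
      by measurable
    assume "AE x in lborel. \<forall>i. x $ i \<noteq> h * n $ i + h / 2"
    then show "AE x in lborel. cis (- (x \<bullet> \<xi>)) * indicator (grid_cell h n) x = (\<Prod>i\<in>UNIV. ?f i (x $ i))"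
    proof eventually_elim
      case (elim x)
      have "cis (- (x \<bullet> \<xi>)) = (\<Prod>i\<in>UNIV. cis (- (x $ i * \<xi> $ i)))"
        using cis_inner_prod[of "-1" x \<xi>] by simp
      moreover have "indicator (grid_cell h n) x = (\<Prod>i\<in>UNIV. complex_of_real (indicator (?I i) (x $ i)))"
      proof (cases "x \<in> grid_cell h n")
        case True
        then show ?thesis using h by (auto simp: grid_cell_eq less_imp_le indicator_def intro!: prod.neutral[symmetric])
      next
        case False
        then obtain i where "\<not> (h * n $ i - h / 2 \<le> x $ i \<and> x $ i < h * n $ i + h / 2)"
          using h by (auto simp: grid_cell_eq)
        then have "x $ i \<notin> ?I i" using elim[rule_format, of i] by auto
        then have "(\<Prod>i\<in>UNIV. complex_of_real (indicator (?I i) (x $ i))) = 0"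
          by (intro prod_zero) (auto simp: indicator_def intro!: exI[of _ i])
        then show ?thesis using False by simp
      qed
      ultimately show ?case by (simp add: scaleR_conv_of_real prod.distrib mult.commute)
    qed
  qed
  also have "\<dots> = (\<Prod>i\<in>UNIV. h * (sinc (h / 2 * \<xi> $ i) * cis (- (h * n $ i * \<xi> $ i))))"
    unfolding integral_prod_lborel_vec(2)[OF int] integral_cis_interval[OF h] ..
  also have "\<dots> = h ^ CARD('n) * (cell_mult h \<xi> * cis (- (h * (vec_of_int n \<bullet> \<xi>))))"
    using cis_inner_prod[of "- h" "vec_of_int n" \<xi>]
    by (simp add: prod.distrib cell_mult_def vec_of_int_def mult.assoc)
  finally have I: "(\<integral>x. cis (- (x \<bullet> \<xi>)) * indicator (grid_cell h n) x \<partial>lborel) =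
      complex_of_real (h ^ CARD('n)) * (cell_mult h \<xi> * cis (- (h * (vec_of_int n \<bullet> \<xi>))))" .
  have "(2 * pi) powr (- real CARD('n) / 2) * h ^ CARD('n) = h ^ CARD('n) / (2 * pi) powr (real CARD('n) / 2)"
    unfolding minus_divide_left[symmetric] powr_minus_divide by simp
  then have c: "complex_of_real ((2 * pi) powr (- real CARD('n) / 2)) * complex_of_real (h ^ CARD('n)) =
      complex_of_real (h ^ CARD('n) / (2 * pi) powr (real CARD('n) / 2))"
    by (simp only: of_real_mult[symmetric])
  show ?thesis
    unfolding fourier_integral_def I dft_basis_def c[symmetric] by (simp only: mult_ac)
qed

section \<open>Step functions on grids\<close>

lemma L2_norm_orthogonal_sum:
  assumes A: "finite A" and e: "\<And>n. n \<in> A \<Longrightarrow> e n \<in> L2 M"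
    and orth: "\<And>n k. n \<in> A \<Longrightarrow> k \<in> A \<Longrightarrow> L2_inner M (e n) (e k) = complex_of_real (if n = k then w else 0)"
  shows "(L2_norm M (\<lambda>x. \<Sum>n\<in>A. c n * e n x))\<^sup>2 = w * (\<Sum>n\<in>A. (cmod (c n))\<^sup>2)"
  using assms
proof (induction A rule: finite_induct)
  case (insert a A)
  let ?s = "\<lambda>x. \<Sum>n\<in>A. c n * e n x"
  have s: "?s \<in> L2 M" using insert by (intro L2_sum L2_scale) auto
  have a: "(\<lambda>x. c a * e a x) \<in> L2 M" using insert by (intro L2_scale) auto
  have "L2_inner M (\<lambda>x. c a * e a x) ?s = (\<Sum>n\<in>A. L2_inner M (\<lambda>x. c a * e a x) (\<lambda>x. c n * e n x))"
    using insert a by (intro L2_inner_sum_right L2_scale) auto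
  also have "\<dots> = 0"
    using insert.hyps by (intro sum.neutral) (auto simp: insert.prems(2))
  finally have 0: "L2_inner M (\<lambda>x. c a * e a x) ?s = 0" .
  have "(L2_norm M (e a))\<^sup>2 = w"
    using insert.prems(2)[of a a] by (simp add: L2_inner_self flip: of_real_power)
  then have N: "(L2_norm M (\<lambda>x. c a * e a x))\<^sup>2 = w * (cmod (c a))\<^sup>2"
    by (simp add: power_mult_distrib mult.commute)
  have IH: "(L2_norm M ?s)\<^sup>2 = w * (\<Sum>n\<in>A. (cmod (c n))\<^sup>2)"
    by (rule insert.IH) (simp_all add: insert.prems)
  have "(L2_norm M (\<lambda>x. c a * e a x + ?s x))\<^sup>2 = w * (cmod (c a))\<^sup>2 + w * (\<Sum>n\<in>A. (cmod (c n))\<^sup>2)"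
    unfolding L2_norm_add_sq[OF a s] 0 N IH by simp
  then show ?case using insert.hyps by (simp add: algebra_simps)
qed simp

lemma integrable_complex_indicator:
  assumes "A \<in> sets M" "emeasure M A < \<infinity>"
  shows "integrable M (indicator A :: _ \<Rightarrow> complex)"
proof -
  have "integrable M (\<lambda>x. complex_of_real (indicator A x))"
    using assms by (intro integrable_of_real integrable_real_indicator)
  moreover have "(\<lambda>x. complex_of_real (indicator A x)) = indicator A" by (auto simp: indicator_def)
  ultimately show ?thesis by simp
qed

definition step_fun :: "real \<Rightarrow> (int ^ 'n \<Rightarrow> complex) \<Rightarrow> real ^ 'n \<Rightarrow> complex" where
  "step_fun h u x = u (grid_index h x)"

lemma borel_measurable_step_fun: "h > 0 \<Longrightarrow> step_fun h u \<in> borel_measurable lborel"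
  unfolding step_fun_def[abs_def] by (rule measurable_compose[OF measurable_grid_index]) auto

lemma integral_step_fun:
  fixes u :: "int ^ 'n \<Rightarrow> real"
  assumes "h > 0"
  shows "integrable lborel (\<lambda>x. u (grid_index h x)) \<longleftrightarrow> integrable (grid_measure h) u"
    and "(\<integral>x. u (grid_index h x) \<partial>lborel) = (\<integral>n. u n \<partial>grid_measure h)"
  unfolding distr_grid_index[OF assms, symmetric]
  by (auto simp: integrable_distr_eq[OF measurable_grid_index[OF assms]] integral_distr[OF measurable_grid_index[OF assms]])

lemma L2_grid_iff: "u \<in> L2 (grid_measure h) \<longleftrightarrow> integrable (grid_measure h) (\<lambda>n. (cmod (u n))\<^sup>2)"
  by (simp add: L2_def grid_measure_def)

lemma L2_step_fun:
  assumes "h > 0"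
  shows "step_fun h u \<in> L2 lborel \<longleftrightarrow> u \<in> L2 (grid_measure h)"
    and "L2_norm lborel (step_fun h u) = L2_norm (grid_measure h) u"
  using integral_step_fun[OF assms, of "\<lambda>n. (cmod (u n))\<^sup>2"] borel_measurable_step_fun[OF assms, of u]
  by (auto simp: L2_grid_iff L2_norm_def) (auto simp: L2_def step_fun_def)

lemma step_fun_finite_support:
  assumes "finite A" "\<And>n. n \<notin> A \<Longrightarrow> u n = 0"
  shows "step_fun h u x = (\<Sum>n\<in>A. u n * indicator (grid_cell h n) x)"
proof -
  have "(\<Sum>n\<in>A. u n * indicator (grid_cell h n) x) = (\<Sum>n\<in>A. if n = grid_index h x then u n else 0)"
    by (intro sum.cong) (auto simp: grid_cell_def)
  then show ?thesis using assms by (auto simp: step_fun_def sum.delta)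
qed

lemma integrable_indicator_cell:
  "h > 0 \<Longrightarrow> integrable lborel (\<lambda>x. indicator (grid_cell h n) x :: complex)"
  using sets_grid_cell[of h n] emeasure_grid_cell[of h n]
    integrable_complex_indicator[of "grid_cell h n" lborel] by (simp add: ennreal_less_top)

lemma integrable_step_fun:
  assumes "h > 0" "finite A" "\<And>n. n \<notin> A \<Longrightarrow> u n = 0"
  shows "integrable lborel (step_fun h u)"
proof -
  have "integrable lborel (\<lambda>x. \<Sum>n\<in>A. u n * indicator (grid_cell h n) x)"
    by (intro Bochner_Integration.integrable_sum integrable_mult_right integrable_indicator_cell assms)
  moreover have "(\<lambda>x. \<Sum>n\<in>A. u n * indicator (grid_cell h n) x) = step_fun h u"
    by (rule ext) (rule step_fun_finite_support[symmetric, OF assms(2,3)])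
  ultimately show ?thesis by (simp only:)
qed

lemma L2_step_fun_finite:
  assumes "h > 0" "finite A" "\<And>n. n \<notin> A \<Longrightarrow> u n = 0"
  shows "step_fun h u \<in> L2 lborel"
proof -
  define K where "K = (\<Sum>n\<in>A. cmod (u n))"
  have K: "cmod (step_fun h u x) \<le> K" for x
  proof -
    have "cmod (\<Sum>n\<in>A. u n * indicator (grid_cell h n) x) \<le> (\<Sum>n\<in>A. cmod (u n * indicator (grid_cell h n) x))"
      by (rule norm_sum)
    also have "\<dots> \<le> (\<Sum>n\<in>A. cmod (u n))"
      by (intro sum_mono) (simp add: norm_mult indicator_def)
    also have "(\<Sum>n\<in>A. u n * indicator (grid_cell h n) x) = step_fun h u x"
      by (rule step_fun_finite_support[symmetric, OF assms(2,3)])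
    finally show ?thesis by (simp only: K_def)
  qed
  have int: "integrable lborel (\<lambda>x. K * cmod (step_fun h u x))"
    using integrable_step_fun[OF assms] by simp
  have "integrable lborel (\<lambda>x. (cmod (step_fun h u x))\<^sup>2)"
  proof (rule Bochner_Integration.integrable_bound[OF int])
    show "(\<lambda>x. (cmod (step_fun h u x))\<^sup>2) \<in> borel_measurable lborel"
      using borel_measurable_step_fun[OF assms(1), of u] by measurable
    have "(cmod (step_fun h u x))\<^sup>2 \<le> K * cmod (step_fun h u x)" for x
      unfolding power2_eq_square by (intro mult_right_mono K) simp
    then show "AE x in lborel. norm ((cmod (step_fun h u x))\<^sup>2) \<le> norm (K * cmod (step_fun h u x))"
      by (auto intro: order_trans[OF _ abs_ge_self])
  qed
  then show ?thesis using borel_measurable_step_fun[OF assms(1), of u] by (simp add: L2_def)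
qed

lemma finite_int_vec_box: "finite {n :: int ^ 'n. \<forall>i. n $ i \<in> {a..b}}"
proof -
  have "{n :: int ^ 'n. \<forall>i. n $ i \<in> {a..b}} \<subseteq> vec_lambda ` (PiE UNIV (\<lambda>_. {a..b}))"
    by (auto intro!: image_eqI[of _ _ "vec_nth _"])
  then show ?thesis
    by (rule finite_subset) (intro finite_imageI finite_PiE, auto)
qed

lemma finite_grid_index_image:
  assumes h: "h > 0" and K: "bounded K"
  shows "finite (grid_index h ` K)"
proof -
  obtain R where R: "\<And>x. x \<in> K \<Longrightarrow> norm x \<le> R" using K by (auto simp: bounded_iff)
  have "grid_index h ` K \<subseteq> {n. \<forall>i. n $ i \<in> {\<lfloor>- (R / h)\<rfloor>..\<lfloor>R / h + 1 / 2\<rfloor>}}"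
  proof clarify
    fix x i assume "x \<in> K"
    then have "\<bar>x $ i\<bar> \<le> R" using R component_le_norm_cart[of x i] by force
    then have "- (R / h) \<le> x $ i / h + 1 / 2" "x $ i / h + 1 / 2 \<le> R / h + 1 / 2"
      using h by (auto simp: field_simps)
    then show "grid_index h x $ i \<in> {\<lfloor>- (R / h)\<rfloor>..\<lfloor>R / h + 1 / 2\<rfloor>}"
      by (simp add: grid_index_def floor_mono)
  qed
  then show ?thesis by (rule finite_subset[OF _ finite_int_vec_box])
qed

lemma same_cell_dist:
  fixes x y :: "real ^ 'n" and h :: real
  assumes h: "h > 0" and eq: "grid_index h x = grid_index h y"
  shows "norm (x - y) \<le> CARD('n) * h"
proof -
  have "\<bar>(x - y) $ i\<bar> \<le> h" for i
  proof -
    have "h * grid_index h y $ i - h / 2 \<le> x $ i \<and> x $ i < h * grid_index h y $ i + h / 2"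
      "h * grid_index h y $ i - h / 2 \<le> y $ i \<and> y $ i < h * grid_index h y $ i + h / 2"
      using grid_index_eq_iff[OF h, of x "grid_index h y"] grid_index_eq_iff[OF h, of y "grid_index h y"] eq
      by simp_all
    then show ?thesis unfolding vector_minus_component by linarith
  qed
  then have "(\<Sum>i\<in>UNIV. \<bar>(x - y) $ i\<bar>) \<le> (\<Sum>i\<in>(UNIV :: 'n set). h)" by (intro sum_mono)
  then show ?thesis using norm_le_l1_cart[of "x - y"] by simp
qed

text \<open>Smallness in L1 gives convergence of Fourier integrals at every point, smallness in L2
  gives convergence of norms. Demanding it for all small h lets two functions be approximated on the
  same grid, so that linear combinations can be treated.\<close>

definition step_approximable :: "(real ^ 'n \<Rightarrow> complex) \<Rightarrow> bool" where
  "step_approximable f \<longleftrightarrow> integrable lborel f \<and> f \<in> L2 lborel \<and>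
     (\<forall>e>0. \<exists>\<delta>>0. \<forall>h. 0 < h \<and> h < \<delta> \<longrightarrow> (\<exists>A u. finite A \<and> (\<forall>n. n \<notin> A \<longrightarrow> u n = 0) \<and>
        (\<integral>x. cmod (f x - step_fun h u x) \<partial>lborel) < e \<and> L2_norm lborel (\<lambda>x. f x - step_fun h u x) < e))"

text \<open>A is approximated in measure by a compact K inside it and K by an open U around it. Once
  cells are smaller than the distance from K to the complement of U, the cells that meet K cover K
  and stay in U, so the error lives on the small set \<open>D\<close>.\<close>

lemma step_approximable_indicator:
  fixes A :: "(real ^ 'n) set"
  assumes A: "A \<in> sets borel" "bounded A"
  shows "step_approximable (indicator A)"
proof -
  have fin: "emeasure lborel A < \<infinity>" using emeasure_bounded_finite[OF A(2)] .
  have int: "integrable lborel (indicator A :: _ \<Rightarrow> complex)"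
    using A fin by (intro integrable_complex_indicator) auto
  have L2: "(indicator A :: _ \<Rightarrow> complex) \<in> L2 lborel"
  proof -
    have "integrable lborel (indicator A :: _ \<Rightarrow> real)" using A fin by (simp add: integrable_indicator_iff)
    moreover have "(\<lambda>x. (cmod (indicator A x))\<^sup>2) = (indicator A :: _ \<Rightarrow> real)" by (auto simp: indicator_def)
    ultimately show ?thesis using A by (simp add: L2_def)
  qed
  have "\<exists>\<delta>>0. \<forall>h. 0 < h \<and> h < \<delta> \<longrightarrow> (\<exists>N u. finite N \<and> (\<forall>n. n \<notin> N \<longrightarrow> u n = 0) \<and>
        (\<integral>x. cmod (indicator A x - step_fun h u x) \<partial>lborel) < e \<and> L2_norm lborel (\<lambda>x. indicator A x - step_fun h u x) < e)"
    if e: "e > 0" for e :: real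
  proof -
    \<comment> \<open>Twice r must lie below e for the L1 error, which is bounded by a measure, and
      below e^2 for the L2 error, which is bounded by its square root.\<close>
    define r where "r = min e (e\<^sup>2) / 3"
    have r: "r > 0" "2 * r < e" "2 * r < e\<^sup>2" using e by (auto simp: r_def min_def)
    have "A \<in> sets lebesgue" using A by auto
    from sets_lebesgue_inner_closed[OF this r(1)] obtain K where K: "closed K" "K \<subseteq> A" "emeasure lebesgue (A - K) < ennreal r"
      by metis
    have cK: "compact K" using K A bounded_subset by (auto simp: compact_eq_bounded_closed)
    have K': "emeasure lborel (A - K) < ennreal r"
      using K A by simp
    have bK: "K \<in> sets borel" using K by auto
    from outer_regular_lborel[OF bK r(1)] obtain U where U: "open U" "K \<subseteq> U" "emeasure lborel (U - K) < ennreal r"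
      by metis
    obtain d where d: "d > 0" "(\<Union>x\<in>K. ball x d) \<subseteq> U"
      using compact_subset_open_imp_ball_epsilon_subset[OF cK U(1,2)] by blast
    define D where "D = (A - K) \<union> (U - K)"
    have Ds: "D \<in> sets lborel" unfolding D_def using A bK U by auto
    have "emeasure lborel D \<le> emeasure lborel (A - K) + emeasure lborel (U - K)"
      unfolding D_def using A bK U by (intro emeasure_subadditive) auto
    also have "\<dots> \<le> ennreal r + ennreal r" using K' U(3) by (intro add_mono) auto
    finally have De: "emeasure lborel D \<le> ennreal (2 * r)" using r by (simp add: ennreal_plus[symmetric] del: ennreal_plus)
    then have Dfin: "emeasure lborel D < \<infinity>" by (simp add: le_less_trans ennreal_less_top)
    have Dm: "measure lborel D \<le> 2 * r" using De r by (simp add: measure_def enn2real_leI)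
    have intD: "integrable lborel (indicator D :: _ \<Rightarrow> real)" using Ds Dfin by (simp add: integrable_indicator_iff)
    show ?thesis
    proof (intro exI[of _ "d / CARD('n)"] conjI allI impI)
      show "d / CARD('n) > 0" using d by simp
      fix h :: real assume h: "0 < h \<and> h < d / CARD('n)"
      then have h0: "h > 0" and hd: "CARD('n) * h < d" by (auto simp: field_simps)
      define N where "N = grid_index h ` K"
      define u :: "int ^ 'n \<Rightarrow> complex" where "u = indicator N"
      have N: "finite N" unfolding N_def by (rule finite_grid_index_image[OF h0 compact_imp_bounded[OF cK]])
      have u0: "u n = 0" if "n \<notin> N" for n using that by (simp add: u_def)
      have le: "cmod (indicator A x - step_fun h u x) \<le> indicator D x" for x
      proof (cases "grid_index h x \<in> N")
        case True
        then obtain y where y: "y \<in> K" "grid_index h x = grid_index h y" by (auto simp: N_def)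
        have "norm (x - y) < d" using same_cell_dist[OF h0 y(2)] hd by linarith
        then have "x \<in> ball y d" by (simp add: dist_norm norm_minus_commute)
        then have "x \<in> U" using d(2) y(1) by blast
        then show ?thesis using True K(2) by (auto simp: step_fun_def u_def D_def indicator_def)
      next
        case False
        then have "x \<notin> K" by (auto simp: N_def)
        then show ?thesis using False by (auto simp: step_fun_def u_def D_def indicator_def)
      qed
      have m: "(\<lambda>x. indicator A x - step_fun h u x) \<in> borel_measurable lborel"
        using borel_measurable_step_fun[OF h0, of u] A by measurable
      have "(\<integral>x. cmod (indicator A x - step_fun h u x) \<partial>lborel) \<le> (\<integral>x. indicator D x \<partial>lborel)"
        using m by (intro integral_mono' intD le) auto
      also have "\<dots> = measure lborel D" using Ds by simp
      also have "\<dots> < e" using Dm r by simp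
      finally have 1: "(\<integral>x. cmod (indicator A x - step_fun h u x) \<partial>lborel) < e" .
      have "(L2_norm lborel (\<lambda>x. indicator A x - step_fun h u x))\<^sup>2 \<le> (\<integral>x. indicator D x \<partial>lborel)"
        unfolding L2_norm_sq
      proof (intro integral_mono' intD)
        fix x :: "real ^ 'n"
        have "(cmod (indicator A x - step_fun h u x))\<^sup>2 \<le> (indicator D x :: real)\<^sup>2" by (intro power_mono le) auto
        also have "(indicator D x :: real)\<^sup>2 = indicator D x" by (simp add: indicator_def)
        finally show "(cmod (indicator A x - step_fun h u x))\<^sup>2 \<le> indicator D x" .
      qed auto
      also have "\<dots> = measure lborel D" using Ds by simp
      also have "\<dots> < e\<^sup>2" using Dm r by simp
      finally have "L2_norm lborel (\<lambda>x. indicator A x - step_fun h u x) < e" using e by (simp add: power2_less_imp_less)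
      with 1 N u0 show "\<exists>N u. finite N \<and> (\<forall>n. n \<notin> N \<longrightarrow> u n = 0) \<and>
        (\<integral>x. cmod (indicator A x - step_fun h u x) \<partial>lborel) < e \<and> L2_norm lborel (\<lambda>x. indicator A x - step_fun h u x) < e"
        by blast
    qed
  qed
  then show ?thesis using int L2 by (simp add: step_approximable_def)
qed

lemma step_approximable_linear:
  assumes f: "step_approximable f" and g: "step_approximable g"
  shows "step_approximable (\<lambda>x. f x + c * g x)"
  unfolding step_approximable_def
proof (intro conjI allI impI)
  note F = f[unfolded step_approximable_def] and G = g[unfolded step_approximable_def]
  have fi: "integrable lborel f" "f \<in> L2 lborel" and gi: "integrable lborel g" "g \<in> L2 lborel" using F G by auto
  show "integrable lborel (\<lambda>x. f x + c * g x)" using fi gi by simp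
  show "(\<lambda>x. f x + c * g x) \<in> L2 lborel" by (intro L2_intros fi gi)
  fix e :: real assume e: "e > 0"
  define r where "r = e / 2 / (1 + cmod c)"
  have c: "1 + cmod c > 0" by (simp add: add_pos_nonneg)
  then have c0: "1 + cmod c \<noteq> 0" by simp
  have "r * (1 + cmod c) = e / 2"
    unfolding r_def by (subst times_divide_eq_left) (rule nonzero_mult_div_cancel_right[OF c0])
  then have "r + cmod c * r = e / 2" by (simp add: algebra_simps)
  with e have r: "r > 0" "r + cmod c * r < e" using c by (simp_all add: r_def)
  obtain d1 where d1_pos: "d1 > 0"
    and d1: "\<And>h. 0 < h \<Longrightarrow> h < d1 \<Longrightarrow> \<exists>A u. finite A \<and> (\<forall>n. n \<notin> A \<longrightarrow> u n = 0) \<and>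
        (\<integral>x. cmod (f x - step_fun h u x) \<partial>lborel) < r \<and> L2_norm lborel (\<lambda>x. f x - step_fun h u x) < r"
    using F[THEN conjunct2, THEN conjunct2, rule_format, OF r(1)] by blast
  obtain d2 where d2_pos: "d2 > 0"
    and d2: "\<And>h. 0 < h \<Longrightarrow> h < d2 \<Longrightarrow> \<exists>A u. finite A \<and> (\<forall>n. n \<notin> A \<longrightarrow> u n = 0) \<and>
        (\<integral>x. cmod (g x - step_fun h u x) \<partial>lborel) < r \<and> L2_norm lborel (\<lambda>x. g x - step_fun h u x) < r"
    using G[THEN conjunct2, THEN conjunct2, rule_format, OF r(1)] by blast
  note d = d1_pos d2_pos
  show "\<exists>\<delta>>0. \<forall>h. 0 < h \<and> h < \<delta> \<longrightarrow> (\<exists>A u. finite A \<and> (\<forall>n. n \<notin> A \<longrightarrow> u n = 0) \<and>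
        (\<integral>x. cmod (f x + c * g x - step_fun h u x) \<partial>lborel) < e \<and>
        L2_norm lborel (\<lambda>x. f x + c * g x - step_fun h u x) < e)"
  proof (intro exI[of _ "min d1 d2"] conjI allI impI)
    show "min d1 d2 > 0" using d by simp
    fix h assume "0 < h \<and> h < min d1 d2"
    then have h: "h > 0" "h < d1" "h < d2" by auto
    obtain A u where u: "finite A" "\<And>n. n \<notin> A \<Longrightarrow> u n = 0" "(\<integral>x. cmod (f x - step_fun h u x) \<partial>lborel) < r"
      "L2_norm lborel (\<lambda>x. f x - step_fun h u x) < r" using d1[OF h(1,2)] by blast
    obtain B v where v: "finite B" "\<And>n. n \<notin> B \<Longrightarrow> v n = 0" "(\<integral>x. cmod (g x - step_fun h v x) \<partial>lborel) < r"
      "L2_norm lborel (\<lambda>x. g x - step_fun h v x) < r" using d2[OF h(1,3)] by blast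
    note ui = integrable_step_fun[where u = u, OF h(1) u(1,2)] L2_step_fun_finite[where u = u, OF h(1) u(1,2)]
    note vi = integrable_step_fun[where u = v, OF h(1) v(1,2)] L2_step_fun_finite[where u = v, OF h(1) v(1,2)]
    let ?w = "\<lambda>n. u n + c * v n"
    have eq: "f x + c * g x - step_fun h ?w x = (f x - step_fun h u x) + c * (g x - step_fun h v x)" for x
      by (simp add: step_fun_def algebra_simps)
    have "(\<integral>x. cmod (f x + c * g x - step_fun h ?w x) \<partial>lborel) \<le>
        (\<integral>x. cmod (f x - step_fun h u x) + cmod c * cmod (g x - step_fun h v x) \<partial>lborel)"
      unfolding eq using fi gi ui vi
      by (intro integral_mono) (auto intro!: order_trans[OF norm_triangle_ineq] simp: norm_mult)
    also have "\<dots> = (\<integral>x. cmod (f x - step_fun h u x) \<partial>lborel) + cmod c * (\<integral>x. cmod (g x - step_fun h v x) \<partial>lborel)"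
      using fi gi ui vi by simp
    also have "\<dots> \<le> r + cmod c * r" using u v by (intro add_mono mult_left_mono) auto
    finally have 1: "(\<integral>x. cmod (f x + c * g x - step_fun h ?w x) \<partial>lborel) < e" using r by simp
    have "L2_norm lborel (\<lambda>x. f x + c * g x - step_fun h ?w x) \<le>
        L2_norm lborel (\<lambda>x. f x - step_fun h u x) + L2_norm lborel (\<lambda>x. c * (g x - step_fun h v x))"
      unfolding eq by (intro L2_norm_triangle L2_intros fi gi ui vi)
    also have "\<dots> \<le> r + cmod c * r" unfolding L2_norm_scale using u v by (intro add_mono mult_left_mono) auto
    finally have 2: "L2_norm lborel (\<lambda>x. f x + c * g x - step_fun h ?w x) < e" using r by simp
    show "\<exists>A u. finite A \<and> (\<forall>n. n \<notin> A \<longrightarrow> u n = 0) \<and>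
        (\<integral>x. cmod (f x + c * g x - step_fun h u x) \<partial>lborel) < e \<and>
        L2_norm lborel (\<lambda>x. f x + c * g x - step_fun h u x) < e"
      using 1 2 u(1,2) v(1,2) by (intro exI[of _ "A \<union> B"] exI[of _ ?w]) auto
  qed
qed

lemma step_approximable_zero: "step_approximable (\<lambda>x :: real ^ 'n. 0)"
proof -
  have "step_approximable (indicator {} :: real ^ 'n \<Rightarrow> complex)"
    by (rule step_approximable_indicator) auto
  moreover have "(indicator {} :: real ^ 'n \<Rightarrow> complex) = (\<lambda>x. 0)" by (auto simp: indicator_def)
  ultimately show ?thesis by (simp only:)
qed

lemma step_approximable_sum:
  "finite I \<Longrightarrow> (\<And>i. i \<in> I \<Longrightarrow> step_approximable (f i)) \<Longrightarrow> step_approximable (\<lambda>x. \<Sum>i\<in>I. c i * f i x)"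
proof (induction I rule: finite_induct)
  case (insert i I)
  then have "step_approximable (\<lambda>x. (\<Sum>i\<in>I. c i * f i x) + c i * f i x)"
    by (intro step_approximable_linear) auto
  then show ?case using insert by (simp add: add.commute)
qed (simp add: step_approximable_zero)

lemma step_approximable_limit:
  assumes s: "\<And>i :: nat. step_approximable (s i)" and f: "integrable lborel f" "f \<in> L2 lborel"
    and l1: "(\<lambda>i. \<integral>x. cmod (f x - s i x) \<partial>lborel) \<longlonglongrightarrow> 0"
    and l2: "(\<lambda>i. L2_norm lborel (\<lambda>x. f x - s i x)) \<longlonglongrightarrow> 0"
  shows "step_approximable f"
  unfolding step_approximable_def
proof (intro conjI allI impI f)
  fix e :: real assume e: "e > 0"
  have "\<forall>\<^sub>F i in sequentially. (\<integral>x. cmod (f x - s i x) \<partial>lborel) < e / 2 \<and> L2_norm lborel (\<lambda>x. f x - s i x) < e / 2"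
    using e by (intro eventually_conj order_tendstoD(2)[OF l1] order_tendstoD(2)[OF l2]) auto
  then obtain i where i: "(\<integral>x. cmod (f x - s i x) \<partial>lborel) < e / 2" "L2_norm lborel (\<lambda>x. f x - s i x) < e / 2"
    by (auto simp: eventually_sequentially)
  note S = s[of i, unfolded step_approximable_def]
  have si: "integrable lborel (s i)" "s i \<in> L2 lborel" using S by auto
  obtain d where d: "d > 0" and d': "\<And>h. 0 < h \<Longrightarrow> h < d \<Longrightarrow> \<exists>A u. finite A \<and> (\<forall>n. n \<notin> A \<longrightarrow> u n = 0) \<and>
        (\<integral>x. cmod (s i x - step_fun h u x) \<partial>lborel) < e / 2 \<and> L2_norm lborel (\<lambda>x. s i x - step_fun h u x) < e / 2"
    using S[THEN conjunct2, THEN conjunct2, rule_format, OF half_gt_zero[OF e]] by blast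
  show "\<exists>\<delta>>0. \<forall>h. 0 < h \<and> h < \<delta> \<longrightarrow> (\<exists>A u. finite A \<and> (\<forall>n. n \<notin> A \<longrightarrow> u n = 0) \<and>
        (\<integral>x. cmod (f x - step_fun h u x) \<partial>lborel) < e \<and> L2_norm lborel (\<lambda>x. f x - step_fun h u x) < e)"
  proof (intro exI[of _ d] conjI allI impI d)
    fix h assume "0 < h \<and> h < d"
    then have h: "h > 0" "h < d" by auto
    obtain A u where u: "finite A" "\<And>n. n \<notin> A \<Longrightarrow> u n = 0" "(\<integral>x. cmod (s i x - step_fun h u x) \<partial>lborel) < e / 2"
      "L2_norm lborel (\<lambda>x. s i x - step_fun h u x) < e / 2" using d'[OF h] by blast
    note ui = integrable_step_fun[where u = u, OF h(1) u(1,2)] L2_step_fun_finite[where u = u, OF h(1) u(1,2)]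
    have "(\<integral>x. cmod (f x - step_fun h u x) \<partial>lborel) \<le>
        (\<integral>x. cmod (f x - s i x) + cmod (s i x - step_fun h u x) \<partial>lborel)"
    proof (intro integral_mono)
      fix x
      show "cmod (f x - step_fun h u x) \<le> cmod (f x - s i x) + cmod (s i x - step_fun h u x)"
        using norm_triangle_ineq[of "f x - s i x" "s i x - step_fun h u x"] by simp
    qed (use f si ui in auto)
    also have "\<dots> = (\<integral>x. cmod (f x - s i x) \<partial>lborel) + (\<integral>x. cmod (s i x - step_fun h u x) \<partial>lborel)"
      using f si ui by simp
    finally have 1: "(\<integral>x. cmod (f x - step_fun h u x) \<partial>lborel) < e" using i u by simp
    have "L2_norm lborel (\<lambda>x. f x - step_fun h u x) < e"
      using L2_norm_triangle3[OF f(2) si(2) ui(2)] i u by linarith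
    with 1 u(1,2) show "\<exists>A u. finite A \<and> (\<forall>n. n \<notin> A \<longrightarrow> u n = 0) \<and>
        (\<integral>x. cmod (f x - step_fun h u x) \<partial>lborel) < e \<and> L2_norm lborel (\<lambda>x. f x - step_fun h u x) < e"
      by blast
  qed
qed

text \<open>Simple functions cut off to growing balls are finite combinations of indicators of
  bounded sets. They are dominated by 2 |f|, so the errors are dominated by 3 |f| and tend to 0 in
  both norms.\<close>

lemma step_approximable_all:
  fixes f :: "real ^ 'n \<Rightarrow> complex"
  assumes f: "integrable lborel f" "f \<in> L2 lborel"
  shows "step_approximable f"
proof -
  have fm: "f \<in> borel_measurable lborel" using f by (simp add: L2_def)
  obtain s where s: "\<And>i. simple_function lborel (s i)" "\<And>x. (\<lambda>i. s i x) \<longlonglongrightarrow> f x"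
    "\<And>i x. dist (s i x) 0 \<le> 2 * dist (f x) 0"
    using borel_measurable_implies_sequence_metric[OF fm, of 0] by auto
  have sm: "s i \<in> borel_measurable lborel" for i using s(1) by (rule borel_measurable_simple_function)
  \<comment> \<open>The cutoff makes the level sets bounded, as
    \<open>step_approximable_indicator\<close> requires.\<close>
  define t where "t i x = s i x * indicator (cball 0 (real i)) x" for i x
  have cb: "cball 0 (real i) \<in> sets (borel :: (real ^ 'n) measure)" for i by (simp add: borel_closed)
  have tm: "t i \<in> borel_measurable lborel" for i
    unfolding t_def[abs_def] using sm[of i] cb[of i] by measurable
  have ta: "step_approximable (t i)" for i
  proof -
    have fin: "finite (range (s i))" using simple_functionD(1)[OF s(1)[of i]] by simp
    have "t i x = (\<Sum>y\<in>range (s i). y * indicator (s i -` {y} \<inter> cball 0 (real i)) x)" for x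
    proof -
      have "(\<Sum>y\<in>range (s i). y * indicator (s i -` {y} \<inter> cball 0 (real i)) x) =
        (\<Sum>y\<in>range (s i). if y = s i x then y * indicator (cball 0 (real i)) x else 0)"
        by (intro sum.cong) (auto simp: indicator_def)
      also have "\<dots> = t i x" using fin by (simp add: sum.delta t_def)
      finally show ?thesis ..
    qed
    then have "t i = (\<lambda>x. \<Sum>y\<in>range (s i). y * indicator (s i -` {y} \<inter> cball 0 (real i)) x)" by auto
    moreover have "s i -` {y} \<in> sets borel" for y
      using simple_functionD(2)[OF s(1)[of i], of "{y}"] by simp
    ultimately show ?thesis
      by (auto intro!: step_approximable_sum fin step_approximable_indicator bounded_subset[OF bounded_cball])
  qed
  have lim: "(\<lambda>i. t i x) \<longlonglongrightarrow> f x" for x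
  proof -
    obtain N :: nat where N: "norm x \<le> N" using real_arch_simple by blast
    have "\<forall>\<^sub>F i in sequentially. s i x = t i x"
      using eventually_ge_at_top[of N] by eventually_elim (use N in \<open>auto simp: t_def indicator_def\<close>)
    then show ?thesis using s(2) by (rule Lim_transform_eventually[rotated])
  qed
  have bd: "cmod (f x - t i x) \<le> 3 * cmod (f x)" for x i
  proof -
    have "cmod (t i x) \<le> 2 * cmod (f x)" using s(3)[of i x] by (auto simp: t_def indicator_def)
    then show ?thesis using norm_triangle_ineq4[of "f x" "t i x"] by linarith
  qed
  have "(\<lambda>i. \<integral>x. cmod (f x - t i x) \<partial>lborel) \<longlonglongrightarrow> (\<integral>x. cmod (f x - f x) \<partial>(lborel :: (real ^ 'n) measure))"
  proof (rule integral_dominated_convergence)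
    show "integrable lborel (\<lambda>x. 3 * cmod (f x))" using f by simp
    show "AE x in lborel. (\<lambda>i. cmod (f x - t i x)) \<longlonglongrightarrow> cmod (f x - f x)"
      by (intro always_eventually allI tendsto_intros lim)
    show "AE x in lborel. norm (cmod (f x - t i x)) \<le> 3 * cmod (f x)" for i using bd by simp
    show "(\<lambda>x. cmod (f x - t i x)) \<in> borel_measurable lborel" for i using fm tm[of i] by measurable
  qed simp
  moreover have "(\<lambda>i. \<integral>x. (cmod (f x - t i x))\<^sup>2 \<partial>lborel) \<longlonglongrightarrow> (\<integral>x. (cmod (f x - f x))\<^sup>2 \<partial>(lborel :: (real ^ 'n) measure))"
  proof (rule integral_dominated_convergence)
    show "integrable lborel (\<lambda>x. 9 * (cmod (f x))\<^sup>2)" using f by (simp add: L2_def)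
    show "AE x in lborel. (\<lambda>i. (cmod (f x - t i x))\<^sup>2) \<longlonglongrightarrow> (cmod (f x - f x))\<^sup>2"
      by (intro always_eventually allI tendsto_intros lim)
    have "(cmod (f x - t i x))\<^sup>2 \<le> (3 * cmod (f x))\<^sup>2" for x i by (intro power_mono bd) auto
    then show "AE x in lborel. norm ((cmod (f x - t i x))\<^sup>2) \<le> 9 * (cmod (f x))\<^sup>2" for i
      by (simp add: power_mult_distrib)
    show "(\<lambda>x. (cmod (f x - t i x))\<^sup>2) \<in> borel_measurable lborel" for i using fm tm[of i] by measurable
  qed simp
  then have "(\<lambda>i. L2_norm lborel (\<lambda>x. f x - t i x)) \<longlonglongrightarrow> sqrt 0"
    unfolding L2_norm_def by (intro tendsto_real_sqrt) simp
  ultimately show ?thesis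
    by (intro step_approximable_limit[OF ta f]) simp_all
qed

section \<open>The Fourier transform is unitary\<close>

lemma integrable_cis_mult:
  assumes "integrable lborel f"
  shows "integrable lborel (\<lambda>x. cis (- (x \<bullet> \<xi>)) * f x)"
proof (rule Bochner_Integration.integrable_bound[OF assms])
  show "(\<lambda>x. cis (- (x \<bullet> \<xi>)) * f x) \<in> borel_measurable lborel"
    using borel_measurable_integrable[OF assms] by measurable
qed (simp add: norm_mult)

lemma fourier_integral_linear:
  assumes "integrable lborel f" "integrable lborel g"
  shows "fourier_integral (\<lambda>x. f x + c * g x) \<xi> = fourier_integral f \<xi> + c * fourier_integral g \<xi>"
proof -
  have "(\<integral>x. cis (- (x \<bullet> \<xi>)) * (f x + c * g x) \<partial>lborel) =
     (\<integral>x. cis (- (x \<bullet> \<xi>)) * f x + c * (cis (- (x \<bullet> \<xi>)) * g x) \<partial>lborel)"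
    by (simp add: algebra_simps)
  also have "\<dots> = (\<integral>x. cis (- (x \<bullet> \<xi>)) * f x \<partial>lborel) + c * (\<integral>x. cis (- (x \<bullet> \<xi>)) * g x \<partial>lborel)"
    using integrable_cis_mult[OF assms(1), of \<xi>] integrable_cis_mult[OF assms(2), of \<xi>] by simp
  finally show ?thesis by (simp add: fourier_integral_def algebra_simps)
qed

lemma fourier_integral_diff:
  assumes "integrable lborel f" "integrable lborel g"
  shows "fourier_integral (\<lambda>x. f x - g x) \<xi> = fourier_integral f \<xi> - fourier_integral g \<xi>"
  using fourier_integral_linear[OF assms, of "-1" \<xi>] by simp

lemma fourier_integral_diff':
  assumes "integrable lborel f" "integrable lborel g"
  shows "fourier_integral (\<lambda>x. f x - g x) = (\<lambda>\<xi>. fourier_integral f \<xi> - fourier_integral g \<xi>)"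
  by (rule ext) (rule fourier_integral_diff[OF assms])

lemma fourier_integral_sum:
  assumes "finite A" "\<And>n. n \<in> A \<Longrightarrow> integrable lborel (f n)"
  shows "fourier_integral (\<lambda>x. \<Sum>n\<in>A. c n * f n x) \<xi> = (\<Sum>n\<in>A. c n * fourier_integral (f n) \<xi>)"
  using assms
proof (induction A rule: finite_induct)
  case empty
  then show ?case by (simp add: fourier_integral_def)
next
  case (insert a A)
  have "fourier_integral (\<lambda>x. (\<Sum>n\<in>A. c n * f n x) + c a * f a x) \<xi> =
      fourier_integral (\<lambda>x. \<Sum>n\<in>A. c n * f n x) \<xi> + c a * fourier_integral (f a) \<xi>"
    using insert by (intro fourier_integral_linear) auto
  then show ?case using insert by (simp add: add.commute)
qed

lemma fourier_integral_bound:
  fixes f :: "real ^ 'n \<Rightarrow> complex"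
  shows "cmod (fourier_integral f \<xi>) \<le> (2 * pi) powr (- real CARD('n) / 2) * (\<integral>x. cmod (f x) \<partial>lborel)"
proof -
  have "cmod (\<integral>x. cis (- (x \<bullet> \<xi>)) * f x \<partial>lborel) \<le> (\<integral>x. cmod (cis (- (x \<bullet> \<xi>)) * f x) \<partial>lborel)"
    by (rule integral_norm_bound)
  then show ?thesis
    by (simp add: fourier_integral_def norm_mult mult_left_mono)
qed

lemma borel_measurable_fourier_integral:
  assumes [measurable]: "f \<in> borel_measurable lborel"
  shows "fourier_integral f \<in> borel_measurable lborel"
proof -
  have "(\<lambda>\<xi>. \<integral>x. cis (- (x \<bullet> \<xi>)) * f x \<partial>lborel) \<in> borel_measurable lborel"
    by (rule lborel.borel_measurable_lebesgue_integral) measurable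
  then show ?thesis unfolding fourier_integral_def[abs_def] by measurable
qed

lemma fourier_integral_step_fun:
  fixes h :: real
  assumes "h > 0" "finite A" "\<And>n. n \<notin> A \<Longrightarrow> u n = 0"
  shows "fourier_integral (step_fun h u) \<xi> = (\<Sum>n\<in>A. u n * (cell_mult h \<xi> * dft_basis h n \<xi>))"
proof -
  have "step_fun h u = (\<lambda>x. \<Sum>n\<in>A. u n * indicator (grid_cell h n) x)"
    by (rule ext) (rule step_fun_finite_support[OF assms(2,3)])
  then have "fourier_integral (step_fun h u) \<xi> =
      fourier_integral (\<lambda>x. \<Sum>n\<in>A. u n * indicator (grid_cell h n) x) \<xi>"
    by (simp only:)
  also have "\<dots> = (\<Sum>n\<in>A. u n * fourier_integral (indicator (grid_cell h n)) \<xi>)"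
    by (rule fourier_integral_sum[OF assms(2)]) (rule integrable_indicator_cell[OF assms(1)])
  finally show ?thesis unfolding fourier_integral_cell[OF assms(1)] .
qed

lemma L2_cell_transform:
  assumes h: "h > 0"
  shows "(\<lambda>\<xi>. cell_mult h \<xi> * dft_basis h n \<xi>) \<in> L2 lborel"
proof -
  have "(\<lambda>\<xi>. complex_of_real ((cmod (cell_mult h \<xi> * dft_basis h n \<xi>))\<^sup>2)) =
      (\<lambda>\<xi>. cnj (cell_mult h \<xi> * dft_basis h n \<xi>) * (cell_mult h \<xi> * dft_basis h n \<xi>))"
    by (rule ext) (simp only: complex_norm_square mult.commute)
  then have "integrable lborel (\<lambda>\<xi>. complex_of_real ((cmod (cell_mult h \<xi> * dft_basis h n \<xi>))\<^sup>2))"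
    using cell_transform_inner(1)[OF h, of n n] by simp
  then have "integrable lborel (\<lambda>\<xi>. (cmod (cell_mult h \<xi> * dft_basis h n \<xi>))\<^sup>2)"
    by (simp only: complex_of_real_integrable_eq)
  then show ?thesis unfolding L2_def by simp
qed

lemma cell_inner:
  fixes h :: real and n k :: "int ^ 'n"
  assumes h: "h > 0"
  shows "L2_inner lborel (indicator (grid_cell h n)) (indicator (grid_cell h k)) =
     complex_of_real (if n = k then h ^ CARD('n) else 0)"
proof -
  have "L2_inner lborel (indicator (grid_cell h n)) (indicator (grid_cell h k)) =
     (\<integral>x. (if n = k then indicator (grid_cell h n) x else 0) \<partial>lborel)"
    unfolding L2_inner_def
    by (intro Bochner_Integration.integral_cong) (auto simp: indicator_def grid_cell_def)
  also have "\<dots> = complex_of_real (if n = k then measure lborel (grid_cell h n) else 0)"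
  proof -
    have "(\<integral>x. (indicator (grid_cell h n) x :: complex) \<partial>lborel) = (\<integral>x. complex_of_real (indicator (grid_cell h n) x) \<partial>lborel)"
      by (intro Bochner_Integration.integral_cong) (auto simp: indicator_def)
    also have "\<dots> = complex_of_real (measure lborel (grid_cell h n))"
      using sets_grid_cell[OF h, of n] by simp
    finally show ?thesis by (cases "n = k") simp_all
  qed
  finally show ?thesis using h by (simp add: measure_def emeasure_grid_cell)
qed

text \<open>Both functions are combinations of orthogonal systems with the same coefficients and the
  same squared norms.\<close>

lemma step_fun_plancherel:
  fixes h :: real and u :: "int ^ 'n \<Rightarrow> complex"
  assumes h: "h > 0" and A: "finite A" "\<And>n. n \<notin> A \<Longrightarrow> u n = 0"
  shows "fourier_integral (step_fun h u) \<in> L2 lborel"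
    and "L2_norm lborel (fourier_integral (step_fun h u)) = L2_norm lborel (step_fun h u)"
proof -
  have F: "fourier_integral (step_fun h u) = (\<lambda>\<xi>. \<Sum>n\<in>A. u n * (cell_mult h \<xi> * dft_basis h n \<xi>))"
    by (rule ext) (rule fourier_integral_step_fun[OF h A])
  have S: "step_fun h u = (\<lambda>x. \<Sum>n\<in>A. u n * indicator (grid_cell h n) x)"
    by (rule ext) (rule step_fun_finite_support[OF A])
  show "fourier_integral (step_fun h u) \<in> L2 lborel"
    unfolding F by (intro L2_sum L2_scale L2_cell_transform h)
  have ind: "(indicator (grid_cell h n) :: _ \<Rightarrow> complex) \<in> L2 lborel" for n
  proof -
    have "step_fun h (\<lambda>k. if k = n then 1 else 0) \<in> L2 lborel"
      by (rule L2_step_fun_finite[OF h, of "{n}"]) auto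
    moreover have "step_fun h (\<lambda>k. if k = n then 1 else 0) = indicator (grid_cell h n)"
      by (auto simp: step_fun_def indicator_def grid_cell_def)
    ultimately show ?thesis by simp
  qed
  have "(L2_norm lborel (fourier_integral (step_fun h u)))\<^sup>2 = (L2_norm lborel (step_fun h u))\<^sup>2"
    unfolding F unfolding S
    unfolding L2_norm_orthogonal_sum[where e = "\<lambda>n \<xi>. complex_of_real (cell_mult h \<xi>) * dft_basis h n \<xi>",
        OF A(1) L2_cell_transform[OF h] cell_transform_inner(2)[OF h]]
      L2_norm_orthogonal_sum[where e = "\<lambda>n. indicator (grid_cell h n)", OF A(1) ind cell_inner[OF h]] ..
  then show "L2_norm lborel (fourier_integral (step_fun h u)) = L2_norm lborel (step_fun h u)"
    by simp
qed

text \<open>The L1 part of the approximation makes the transforms of the step functions converge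
  pointwise, the L2 part bounds their norms, and Fatou passes the bound to the limit. The
  approximating sequence is recorded for \<open>plancherel\<close>.\<close>

lemma fourier_integral_contraction:
  fixes f :: "real ^ 'n \<Rightarrow> complex"
  assumes f: "integrable lborel f" "f \<in> L2 lborel"
  shows "\<exists>p :: nat \<Rightarrow> real ^ 'n \<Rightarrow> complex. (\<forall>k. integrable lborel (p k) \<and> p k \<in> L2 lborel \<and>
      fourier_integral (p k) \<in> L2 lborel \<and> L2_norm lborel (fourier_integral (p k)) = L2_norm lborel (p k) \<and>
      L2_norm lborel (\<lambda>x. f x - p k x) \<le> 1 / (real k + 1))"
    and "fourier_integral f \<in> L2 lborel"
    and "L2_norm lborel (fourier_integral f) \<le> L2_norm lborel f"
proof -
  have ex: "\<exists>g. integrable lborel g \<and> g \<in> L2 lborel \<and> fourier_integral g \<in> L2 lborel \<and>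
      L2_norm lborel (fourier_integral g) = L2_norm lborel g \<and>
      L2_norm lborel (\<lambda>x. f x - g x) \<le> 1 / (real k + 1) \<and> (\<integral>x. cmod (f x - g x) \<partial>lborel) \<le> 1 / (real k + 1)" for k :: nat
  proof -
    define r where "r = 1 / (real k + 1)"
    have r: "r > 0" by (simp add: r_def)
    obtain d where d: "d > 0" "\<And>h. 0 < h \<Longrightarrow> h < d \<Longrightarrow> \<exists>A u. finite A \<and> (\<forall>n. n \<notin> A \<longrightarrow> u n = 0) \<and>
        (\<integral>x. cmod (f x - step_fun h u x) \<partial>lborel) < r \<and> L2_norm lborel (\<lambda>x. f x - step_fun h u x) < r"
      using step_approximable_all[OF f, unfolded step_approximable_def, THEN conjunct2, THEN conjunct2, rule_format, OF r]
      by blast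
    have hh: "0 < d / 2" "d / 2 < d" using d(1) by simp_all
    obtain A u where u: "finite A" "\<And>n. n \<notin> A \<Longrightarrow> u n = 0"
        "(\<integral>x. cmod (f x - step_fun (d / 2) u x) \<partial>lborel) < r" "L2_norm lborel (\<lambda>x. f x - step_fun (d / 2) u x) < r"
      using d(2)[OF hh] by blast
    show ?thesis
      using integrable_step_fun[where u = u, OF hh(1) u(1,2)] L2_step_fun_finite[where u = u, OF hh(1) u(1,2)]
        step_fun_plancherel[where u = u, OF hh(1) u(1,2)] u(3,4)
      unfolding r_def by (intro exI[of _ "step_fun (d / 2) u"]) auto
  qed
  have "\<exists>p. \<forall>k :: nat. integrable lborel (p k) \<and> p k \<in> L2 lborel \<and> fourier_integral (p k) \<in> L2 lborel \<and>
      L2_norm lborel (fourier_integral (p k)) = L2_norm lborel (p k) \<and>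
      L2_norm lborel (\<lambda>x. f x - p k x) \<le> 1 / (real k + 1) \<and> (\<integral>x. cmod (f x - p k x) \<partial>lborel) \<le> 1 / (real k + 1)"
    by (rule choice) (rule allI, rule ex)
  then obtain p :: "nat \<Rightarrow> real ^ 'n \<Rightarrow> complex" where p: "\<And>k. integrable lborel (p k)" "\<And>k. p k \<in> L2 lborel"
    "\<And>k. fourier_integral (p k) \<in> L2 lborel" "\<And>k. L2_norm lborel (fourier_integral (p k)) = L2_norm lborel (p k)"
    "\<And>k. L2_norm lborel (\<lambda>x. f x - p k x) \<le> 1 / (real k + 1)" "\<And>k. (\<integral>x. cmod (f x - p k x) \<partial>lborel) \<le> 1 / (real k + 1)"
    by blast
  show "\<exists>p :: nat \<Rightarrow> real ^ 'n \<Rightarrow> complex. (\<forall>k. integrable lborel (p k) \<and> p k \<in> L2 lborel \<and>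
      fourier_integral (p k) \<in> L2 lborel \<and> L2_norm lborel (fourier_integral (p k)) = L2_norm lborel (p k) \<and>
      L2_norm lborel (\<lambda>x. f x - p k x) \<le> 1 / (real k + 1))"
    using p by blast
  define C where "C = (2 * pi) powr (- real CARD('n) / 2)"
  have z: "(\<lambda>k. 1 / (real k + 1)) \<longlonglongrightarrow> 0"
    using LIMSEQ_inverse_real_of_nat by (simp add: inverse_eq_divide add.commute)
  have lim: "(\<lambda>k. fourier_integral (p k) \<xi>) \<longlonglongrightarrow> fourier_integral f \<xi>" for \<xi>
  proof (rule LIM_zero_cancel, rule Lim_null_comparison)
    show "\<forall>\<^sub>F k in sequentially. norm (fourier_integral (p k) \<xi> - fourier_integral f \<xi>) \<le> C * (1 / (real k + 1))"
    proof (intro always_eventually allI)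
      fix k
      have "norm (fourier_integral (p k) \<xi> - fourier_integral f \<xi>) = cmod (fourier_integral (\<lambda>x. f x - p k x) \<xi>)"
        by (simp add: fourier_integral_diff[OF f(1) p(1)] norm_minus_commute)
      also have "\<dots> \<le> C * (\<integral>x. cmod (f x - p k x) \<partial>lborel)" unfolding C_def by (rule fourier_integral_bound)
      also have "\<dots> \<le> C * (1 / (real k + 1))" using p(6)[of k] by (intro mult_left_mono) (auto simp: C_def)
      finally show "norm (fourier_integral (p k) \<xi> - fourier_integral f \<xi>) \<le> C * (1 / (real k + 1))" .
    qed
    show "(\<lambda>k. C * (1 / (real k + 1))) \<longlonglongrightarrow> 0" using tendsto_mult[OF tendsto_const z, of C] by simp
  qed
  have m: "fourier_integral f \<in> borel_measurable lborel"
    by (rule borel_measurable_fourier_integral[OF L2_D(1)[OF f(2)]])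
  have fat: "fourier_integral f \<in> L2 lborel \<and> L2_norm lborel (fourier_integral f) \<le> L2_norm lborel f + e" if e: "e > 0" for e :: real
  proof -
    have "\<forall>\<^sub>F k in sequentially. 1 / (real k + 1) < e" using z e by (rule order_tendstoD(2))
    then obtain N where N: "\<And>k. k \<ge> N \<Longrightarrow> 1 / (real k + 1) < e" by (auto simp: eventually_sequentially)
    have ub: "L2_norm lborel (fourier_integral (p (k + N))) \<le> L2_norm lborel f + e" for k
      using L2_norm_reverse_triangle[OF f(2) p(2)[of "k + N"]] p(4,5)[of "k + N"] N[of "k + N"] by simp
    have li: "AE \<xi> in lborel. (\<lambda>k. fourier_integral (p (k + N)) \<xi>) \<longlonglongrightarrow> fourier_integral f \<xi>"
      by (intro always_eventually allI LIMSEQ_ignore_initial_segment lim)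
    note fatou = L2_fatou[where w = "\<lambda>k. fourier_integral (p (k + N))", OF p(3) ub m li]
    show ?thesis by (intro conjI fatou)
  qed
  show "fourier_integral f \<in> L2 lborel" using fat[of 1] by simp
  show "L2_norm lborel (fourier_integral f) \<le> L2_norm lborel f"
  proof (rule field_le_epsilon)
    fix e :: real assume "0 < e"
    from fat[OF this] show "L2_norm lborel (fourier_integral f) \<le> L2_norm lborel f + e" ..
  qed
qed

text \<open>Equality holds for the approximants p k, and the contraction property applied to f - p k
  shows that replacing f by p k changes each side by at most 1 / (k + 1).\<close>

lemma plancherel:
  fixes f :: "real ^ 'n \<Rightarrow> complex"
  assumes f: "integrable lborel f" "f \<in> L2 lborel"
  shows "L2_norm lborel (fourier_integral f) = L2_norm lborel f"
proof -
  note F = fourier_integral_contraction[OF f]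
  obtain p :: "nat \<Rightarrow> real ^ 'n \<Rightarrow> complex" where p: "\<And>k. integrable lborel (p k)" "\<And>k. p k \<in> L2 lborel"
    "\<And>k. fourier_integral (p k) \<in> L2 lborel" "\<And>k. L2_norm lborel (fourier_integral (p k)) = L2_norm lborel (p k)"
    "\<And>k. L2_norm lborel (\<lambda>x. f x - p k x) \<le> 1 / (real k + 1)"
    using F(1) by blast
  have "\<bar>L2_norm lborel (fourier_integral f) - L2_norm lborel f\<bar> \<le> 2 * (1 / (real k + 1))" for k
  proof -
    have "\<bar>L2_norm lborel (fourier_integral f) - L2_norm lborel (fourier_integral (p k))\<bar> \<le>
        L2_norm lborel (\<lambda>\<xi>. fourier_integral f \<xi> - fourier_integral (p k) \<xi>)"
      by (intro L2_norm_reverse_triangle F p)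
    also have "\<dots> = L2_norm lborel (fourier_integral (\<lambda>x. f x - p k x))"
      by (simp only: fourier_integral_diff'[OF f(1) p(1)])
    also have "\<dots> \<le> L2_norm lborel (\<lambda>x. f x - p k x)"
      using f p by (intro fourier_integral_contraction(3) L2_diff) auto
    finally show ?thesis
      using L2_norm_reverse_triangle[OF f(2) p(2)[of k]] p(4,5)[of k] by linarith
  qed
  moreover have "(\<lambda>k. 2 * (1 / (real k + 1))) \<longlonglongrightarrow> 2 * 0"
    using LIMSEQ_inverse_real_of_nat by (intro tendsto_mult tendsto_const) (simp add: inverse_eq_divide add.commute)
  ultimately have "\<bar>L2_norm lborel (fourier_integral f) - L2_norm lborel f\<bar> \<le> 0"
    by (intro LIMSEQ_le_const[where X = "\<lambda>k. 2 * (1 / (real k + 1))"]) auto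
  then show ?thesis by simp
qed

text \<open>A relation, because images are determined only up to null sets. The one notion covers
  both Fourier transforms and both embeddings of the grid.\<close>

definition L2_isometry :: "'a measure \<Rightarrow> 'b measure \<Rightarrow> (('a \<Rightarrow> complex) \<times> ('b \<Rightarrow> complex)) set \<Rightarrow> bool" where
  "L2_isometry M N J \<longleftrightarrow> J \<subseteq> L2 M \<times> L2 N \<and> (\<forall>f \<in> L2 M. \<exists>g. (f, g) \<in> J) \<and>
     (\<forall>f g. (f, g) \<in> J \<longrightarrow> L2_norm N g = L2_norm M f) \<and>
     (\<forall>f g f' g' c. (f, g) \<in> J \<longrightarrow> (f', g') \<in> J \<longrightarrow> (\<lambda>x. f x + c * f' x, \<lambda>x. g x + c * g' x) \<in> J) \<and>
     (\<forall>f g g'. (f, g) \<in> J \<longrightarrow> g' \<in> borel_measurable N \<longrightarrow> (AE x in N. g' x = g x) \<longrightarrow> (f, g') \<in> J)"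

context
  fixes M :: "'a measure" and N :: "'b measure" and J
  assumes J: "L2_isometry M N J"
begin

lemma isometry_L2: "(f, g) \<in> J \<Longrightarrow> f \<in> L2 M" "(f, g) \<in> J \<Longrightarrow> g \<in> L2 N"
  using J unfolding L2_isometry_def by auto

lemma isometry_total: "f \<in> L2 M \<Longrightarrow> \<exists>g. (f, g) \<in> J"
  using J unfolding L2_isometry_def by auto

lemma isometry_norm: "(f, g) \<in> J \<Longrightarrow> L2_norm N g = L2_norm M f"
  using J unfolding L2_isometry_def by blast

lemma isometry_linear: "(f, g) \<in> J \<Longrightarrow> (f', g') \<in> J \<Longrightarrow> (\<lambda>x. f x + c * f' x, \<lambda>x. g x + c * g' x) \<in> J"
  using J unfolding L2_isometry_def by blast

lemma isometry_AE: "(f, g) \<in> J \<Longrightarrow> g' \<in> borel_measurable N \<Longrightarrow> AE x in N. g' x = g x \<Longrightarrow> (f, g') \<in> J"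
  using J unfolding L2_isometry_def by blast

lemma isometry_diff: "(f, g) \<in> J \<Longrightarrow> (f', g') \<in> J \<Longrightarrow> (\<lambda>x. f x - f' x, \<lambda>x. g x - g' x) \<in> J"
  using isometry_linear[of f g f' g' "-1"] by simp

lemma isometry_zero: "(\<lambda>x. 0, \<lambda>x. 0) \<in> J"
proof -
  obtain g where "(\<lambda>x. 0, g) \<in> J" using isometry_total[OF L2_zero] by blast
  from isometry_diff[OF this this] show ?thesis by simp
qed

lemma isometry_scale: "(f, g) \<in> J \<Longrightarrow> (\<lambda>x. c * f x, \<lambda>x. c * g x) \<in> J"
  using isometry_linear[OF isometry_zero, of f g c] by simp

lemma isometry_add: "(f, g) \<in> J \<Longrightarrow> (f', g') \<in> J \<Longrightarrow> (\<lambda>x. f x + f' x, \<lambda>x. g x + g' x) \<in> J"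
  using isometry_linear[of f g f' g' 1] by simp

lemma isometry_cong_AE:
  assumes "(f, g) \<in> J" "(f', g') \<in> J" "AE x in M. f x = f' x"
  shows "AE x in N. g x = g' x"
proof -
  note d = isometry_diff[OF assms(1,2)]
  have "L2_norm M (\<lambda>x. f x - f' x) = 0"
    using L2_norm_eq_0[OF isometry_L2(1)[OF d]] assms(3) by simp
  then have "L2_norm N (\<lambda>x. g x - g' x) = 0" using isometry_norm[OF d] by simp
  then show ?thesis using L2_norm_eq_0[OF isometry_L2(2)[OF d]] by simp
qed

lemma isometry_cong_AE_left:
  assumes "(f, g) \<in> J" "f' \<in> L2 M" "AE x in M. f x = f' x"
  shows "(f', g) \<in> J"
proof -
  obtain g' where g': "(f', g') \<in> J" using isometry_total[OF assms(2)] by blast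
  then show ?thesis
    using isometry_cong_AE[OF assms(1) g' assms(3)] isometry_L2(2)[OF assms(1)]
    by (intro isometry_AE[OF g']) (auto simp: L2_def)
qed

text \<open>Polarization: preservation of the norm of f + c f' gives the real part of c <f, f'>, and
  the choices c = 1 and c = - i yield the real and the imaginary part.\<close>

lemma isometry_inner:
  assumes "(f, g) \<in> J" "(f', g') \<in> J"
  shows "L2_inner N g g' = L2_inner M f f'"
proof -
  note f = isometry_L2[OF assms(1)] and f' = isometry_L2[OF assms(2)]
  have Re: "Re (c * L2_inner N g g') = Re (c * L2_inner M f f')" for c
  proof -
    have "(L2_norm N (\<lambda>x. g x + c * g' x))\<^sup>2 = (L2_norm M (\<lambda>x. f x + c * f' x))\<^sup>2"
      using isometry_norm[OF isometry_linear[OF assms, of c]] by simp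
    then show ?thesis
      using isometry_norm[OF assms(1)] isometry_norm[OF assms(2)]
      by (simp add: L2_norm_add_sq f f' L2_scale)
  qed
  show ?thesis using Re[of 1] Re[of "- \<i>"] by (simp add: complex_eq_iff)
qed

end

section \<open>Extension of the Fourier transform to all of L2\<close>

lemma L2_tendsto_sequence:
  assumes "L2_tendsto M sequentially p f"
  obtains N where "f \<in> L2 M" "\<And>n. p (n + N) \<in> L2 M"
    "(\<lambda>n. L2_norm M (\<lambda>x. p (n + N) x - f x)) \<longlonglongrightarrow> 0"
proof -
  obtain N where N: "\<And>n. n \<ge> N \<Longrightarrow> p n \<in> L2 M"
    using assms by (auto simp: L2_tendsto_def eventually_sequentially)
  show thesis
  proof
    show "f \<in> L2 M" "\<And>n. p (n + N) \<in> L2 M" using assms N by (auto simp: L2_tendsto_def)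
    have "(\<lambda>n. L2_norm M (\<lambda>x. p n x - f x)) \<longlonglongrightarrow> 0" using assms by (simp add: L2_tendsto_def)
    then show "(\<lambda>n. L2_norm M (\<lambda>x. p (n + N) x - f x)) \<longlonglongrightarrow> 0" by (rule LIMSEQ_ignore_initial_segment)
  qed
qed

lemma tendsto_L2_norm:
  assumes "f \<in> L2 M" "\<And>n. p n \<in> L2 M" "(\<lambda>n. L2_norm M (\<lambda>x. p n x - f x)) \<longlonglongrightarrow> 0"
  shows "(\<lambda>n. L2_norm M (p n)) \<longlonglongrightarrow> L2_norm M f"
proof (rule LIM_zero_cancel, rule Lim_null_comparison[OF _ assms(3)])
  show "\<forall>\<^sub>F n in sequentially. norm (L2_norm M (p n) - L2_norm M f) \<le> L2_norm M (\<lambda>x. p n x - f x)"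
    using L2_norm_reverse_triangle[OF assms(2,1)] by simp
qed

lemma tendsto_L2_inner:
  assumes f: "f \<in> L2 M" "\<And>n. p n \<in> L2 M" "(\<lambda>n. L2_norm M (\<lambda>x. p n x - f x)) \<longlonglongrightarrow> 0"
    and g: "g \<in> L2 M" "\<And>n. q n \<in> L2 M" "(\<lambda>n. L2_norm M (\<lambda>x. q n x - g x)) \<longlonglongrightarrow> 0"
  shows "(\<lambda>n. L2_inner M (p n) (q n)) \<longlonglongrightarrow> L2_inner M f g"
proof (rule LIM_zero_cancel, rule Lim_null_comparison)
  show "\<forall>\<^sub>F n in sequentially. norm (L2_inner M (p n) (q n) - L2_inner M f g) \<le>
     L2_norm M (\<lambda>x. p n x - f x) * L2_norm M (q n) + L2_norm M f * L2_norm M (\<lambda>x. q n x - g x)"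
  proof (intro always_eventually allI)
    fix n
    have "L2_inner M (p n) (q n) - L2_inner M f g =
        L2_inner M (\<lambda>x. p n x - f x) (q n) + L2_inner M f (\<lambda>x. q n x - g x)"
      by (simp add: L2_inner_diff_left L2_inner_diff_right f g)
    also have "cmod \<dots> \<le> L2_norm M (\<lambda>x. p n x - f x) * L2_norm M (q n) + L2_norm M f * L2_norm M (\<lambda>x. q n x - g x)"
      by (intro order_trans[OF norm_triangle_ineq] add_mono L2_cauchy_schwarz L2_diff f g)
    finally show "norm (L2_inner M (p n) (q n) - L2_inner M f g) \<le>
     L2_norm M (\<lambda>x. p n x - f x) * L2_norm M (q n) + L2_norm M f * L2_norm M (\<lambda>x. q n x - g x)" .
  qed
  have "(\<lambda>n. L2_norm M (\<lambda>x. p n x - f x) * L2_norm M (q n) + L2_norm M f * L2_norm M (\<lambda>x. q n x - g x))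
      \<longlonglongrightarrow> 0 * L2_norm M g + L2_norm M f * 0"
    by (intro tendsto_intros f g tendsto_L2_norm)
  then show "(\<lambda>n. L2_norm M (\<lambda>x. p n x - f x) * L2_norm M (q n) + L2_norm M f * L2_norm M (\<lambda>x. q n x - g x))
      \<longlonglongrightarrow> 0" by simp
qed

lemma fourierE:
  assumes "(f, g) \<in> fourier"
  obtains p where "f \<in> L2 lborel" "g \<in> L2 lborel" "\<And>n. integrable lborel (p n)" "\<And>n. p n \<in> L2 lborel"
    "(\<lambda>n. L2_norm lborel (\<lambda>x. p n x - f x)) \<longlonglongrightarrow> 0"
    "(\<lambda>n. L2_norm lborel (\<lambda>x. fourier_integral (p n) x - g x)) \<longlonglongrightarrow> 0"
proof -
  obtain p where p: "\<And>n. integrable lborel (p n)" "L2_tendsto lborel sequentially p f"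
    "L2_tendsto lborel sequentially (\<lambda>n. fourier_integral (p n)) g"
    using assms by (auto simp: fourier_def)
  obtain N where N: "f \<in> L2 lborel" "\<And>n. p (n + N) \<in> L2 lborel"
    "(\<lambda>n. L2_norm lborel (\<lambda>x. p (n + N) x - f x)) \<longlonglongrightarrow> 0"
    using L2_tendsto_sequence[OF p(2)] by blast
  have "(\<lambda>n. L2_norm lborel (\<lambda>x. fourier_integral (p n) x - g x)) \<longlonglongrightarrow> 0" and g: "g \<in> L2 lborel"
    using p(3) by (auto simp: L2_tendsto_def)
  then have "(\<lambda>n. L2_norm lborel (\<lambda>x. fourier_integral (p (n + N)) x - g x)) \<longlonglongrightarrow> 0"
    by (intro LIMSEQ_ignore_initial_segment)
  then show thesis using that[of "\<lambda>n. p (n + N)"] N p(1) g by blast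
qed

lemma fourierI:
  assumes "f \<in> L2 lborel" "g \<in> L2 lborel" "\<And>n. integrable lborel (p n)" "\<And>n. p n \<in> L2 lborel"
    "(\<lambda>n. L2_norm lborel (\<lambda>x. p n x - f x)) \<longlonglongrightarrow> 0"
    "(\<lambda>n. L2_norm lborel (\<lambda>x. fourier_integral (p n) x - g x)) \<longlonglongrightarrow> 0"
  shows "(f, g) \<in> fourier"
  unfolding fourier_def using assms fourier_integral_contraction(2)[OF assms(3,4)]
  by (auto simp: L2_tendsto_def intro!: exI[of _ p])

lemma fourier_L1_L2:
  assumes "integrable lborel f" "f \<in> L2 lborel"
  shows "(f, fourier_integral f) \<in> fourier"
  by (rule fourierI[where p = "\<lambda>_. f"]) (use assms fourier_integral_contraction(2) in auto)

lemma fourier_linear: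
  assumes "(f, g) \<in> fourier" "(f', g') \<in> fourier"
  shows "(\<lambda>x. f x + c * f' x, \<lambda>x. g x + c * g' x) \<in> fourier"
proof -
  from fourierE[OF assms(1)] obtain p where p: "f \<in> L2 lborel" "g \<in> L2 lborel" "\<And>n. integrable lborel (p n)" "\<And>n. p n \<in> L2 lborel"
    "(\<lambda>n. L2_norm lborel (\<lambda>x. p n x - f x)) \<longlonglongrightarrow> 0"
    "(\<lambda>n. L2_norm lborel (\<lambda>x. fourier_integral (p n) x - g x)) \<longlonglongrightarrow> 0" by blast
  from fourierE[OF assms(2)] obtain q where q: "f' \<in> L2 lborel" "g' \<in> L2 lborel" "\<And>n. integrable lborel (q n)" "\<And>n. q n \<in> L2 lborel"
    "(\<lambda>n. L2_norm lborel (\<lambda>x. q n x - f' x)) \<longlonglongrightarrow> 0"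
    "(\<lambda>n. L2_norm lborel (\<lambda>x. fourier_integral (q n) x - g' x)) \<longlonglongrightarrow> 0" by blast
  have add: "(\<lambda>n. L2_norm lborel (\<lambda>x. a n x + c * b n x - (a' x + c * b' x))) \<longlonglongrightarrow> 0"
    if a: "\<And>n. a n \<in> L2 lborel" "a' \<in> L2 lborel" "(\<lambda>n. L2_norm lborel (\<lambda>x. a n x - a' x)) \<longlonglongrightarrow> 0"
    and b: "\<And>n. b n \<in> L2 lborel" "b' \<in> L2 lborel" "(\<lambda>n. L2_norm lborel (\<lambda>x. b n x - b' x)) \<longlonglongrightarrow> 0"
    for a b :: "nat \<Rightarrow> real ^ 'b \<Rightarrow> complex" and a' b'
  proof (rule Lim_null_comparison)
    show "\<forall>\<^sub>F n in sequentially. norm (L2_norm lborel (\<lambda>x. a n x + c * b n x - (a' x + c * b' x))) \<le>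
        L2_norm lborel (\<lambda>x. a n x - a' x) + cmod c * L2_norm lborel (\<lambda>x. b n x - b' x)"
    proof (intro always_eventually allI)
      fix n
      have "(\<lambda>x. a n x + c * b n x - (a' x + c * b' x)) = (\<lambda>x. (a n x - a' x) + c * (b n x - b' x))"
        by (auto simp: algebra_simps)
      then show "norm (L2_norm lborel (\<lambda>x. a n x + c * b n x - (a' x + c * b' x))) \<le>
        L2_norm lborel (\<lambda>x. a n x - a' x) + cmod c * L2_norm lborel (\<lambda>x. b n x - b' x)"
        using L2_norm_triangle[OF L2_diff[OF a(1)[of n] a(2)] L2_scale[OF L2_diff[OF b(1)[of n] b(2)], of c]] by simp
    qed
    show "(\<lambda>n. L2_norm lborel (\<lambda>x. a n x - a' x) + cmod c * L2_norm lborel (\<lambda>x. b n x - b' x)) \<longlonglongrightarrow> 0"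
      using tendsto_add[OF a(3) tendsto_mult[OF tendsto_const b(3)], of "cmod c"] by simp
  qed
  show ?thesis
  proof (rule fourierI[where p = "\<lambda>n x. p n x + c * q n x"])
    show "(\<lambda>n. L2_norm lborel (\<lambda>x. p n x + c * q n x - (f x + c * f' x))) \<longlonglongrightarrow> 0"
      by (intro add p q)
    have "(\<lambda>n. L2_norm lborel (\<lambda>x. fourier_integral (p n) x + c * fourier_integral (q n) x - (g x + c * g' x))) \<longlonglongrightarrow> 0"
      by (intro add p q fourier_integral_contraction(2))
    then show "(\<lambda>n. L2_norm lborel (\<lambda>x. fourier_integral (\<lambda>x. p n x + c * q n x) x - (g x + c * g' x))) \<longlonglongrightarrow> 0"
      by (simp add: fourier_integral_linear[OF p(3) q(3)])
  qed (use p q in \<open>auto intro!: L2_add L2_scale\<close>)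
qed

text \<open>Cut-offs of f to balls are integrable and square-integrable, and by Plancherel their
  transforms form a Cauchy sequence.\<close>

lemma fourier_total:
  fixes f :: "real ^ 'n \<Rightarrow> complex"
  assumes f: "f \<in> L2 lborel"
  shows "\<exists>g. (f, g) \<in> fourier"
proof -
  define p where "p n x = f x * indicator (cball 0 (real n)) x" for n x
  have [measurable]: "f \<in> borel_measurable lborel" using f by (simp add: L2_def)
  have cb: "cball 0 r \<in> sets (borel :: (real ^ 'n) measure)" for r by (simp add: borel_closed)
  have pm: "p n \<in> borel_measurable lborel" for n unfolding p_def[abs_def] using cb[of "real n"] by measurable
  have pL: "p n \<in> L2 lborel" for n
    by (rule L2_bound[OF f pm, where K = 1]) (auto simp: p_def norm_mult indicator_def)
  have pi: "integrable lborel (p n)" for n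
  proof -
    have "(indicator (cball 0 (real n)) :: real ^ 'n \<Rightarrow> complex) \<in> L2 lborel"
      using step_approximable_indicator[OF cb, of "real n"] by (simp add: step_approximable_def)
    from integrable_L2_mult[OF f this] show ?thesis by (simp add: p_def[abs_def])
  qed
  have "(\<lambda>n. \<integral>x. (cmod (p n x - f x))\<^sup>2 \<partial>lborel) \<longlonglongrightarrow> (\<integral>x. 0 \<partial>(lborel :: (real ^ 'n) measure))"
  proof (rule integral_dominated_convergence)
    show "integrable lborel (\<lambda>x. (cmod (f x))\<^sup>2)" using f by (simp add: L2_def)
    show "AE x in lborel. (\<lambda>i. (cmod (p i x - f x))\<^sup>2) \<longlonglongrightarrow> 0"
    proof (rule AE_I2, rule tendsto_eventually)
      fix x :: "real ^ 'n"
      obtain N :: nat where N: "norm x \<le> N" using real_arch_simple by blast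
      show "\<forall>\<^sub>F i in sequentially. (cmod (p i x - f x))\<^sup>2 = 0"
        using eventually_ge_at_top[of N] by eventually_elim (use N in \<open>auto simp: p_def indicator_def\<close>)
    qed
    show "AE x in lborel. norm ((cmod (p i x - f x))\<^sup>2) \<le> (cmod (f x))\<^sup>2" for i
      by (auto simp: p_def indicator_def)
    show "(\<lambda>x. (cmod (p i x - f x))\<^sup>2) \<in> borel_measurable lborel" for i using pm[of i] by measurable
  qed simp
  then have pf: "(\<lambda>n. L2_norm lborel (\<lambda>x. p n x - f x)) \<longlonglongrightarrow> 0"
    unfolding L2_norm_def using tendsto_real_sqrt by force
  have "\<exists>g. g \<in> L2 lborel \<and> (\<lambda>n. L2_norm lborel (\<lambda>x. fourier_integral (p n) x - g x)) \<longlonglongrightarrow> 0"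
  proof (rule L2_complete)
    show "fourier_integral (p n) \<in> L2 lborel" for n by (rule fourier_integral_contraction(2)[OF pi pL])
    fix e :: real assume e: "e > 0"
    have "\<forall>\<^sub>F n in sequentially. L2_norm lborel (\<lambda>x. p n x - f x) < e / 2"
      using e by (intro order_tendstoD(2)[OF pf]) simp
    then obtain N where N: "\<And>n. n \<ge> N \<Longrightarrow> L2_norm lborel (\<lambda>x. p n x - f x) < e / 2"
      by (auto simp: eventually_sequentially)
    have "L2_norm lborel (\<lambda>x. fourier_integral (p m) x - fourier_integral (p n) x) < e" if "m \<ge> N" "n \<ge> N" for m n
    proof -
      have "L2_norm lborel (\<lambda>x. fourier_integral (p m) x - fourier_integral (p n) x) = L2_norm lborel (\<lambda>x. p m x - p n x)"
        using plancherel[of "\<lambda>x. p m x - p n x"] pi pL by (simp add: fourier_integral_diff' L2_diff)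
      also have "\<dots> \<le> L2_norm lborel (\<lambda>x. p m x - f x) + L2_norm lborel (\<lambda>x. f x - p n x)"
        by (intro L2_norm_triangle3 pL f)
      also have "\<dots> < e" using N[OF that(1)] N[OF that(2)] L2_norm_minus_commute[of lborel f "p n"] by linarith
      finally show ?thesis .
    qed
    then show "\<exists>N. \<forall>m\<ge>N. \<forall>n\<ge>N. L2_norm lborel (\<lambda>x. fourier_integral (p m) x - fourier_integral (p n) x) < e" by blast
  qed
  then obtain g where "g \<in> L2 lborel" "(\<lambda>n. L2_norm lborel (\<lambda>x. fourier_integral (p n) x - g x)) \<longlonglongrightarrow> 0" by blast
  then show ?thesis using fourierI[OF f _ pi pL pf] by blast
qed

lemma L2_isometry_fourier: "L2_isometry lborel lborel (fourier :: (real ^ 'n) operator)"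
  unfolding L2_isometry_def
proof (intro conjI allI impI ballI)
  show "(fourier :: (real ^ 'n) operator) \<subseteq> L2 lborel \<times> L2 lborel"
    by (auto simp: fourier_def L2_tendsto_def)
  show "\<exists>g. (f, g) \<in> fourier" if "f \<in> L2 lborel" for f :: "real ^ 'n \<Rightarrow> complex" by (rule fourier_total[OF that])
  show "(\<lambda>x. f x + c * f' x, \<lambda>x. g x + c * g' x) \<in> fourier"
    if "(f, g) \<in> fourier" "(f', g') \<in> fourier" for f g f' g' :: "real ^ 'n \<Rightarrow> complex" and c
    by (rule fourier_linear[OF that])
  fix f g :: "real ^ 'n \<Rightarrow> complex"
  assume fg: "(f, g) \<in> fourier"
  from fourierE[OF fg] obtain p where p: "f \<in> L2 lborel" "g \<in> L2 lborel" "\<And>n. integrable lborel (p n)" "\<And>n. p n \<in> L2 lborel"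
    "(\<lambda>n. L2_norm lborel (\<lambda>x. p n x - f x)) \<longlonglongrightarrow> 0"
    "(\<lambda>n. L2_norm lborel (\<lambda>x. fourier_integral (p n) x - g x)) \<longlonglongrightarrow> 0" by blast
  have "(\<lambda>n. L2_norm lborel (fourier_integral (p n))) \<longlonglongrightarrow> L2_norm lborel g"
    using p by (intro tendsto_L2_norm fourier_integral_contraction(2))
  moreover have "(\<lambda>n. L2_norm lborel (fourier_integral (p n))) \<longlonglongrightarrow> L2_norm lborel f"
    unfolding plancherel[OF p(3,4)] using p by (intro tendsto_L2_norm)
  ultimately show "L2_norm lborel g = L2_norm lborel f" by (rule LIMSEQ_unique)
  fix g' :: "real ^ 'n \<Rightarrow> complex"
  assume g': "g' \<in> borel_measurable lborel" "AE x in lborel. g' x = g x"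
  have gL: "g' \<in> L2 lborel" by (rule L2_cong_AE[OF p(2) g'])
  have "L2_norm lborel (\<lambda>x. fourier_integral (p n) x - g' x) = L2_norm lborel (\<lambda>x. fourier_integral (p n) x - g x)" for n
    using g'(2) by (intro L2_norm_cong_L2 L2_diff fourier_integral_contraction(2)[OF p(3,4)] gL p) auto
  then show "(f, g') \<in> fourier" using fourierI[OF p(1) gL p(3,4,5)] p(6) by simp
qed

lemma fourier_integral_swap:
  fixes f g :: "real ^ 'n \<Rightarrow> complex"
  assumes f: "integrable lborel f" and g: "integrable lborel g"
  shows "(\<integral>x. fourier_integral f x * g x \<partial>lborel) = (\<integral>x. f x * fourier_integral g x \<partial>lborel)"
proof -
  define C where "C = complex_of_real ((2 * pi) powr (- real CARD('n) / 2))"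
  let ?k = "\<lambda>(x, y). cis (- (x \<bullet> y)) * f x * g y"
  have [measurable]: "f \<in> borel_measurable lborel" "g \<in> borel_measurable lborel" using f g by auto
  have int: "integrable (lborel \<Otimes>\<^sub>M lborel) ?k"
  proof (rule Bochner_Integration.integrable_bound)
    show "integrable (lborel \<Otimes>\<^sub>M lborel) (\<lambda>(x, y). f x * g y)"
      by (rule lborel_pair.Fubini_integrable) (use f g in \<open>auto simp: norm_mult\<close>)
    show "?k \<in> borel_measurable (lborel \<Otimes>\<^sub>M lborel)" by measurable
  qed (auto simp: norm_mult split: prod.splits)
  have 1: "fourier_integral f y * g y = C * (\<integral>x. ?k (x, y) \<partial>lborel)" for y
  proof -
    have "(\<integral>x. ?k (x, y) \<partial>lborel) = (\<integral>x. cis (- (x \<bullet> y)) * f x \<partial>lborel) * g y" by simp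
    then show ?thesis by (simp only: fourier_integral_def C_def mult.assoc)
  qed
  have 2: "f x * fourier_integral g x = C * (\<integral>y. ?k (x, y) \<partial>lborel)" for x
  proof -
    have "(\<integral>y. ?k (x, y) \<partial>lborel) = (\<integral>y. f x * (cis (- (y \<bullet> x)) * g y) \<partial>lborel)"
      by (intro Bochner_Integration.integral_cong) (auto simp: inner_commute mult_ac)
    also have "\<dots> = f x * (\<integral>y. cis (- (y \<bullet> x)) * g y \<partial>lborel)" by (rule integral_mult_right_zero)
    finally show ?thesis by (simp only: fourier_integral_def C_def mult_ac)
  qed
  have "(\<integral>y. (\<integral>x. ?k (x, y) \<partial>lborel) \<partial>lborel) = (\<integral>x. (\<integral>y. ?k (x, y) \<partial>lborel) \<partial>lborel)"
    using lborel_pair.Fubini_integral[of "\<lambda>x y. ?k (x, y)"] int by simp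
  then show ?thesis unfolding 1 2 integral_mult_right_zero by (simp only:)
qed

text \<open>The conjugate in the first factor turns the inner product into the bilinear pairing. For
  integrable functions the identity is Fubini with a symmetric kernel, and both sides are continuous
  in L2.\<close>

lemma fourier_swap:
  assumes "(f, f') \<in> fourier" "(g, g') \<in> fourier"
  shows "L2_inner lborel (\<lambda>x. cnj (f' x)) g = L2_inner lborel (\<lambda>x. cnj (f x)) g'"
proof -
  from fourierE[OF assms(1)] obtain p where p: "f \<in> L2 lborel" "f' \<in> L2 lborel" "\<And>n. integrable lborel (p n)" "\<And>n. p n \<in> L2 lborel"
    "(\<lambda>n. L2_norm lborel (\<lambda>x. p n x - f x)) \<longlonglongrightarrow> 0"
    "(\<lambda>n. L2_norm lborel (\<lambda>x. fourier_integral (p n) x - f' x)) \<longlonglongrightarrow> 0" by blast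
  from fourierE[OF assms(2)] obtain q where q: "g \<in> L2 lborel" "g' \<in> L2 lborel" "\<And>n. integrable lborel (q n)" "\<And>n. q n \<in> L2 lborel"
    "(\<lambda>n. L2_norm lborel (\<lambda>x. q n x - g x)) \<longlonglongrightarrow> 0"
    "(\<lambda>n. L2_norm lborel (\<lambda>x. fourier_integral (q n) x - g' x)) \<longlonglongrightarrow> 0" by blast
  have c: "(\<lambda>n. L2_norm lborel (\<lambda>x. cnj (a n x) - cnj (b x))) \<longlonglongrightarrow> 0"
    if "(\<lambda>n. L2_norm lborel (\<lambda>x. a n x - b x)) \<longlonglongrightarrow> 0" for a :: "nat \<Rightarrow> real ^ 'a \<Rightarrow> complex" and b
    using that by (simp flip: complex_cnj_diff)
  have "(\<lambda>n. L2_inner lborel (\<lambda>x. cnj (fourier_integral (p n) x)) (q n)) \<longlonglongrightarrow> L2_inner lborel (\<lambda>x. cnj (f' x)) g"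
    by (intro tendsto_L2_inner c p q L2_cnj fourier_integral_contraction(2))
  moreover have "(\<lambda>n. L2_inner lborel (\<lambda>x. cnj (p n x)) (fourier_integral (q n))) \<longlonglongrightarrow> L2_inner lborel (\<lambda>x. cnj (f x)) g'"
    by (intro tendsto_L2_inner c p q L2_cnj fourier_integral_contraction(2))
  moreover have "L2_inner lborel (\<lambda>x. cnj (fourier_integral (p n) x)) (q n) = L2_inner lborel (\<lambda>x. cnj (p n x)) (fourier_integral (q n))" for n
    using fourier_integral_swap[OF p(3) q(3)] by (simp add: L2_inner_def)
  ultimately show ?thesis by (simp add: LIMSEQ_unique)
qed

text \<open>By the symmetry \<open>\<integral> \<F>f \<cdot> g = \<integral> f \<cdot> \<F>g\<close> the adjoint of \<open>\<F>\<close> is \<open>g \<mapsto> cnj (\<F> (cnj g))\<close>,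
  hence isometric, and an isometry with isometric adjoint is onto.\<close>

lemma fourier_onto:
  assumes g: "g \<in> L2 lborel"
  shows "\<exists>f. (f, g) \<in> fourier"
proof -
  note iso = L2_isometry_fourier
  obtain k where k: "(\<lambda>x. cnj (g x), k) \<in> fourier" using fourier_total[OF L2_cnj[OF g]] by blast
  define f where "f x = cnj (k x)" for x
  have f: "f \<in> L2 lborel" unfolding f_def[abs_def] by (intro L2_cnj isometry_L2(2)[OF iso k])
  obtain f' where f': "(f, f') \<in> fourier" using fourier_total[OF f] by blast
  note f'L = isometry_L2(2)[OF iso f']
  have nf: "L2_norm lborel f = L2_norm lborel g"
    using isometry_norm[OF iso k] by (simp add: f_def[abs_def])
  have "L2_inner lborel g f' = L2_inner lborel f f"
    using fourier_swap[OF k f'] by (simp add: f_def[abs_def])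
  then have "Re (L2_inner lborel f' g) = (L2_norm lborel f)\<^sup>2"
    using arg_cong[OF L2_inner_cnj[of lborel f' g], of Re] by (simp add: L2_inner_self)
  \<comment> \<open>The squared norms of f' and g and the real part of their inner product all equal
    |g|^2, so the square expands to 0.\<close>
  then have "(L2_norm lborel (\<lambda>x. f' x - g x))\<^sup>2 = 0"
    using L2_norm_diff_sq[OF f'L g] isometry_norm[OF iso f'] nf by simp
  then have "AE x in lborel. f' x - g x = 0"
    using L2_norm_eq_0[OF L2_diff[OF f'L g]] by simp
  then have "AE x in lborel. g x = f' x" by eventually_elim simp
  then show ?thesis using isometry_AE[OF iso f'] g by (auto simp: L2_def)
qed

section \<open>The discrete Fourier transform is unitary\<close>

lemma L2_tendsto_norm:
  assumes "L2_tendsto M F u f"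
  shows "((\<lambda>i. L2_norm M (u i)) \<longlongrightarrow> L2_norm M f) F"
proof (rule LIM_zero_cancel, rule Lim_null_comparison)
  have ev: "\<forall>\<^sub>F i in F. u i \<in> L2 M" and f: "f \<in> L2 M" using assms by (auto simp: L2_tendsto_def)
  show "\<forall>\<^sub>F i in F. norm (L2_norm M (u i) - L2_norm M f) \<le> L2_norm M (\<lambda>x. u i x - f x)"
    using ev by eventually_elim (use L2_norm_reverse_triangle f in auto)
  show "((\<lambda>i. L2_norm M (\<lambda>x. u i x - f x)) \<longlongrightarrow> 0) F" using assms by (simp add: L2_tendsto_def)
qed

lemma L2_tendsto_linear:
  assumes u: "L2_tendsto M F u f" and v: "L2_tendsto M F v g"
  shows "L2_tendsto M F (\<lambda>i x. u i x + c * v i x) (\<lambda>x. f x + c * g x)"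
proof -
  have eu: "\<forall>\<^sub>F i in F. u i \<in> L2 M" and f: "f \<in> L2 M" and ev: "\<forall>\<^sub>F i in F. v i \<in> L2 M" and g: "g \<in> L2 M"
    and lu: "((\<lambda>i. L2_norm M (\<lambda>x. u i x - f x)) \<longlongrightarrow> 0) F"
    and lv: "((\<lambda>i. L2_norm M (\<lambda>x. v i x - g x)) \<longlongrightarrow> 0) F"
    using u v by (auto simp: L2_tendsto_def)
  have "\<forall>\<^sub>F i in F. (\<lambda>x. u i x + c * v i x) \<in> L2 M"
    using eu ev by eventually_elim (intro L2_add L2_scale)
  moreover have "((\<lambda>i. L2_norm M (\<lambda>x. u i x + c * v i x - (f x + c * g x))) \<longlongrightarrow> 0) F"
  proof (rule Lim_null_comparison)
    show "\<forall>\<^sub>F i in F. norm (L2_norm M (\<lambda>x. u i x + c * v i x - (f x + c * g x))) \<le>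
        L2_norm M (\<lambda>x. u i x - f x) + cmod c * L2_norm M (\<lambda>x. v i x - g x)"
      using eu ev
    proof eventually_elim
      case (elim i)
      have "(\<lambda>x. u i x + c * v i x - (f x + c * g x)) = (\<lambda>x. (u i x - f x) + c * (v i x - g x))"
        by (auto simp: algebra_simps)
      then show ?case
        using L2_norm_triangle[OF L2_diff[OF elim(1) f] L2_scale[OF L2_diff[OF elim(2) g], of c]] by simp
    qed
    show "((\<lambda>i. L2_norm M (\<lambda>x. u i x - f x) + cmod c * L2_norm M (\<lambda>x. v i x - g x)) \<longlongrightarrow> 0) F"
      using tendsto_add[OF lu tendsto_mult[OF tendsto_const lv], of "cmod c"] by simp
  qed
  ultimately show ?thesis unfolding L2_tendsto_def using f g by (intro conjI L2_add L2_scale) auto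
qed

locale orthogonal_system =
  fixes M :: "'a measure" and e :: "'k \<Rightarrow> 'a \<Rightarrow> complex" and w :: real
  assumes L2_e: "e n \<in> L2 M" and w_pos: "w > 0"
    and orth: "L2_inner M (e n) (e k) = complex_of_real (if n = k then w else 0)"
begin

lemma norm_finite_sum: "finite A \<Longrightarrow> (L2_norm M (\<lambda>x. \<Sum>n\<in>A. c n * e n x))\<^sup>2 = w * (\<Sum>n\<in>A. (cmod (c n))\<^sup>2)"
  by (rule L2_norm_orthogonal_sum) (auto simp: L2_e orth)

lemma L2_finite_sum: "(\<lambda>x. \<Sum>n\<in>A. c n * e n x) \<in> L2 M"
  by (intro L2_sum L2_scale L2_e)

lemma has_sum_norm:
  assumes s: "L2_has_sum M (\<lambda>n x. c n * e n x) s" and c: "(\<lambda>n. (cmod (c n))\<^sup>2) summable_on UNIV"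
  shows "(L2_norm M s)\<^sup>2 = w * (\<Sum>\<^sub>\<infinity>n. (cmod (c n))\<^sup>2)"
proof -
  have a: "((\<lambda>A. (L2_norm M (\<lambda>x. \<Sum>n\<in>A. c n * e n x))\<^sup>2) \<longlongrightarrow> (L2_norm M s)\<^sup>2) (finite_subsets_at_top UNIV)"
    using L2_tendsto_norm[OF s[unfolded L2_has_sum_def]] by (intro tendsto_power)
  have b: "((\<lambda>A. w * (\<Sum>n\<in>A. (cmod (c n))\<^sup>2)) \<longlongrightarrow> w * (\<Sum>\<^sub>\<infinity>n. (cmod (c n))\<^sup>2)) (finite_subsets_at_top UNIV)"
    using has_sum_infsum[OF c] unfolding has_sum_def by (intro tendsto_mult tendsto_const)
  have ev: "\<forall>\<^sub>F A in finite_subsets_at_top UNIV. (L2_norm M (\<lambda>x. \<Sum>n\<in>A. c n * e n x))\<^sup>2 = w * (\<Sum>n\<in>A. (cmod (c n))\<^sup>2)"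
    using norm_finite_sum by (auto simp: eventually_finite_subsets_at_top)
  show ?thesis
    by (rule tendsto_unique[OF finite_subsets_at_top_neq_bot Lim_transform_eventually[OF a ev] b])
qed

text \<open>The sums over finite sets form a Cauchy net, while \<open>L2_complete\<close> speaks of
  sequences. So finite sets F k are chosen whose enlargements change the sum by less than 1 / (k +
  1); the limit along them is the limit of the net.\<close>

lemma has_sum_exists:
  assumes c: "(\<lambda>n. (cmod (c n))\<^sup>2) summable_on UNIV"
  shows "\<exists>s. L2_has_sum M (\<lambda>n x. c n * e n x) s"
proof -
  let ?s = "\<lambda>A x. \<Sum>n\<in>A. c n * e n x"
  define S where "S = (\<Sum>\<^sub>\<infinity>n. (cmod (c n))\<^sup>2)"
  have lim: "((\<lambda>A. \<Sum>n\<in>A. (cmod (c n))\<^sup>2) \<longlongrightarrow> S) (finite_subsets_at_top UNIV)"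
    using has_sum_infsum[OF c] by (simp add: has_sum_def S_def)
  have ex: "\<exists>F. finite F \<and> (\<forall>A. finite A \<longrightarrow> F \<subseteq> A \<longrightarrow> L2_norm M (\<lambda>x. ?s A x - ?s F x) < r)" if r: "r > 0" for r
  proof -
    \<comment> \<open>Two partial energies within q of the total differ by less than 2 q, which
      makes the squared norm of the difference less than r^2.\<close>
    define q where "q = r\<^sup>2 / (2 * w)"
    have q: "q > 0" using r w_pos by (simp add: q_def)
    have "\<forall>\<^sub>F A in finite_subsets_at_top UNIV. dist (\<Sum>n\<in>A. (cmod (c n))\<^sup>2) S < q"
      using lim q by (rule tendstoD)
    then obtain F where F: "finite F" "\<And>A. finite A \<Longrightarrow> F \<subseteq> A \<Longrightarrow> dist (\<Sum>n\<in>A. (cmod (c n))\<^sup>2) S < q"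
      by (auto simp: eventually_finite_subsets_at_top)
    have "L2_norm M (\<lambda>x. ?s A x - ?s F x) < r" if A: "finite A" "F \<subseteq> A" for A
    proof -
      have "(\<lambda>x. ?s A x - ?s F x) = ?s (A - F)"
        using A F(1) by (auto simp: sum_diff)
      then have "(L2_norm M (\<lambda>x. ?s A x - ?s F x))\<^sup>2 = w * (\<Sum>n\<in>A - F. (cmod (c n))\<^sup>2)"
        using norm_finite_sum[of "A - F" c] A by simp
      also have "(\<Sum>n\<in>A - F. (cmod (c n))\<^sup>2) = (\<Sum>n\<in>A. (cmod (c n))\<^sup>2) - (\<Sum>n\<in>F. (cmod (c n))\<^sup>2)"
        using A F(1) by (simp add: sum_diff)
      also have "\<dots> < 2 * q"
        using F(2)[OF A] F(2)[OF F(1) order_refl] by (simp add: dist_real_def)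
      also have "w * (2 * q) = r\<^sup>2" using w_pos by (simp add: q_def)
      finally show ?thesis using r w_pos by (simp add: power2_less_imp_less)
    qed
    then show ?thesis using F(1) by blast
  qed
  have "\<exists>F. \<forall>k :: nat. finite (F k) \<and> (\<forall>A. finite A \<longrightarrow> F k \<subseteq> A \<longrightarrow> L2_norm M (\<lambda>x. ?s A x - ?s (F k) x) < 1 / (real k + 1))"
    by (rule choice) (rule allI, rule ex, simp)
  then obtain F where F: "\<And>k :: nat. finite (F k)"
    "\<And>k A. finite A \<Longrightarrow> F k \<subseteq> A \<Longrightarrow> L2_norm M (\<lambda>x. ?s A x - ?s (F k) x) < 1 / (real k + 1)"
    by blast
  have small: "\<exists>N. \<forall>k\<ge>N. 1 / (real k + 1) < r" if "r > 0" for r :: real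
  proof -
    have "(\<lambda>k. 1 / (real k + 1)) \<longlonglongrightarrow> 0"
      using LIMSEQ_inverse_real_of_nat by (simp add: inverse_eq_divide add.commute)
    from order_tendstoD(2)[OF this that] show ?thesis by (simp add: eventually_sequentially)
  qed
  have "\<exists>s. s \<in> L2 M \<and> (\<lambda>k. L2_norm M (\<lambda>x. ?s (F k) x - s x)) \<longlonglongrightarrow> 0"
  proof (rule L2_complete[OF L2_finite_sum])
    fix r :: real assume "r > 0"
    then obtain N where N: "\<And>k. k \<ge> N \<Longrightarrow> 1 / (real k + 1) < r / 2" using small[of "r / 2"] by auto
    have "L2_norm M (\<lambda>x. ?s (F m) x - ?s (F n) x) < r" if "m \<ge> N" "n \<ge> N" for m n
    proof -
      have "L2_norm M (\<lambda>x. ?s (F m) x - ?s (F n) x) \<le>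
          L2_norm M (\<lambda>x. ?s (F m) x - ?s (F m \<union> F n) x) + L2_norm M (\<lambda>x. ?s (F m \<union> F n) x - ?s (F n) x)"
        by (intro L2_norm_triangle3 L2_finite_sum)
      also have "L2_norm M (\<lambda>x. ?s (F m) x - ?s (F m \<union> F n) x) = L2_norm M (\<lambda>x. ?s (F m \<union> F n) x - ?s (F m) x)"
        by (rule L2_norm_minus_commute)
      also have "\<dots> < r / 2" using F(2)[of "F m \<union> F n" m] F(1) N[OF that(1)] by simp
      also have "L2_norm M (\<lambda>x. ?s (F m \<union> F n) x - ?s (F n) x) < r / 2"
        using F(2)[of "F m \<union> F n" n] F(1) N[OF that(2)] by simp
      finally show ?thesis by simp
    qed
    then show "\<exists>N. \<forall>m\<ge>N. \<forall>n\<ge>N. L2_norm M (\<lambda>x. ?s (F m) x - ?s (F n) x) < r" by blast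
  qed
  then obtain s where s: "s \<in> L2 M" "(\<lambda>k. L2_norm M (\<lambda>x. ?s (F k) x - s x)) \<longlonglongrightarrow> 0" by blast
  have "((\<lambda>A. L2_norm M (\<lambda>x. ?s A x - s x)) \<longlongrightarrow> 0) (finite_subsets_at_top UNIV)"
  proof (rule tendstoI)
    fix r :: real assume r: "r > 0"
    obtain N where N: "\<And>k. k \<ge> N \<Longrightarrow> 1 / (real k + 1) < r / 2" using small[of "r / 2"] r by auto
    have "\<forall>\<^sub>F k in sequentially. L2_norm M (\<lambda>x. ?s (F k) x - s x) < r / 2"
      using r by (intro order_tendstoD(2)[OF s(2)]) simp
    then obtain N' where N': "\<And>k. k \<ge> N' \<Longrightarrow> L2_norm M (\<lambda>x. ?s (F k) x - s x) < r / 2"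
      by (auto simp: eventually_sequentially)
    define k where "k = max N N'"
    have "dist (L2_norm M (\<lambda>x. ?s A x - s x)) 0 < r" if A: "finite A" "F k \<subseteq> A" for A
    proof -
      have "L2_norm M (\<lambda>x. ?s A x - s x) \<le> L2_norm M (\<lambda>x. ?s A x - ?s (F k) x) + L2_norm M (\<lambda>x. ?s (F k) x - s x)"
        by (intro L2_norm_triangle3 L2_finite_sum s)
      also have "\<dots> < r / 2 + r / 2"
        using F(2)[OF A] N[of k] N'[of k] by (intro add_strict_mono) (auto simp: k_def)
      finally show ?thesis by simp
    qed
    then show "\<forall>\<^sub>F A in finite_subsets_at_top UNIV. dist (L2_norm M (\<lambda>x. ?s A x - s x)) 0 < r"
      using F(1)[of k] by (auto simp: eventually_finite_subsets_at_top)
  qed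
  then have "L2_has_sum M (\<lambda>n x. c n * e n x) s"
    unfolding L2_has_sum_def L2_tendsto_def using s(1) L2_finite_sum by simp
  then show ?thesis by blast
qed

lemma inner_finite_sum:
  assumes "g \<in> L2 M"
  shows "L2_inner M (\<lambda>x. \<Sum>n\<in>A. c n * e n x) g = (\<Sum>n\<in>A. cnj (c n) * L2_inner M (e n) g)"
proof -
  have "L2_inner M g (\<lambda>x. \<Sum>n\<in>A. c n * e n x) = (\<Sum>n\<in>A. L2_inner M g (\<lambda>x. c n * e n x))"
    by (intro L2_inner_sum_right assms L2_scale L2_e)
  then have "cnj (L2_inner M g (\<lambda>x. \<Sum>n\<in>A. c n * e n x)) = cnj (\<Sum>n\<in>A. c n * L2_inner M g (e n))"
    by simp
  then show ?thesis by (simp only: L2_inner_cnj cnj_sum complex_cnj_mult)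
qed

text \<open>The c n are the expansion coefficients <e n, g> / w. The second claim is Pythagoras for
  the remainder of the projection; the first says that the squared norm of this remainder is
  non-negative.\<close>

lemma bessel:
  fixes c :: "'k \<Rightarrow> complex"
  assumes g: "g \<in> L2 M" and A: "finite A" and c: "\<And>n. L2_inner M (e n) g = complex_of_real w * c n"
  shows "w * (\<Sum>n\<in>A. (cmod (c n))\<^sup>2) \<le> (L2_norm M g)\<^sup>2"
    and "(L2_norm M (\<lambda>x. g x - (\<Sum>n\<in>A. c n * e n x)))\<^sup>2 = (L2_norm M g)\<^sup>2 - w * (\<Sum>n\<in>A. (cmod (c n))\<^sup>2)"
proof -
  have "Re (L2_inner M g (\<lambda>x. \<Sum>n\<in>A. c n * e n x)) = Re (L2_inner M (\<lambda>x. \<Sum>n\<in>A. c n * e n x) g)"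
    using arg_cong[OF L2_inner_cnj[of M g "\<lambda>x. \<Sum>n\<in>A. c n * e n x"], of Re] by simp
  also have "L2_inner M (\<lambda>x. \<Sum>n\<in>A. c n * e n x) g = (\<Sum>n\<in>A. complex_of_real (w * (cmod (c n))\<^sup>2))"
    unfolding inner_finite_sum[OF g] c
    by (intro sum.cong refl) (simp add: complex_norm_square mult_ac del: of_real_power)
  also have "Re \<dots> = w * (\<Sum>n\<in>A. (cmod (c n))\<^sup>2)" by (simp add: sum_distrib_left del: of_real_mult of_real_power)
  finally have "Re (L2_inner M g (\<lambda>x. \<Sum>n\<in>A. c n * e n x)) = w * (\<Sum>n\<in>A. (cmod (c n))\<^sup>2)" .
  then show eq: "(L2_norm M (\<lambda>x. g x - (\<Sum>n\<in>A. c n * e n x)))\<^sup>2 = (L2_norm M g)\<^sup>2 - w * (\<Sum>n\<in>A. (cmod (c n))\<^sup>2)"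
    using L2_norm_diff_sq[OF g L2_finite_sum[of c A]] norm_finite_sum[OF A, of c] by simp
  have "0 \<le> (L2_norm M (\<lambda>x. g x - (\<Sum>n\<in>A. c n * e n x)))\<^sup>2" by simp
  then show "w * (\<Sum>n\<in>A. (cmod (c n))\<^sup>2) \<le> (L2_norm M g)\<^sup>2" unfolding eq by simp
qed

text \<open>By \<open>bessel\<close> the squared remainder is |g|^2 minus the partial energy, and
  this tends to 0 under \<open>eq\<close>.\<close>

lemma parseval_has_sum:
  fixes c :: "'k \<Rightarrow> complex"
  assumes g: "g \<in> L2 M" and c: "\<And>n. L2_inner M (e n) g = complex_of_real w * c n"
    and s: "(\<lambda>n. (cmod (c n))\<^sup>2) summable_on UNIV" and eq: "w * (\<Sum>\<^sub>\<infinity>n. (cmod (c n))\<^sup>2) = (L2_norm M g)\<^sup>2"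
  shows "L2_has_sum M (\<lambda>n x. c n * e n x) g"
proof -
  have "((\<lambda>A. (L2_norm M g)\<^sup>2 - w * (\<Sum>n\<in>A. (cmod (c n))\<^sup>2)) \<longlongrightarrow> (L2_norm M g)\<^sup>2 - w * (\<Sum>\<^sub>\<infinity>n. (cmod (c n))\<^sup>2)) (finite_subsets_at_top UNIV)"
    using has_sum_infsum[OF s] unfolding has_sum_def by (intro tendsto_intros)
  then have "((\<lambda>A. sqrt ((L2_norm M g)\<^sup>2 - w * (\<Sum>n\<in>A. (cmod (c n))\<^sup>2))) \<longlongrightarrow> sqrt 0) (finite_subsets_at_top UNIV)"
    unfolding eq by (intro tendsto_real_sqrt) simp
  moreover have "\<forall>\<^sub>F A in finite_subsets_at_top UNIV. sqrt ((L2_norm M g)\<^sup>2 - w * (\<Sum>n\<in>A. (cmod (c n))\<^sup>2)) = L2_norm M (\<lambda>x. (\<Sum>n\<in>A. c n * e n x) - g x)"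
    unfolding eventually_finite_subsets_at_top
  proof (intro exI[of _ "{}"] conjI allI impI)
    fix A :: "'k set" assume "finite A \<and> {} \<subseteq> A \<and> A \<subseteq> UNIV"
    then have A: "finite A" by simp
    show "sqrt ((L2_norm M g)\<^sup>2 - w * (\<Sum>n\<in>A. (cmod (c n))\<^sup>2)) = L2_norm M (\<lambda>x. (\<Sum>n\<in>A. c n * e n x) - g x)"
      unfolding bessel(2)[OF g A c, symmetric] by (simp add: L2_norm_minus_commute[of M g])
  qed auto
  ultimately have "((\<lambda>A. L2_norm M (\<lambda>x. (\<Sum>n\<in>A. c n * e n x) - g x)) \<longlongrightarrow> sqrt 0) (finite_subsets_at_top UNIV)"
    by (rule Lim_transform_eventually)
  then show ?thesis unfolding L2_has_sum_def L2_tendsto_def using g L2_finite_sum by simp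
qed

end

section \<open>The torus and the orthogonality of its exponentials\<close>

abbreviation torus :: "real \<Rightarrow> (real ^ 'n) set" where "torus h \<equiv> cube (pi / h)"

lemma sets_cube [measurable]: "cube r \<in> sets borel" "cube r \<inter> space lborel \<in> sets lborel"
  by (simp_all add: cube_def)

lemma mem_cube: "x \<in> cube r \<longleftrightarrow> (\<forall>i. \<bar>x $ i\<bar> \<le> r)"
  by (auto simp: cube_def mem_box_cart abs_le_iff minus_le_iff)

lemma L2_indicator_cube: "(indicator (cube r) :: real ^ 'n \<Rightarrow> complex) \<in> L2 lborel"
proof -
  have "bounded (cube r :: (real ^ 'n) set)" by (simp add: cube_def)
  from step_approximable_indicator[OF sets_cube(1) this] show ?thesis
    unfolding step_approximable_def by blast
qed

lemma measurable_torus: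
  "g \<in> borel_measurable (torus_measure h) \<longleftrightarrow> (\<lambda>\<xi>. indicator (torus h) \<xi> * g \<xi>) \<in> borel_measurable lborel"
  for g :: "_ \<Rightarrow> complex"
proof -
  have "(\<lambda>\<xi>. indicator (torus h) \<xi> *\<^sub>R g \<xi>) = (\<lambda>\<xi>. indicator (torus h) \<xi> * g \<xi>)"
    by (auto simp: indicator_def)
  then show ?thesis
    unfolding torus_measure_def by (subst borel_measurable_restrict_space_iff) (simp_all add: sets_cube)
qed

text \<open>Functions on the torus are handled through their extension by zero, so that both
  frequency spaces are treated inside L2 of \<open>lborel\<close>.\<close>

lemma L2_torus:
  "g \<in> L2 (torus_measure h) \<longleftrightarrow> (\<lambda>\<xi>. indicator (torus h) \<xi> * g \<xi>) \<in> L2 lborel"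
  "L2_norm (torus_measure h) g = L2_norm lborel (\<lambda>\<xi>. indicator (torus h) \<xi> * g \<xi>)"
proof -
  have eq: "indicator (torus h) \<xi> *\<^sub>R (cmod (g \<xi>))\<^sup>2 = (cmod (indicator (torus h) \<xi> * g \<xi>))\<^sup>2" for \<xi>
    by (auto simp: indicator_def)
  have "integrable (torus_measure h) (\<lambda>\<xi>. (cmod (g \<xi>))\<^sup>2) \<longleftrightarrow> integrable lborel (\<lambda>\<xi>. (cmod (indicator (torus h) \<xi> * g \<xi>))\<^sup>2)"
    unfolding torus_measure_def by (subst integrable_restrict_space) (simp_all only: sets_cube eq)
  then show "g \<in> L2 (torus_measure h) \<longleftrightarrow> (\<lambda>\<xi>. indicator (torus h) \<xi> * g \<xi>) \<in> L2 lborel"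
    by (simp only: L2_def mem_Collect_eq measurable_torus)
  show "L2_norm (torus_measure h) g = L2_norm lborel (\<lambda>\<xi>. indicator (torus h) \<xi> * g \<xi>)"
    unfolding L2_norm_def torus_measure_def by (subst integral_restrict_space) (simp_all only: sets_cube eq)
qed

lemma L2_inner_torus:
  "L2_inner (torus_measure h) f g = L2_inner lborel (\<lambda>\<xi>. indicator (torus h) \<xi> * f \<xi>) (\<lambda>\<xi>. indicator (torus h) \<xi> * g \<xi>)"
proof -
  have eq: "indicator (torus h) \<xi> *\<^sub>R (cnj (f \<xi>) * g \<xi>) = cnj (indicator (torus h) \<xi> * f \<xi>) * (indicator (torus h) \<xi> * g \<xi>)" for \<xi>
    by (auto simp: indicator_def)
  show ?thesis
    unfolding L2_inner_def torus_measure_def by (subst integral_restrict_space) (simp_all only: sets_cube eq)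
qed

lemma AE_torus:
  "(AE \<xi> in torus_measure h. P \<xi>) \<longleftrightarrow> (AE \<xi> in lborel. \<xi> \<in> torus h \<longrightarrow> P \<xi>)"
  unfolding torus_measure_def by (rule AE_restrict_space_iff) (rule sets_cube)

lemma L2_restrict_torus: "g \<in> L2 lborel \<Longrightarrow> g \<in> L2 (torus_measure h)"
  unfolding L2_torus using sets_cube(1)
  by (rule_tac L2_bound[where K = 1 and f = g]) (auto simp: norm_mult indicator_def L2_def)

lemma integral_cis_torus:
  fixes m :: int and h :: real
  assumes h: "h > 0"
  shows "(\<integral>s. indicator {- (pi / h)..pi / h} s *\<^sub>R cis (h * (m * s)) \<partial>lborel) = complex_of_real (if m = 0 then 2 * pi / h else 0)"
proof -
  have p: "2 * pi / h > 0" using h by simp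
  have "(\<integral>s. indicator {0 - (2 * pi / h) / 2..0 + (2 * pi / h) / 2} s *\<^sub>R cis (- (s * (- (h * m)))) \<partial>lborel)
      = complex_of_real (2 * pi / h) * (complex_of_real (sinc ((2 * pi / h) / 2 * (- (h * m)))) * cis (- (0 * (- (h * m)))))"
    by (rule integral_cis_interval[OF p])
  moreover have "sinc ((2 * pi / h) / 2 * (- (h * m))) = (if m = 0 then 1 else 0)"
  proof -
    have "(2 * pi / h) / 2 * (- (h * m)) = - (pi * m)" using h by simp
    moreover have "sin (pi * real_of_int m) = 0" by (metis mult.commute sin_zero_iff_int2)
    ultimately show ?thesis by simp
  qed
  ultimately show ?thesis by (simp add: mult_ac)
qed

lemma orthogonal_dft_basis:
  assumes h: "h > 0"
  shows "orthogonal_system (torus_measure h) (dft_basis h :: int ^ 'n \<Rightarrow> _) (h ^ CARD('n))"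
proof
  show "h ^ CARD('n) > 0" using h by simp
  fix n k :: "int ^ 'n"
  have fin: "emeasure lborel (torus h :: (real ^ 'n) set) < \<infinity>"
    unfolding cube_def by (rule emeasure_lborel_cbox_finite)
  have ind: "(indicator (torus h) :: real ^ 'n \<Rightarrow> complex) \<in> L2 lborel"
    by (rule L2_indicator_cube)
  show "dft_basis h n \<in> L2 (torus_measure h)"
    unfolding L2_torus
    by (rule L2_bound[OF ind, where K = "h ^ CARD('n) / (2 * pi) powr (real CARD('n) / 2)"])
       (use sets_cube(1) h in \<open>auto simp: norm_mult norm_dft_basis mult.commute\<close>)
  let ?C = "complex_of_real ((h ^ CARD('n))\<^sup>2 / (2 * pi) ^ CARD('n))"
  let ?g = "\<lambda>i s. indicator {- (pi / h)..pi / h} s *\<^sub>R cis (h * (real_of_int (n $ i - k $ i) * s))"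
  have int: "integrable lborel (?g i)" for i
    by (rule borel_integrable_compact) (auto intro!: continuous_intros)
  have eq: "cnj (indicator (torus h) \<xi> * dft_basis h n \<xi>) * (indicator (torus h) \<xi> * dft_basis h k \<xi>) = ?C * (\<Prod>i\<in>UNIV. ?g i (\<xi> $ i))" for \<xi>
  proof -
    have i: "indicator (torus h) \<xi> = (\<Prod>i\<in>UNIV. complex_of_real (indicator {- (pi / h)..pi / h} (\<xi> $ i)))"
    proof (cases "\<xi> \<in> torus h")
      case True
      then show ?thesis by (auto simp: cube_def mem_box_cart intro!: prod.neutral[symmetric])
    next
      case False
      then obtain i where "\<xi> $ i \<notin> {- (pi / h)..pi / h}" by (auto simp: cube_def mem_box_cart)
      then have "(\<Prod>i\<in>UNIV. complex_of_real (indicator {- (pi / h)..pi / h} (\<xi> $ i))) = 0"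
        by (intro prod_zero) (auto simp: indicator_def intro!: exI[of _ i])
      then show ?thesis using False by simp
    qed
    have "cnj (indicator (torus h) \<xi> * dft_basis h n \<xi>) * (indicator (torus h) \<xi> * dft_basis h k \<xi>) =
        indicator (torus h) \<xi> * (cnj (dft_basis h n \<xi>) * dft_basis h k \<xi>)"
      by (simp add: indicator_def)
    also have "\<dots> = ?C * (\<Prod>i\<in>UNIV. ?g i (\<xi> $ i))"
      unfolding cnj_dft_basis_mult i scaleR_conv_of_real prod.distrib by (simp only: mult_ac)
    finally show ?thesis .
  qed
  have "L2_inner (torus_measure h) (dft_basis h n) (dft_basis h k) =
      ?C * (\<Prod>i\<in>UNIV. complex_of_real (if n $ i - k $ i = 0 then 2 * pi / h else 0))"
    unfolding L2_inner_torus unfolding L2_inner_def eq integral_mult_right_zero integral_prod_lborel_vec(2)[OF int] integral_cis_torus[OF h] ..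
  also have "\<dots> = complex_of_real (if n = k then h ^ CARD('n) else 0)"
  proof (cases "n = k")
    case True
    then show ?thesis using h by (simp add: power2_eq_square power_divide field_simps)
  next
    case False
    then obtain i where "n $ i \<noteq> k $ i" by (auto simp: vec_eq_iff)
    then have "(\<Prod>i\<in>UNIV. complex_of_real (if n $ i - k $ i = 0 then 2 * pi / h else 0)) = 0"
      by (intro prod_zero) auto
    then show ?thesis using False by (simp only: mult_zero_right if_False of_real_0)
  qed
  finally show "L2_inner (torus_measure h) (dft_basis h n) (dft_basis h k) = complex_of_real (if n = k then h ^ CARD('n) else 0)" .
qed

lemma discrete_fourier_iff:
  "(u, g) \<in> discrete_fourier h \<longleftrightarrow> u \<in> L2 (grid_measure h) \<and> L2_has_sum (torus_measure h) (\<lambda>n \<xi>. u n * dft_basis h n \<xi>) g"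
  unfolding discrete_fourier_def by (simp add: dft_basis_def mult_ac)

lemma L2_isometry_discrete_fourier:
  assumes h: "h > 0"
  shows "L2_isometry (grid_measure h) (torus_measure h) (discrete_fourier h :: ((int ^ 'n \<Rightarrow> complex) \<times> _) set)"
proof -
  interpret orthogonal_system "torus_measure h" "dft_basis h :: int ^ 'n \<Rightarrow> _" "h ^ CARD('n)"
    by (rule orthogonal_dft_basis[OF h])
  show ?thesis
    unfolding L2_isometry_def
  proof (intro conjI allI impI ballI)
    show "(discrete_fourier h :: ((int ^ 'n \<Rightarrow> complex) \<times> _) set) \<subseteq> L2 (grid_measure h) \<times> L2 (torus_measure h)"
      by (auto simp: discrete_fourier_iff L2_has_sum_def L2_tendsto_def)
    show "\<exists>g. (u, g) \<in> discrete_fourier h" if "u \<in> L2 (grid_measure h)" for u :: "int ^ 'n \<Rightarrow> complex"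
      using has_sum_exists[of u] L2_grid_measure(1)[OF h, of u] that by (auto simp: discrete_fourier_iff)
    fix u :: "int ^ 'n \<Rightarrow> complex" and g assume ug: "(u, g) \<in> discrete_fourier h"
    then have u: "u \<in> L2 (grid_measure h)" and s: "L2_has_sum (torus_measure h) (\<lambda>n \<xi>. u n * dft_basis h n \<xi>) g"
      by (auto simp: discrete_fourier_iff)
    have "(L2_norm (torus_measure h) g)\<^sup>2 = (L2_norm (grid_measure h) u)\<^sup>2"
      using has_sum_norm[OF s] u h by (simp add: L2_grid_measure[OF h] infsum_nonneg)
    then show "L2_norm (torus_measure h) g = L2_norm (grid_measure h) u" by simp
    show "(u, g') \<in> discrete_fourier h" if g': "g' \<in> borel_measurable (torus_measure h)" "AE x in torus_measure h. g' x = g x" for g'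
    proof -
      have gL: "g \<in> L2 (torus_measure h)" using s by (simp add: L2_has_sum_def L2_tendsto_def)
      have g'L: "g' \<in> L2 (torus_measure h)" by (rule L2_cong_AE[OF gL g'])
      have "L2_norm (torus_measure h) (\<lambda>x. (\<Sum>n\<in>A. u n * dft_basis h n x) - g' x) =
          L2_norm (torus_measure h) (\<lambda>x. (\<Sum>n\<in>A. u n * dft_basis h n x) - g x)" for A
        using g'(2) by (intro L2_norm_cong_L2 L2_diff L2_finite_sum gL g'L) auto
      then show ?thesis using s u g'L by (simp add: discrete_fourier_iff L2_has_sum_def L2_tendsto_def)
    qed
    fix v :: "int ^ 'n \<Rightarrow> complex" and k c assume "(v, k) \<in> discrete_fourier h"
    then have v: "v \<in> L2 (grid_measure h)" and t: "L2_has_sum (torus_measure h) (\<lambda>n \<xi>. v n * dft_basis h n \<xi>) k"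
      by (auto simp: discrete_fourier_iff)
    have "L2_has_sum (torus_measure h) (\<lambda>n \<xi>. (u n + c * v n) * dft_basis h n \<xi>) (\<lambda>x. g x + c * k x)"
      using L2_tendsto_linear[OF s[unfolded L2_has_sum_def] t[unfolded L2_has_sum_def], of c]
      by (simp add: L2_has_sum_def sum_distrib_left sum.distrib[symmetric] algebra_simps)
    then show "(\<lambda>x. u x + c * v x, \<lambda>x. g x + c * k x) \<in> discrete_fourier h"
      using u v by (simp add: discrete_fourier_iff L2_add L2_scale)
  qed
qed

text \<open>Preimages of a convergent sequence form a Cauchy sequence, and the image of their limit
  agrees with g almost everywhere. It serves to pass from modulated functions to the function
  itself.\<close>

lemma isometry_range_closed:
  assumes J: "L2_isometry M N J" and uJ: "\<And>k :: nat. (u k, p k) \<in> J"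
    and g: "g \<in> L2 N" and lim: "(\<lambda>k. L2_norm N (\<lambda>x. p k x - g x)) \<longlonglongrightarrow> 0"
  shows "\<exists>f. (f, g) \<in> J"
proof -
  note uL = isometry_L2[OF J uJ]
  have "\<exists>f. f \<in> L2 M \<and> (\<lambda>k. L2_norm M (\<lambda>x. u k x - f x)) \<longlonglongrightarrow> 0"
  proof (rule L2_complete[OF uL(1)])
    fix e :: real assume e: "e > 0"
    have "\<forall>\<^sub>F n in sequentially. L2_norm N (\<lambda>x. p n x - g x) < e / 2"
      using e by (intro order_tendstoD(2)[OF lim]) simp
    then obtain K where K: "\<And>n. n \<ge> K \<Longrightarrow> L2_norm N (\<lambda>x. p n x - g x) < e / 2"
      by (auto simp: eventually_sequentially)
    have "L2_norm M (\<lambda>x. u m x - u n x) < e" if "m \<ge> K" "n \<ge> K" for m n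
    proof -
      have "L2_norm M (\<lambda>x. u m x - u n x) = L2_norm N (\<lambda>x. p m x - p n x)"
        by (rule isometry_norm[OF J isometry_diff[OF J uJ uJ], symmetric])
      also have "\<dots> \<le> L2_norm N (\<lambda>x. p m x - g x) + L2_norm N (\<lambda>x. g x - p n x)"
        by (intro L2_norm_triangle3 uL g)
      also have "\<dots> < e" using K[OF that(1)] K[OF that(2)] L2_norm_minus_commute[of N g "p n"] by linarith
      finally show ?thesis .
    qed
    then show "\<exists>N. \<forall>m\<ge>N. \<forall>n\<ge>N. L2_norm M (\<lambda>x. u m x - u n x) < e" by blast
  qed
  then obtain f where f: "f \<in> L2 M" "(\<lambda>k. L2_norm M (\<lambda>x. u k x - f x)) \<longlonglongrightarrow> 0" by blast
  obtain g' where g': "(f, g') \<in> J" using isometry_total[OF J f(1)] by blast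
  note g'L = isometry_L2(2)[OF J g']
  have "L2_norm N (\<lambda>x. g x - g' x) \<le> L2_norm N (\<lambda>x. p k x - g x) + L2_norm M (\<lambda>x. u k x - f x)" for k
    using L2_norm_triangle3[OF g uL(2)[of k] g'L] L2_norm_minus_commute[of N g "p k"]
      isometry_norm[OF J isometry_diff[OF J uJ[of k] g']] by simp
  then have "L2_norm N (\<lambda>x. g x - g' x) \<le> 0 + 0"
    using tendsto_add[OF lim f(2)] by (intro LIMSEQ_le_const[where X = "\<lambda>k. L2_norm N (\<lambda>x. p k x - g x) + L2_norm M (\<lambda>x. u k x - f x)"]) auto
  then have "L2_norm N (\<lambda>x. g x - g' x) = 0" by (simp add: antisym)
  then have "AE x in N. g x - g' x = 0" using L2_norm_eq_0[OF L2_diff[OF g g'L]] by simp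
  then have "AE x in N. g x = g' x" by eventually_elim simp
  then show ?thesis using isometry_AE[OF J g'] g by (auto simp: L2_def)
qed

lemma cmod_cis_minus_one_le: "cmod (cis t - 1) \<le> \<bar>t\<bar>"
proof (rule power2_le_imp_le)
  have "(cmod (cis t - 1))\<^sup>2 = (cos t - 1)\<^sup>2 + (sin t)\<^sup>2" by (simp add: cmod_power2)
  also have "\<dots> = 2 - 2 * cos t"
    using sin_cos_squared_add[of t] by (simp add: power2_diff)
  also have "\<dots> = 4 * (sin (t / 2))\<^sup>2" using cos_double_sin[of "t / 2"] by simp
  also have "\<dots> \<le> 4 * (\<bar>t / 2\<bar>)\<^sup>2"
    by (simp only: power2_abs[of "sin (t / 2)", symmetric]) (intro mult_left_mono power_mono abs_sin_x_le_abs_x, auto)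
  finally show "(cmod (cis t - 1))\<^sup>2 \<le> \<bar>t\<bar>\<^sup>2" by (simp add: power_divide)
qed simp

section \<open>Surjectivity of the discrete Fourier transform\<close>

lemma borel_measurable_nn_integral_count_space:
  fixes f :: "'i \<Rightarrow> 'a \<Rightarrow> ennreal"
  assumes I: "countable I" and f: "\<And>i. f i \<in> borel_measurable M"
  shows "(\<lambda>x. \<integral>\<^sup>+i. f i x \<partial>count_space I) \<in> borel_measurable M"
proof (cases "finite I")
  case True
  then show ?thesis using f by (simp add: nn_integral_count_space_finite)
next
  case False
  note bij = bij_betw_from_nat_into[OF I False]
  have "(\<integral>\<^sup>+i. f i x \<partial>count_space I) = (\<Sum>n. f (from_nat_into I n) x)" for x
    by (simp add: nn_integral_bij_count_space[symmetric, OF bij] nn_integral_count_space_nat)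
  then show ?thesis using f by simp
qed

lemma nn_integral_translate_lborel:
  fixes f :: "'a::euclidean_space \<Rightarrow> ennreal"
  assumes [measurable]: "f \<in> borel_measurable borel"
  shows "(\<integral>\<^sup>+x. f (c + x) \<partial>lborel) = (\<integral>\<^sup>+x. f x \<partial>lborel)"
  by (subst (2) lborel_distr_plus[of c, symmetric]) (simp add: nn_integral_distr)

text \<open>Each point lies in exactly one cell; translating every cell to the one at 0 turns the
  integral into that of the periodization over a fundamental domain.\<close>

lemma nn_integral_grid_tiling:
  fixes f :: "real ^ 'n \<Rightarrow> ennreal" and h :: real
  assumes h: "h > 0" and [measurable]: "f \<in> borel_measurable borel"
  shows "(\<integral>\<^sup>+x. f x \<partial>lborel) =
    (\<integral>\<^sup>+y. (\<integral>\<^sup>+n. f (y - h *\<^sub>R vec_of_int n) \<partial>count_space UNIV) * indicator (grid_cell h 0) y \<partial>lborel)"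
proof -
  have cell: "grid_index h (y - h *\<^sub>R vec_of_int n) = - n \<longleftrightarrow> y \<in> grid_cell h 0" for y and n :: "int ^ 'n"
    using h by (simp add: grid_cell_def grid_index_eq_iff vec_of_int_def)
  have [measurable]: "grid_cell h n \<in> sets borel" for n :: "int ^ 'n" by (rule sets_grid_cell[OF h])
  have "(\<integral>\<^sup>+x. f x \<partial>lborel) = (\<integral>\<^sup>+x. (\<integral>\<^sup>+n. f x * indicator (grid_cell h (- n)) x \<partial>count_space UNIV) \<partial>lborel)"
  proof (rule nn_integral_cong)
    fix x :: "real ^ 'n"
    have "(\<integral>\<^sup>+n. f x * indicator (grid_cell h (- n)) x \<partial>count_space UNIV) =
        (\<integral>\<^sup>+n. f x * indicator {- grid_index h x} n \<partial>count_space UNIV)"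
      by (intro nn_integral_cong) (auto simp: grid_cell_def indicator_def)
    then show "f x = (\<integral>\<^sup>+n. f x * indicator (grid_cell h (- n)) x \<partial>count_space UNIV)"
      by (simp add: nn_integral_cmult_indicator)
  qed
  also have "\<dots> = (\<integral>\<^sup>+n. (\<integral>\<^sup>+x. f x * indicator (grid_cell h (- n)) x \<partial>lborel) \<partial>count_space UNIV)"
    by (intro nn_integral_count_space_nn_integral countable_int_vec) measurable
  also have "\<dots> = (\<integral>\<^sup>+n. (\<integral>\<^sup>+y. f (y - h *\<^sub>R vec_of_int n) * indicator (grid_cell h 0) y \<partial>lborel) \<partial>count_space UNIV)"
  proof (rule nn_integral_cong)
    fix n :: "int ^ 'n"
    have "(\<integral>\<^sup>+x. f x * indicator (grid_cell h (- n)) x \<partial>lborel) =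
      (\<integral>\<^sup>+y. f (- (h *\<^sub>R vec_of_int n) + y) * indicator (grid_cell h (- n)) (- (h *\<^sub>R vec_of_int n) + y) \<partial>lborel)"
      by (rule nn_integral_translate_lborel[symmetric]) measurable
    also have "\<dots> = (\<integral>\<^sup>+y. f (y - h *\<^sub>R vec_of_int n) * indicator (grid_cell h 0) y \<partial>lborel)"
    proof (rule nn_integral_cong)
      fix y
      have "indicator (grid_cell h (- n)) (y - h *\<^sub>R vec_of_int n) = (indicator (grid_cell h 0) y :: ennreal)"
        using cell[of y n] by (simp add: indicator_def grid_cell_def)
      then show "f (- (h *\<^sub>R vec_of_int n) + y) * indicator (grid_cell h (- n)) (- (h *\<^sub>R vec_of_int n) + y) =
          f (y - h *\<^sub>R vec_of_int n) * indicator (grid_cell h 0) y" by (simp add: add.commute)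
    qed
    finally show "(\<integral>\<^sup>+x. f x * indicator (grid_cell h (- n)) x \<partial>lborel) =
        (\<integral>\<^sup>+y. f (y - h *\<^sub>R vec_of_int n) * indicator (grid_cell h 0) y \<partial>lborel)" .
  qed
  also have "\<dots> = (\<integral>\<^sup>+y. (\<integral>\<^sup>+n. f (y - h *\<^sub>R vec_of_int n) * indicator (grid_cell h 0) y \<partial>count_space UNIV) \<partial>lborel)"
    by (intro nn_integral_count_space_nn_integral[symmetric] countable_int_vec) measurable
  also have "\<dots> = (\<integral>\<^sup>+y. (\<integral>\<^sup>+n. f (y - h *\<^sub>R vec_of_int n) \<partial>count_space UNIV) * indicator (grid_cell h 0) y \<partial>lborel)"
    by (intro nn_integral_cong nn_integral_multc) simp
  finally show ?thesis .
qed

text \<open>By Plancherel on \<open>\<real>\<^sup>d\<close>, the energies of the samples of the transform of \<open>g\<close> on the translates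
  of the grid average to \<open>\<parallel>g\<parallel>\<^sup>2\<close>; each is at most \<open>\<parallel>g\<parallel>\<^sup>2\<close> by Bessel, so Parseval holds for
  almost every translate, that is, for almost every modulation of \<open>g\<close>.\<close>

lemma parseval_almost_every_modulation:
  fixes g :: "real ^ 'n \<Rightarrow> complex"
  assumes h: "h > 0" and g: "g \<in> L2 (torus_measure h)"
  shows "AE y in lborel. y \<in> grid_cell h 0 \<longrightarrow> (\<exists>u. (u, \<lambda>\<xi>. cis (- (y \<bullet> \<xi>)) * g \<xi>) \<in> discrete_fourier h)"
proof -
  interpret orthogonal_system "torus_measure h" "dft_basis h :: int ^ 'n \<Rightarrow> _" "h ^ CARD('n)"
    by (rule orthogonal_dft_basis[OF h])
  define g0 where "g0 \<xi> = indicator (torus h) \<xi> * g \<xi>" for \<xi>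
  have g0: "g0 \<in> L2 lborel" using g by (simp add: L2_torus g0_def[abs_def])
  have g0i: "integrable lborel g0"
  proof -
    have "integrable lborel (\<lambda>\<xi>. indicator (torus h) \<xi> * g0 \<xi>)"
      by (rule integrable_L2_mult[OF L2_indicator_cube g0])
    moreover have "(\<lambda>\<xi>. indicator (torus h) \<xi> * g0 \<xi>) = g0" by (auto simp: g0_def indicator_def)
    ultimately show ?thesis by simp
  qed
  define f where "f = fourier_integral g0"
  have fL: "f \<in> L2 lborel" unfolding f_def by (rule fourier_integral_contraction(2)[OF g0i g0])
  have [measurable]: "f \<in> borel_measurable borel" using fL by (simp add: L2_def)
  have fn: "L2_norm lborel f = L2_norm (torus_measure h) g"
    unfolding f_def plancherel[OF g0i g0] by (simp add: L2_torus g0_def[abs_def])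
  define gm where "gm y = (\<lambda>\<xi>. cis (- (y \<bullet> \<xi>)) * g \<xi>)" for y :: "real ^ 'n"
  define u where "u y n = f (y - h *\<^sub>R vec_of_int n)" for y and n :: "int ^ 'n"
  have gmL: "gm y \<in> L2 (torus_measure h)" for y
  proof -
    have "(\<lambda>\<xi>. indicator (torus h) \<xi> * gm y \<xi>) = (\<lambda>\<xi>. cis (- (y \<bullet> \<xi>)) * g0 \<xi>)"
      by (auto simp: gm_def g0_def)
    moreover have "(\<lambda>\<xi>. cis (- (y \<bullet> \<xi>)) * g0 \<xi>) \<in> L2 lborel"
    proof (rule L2_bound[OF g0, where K = 1])
      show "(\<lambda>\<xi>. cis (- (y \<bullet> \<xi>)) * g0 \<xi>) \<in> borel_measurable lborel"
        using L2_D(1)[OF g0] by measurable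
    qed (simp add: norm_mult)
    ultimately show ?thesis by (simp add: L2_torus)
  qed
  have gmn: "L2_norm (torus_measure h) (gm y) = L2_norm (torus_measure h) g" for y
    by (simp add: L2_norm_def gm_def norm_mult)
  \<comment> \<open>Modulating g translates its Fourier transform, so the coefficients of
    \<open>gm y\<close> are the samples of f on the grid translated by y (and reflected).\<close>
  have coef: "L2_inner (torus_measure h) (dft_basis h n) (gm y) = complex_of_real (h ^ CARD('n)) * u y n" for n y
  proof -
    let ?C = "complex_of_real (h ^ CARD('n) / (2 * pi) powr (real CARD('n) / 2))"
    have "L2_inner (torus_measure h) (dft_basis h n) (gm y) = (\<integral>\<xi>. ?C * (cis (- (\<xi> \<bullet> (y - h *\<^sub>R vec_of_int n))) * g0 \<xi>) \<partial>lborel)"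
      unfolding L2_inner_torus unfolding L2_inner_def
    proof (intro Bochner_Integration.integral_cong refl)
      fix \<xi> :: "real ^ 'n"
      have "cis (- (\<xi> \<bullet> (y - h *\<^sub>R vec_of_int n))) = cis (h * (vec_of_int n \<bullet> \<xi>)) * cis (- (y \<bullet> \<xi>))"
        by (simp add: cis_mult inner_diff_right inner_commute)
      then show "cnj (indicator (torus h) \<xi> * dft_basis h n \<xi>) * (indicator (torus h) \<xi> * gm y \<xi>) =
          ?C * (cis (- (\<xi> \<bullet> (y - h *\<^sub>R vec_of_int n))) * g0 \<xi>)"
        by (simp add: dft_basis_def gm_def g0_def cis_cnj indicator_def)
    qed
    also have "\<dots> = ?C * (\<integral>\<xi>. cis (- (\<xi> \<bullet> (y - h *\<^sub>R vec_of_int n))) * g0 \<xi> \<partial>lborel)"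
      by (rule integral_mult_right_zero)
    also have "?C = complex_of_real (h ^ CARD('n)) * complex_of_real ((2 * pi) powr (- real CARD('n) / 2))"
      unfolding of_real_mult[symmetric] minus_divide_left[symmetric] powr_minus_divide by simp
    finally show ?thesis by (simp only: u_def f_def fourier_integral_def mult.assoc)
  qed
  have bes: "h ^ CARD('n) * (\<Sum>n\<in>A. (cmod (u y n))\<^sup>2) \<le> (L2_norm (torus_measure h) g)\<^sup>2" if "finite A" for A y
    using bessel(1)[OF gmL that coef, of y] by (simp add: gmn)
  have summ: "(\<lambda>n. (cmod (u y n))\<^sup>2) summable_on UNIV" for y
  proof (rule nonneg_bdd_above_summable_on)
    have "(\<Sum>n\<in>A. (cmod (u y n))\<^sup>2) \<le> (L2_norm (torus_measure h) g)\<^sup>2 / h ^ CARD('n)" if "finite A" for A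
      using bes[OF that, of y] h by (simp add: field_simps)
    then show "bdd_above (sum (\<lambda>n. (cmod (u y n))\<^sup>2) ` {F. F \<subseteq> UNIV \<and> finite F})"
      by (intro bdd_aboveI2[where M = "(L2_norm (torus_measure h) g)\<^sup>2 / h ^ CARD('n)"]) auto
  qed auto
  define E where "E y = h ^ CARD('n) * (\<Sum>\<^sub>\<infinity>n. (cmod (u y n))\<^sup>2)" for y
  have Ele: "E y \<le> (L2_norm (torus_measure h) g)\<^sup>2" for y
  proof -
    have "((\<lambda>A. h ^ CARD('n) * (\<Sum>n\<in>A. (cmod (u y n))\<^sup>2)) \<longlongrightarrow> E y) (finite_subsets_at_top UNIV)"
      using has_sum_infsum[OF summ[of y]] unfolding has_sum_def E_def by (intro tendsto_intros)
    then show ?thesis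
      by (rule tendsto_upperbound) (auto simp: eventually_finite_subsets_at_top bes)
  qed
  have En: "ennreal (E y) = ennreal (h ^ CARD('n)) * (\<integral>\<^sup>+n. ennreal ((cmod (f (y - h *\<^sub>R vec_of_int n)))\<^sup>2) \<partial>count_space UNIV)" for y
  proof -
    have ab: "Infinite_Set_Sum.abs_summable_on (\<lambda>n. (cmod (u y n))\<^sup>2) UNIV"
      using summ[of y] abs_summable_equivalent[of "\<lambda>n. (cmod (u y n))\<^sup>2" UNIV] by (simp add: abs_summable_on_def)
    have "(\<integral>\<^sup>+n. ennreal ((cmod (u y n))\<^sup>2) \<partial>count_space UNIV) = ennreal (infsetsum (\<lambda>n. (cmod (u y n))\<^sup>2) UNIV)"
      using ab by (intro nn_integral_conv_infsetsum) auto
    also have "infsetsum (\<lambda>n. (cmod (u y n))\<^sup>2) UNIV = (\<Sum>\<^sub>\<infinity>n. (cmod (u y n))\<^sup>2)"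
      using ab by (rule infsetsum_infsum)
    finally show ?thesis using h by (simp add: E_def u_def ennreal_mult infsum_nonneg)
  qed
  have cell [measurable]: "grid_cell h (0 :: int ^ 'n) \<in> sets borel" by (rule sets_grid_cell[OF h])
  define N where "N = (L2_norm (torus_measure h) g)\<^sup>2"
  have Sm: "(\<lambda>y. \<integral>\<^sup>+n. ennreal ((cmod (f (y - h *\<^sub>R vec_of_int n)))\<^sup>2) \<partial>count_space (UNIV :: (int ^ 'n) set)) \<in> borel_measurable borel"
    by (rule borel_measurable_nn_integral_count_space[OF countable_int_vec]) measurable
  have Em: "(\<lambda>y. ennreal (E y)) \<in> borel_measurable borel"
    unfolding En using Sm by measurable
  have "(\<integral>\<^sup>+y. ennreal (E y) * indicator (grid_cell h (0 :: int ^ 'n)) y \<partial>lborel) =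
      ennreal (h ^ CARD('n)) * (\<integral>\<^sup>+y. (\<integral>\<^sup>+n. ennreal ((cmod (f (y - h *\<^sub>R vec_of_int n)))\<^sup>2) \<partial>count_space UNIV) * indicator (grid_cell h (0 :: int ^ 'n)) y \<partial>lborel)"
    unfolding En mult.assoc by (rule nn_integral_cmult) (use Sm in measurable)
  also have "\<dots> = ennreal (h ^ CARD('n)) * (\<integral>\<^sup>+x. ennreal ((cmod (f x))\<^sup>2) \<partial>lborel)"
    by (subst nn_integral_grid_tiling[OF h, of "\<lambda>x. ennreal ((cmod (f x))\<^sup>2)"]) auto
  also have "(\<integral>\<^sup>+x. ennreal ((cmod (f x))\<^sup>2) \<partial>lborel) = ennreal N"
    unfolding N_def fn[symmetric] L2_norm_sq using L2_D(2)[OF fL] by (intro nn_integral_eq_integral) auto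
  finally have int: "(\<integral>\<^sup>+y. ennreal (E y) * indicator (grid_cell h (0 :: int ^ 'n)) y \<partial>lborel) = ennreal (h ^ CARD('n)) * ennreal N" .
  \<comment> \<open>The deficit \<open>N - E y\<close> is non-negative on the cell, and its integral
    there is N times the volume of the cell minus the same amount, so it vanishes almost everywhere
    on the cell.\<close>
  have "(\<integral>\<^sup>+y. (ennreal N * indicator (grid_cell h (0 :: int ^ 'n)) y - ennreal (E y) * indicator (grid_cell h (0 :: int ^ 'n)) y) \<partial>lborel) =
      (\<integral>\<^sup>+y. ennreal N * indicator (grid_cell h (0 :: int ^ 'n)) y \<partial>lborel) - (\<integral>\<^sup>+y. ennreal (E y) * indicator (grid_cell h (0 :: int ^ 'n)) y \<partial>lborel)"
  proof (rule nn_integral_diff)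
    show "(\<integral>\<^sup>+y. ennreal (E y) * indicator (grid_cell h (0 :: int ^ 'n)) y \<partial>lborel) \<noteq> \<infinity>"
      unfolding int by (simp add: ennreal_mult_eq_top_iff)
    show "AE y in lborel. ennreal (E y) * indicator (grid_cell h (0 :: int ^ 'n)) y \<le> ennreal N * indicator (grid_cell h (0 :: int ^ 'n)) y"
      using Ele by (auto simp: N_def intro!: AE_I2 mult_right_mono ennreal_leI)
    show "(\<lambda>y. ennreal (E y) * indicator (grid_cell h (0 :: int ^ 'n)) y) \<in> borel_measurable lborel"
      using Em by measurable
  qed measurable
  also have "(\<integral>\<^sup>+y. ennreal N * indicator (grid_cell h (0 :: int ^ 'n)) y \<partial>lborel) = ennreal N * ennreal (h ^ CARD('n))"
    using cell by (simp add: nn_integral_cmult_indicator emeasure_grid_cell[OF h])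
  also have "ennreal N * ennreal (h ^ CARD('n)) - (\<integral>\<^sup>+y. ennreal (E y) * indicator (grid_cell h (0 :: int ^ 'n)) y \<partial>lborel) = 0"
    unfolding int by (simp add: mult.commute ennreal_mult_eq_top_iff diff_eq_0_iff_ennreal)
  finally have "AE y in lborel. ennreal N * indicator (grid_cell h (0 :: int ^ 'n)) y - ennreal (E y) * indicator (grid_cell h (0 :: int ^ 'n)) y = 0"
    using Em by (subst (asm) nn_integral_0_iff_AE) auto
  then show ?thesis
  proof eventually_elim
    case (elim y)
    show ?case
    proof
      assume "y \<in> grid_cell h 0"
      then have "ennreal N - ennreal (E y) = 0" using elim by simp
      then have "ennreal N \<le> ennreal (E y)" by (simp add: diff_eq_0_iff_ennreal)
      moreover have "0 \<le> E y" using h by (simp add: E_def infsum_nonneg)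
      ultimately have "N \<le> E y" by simp
      then have "E y = (L2_norm (torus_measure h) (gm y))\<^sup>2" using Ele[of y] by (simp add: gmn N_def)
      then have "L2_has_sum (torus_measure h) (\<lambda>n \<xi>. u y n * dft_basis h n \<xi>) (gm y)"
        by (intro parseval_has_sum gmL coef summ) (simp add: E_def)
      then show "\<exists>u. (u, \<lambda>\<xi>. cis (- (y \<bullet> \<xi>)) * g \<xi>) \<in> discrete_fourier h"
        using summ[of y] L2_grid_measure(1)[OF h, of "u y"] unfolding gm_def discrete_fourier_iff by blast
    qed
  qed
qed

text \<open>The modulations that lie in the range have full measure near 0, so some of them tend to
  the trivial one. As the torus is bounded, the modulated functions then converge to g, and the
  range is closed.\<close>

lemma discrete_fourier_onto:
  fixes g :: "real ^ 'n \<Rightarrow> complex"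
  assumes h: "h > 0" and g: "g \<in> L2 (torus_measure h)"
  shows "\<exists>u. (u, g) \<in> discrete_fourier h"
proof -
  define P where "P y \<longleftrightarrow> (\<exists>u. (u, \<lambda>\<xi>. cis (- (y \<bullet> \<xi>)) * g \<xi>) \<in> discrete_fourier h)" for y
  have "\<exists>y. y \<in> ball 0 r \<and> P y" if r: "r > 0" for r
  proof (rule ccontr)
    assume no: "\<not> ?thesis"
    \<comment> \<open>B lies in the cell of 0, so if every point of it failed, a non-empty open set
      would be null.\<close>
    define B where "B = ball (0 :: real ^ 'n) (min r (h / 2))"
    have "x \<in> grid_cell h 0" if "x \<in> B" for x
    proof -
      have "\<bar>x $ i\<bar> < h / 2" for i
        using that component_le_norm_cart[of x i] by (simp add: B_def)
      then have "- h / 2 \<le> x $ i \<and> x $ i < h / 2" for i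
        by (metis abs_less_iff less_eq_real_def minus_divide_left minus_less_iff)
      then show ?thesis using h by (simp add: grid_cell_eq)
    qed
    moreover have "AE y in lborel. y \<in> grid_cell h 0 \<longrightarrow> P y"
      unfolding P_def by (rule parseval_almost_every_modulation[OF h g])
    ultimately have "AE y in lborel. y \<notin> B"
      using no by (auto simp: B_def elim!: eventually_mono)
    then have "B \<in> null_sets lborel" using AE_iff_null_sets[of B lborel] by (simp add: B_def)
    then have "negligible B" by (simp add: negligible_iff_null_sets null_sets_completionI)
    moreover have "open B" "B \<noteq> {}" using r h by (auto simp: B_def)
    ultimately show False using open_not_negligible by blast
  qed
  then have "\<exists>y. \<forall>k :: nat. y k \<in> ball 0 (1 / (real k + 1)) \<and> P (y k)"
    by (intro choice) auto
  then obtain y where y: "\<And>k :: nat. norm (y k) < 1 / (real k + 1)" "\<And>k. P (y k)" by auto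
  have "\<exists>u. \<forall>k. (u k, \<lambda>\<xi>. cis (- (y k \<bullet> \<xi>)) * g \<xi>) \<in> discrete_fourier h"
    using y(2) unfolding P_def by (intro choice) auto
  then obtain u where u: "\<And>k. (u k, \<lambda>\<xi>. cis (- (y k \<bullet> \<xi>)) * g \<xi>) \<in> discrete_fourier h" by blast
  note uL = isometry_L2(2)[OF L2_isometry_discrete_fourier[OF h] u]
  obtain R where R: "\<And>\<xi> :: real ^ 'n. \<xi> \<in> torus h \<Longrightarrow> norm \<xi> \<le> R" "R > 0"
    using bounded_cbox[of "\<chi> i. - (pi / h)" "\<chi> i. pi / h"] unfolding bounded_pos cube_def by blast
  have est: "L2_norm (torus_measure h) (\<lambda>\<xi>. cis (- (y k \<bullet> \<xi>)) * g \<xi> - g \<xi>) \<le> (1 / (real k + 1)) * (R * L2_norm (torus_measure h) g)" for k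
  proof -
    have pos: "0 \<le> 1 / (real k + 1) * R" using R(2) by simp
    have "cmod (cis (- (y k \<bullet> \<xi>)) * g \<xi> - g \<xi>) \<le> cmod (complex_of_real (1 / (real k + 1) * R) * g \<xi>)" if "\<xi> \<in> torus h" for \<xi>
    proof -
      have "cis (- (y k \<bullet> \<xi>)) * g \<xi> - g \<xi> = (cis (- (y k \<bullet> \<xi>)) - 1) * g \<xi>" by (simp add: algebra_simps)
      moreover have "cmod (cis (- (y k \<bullet> \<xi>)) - 1) \<le> norm (y k) * norm \<xi>"
        using cmod_cis_minus_one_le[of "- (y k \<bullet> \<xi>)"] Cauchy_Schwarz_ineq2[of "y k" \<xi>] by simp
      moreover have "norm (y k) * norm \<xi> \<le> 1 / (real k + 1) * R"
        using y(1)[of k] R(1)[OF that] by (intro mult_mono) auto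
      ultimately have "cmod (cis (- (y k \<bullet> \<xi>)) * g \<xi> - g \<xi>) = cmod (cis (- (y k \<bullet> \<xi>)) - 1) * cmod (g \<xi>)"
        "cmod (cis (- (y k \<bullet> \<xi>)) - 1) \<le> 1 / (real k + 1) * R"
        by (simp_all only: norm_mult)
      then have "cmod (cis (- (y k \<bullet> \<xi>)) * g \<xi> - g \<xi>) \<le> (1 / (real k + 1) * R) * cmod (g \<xi>)"
        by (simp only: mult_right_mono norm_ge_zero)
      then show ?thesis by (simp only: norm_mult norm_of_real abs_of_nonneg[OF pos])
    qed
    then have "AE \<xi> in torus_measure h. cmod (cis (- (y k \<bullet> \<xi>)) * g \<xi> - g \<xi>) \<le> cmod (complex_of_real (1 / (real k + 1) * R) * g \<xi>)"
      unfolding AE_torus by auto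
    then have "L2_norm (torus_measure h) (\<lambda>\<xi>. cis (- (y k \<bullet> \<xi>)) * g \<xi> - g \<xi>) \<le> L2_norm (torus_measure h) (\<lambda>\<xi>. complex_of_real (1 / (real k + 1) * R) * g \<xi>)"
      using L2_diff[OF uL[of k] g] by (intro L2_norm_mono_AE L2_scale g) (auto simp: L2_def)
    then show ?thesis by (simp only: L2_norm_scale norm_of_real abs_of_nonneg[OF pos] mult.assoc)
  qed
  have lim: "(\<lambda>k. L2_norm (torus_measure h) (\<lambda>\<xi>. cis (- (y k \<bullet> \<xi>)) * g \<xi> - g \<xi>)) \<longlonglongrightarrow> 0"
  proof (rule Lim_null_comparison)
    show "\<forall>\<^sub>F k in sequentially. norm (L2_norm (torus_measure h) (\<lambda>\<xi>. cis (- (y k \<bullet> \<xi>)) * g \<xi> - g \<xi>)) \<le> (1 / (real k + 1)) * (R * L2_norm (torus_measure h) g)"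
      using est by simp
    have "(\<lambda>k. 1 / (real k + 1)) \<longlonglongrightarrow> 0"
      using LIMSEQ_inverse_real_of_nat by (simp add: inverse_eq_divide add.commute)
    from tendsto_mult[OF this tendsto_const, of "R * L2_norm (torus_measure h) g"]
    show "(\<lambda>k. (1 / (real k + 1)) * (R * L2_norm (torus_measure h) g)) \<longlonglongrightarrow> 0" by simp
  qed
  show ?thesis
    by (rule isometry_range_closed[OF L2_isometry_discrete_fourier[OF h] u g lim])
qed

section \<open>Estimates for the symbols\<close>

definition sine_point :: "real \<Rightarrow> real ^ 'n \<Rightarrow> real ^ 'n" where
  "sine_point h \<xi> = (\<chi> i. 2 / h * sin (h / 2 * \<xi> $ i))"

lemma sinc_bounds:
  assumes "\<bar>x\<bar> \<le> pi / 2"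
  shows "1 / 2 \<le> sinc x" "sinc x \<le> 1" "1 - sinc x \<le> x\<^sup>2 / 6"
proof -
  have b: "\<bar>sin x - x\<bar> \<le> \<bar>x\<bar> ^ 3 / 6"
    using Maclaurin_sin_bound[of x 3] by (simp add: numeral_3_eq_3 sin_coeff_def fact_numeral)
  have "\<bar>1 - sinc x\<bar> \<le> x\<^sup>2 / 6"
  proof (cases "x = 0")
    case False
    have "\<bar>1 - sinc x\<bar> = \<bar>sin x - x\<bar> / \<bar>x\<bar>"
      using False by (simp add: abs_divide[symmetric] diff_divide_distrib abs_minus_commute)
    also have "\<dots> \<le> (\<bar>x\<bar> ^ 3 / 6) / \<bar>x\<bar>" by (intro divide_right_mono b) simp
    also have "\<dots> = x\<^sup>2 / 6" using False by (simp add: power3_eq_cube power2_eq_square field_simps abs_mult_self_eq flip: abs_mult)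
    finally show ?thesis .
  qed simp
  then show d: "1 - sinc x \<le> x\<^sup>2 / 6" by linarith
  \<comment> \<open>By the Taylor bound 1 - x^2 / 6 the lower bound 1/2 needs x^2 <= 3, which holds
    as pi / 2 <= 17 / 10.\<close>
  have "x\<^sup>2 \<le> (pi / 2)\<^sup>2" using power_mono[OF assms, of 2] by simp
  also have "\<dots> \<le> (17 / 10)\<^sup>2" using pi_approx(2) by (intro power_mono) auto
  also have "\<dots> \<le> 3" by (simp add: power2_eq_square)
  finally show "1 / 2 \<le> sinc x" using d by linarith
  have "\<bar>sin x\<bar> \<le> \<bar>x\<bar>" by (rule abs_sin_x_le_abs_x)
  then have "\<bar>sinc x\<bar> \<le> 1" by (auto simp: abs_divide divide_le_eq_1)
  then show "sinc x \<le> 1" by linarith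
qed

lemma torus_half:
  assumes "h > 0" "\<xi> \<in> torus h"
  shows "\<bar>h / 2 * \<xi> $ i\<bar> \<le> pi / 2"
proof -
  have "\<bar>\<xi> $ i\<bar> \<le> pi / h" using assms by (simp add: mem_cube)
  then have "h * \<bar>\<xi> $ i\<bar> \<le> pi" using assms by (simp add: field_simps)
  then show ?thesis using assms by (simp add: abs_mult)
qed

lemma sine_point_nth:
  "h > 0 \<Longrightarrow> sine_point h \<xi> $ i = sinc (h / 2 * \<xi> $ i) * \<xi> $ i"
  by (simp add: sine_point_def)

lemma norm_torus_le:
  fixes \<xi> :: "real ^ 'n"
  assumes h: "h > 0" and \<xi>: "\<xi> \<in> torus h"
  shows "h * norm \<xi> \<le> pi * real CARD('n)"
proof -
  have "norm \<xi> \<le> (\<Sum>i\<in>UNIV. \<bar>\<xi> $ i\<bar>)" by (rule norm_le_l1_cart)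
  also have "\<dots> \<le> (\<Sum>i\<in>(UNIV :: 'n set). pi / h)" using \<xi> by (intro sum_mono) (simp add: mem_cube)
  finally have "norm \<xi> \<le> real CARD('n) * (pi / h)" by simp
  then show ?thesis using h by (simp add: field_simps)
qed

text \<open>In each coordinate a point of the segment is xi times a factor between 1/2 and 1. The
  bounds along the whole segment serve the mean value theorem: a gradient bound with negative
  exponent is singular at the origin, from which the segment keeps the distance |xi| / 2.\<close>

lemma sine_point_bounds:
  fixes \<xi> :: "real ^ 'n"
  assumes h: "h > 0" and \<xi>: "\<xi> \<in> torus h"
  shows "norm (\<xi> - sine_point h \<xi>) \<le> real CARD('n) * (h\<^sup>2 * norm \<xi> ^ 3)"
    and "z \<in> closed_segment \<xi> (sine_point h \<xi>) \<Longrightarrow> norm \<xi> / 2 \<le> norm z"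
    and "z \<in> closed_segment \<xi> (sine_point h \<xi>) \<Longrightarrow> norm z \<le> norm \<xi>"
proof -
  note s = sinc_bounds[OF torus_half[OF h \<xi>]]
  have "norm (\<xi> - sine_point h \<xi>) \<le> (\<Sum>i\<in>UNIV. \<bar>(\<xi> - sine_point h \<xi>) $ i\<bar>)" by (rule norm_le_l1_cart)
  also have "\<dots> \<le> (\<Sum>i\<in>(UNIV :: 'n set). h\<^sup>2 * norm \<xi> ^ 3)"
  proof (rule sum_mono)
    fix i
    have "(\<xi> - sine_point h \<xi>) $ i = (1 - sinc (h / 2 * \<xi> $ i)) * \<xi> $ i"
      by (simp only: vector_minus_component sine_point_nth[OF h] left_diff_distrib mult_1_left)
    then have "\<bar>(\<xi> - sine_point h \<xi>) $ i\<bar> = (1 - sinc (h / 2 * \<xi> $ i)) * \<bar>\<xi> $ i\<bar>"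
      using s(2)[of i] by (simp only: abs_mult abs_of_nonneg diff_ge_0_iff_ge)
    also have "\<dots> \<le> ((h / 2 * \<xi> $ i)\<^sup>2 / 6) * \<bar>\<xi> $ i\<bar>" by (intro mult_right_mono s(3)) simp
    also have "\<dots> = h\<^sup>2 * \<bar>\<xi> $ i\<bar> ^ 3 / 24"
      by (simp add: power2_eq_square power3_eq_cube)
    also have "\<dots> \<le> h\<^sup>2 * norm \<xi> ^ 3 / 24"
      using h by (intro divide_right_mono mult_left_mono power_mono component_le_norm_cart) auto
    also have "\<dots> \<le> h\<^sup>2 * norm \<xi> ^ 3" by simp
    finally show "\<bar>(\<xi> - sine_point h \<xi>) $ i\<bar> \<le> h\<^sup>2 * norm \<xi> ^ 3" .
  qed
  finally show "norm (\<xi> - sine_point h \<xi>) \<le> real CARD('n) * (h\<^sup>2 * norm \<xi> ^ 3)" by simp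
  assume "z \<in> closed_segment \<xi> (sine_point h \<xi>)"
  then obtain t where t: "0 \<le> t" "t \<le> 1" "z = (1 - t) *\<^sub>R \<xi> + t *\<^sub>R sine_point h \<xi>"
    by (auto simp: in_segment)
  have z: "\<exists>c. 1 / 2 \<le> c \<and> c \<le> 1 \<and> z $ i = c * \<xi> $ i" for i
  proof (intro exI[of _ "(1 - t) + t * sinc (h / 2 * \<xi> $ i)"] conjI)
    have "(1 - t) + t * sinc (h / 2 * \<xi> $ i) \<ge> (1 - t) + t * (1 / 2)"
      using t s(1)[of i] by (intro add_left_mono mult_left_mono) auto
    then show "1 / 2 \<le> (1 - t) + t * sinc (h / 2 * \<xi> $ i)" using t by linarith
    have "(1 - t) + t * sinc (h / 2 * \<xi> $ i) \<le> (1 - t) + t * 1"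
      using t s(2)[of i] by (intro add_left_mono mult_left_mono) auto
    then show "(1 - t) + t * sinc (h / 2 * \<xi> $ i) \<le> 1" by linarith
    show "z $ i = ((1 - t) + t * sinc (h / 2 * \<xi> $ i)) * \<xi> $ i"
      by (simp only: t(3) vector_add_component vector_scaleR_component sine_point_nth[OF h] real_scaleR_def distrib_right mult.assoc)
  qed
  have "\<bar>\<xi> $ i\<bar> / 2 \<le> \<bar>z $ i\<bar> \<and> \<bar>z $ i\<bar> \<le> \<bar>\<xi> $ i\<bar>" for i
  proof -
    obtain c where c: "1 / 2 \<le> c" "c \<le> 1" "z $ i = c * \<xi> $ i" using z[of i] by blast
    have "\<bar>z $ i\<bar> = c * \<bar>\<xi> $ i\<bar>" using c by (simp add: abs_mult)
    then show ?thesis using mult_right_mono[OF c(1), of "\<bar>\<xi> $ i\<bar>"] mult_right_mono[OF c(2), of "\<bar>\<xi> $ i\<bar>"] by simp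
  qed
  note comp = this
  have "norm ((1 / 2) *\<^sub>R \<xi>) \<le> norm z"
    by (rule norm_le_componentwise_cart) (use comp in \<open>simp add: abs_mult\<close>)
  moreover have "norm z \<le> norm \<xi>"
    by (rule norm_le_componentwise_cart) (use comp in simp)
  ultimately show "norm \<xi> / 2 \<le> norm z" "norm z \<le> norm \<xi>" by simp_all
qed

lemma norm_sine_point:
  assumes "h > 0" "\<xi> \<in> torus h"
  shows "norm \<xi> / 2 \<le> norm (sine_point h \<xi>)" "norm (sine_point h \<xi>) \<le> norm \<xi>"
  using sine_point_bounds(2,3)[OF assms, of "sine_point h \<xi>"] by auto

lemma one_minus_prod_le:
  fixes s :: "'i \<Rightarrow> real"
  assumes "finite A" "\<And>i. i \<in> A \<Longrightarrow> 0 \<le> s i \<and> s i \<le> 1"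
  shows "1 - (\<Prod>i\<in>A. s i) \<le> (\<Sum>i\<in>A. 1 - s i)"
  using assms
proof (induction A rule: finite_induct)
  case (insert a A)
  have "(\<Prod>i\<in>A. s i) \<le> 1" using insert.prems by (intro prod_le_1) auto
  then have "(1 - s a) * (\<Prod>i\<in>A. s i) \<le> (1 - s a) * 1"
    using insert.prems by (intro mult_left_mono) auto
  then have "1 - s a * (\<Prod>i\<in>A. s i) \<le> (1 - s a) + (1 - (\<Prod>i\<in>A. s i))"
    by (simp add: algebra_simps)
  also have "\<dots> \<le> (1 - s a) + (\<Sum>i\<in>A. 1 - s i)" using insert by simp
  finally show ?case using insert.hyps by simp
qed simp

text \<open>The lower bound keeps the overlap of J u with low-frequency functions from degenerating.
  In the last estimate the left-hand side is the share of the mass at xi that step interpolation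
  moves out of the torus.\<close>

lemma cell_mult_bounds:
  fixes \<xi> :: "real ^ 'n"
  assumes h: "h > 0" and \<xi>: "\<xi> \<in> torus h"
  shows "(1 / 2) ^ CARD('n) \<le> cell_mult h \<xi>" "cell_mult h \<xi> \<le> 1"
    "1 - (cell_mult h \<xi>)\<^sup>2 \<le> real CARD('n) * (h * norm \<xi>)\<^sup>2"
proof -
  note s = sinc_bounds[OF torus_half[OF h \<xi>]]
  have s0: "0 \<le> sinc (h / 2 * \<xi> $ i)" for i using s(1)[of i] by linarith
  have "(\<Prod>i\<in>(UNIV :: 'n set). 1 / 2 :: real) \<le> cell_mult h \<xi>"
    unfolding cell_mult_def using s(1) by (intro prod_mono) auto
  then show low: "(1 / 2) ^ CARD('n) \<le> cell_mult h \<xi>" by simp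
  show le1: "cell_mult h \<xi> \<le> 1"
    unfolding cell_mult_def using s(2) s0 by (intro prod_le_1) auto
  have "1 - cell_mult h \<xi> \<le> (\<Sum>i\<in>UNIV. 1 - sinc (h / 2 * \<xi> $ i))"
    unfolding cell_mult_def using s(2) s0 by (intro one_minus_prod_le) auto
  also have "\<dots> \<le> (\<Sum>i\<in>(UNIV :: 'n set). (h * norm \<xi>)\<^sup>2 / 24)"
  proof (rule sum_mono)
    fix i
    have "1 - sinc (h / 2 * \<xi> $ i) \<le> (h / 2 * \<xi> $ i)\<^sup>2 / 6" by (rule s(3))
    also have "\<dots> = (h * \<bar>\<xi> $ i\<bar>)\<^sup>2 / 24" by (simp add: power_mult_distrib power_divide)
    also have "\<dots> \<le> (h * norm \<xi>)\<^sup>2 / 24"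
      using h by (intro divide_right_mono power_mono mult_left_mono component_le_norm_cart) auto
    finally show "1 - sinc (h / 2 * \<xi> $ i) \<le> (h * norm \<xi>)\<^sup>2 / 24" .
  qed
  finally have d: "1 - cell_mult h \<xi> \<le> real CARD('n) * (h * norm \<xi>)\<^sup>2 / 24" by simp
  have "1 - (cell_mult h \<xi>)\<^sup>2 = (1 - cell_mult h \<xi>) * (1 + cell_mult h \<xi>)" by (simp add: power2_eq_square algebra_simps)
  also have "\<dots> \<le> (1 - cell_mult h \<xi>) * 2" using le1 by (intro mult_left_mono) auto
  also have "\<dots> \<le> (real CARD('n) * (h * norm \<xi>)\<^sup>2 / 24) * 2" using d by simp
  also have "\<dots> \<le> real CARD('n) * (h * norm \<xi>)\<^sup>2" by simp
  finally show "1 - (cell_mult h \<xi>)\<^sup>2 \<le> real CARD('n) * (h * norm \<xi>)\<^sup>2" .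
qed

text \<open>For r <= 1 the left-hand side is at most 1; for r > 1 the exponent may be raised to 2
  \<alpha>.\<close>

lemma powr_le_sq:
  fixes r s \<alpha> :: real
  assumes "0 \<le> r" "0 \<le> s" "s \<le> 2 * \<alpha>"
  shows "r powr s \<le> (1 + r powr \<alpha>)\<^sup>2"
proof (cases "r \<le> 1")
  case True
  have "r powr s \<le> 1" using True assms by (simp add: powr_le1)
  also have "\<dots> \<le> (1 + r powr \<alpha>)\<^sup>2" by (simp add: one_le_power)
  finally show ?thesis .
next
  case False
  have "r powr s \<le> r powr (\<alpha> + \<alpha>)" using False assms by (intro powr_mono) auto
  also have "\<dots> = (r powr \<alpha>)\<^sup>2" by (simp only: powr_add power2_eq_square)
  also have "\<dots> \<le> (1 + r powr \<alpha>)\<^sup>2" by (intro power_mono) auto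
  finally show ?thesis .
qed

text \<open>The factor \<open>(h r)\<^sup>2\<close> gained from \<open>\<xi> - sine_point h \<xi>\<close> is traded for \<open>h\<^sup>\<gamma> r\<^sup>\<gamma>\<close>, as \<open>h r\<close> is bounded.\<close>

lemma gain_trade:
  fixes h r R \<gamma> s \<alpha> :: real
  assumes h: "0 < h" and r: "0 \<le> r" "h * r \<le> R" and g: "0 \<le> \<gamma>" "\<gamma> \<le> 2" and s: "0 \<le> \<gamma> + s" "\<gamma> + s \<le> 2 * \<alpha>"
  shows "(h * r)\<^sup>2 * r powr s \<le> R powr (2 - \<gamma>) * (h powr \<gamma> * (1 + r powr \<alpha>)\<^sup>2)"
proof (cases "r = 0")
  case False
  then have r0: "r > 0" using r by simp
  have "(h * r)\<^sup>2 = (h * r) powr (\<gamma> + (2 - \<gamma>))" using h r0 by (simp add: powr_numeral)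
  also have "\<dots> = (h * r) powr \<gamma> * (h * r) powr (2 - \<gamma>)" by (rule powr_add)
  also have "\<dots> \<le> (h * r) powr \<gamma> * R powr (2 - \<gamma>)"
    using h r0 r g by (intro mult_left_mono powr_mono2) auto
  also have "(h * r) powr \<gamma> = h powr \<gamma> * r powr \<gamma>" using h r0 by (simp add: powr_mult)
  finally have "(h * r)\<^sup>2 * r powr s \<le> h powr \<gamma> * r powr \<gamma> * R powr (2 - \<gamma>) * r powr s"
    by (intro mult_right_mono) auto
  also have "\<dots> = R powr (2 - \<gamma>) * (h powr \<gamma> * r powr (\<gamma> + s))" by (simp add: powr_add)
  also have "\<dots> \<le> R powr (2 - \<gamma>) * (h powr \<gamma> * (1 + r powr \<alpha>)\<^sup>2)"
    using r s by (intro mult_left_mono powr_le_sq) auto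
  finally show ?thesis .
qed simp

section \<open>Consistency of the three classes of symbols\<close>

lemma gradient_bound:
  assumes G: "is_C1_gradient G g" and B: "\<And>z. z \<in> closed_segment a b \<Longrightarrow> norm (g z) \<le> B"
  shows "\<bar>G a - G b\<bar> \<le> B * norm (a - b)"
proof -
  have "norm (G a - G b) \<le> B * norm (a - b)"
  proof (rule differentiable_bound[of "closed_segment a b" G "\<lambda>z y. y \<bullet> g z"])
    fix z assume z: "z \<in> closed_segment a b"
    show "(G has_derivative (\<lambda>y. y \<bullet> g z)) (at z within closed_segment a b)"
      using G by (auto simp: is_C1_gradient_def gderiv_def intro: has_derivative_at_withinI)
    have "onorm (\<lambda>y. y \<bullet> g z) \<le> norm (g z)"
      by (rule onorm_bound) (use Cauchy_Schwarz_ineq2 in \<open>auto simp: mult.commute\<close>)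
    then show "onorm (\<lambda>y. y \<bullet> g z) \<le> B" using B[OF z] by linarith
  qed auto
  then show ?thesis by simp
qed

lemma C1_continuous: "is_C1_gradient G g \<Longrightarrow> continuous_on UNIV G"
  by (auto simp: is_C1_gradient_def gderiv_def continuous_on_eq_continuous_at intro: has_derivative_continuous)

lemma continuous_on_norm_powr: "0 < \<alpha> \<Longrightarrow> continuous_on UNIV (\<lambda>\<xi> :: 'a::real_normed_vector. norm \<xi> powr \<alpha>)"
  by (intro continuous_on_powr' continuous_intros) auto

text \<open>|xi|^\<alpha> is not differentiable at the origin. Let r and q be the norms of xi and of
  its sine point. Concavity in the form q / r <= (q / r)^\<alpha> bounds r^\<alpha> - q^\<alpha> by
  r^\<alpha> (r - q) / r, and (r - q) / r is of order (h r)^2.\<close>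

lemma norm_powr_symbol_bound:
  fixes \<xi> :: "real ^ 'n"
  assumes h: "h > 0" and \<xi>: "\<xi> \<in> torus h" and \<alpha>: "0 < \<alpha>" "\<alpha> \<le> 1"
  shows "\<bar>norm \<xi> powr \<alpha> - norm (sine_point h \<xi>) powr \<alpha>\<bar> \<le>
    real CARD('n) * (pi * real CARD('n)) powr (2 - \<alpha>) * (h powr \<alpha> * (1 + norm \<xi> powr \<alpha>)\<^sup>2)"
proof (cases "\<xi> = 0")
  case True
  then have "sine_point h \<xi> = 0" by (simp add: sine_point_def vec_eq_iff)
  then show ?thesis using True by simp
next
  case False
  define r where "r = norm \<xi>"
  define q where "q = norm (sine_point h \<xi>)"
  have r: "r > 0" and q: "0 \<le> q" "q \<le> r" using False norm_sine_point[OF h \<xi>] by (auto simp: r_def q_def)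
  have "r - q \<le> norm (\<xi> - sine_point h \<xi>)" unfolding r_def q_def by (rule norm_triangle_ineq2)
  also have "\<dots> \<le> real CARD('n) * (h\<^sup>2 * r ^ 3)" unfolding r_def by (rule sine_point_bounds(1)[OF h \<xi>])
  finally have d: "r - q \<le> real CARD('n) * (h\<^sup>2 * r ^ 3)" .
  have t: "q / r \<le> (q / r) powr \<alpha>"
  proof (cases "q = 0")
    case False
    then have "(q / r) powr 1 \<le> (q / r) powr \<alpha>" using q r \<alpha> by (intro powr_mono') auto
    then show ?thesis using q r by simp
  qed simp
  have "q powr \<alpha> \<le> r powr \<alpha>" using q \<alpha> by (intro powr_mono2) auto
  then have "\<bar>r powr \<alpha> - q powr \<alpha>\<bar> = r powr \<alpha> - q powr \<alpha>" by simp
  also have "\<dots> = r powr \<alpha> - r powr \<alpha> * (q / r) powr \<alpha>" using q r by (simp add: powr_divide)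
  also have "\<dots> \<le> r powr \<alpha> - r powr \<alpha> * (q / r)"
    using t by (intro diff_left_mono mult_left_mono) auto
  also have "\<dots> = r powr \<alpha> * ((r - q) / r)" using r by (simp add: diff_divide_distrib algebra_simps)
  also have "\<dots> \<le> r powr \<alpha> * (real CARD('n) * (h\<^sup>2 * r ^ 3) / r)"
    using d r by (intro mult_left_mono divide_right_mono) auto
  also have "\<dots> = real CARD('n) * ((h * r)\<^sup>2 * r powr \<alpha>)"
    using r by (simp add: power2_eq_square power3_eq_cube)
  also have "\<dots> \<le> real CARD('n) * ((pi * real CARD('n)) powr (2 - \<alpha>) * (h powr \<alpha> * (1 + r powr \<alpha>)\<^sup>2))"
    using norm_torus_le[OF h \<xi>] \<alpha> r h by (intro mult_left_mono gain_trade) (auto simp: r_def)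
  finally show ?thesis by (simp add: r_def q_def mult_ac)
qed

text \<open>All that is used of an admissible symbol.\<close>

definition consistent_symbol :: "(real ^ 'n \<Rightarrow> real) \<Rightarrow> real \<Rightarrow> real \<Rightarrow> real \<Rightarrow> real \<Rightarrow> bool" where
  "consistent_symbol G \<alpha> \<gamma> c C \<longleftrightarrow> 0 < \<gamma> \<and> \<gamma> \<le> \<alpha> \<and> 0 < c \<and> 0 < C \<and> continuous_on UNIV G \<and>
     (\<forall>\<xi>. 0 \<le> G \<xi>) \<and> (\<forall>\<xi>. c * (1 + norm \<xi> powr \<alpha>) \<le> 1 + G \<xi>) \<and>
     (\<forall>h \<xi>. 0 < h \<longrightarrow> h \<le> 1 \<longrightarrow> \<xi> \<in> torus h \<longrightarrow>
        \<bar>G \<xi> - discrete_symbol G h \<xi>\<bar> \<le> C * (h powr \<gamma> * (1 + norm \<xi> powr \<alpha>)\<^sup>2))"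

lemma discrete_symbol_sine_point: "discrete_symbol G h \<xi> = G (sine_point h \<xi>)"
  by (simp add: discrete_symbol_def sine_point_def)

lemma consistent_symbol_case_i:
  fixes G0 :: "real ^ 'n \<Rightarrow> real"
  assumes "admissible_symbol (Case_i \<alpha> \<beta>) G0"
  shows "\<exists>c C. consistent_symbol G0 \<alpha> (symbol_exponent (Case_i \<alpha> \<beta>)) c C"
proof -
  have par: "\<alpha> > 1/2" "\<beta> > -1/2" "\<alpha> \<le> 1 + \<beta>" "1 + \<beta> < 2 * \<alpha>" "2 * \<alpha> \<le> 3 + \<beta>" and G0: "\<And>\<xi>. 0 \<le> G0 \<xi>"
    using assms by auto
  obtain c c0 where c: "c > 0" "c0 > 0" "\<And>\<xi>. c0 \<le> norm \<xi> \<Longrightarrow> c * norm \<xi> powr \<alpha> \<le> G0 \<xi>" using assms by auto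
  obtain g c' where g: "is_C1_gradient G0 g" "c' > 0" "\<And>\<xi>. \<xi> \<noteq> 0 \<Longrightarrow> norm (g \<xi>) \<le> c' * norm \<xi> powr \<beta>"
    using assms by auto
  define \<gamma> where "\<gamma> = symbol_exponent (Case_i \<alpha> \<beta>)"
  \<comment> \<open>\<alpha> > 1/2 and 1 + \<beta> < 2 \<alpha> make the rate positive, \<alpha> <=
    1 + \<beta> keeps it at most \<alpha>, and 2 \<alpha> <= 3 + \<beta> keeps it at most 2. The
    last bound is the budget of \<open>gain_trade\<close> with s = 1 + \<beta>.\<close>
  have \<gamma>: "0 < \<gamma>" "\<gamma> \<le> \<alpha>" "\<gamma> \<le> 2" "0 \<le> \<gamma> + (1 + \<beta>)" "\<gamma> + (1 + \<beta>) \<le> 2 * \<alpha>"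
    using par by (auto simp: \<gamma>_def min_def)
  \<comment> \<open>Outside the ball of radius c0 the growth hypothesis applies since d <= c;
    inside, G0 >= 0 suffices because d (1 + c0^\<alpha>) <= 1.\<close>
  define d where "d = min 1 c / (1 + c0 powr \<alpha>)"
  have p1: "1 + c0 powr \<alpha> \<ge> 1" by simp
  have p0: "0 < 1 + c0 powr \<alpha>" using p1 by linarith
  have d: "0 < d" "d * (1 + c0 powr \<alpha>) \<le> 1" "d \<le> c" "d \<le> 1"
  proof -
    show "0 < d" using c p1 by (simp add: d_def add_pos_nonneg)
    have n0: "1 + c0 powr \<alpha> \<noteq> 0" using p1 by linarith
    show "d * (1 + c0 powr \<alpha>) \<le> 1" using n0 by (simp add: d_def)
    have "d \<le> min 1 c / 1" unfolding d_def using p1 c p0 by (intro divide_left_mono) auto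
    then show "d \<le> c" "d \<le> 1" by auto
  qed
  have low: "d * (1 + norm \<xi> powr \<alpha>) \<le> 1 + G0 \<xi>" for \<xi>
  proof (cases "c0 \<le> norm \<xi>")
    case True
    have "d * (1 + norm \<xi> powr \<alpha>) = d + d * norm \<xi> powr \<alpha>" by (simp add: algebra_simps)
    also have "\<dots> \<le> 1 + c * norm \<xi> powr \<alpha>" using d by (intro add_mono mult_right_mono) auto
    also have "\<dots> \<le> 1 + G0 \<xi>" using c(3)[OF True] by simp
    finally show ?thesis .
  next
    case False
    have "norm \<xi> powr \<alpha> \<le> c0 powr \<alpha>" using False par by (intro powr_mono2) auto
    then have "d * (1 + norm \<xi> powr \<alpha>) \<le> d * (1 + c0 powr \<alpha>)" using d by (intro mult_left_mono) auto
    also have "\<dots> \<le> 1 + G0 \<xi>" using d G0[of \<xi>] by linarith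
    finally show ?thesis .
  qed
  define R where "R = pi * real CARD('n)"
  define C where "C = c' * 2 powr \<bar>\<beta>\<bar> * real CARD('n) * R powr (2 - \<gamma>)"
  have R: "R > 0" by (simp add: R_def)
  have C: "C > 0" using g R by (simp add: C_def)
  have con: "\<bar>G0 \<xi> - discrete_symbol G0 h \<xi>\<bar> \<le> C * (h powr \<gamma> * (1 + norm \<xi> powr \<alpha>)\<^sup>2)"
    if h: "0 < h" and \<xi>: "\<xi> \<in> torus h" for h \<xi>
  proof (cases "\<xi> = 0")
    case True
    then have "sine_point h \<xi> = \<xi>" by (simp add: sine_point_def vec_eq_iff)
    then show ?thesis using C by (simp add: discrete_symbol_sine_point)
  next
    case False
    define r where "r = norm \<xi>"
    have r: "r > 0" using False by (simp add: r_def)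
    \<comment> \<open>For negative \<beta> the factor 2^|\<beta>| pays for the points of the segment
      whose norm is as small as |xi| / 2.\<close>
    have gb: "norm (g z) \<le> c' * (2 powr \<bar>\<beta>\<bar> * r powr \<beta>)" if z: "z \<in> closed_segment \<xi> (sine_point h \<xi>)" for z
    proof -
      have z2: "r / 2 \<le> norm z" "norm z \<le> r" using sine_point_bounds(2,3)[OF h \<xi> z] by (auto simp: r_def)
      have "norm z powr \<beta> \<le> 2 powr \<bar>\<beta>\<bar> * r powr \<beta>"
      proof (cases "\<beta> \<ge> 0")
        case True
        have "norm z powr \<beta> \<le> 1 * r powr \<beta>" using z2 True by (simp add: powr_mono2)
        also have "\<dots> \<le> 2 powr \<bar>\<beta>\<bar> * r powr \<beta>" by (intro mult_right_mono) (auto simp: ge_one_powr_ge_zero)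
        finally show ?thesis .
      next
        case False
        have "norm z powr \<beta> \<le> (r / 2) powr \<beta>" using z2 r False by (intro powr_mono2') auto
        also have "\<dots> = 2 powr \<bar>\<beta>\<bar> * r powr \<beta>" using False r by (simp add: powr_divide powr_minus_divide)
        finally show ?thesis .
      qed
      then have "c' * norm z powr \<beta> \<le> c' * (2 powr \<bar>\<beta>\<bar> * r powr \<beta>)" using g by simp
      moreover have "z \<noteq> 0" using z2 r by auto
      ultimately show ?thesis using g(3)[of z] by linarith
    qed
    have "\<bar>G0 \<xi> - discrete_symbol G0 h \<xi>\<bar> \<le> c' * (2 powr \<bar>\<beta>\<bar> * r powr \<beta>) * norm (\<xi> - sine_point h \<xi>)"
      unfolding discrete_symbol_sine_point by (rule gradient_bound[OF g(1) gb])
    also have "\<dots> \<le> c' * (2 powr \<bar>\<beta>\<bar> * r powr \<beta>) * (real CARD('n) * (h\<^sup>2 * r ^ 3))"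
      using sine_point_bounds(1)[OF h \<xi>] g(2) by (intro mult_left_mono) (auto simp: r_def)
    also have "\<dots> = c' * 2 powr \<bar>\<beta>\<bar> * real CARD('n) * ((h * r)\<^sup>2 * r powr (1 + \<beta>))"
      using r by (simp add: powr_add power2_eq_square power3_eq_cube)
    also have "\<dots> \<le> c' * 2 powr \<bar>\<beta>\<bar> * real CARD('n) * (R powr (2 - \<gamma>) * (h powr \<gamma> * (1 + r powr \<alpha>)\<^sup>2))"
      using norm_torus_le[OF h \<xi>] \<gamma> r h g(2) by (intro mult_left_mono gain_trade) (auto simp: r_def R_def)
    finally show ?thesis by (simp add: C_def r_def mult.assoc)
  qed
  have "consistent_symbol G0 \<alpha> \<gamma> d C"
    unfolding consistent_symbol_def using \<gamma> d C low con G0 C1_continuous[OF g(1)] by blast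
  then show ?thesis unfolding \<gamma>_def by blast
qed

lemma consistent_symbol_case_ii:
  fixes G0 :: "real ^ 'n \<Rightarrow> real"
  assumes "admissible_symbol (Case_ii \<alpha> \<beta>) G0"
  shows "\<exists>c C. consistent_symbol G0 \<alpha> (symbol_exponent (Case_ii \<alpha> \<beta>)) c C"
proof -
  have par: "1/2 < \<alpha>" "\<alpha> \<le> 1" "0 \<le> \<beta>" "1 + \<beta> < 2 * \<alpha>" using assms by auto
  obtain G1 g c c0 where G: "\<And>\<xi>. G0 \<xi> = norm \<xi> powr \<alpha> + G1 \<xi>" "\<And>\<xi>. 0 \<le> G1 \<xi>" "is_C1_gradient G1 g"
    and c: "c > 0" "c0 > 0" "\<And>\<xi>. c0 \<le> norm \<xi> \<Longrightarrow> norm (g \<xi>) \<le> c * norm \<xi> powr \<beta>"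
    using assms by auto
  define \<gamma> where "\<gamma> = symbol_exponent (Case_ii \<alpha> \<beta>)"
  have \<gamma>: "0 < \<gamma>" "\<gamma> \<le> \<alpha>" "\<gamma> \<le> 2" "\<gamma> + (1 + \<beta>) \<le> 2 * \<alpha>" "\<gamma> + 1 \<le> 2 * \<alpha>" "0 \<le> \<gamma> + (1 + \<beta>)" "0 \<le> \<gamma> + 1"
    using par by (auto simp: \<gamma>_def)
  \<comment> \<open>The hypothesis bounds the gradient only away from the origin; on the ball of
    radius c0 compactness does.\<close>
  obtain B where B: "B > 0" "\<And>z. norm z \<le> c0 \<Longrightarrow> norm (g z) \<le> B"
  proof -
    have "continuous_on (cball 0 c0) g"
      using G(3) unfolding is_C1_gradient_def by (blast intro: continuous_on_subset)
    then have "bounded (g ` cball 0 c0)"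
      by (intro compact_imp_bounded compact_continuous_image compact_cball)
    then obtain B where "B > 0" "\<forall>x\<in>g ` cball 0 c0. norm x \<le> B" unfolding bounded_pos by blast
    then show thesis using that[of B] by auto
  qed
  define D where "D = max B c"
  have D: "D > 0" "norm (g z) \<le> D * (1 + norm z powr \<beta>)" for z
  proof -
    show "D > 0" using B by (simp add: D_def less_max_iff_disj)
    show "norm (g z) \<le> D * (1 + norm z powr \<beta>)"
    proof (cases "norm z \<le> c0")
      case True
      have "norm (g z) \<le> D * 1" using B(2)[OF True] by (simp add: D_def)
      also have "\<dots> \<le> D * (1 + norm z powr \<beta>)" using \<open>D > 0\<close> by (intro mult_left_mono) auto
      finally show ?thesis .
    next
      case False
      have "norm (g z) \<le> c * norm z powr \<beta>" using False c(3)[of z] by simp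
      also have "\<dots> \<le> D * (1 + norm z powr \<beta>)" using c by (intro mult_mono) (auto simp: D_def)
      finally show ?thesis .
    qed
  qed
  define R where "R = pi * real CARD('n)"
  have R: "R > 0" by (simp add: R_def)
  define C where "C = real CARD('n) * R powr (2 - \<alpha>) + 2 * D * real CARD('n) * R powr (2 - \<gamma>)"
  have C: "C > 0" using R D by (simp add: C_def add_pos_pos)
  have con: "\<bar>G0 \<xi> - discrete_symbol G0 h \<xi>\<bar> \<le> C * (h powr \<gamma> * (1 + norm \<xi> powr \<alpha>)\<^sup>2)"
    if h: "0 < h" "h \<le> 1" and \<xi>: "\<xi> \<in> torus h" for h \<xi>
  proof -
    define r where "r = norm \<xi>"
    have r: "r \<ge> 0" by (simp add: r_def)
    let ?Q = "h powr \<gamma> * (1 + r powr \<alpha>)\<^sup>2"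
    have gb: "norm (g z) \<le> D * (1 + r powr \<beta>)" if z: "z \<in> closed_segment \<xi> (sine_point h \<xi>)" for z
    proof -
      have "norm z powr \<beta> \<le> r powr \<beta>"
        using sine_point_bounds(3)[OF h(1) \<xi> z] par by (intro powr_mono2) (auto simp: r_def)
      then have "D * (1 + norm z powr \<beta>) \<le> D * (1 + r powr \<beta>)" using D(1) by simp
      then show ?thesis using D(2)[of z] by linarith
    qed
    have "\<bar>G1 \<xi> - G1 (sine_point h \<xi>)\<bar> \<le> D * (1 + r powr \<beta>) * norm (\<xi> - sine_point h \<xi>)"
      by (rule gradient_bound[OF G(3) gb])
    also have "\<dots> \<le> D * (1 + r powr \<beta>) * (real CARD('n) * (h\<^sup>2 * r ^ 3))"
      using sine_point_bounds(1)[OF h(1) \<xi>] D by (intro mult_left_mono) (auto simp: r_def add_nonneg_nonneg)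
    \<comment> \<open>The gradient bound 1 + r^\<beta> leads to two trades, with s = 1 and s = 1 +
      \<beta>.\<close>
    also have "\<dots> = D * real CARD('n) * ((h * r)\<^sup>2 * r powr 1 + (h * r)\<^sup>2 * r powr (1 + \<beta>))"
      using r by (simp add: powr_add power2_eq_square power3_eq_cube algebra_simps)
    also have "\<dots> \<le> D * real CARD('n) * (R powr (2 - \<gamma>) * ?Q + R powr (2 - \<gamma>) * ?Q)"
      using norm_torus_le[OF h(1) \<xi>] \<gamma> r h D by (intro mult_left_mono add_mono gain_trade) (auto simp: r_def R_def)
    also have "\<dots> = 2 * D * real CARD('n) * R powr (2 - \<gamma>) * ?Q" by simp
    finally have 1: "\<bar>G1 \<xi> - G1 (sine_point h \<xi>)\<bar> \<le> 2 * D * real CARD('n) * R powr (2 - \<gamma>) * ?Q" .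
    \<comment> \<open>As h <= 1 and \<gamma> <= \<alpha>, the error h^\<alpha> of the singular part
      is dominated by h^\<gamma>.\<close>
    have "h powr \<alpha> \<le> h powr \<gamma>" using h \<gamma> by (intro powr_mono') auto
    then have hh: "h powr \<alpha> * (1 + r powr \<alpha>)\<^sup>2 \<le> ?Q" by (intro mult_right_mono) auto
    have "\<bar>r powr \<alpha> - norm (sine_point h \<xi>) powr \<alpha>\<bar> \<le> real CARD('n) * R powr (2 - \<alpha>) * (h powr \<alpha> * (1 + r powr \<alpha>)\<^sup>2)"
      unfolding r_def R_def using par by (intro norm_powr_symbol_bound h \<xi>) auto
    also have "\<dots> \<le> real CARD('n) * R powr (2 - \<alpha>) * ?Q" using hh by (intro mult_left_mono) auto
    finally have 2: "\<bar>r powr \<alpha> - norm (sine_point h \<xi>) powr \<alpha>\<bar> \<le> real CARD('n) * R powr (2 - \<alpha>) * ?Q" .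
    have "\<bar>G0 \<xi> - discrete_symbol G0 h \<xi>\<bar> \<le>
        \<bar>r powr \<alpha> - norm (sine_point h \<xi>) powr \<alpha>\<bar> + \<bar>G1 \<xi> - G1 (sine_point h \<xi>)\<bar>"
      unfolding discrete_symbol_sine_point G r_def by linarith
    also have "\<dots> \<le> C * ?Q" using 1 2 by (simp add: C_def distrib_right)
    finally show ?thesis by (simp add: r_def)
  qed
  have "G0 = (\<lambda>\<xi>. norm \<xi> powr \<alpha> + G1 \<xi>)" using G(1) by auto
  then have cont: "continuous_on UNIV G0"
    using par by (auto intro!: continuous_on_add continuous_on_norm_powr C1_continuous[OF G(3)])
  have "consistent_symbol G0 \<alpha> \<gamma> 1 C"
    unfolding consistent_symbol_def using \<gamma> C con cont G(1,2) by (auto simp: add_nonneg_nonneg)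
  then show ?thesis unfolding \<gamma>_def by blast
qed

lemma consistent_symbol_case_iii:
  fixes G0 :: "real ^ 'n \<Rightarrow> real"
  assumes "admissible_symbol (Case_iii \<alpha>) G0"
  shows "\<exists>c C. consistent_symbol G0 \<alpha> (symbol_exponent (Case_iii \<alpha>)) c C"
proof -
  have \<alpha>: "0 < \<alpha>" "\<alpha> \<le> 1" and G: "G0 = (\<lambda>\<xi>. norm \<xi> powr \<alpha>)" using assms by auto
  define C where "C = real CARD('n) * (pi * real CARD('n)) powr (2 - \<alpha>)"
  have C: "C > 0" by (simp add: C_def)
  have "continuous_on UNIV (\<lambda>\<xi> :: real ^ 'n. norm \<xi> powr \<alpha>)" using \<alpha> by (intro continuous_on_norm_powr)
  moreover have "\<bar>norm \<xi> powr \<alpha> - norm (sine_point h \<xi>) powr \<alpha>\<bar> \<le> C * (h powr \<alpha> * (1 + norm \<xi> powr \<alpha>)\<^sup>2)"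
    if "0 < h" "\<xi> \<in> torus h" for h and \<xi> :: "real ^ 'n"
    unfolding C_def by (rule norm_powr_symbol_bound[OF that \<alpha>])
  ultimately have "consistent_symbol G0 \<alpha> \<alpha> 1 C"
    unfolding consistent_symbol_def discrete_symbol_sine_point G using \<alpha> C by auto
  then show ?thesis by auto
qed

lemma admissible_symbol_consistent:
  fixes G0 :: "real ^ 'n \<Rightarrow> real"
  assumes "admissible_symbol p G0"
  obtains \<alpha> c C where "consistent_symbol G0 \<alpha> (symbol_exponent p) c C"
  using assms consistent_symbol_case_i consistent_symbol_case_ii consistent_symbol_case_iii
  by (cases p) blast+

section \<open>Resolvents of Schroedinger operators\<close>

text \<open>Common form of H and H_h: U is the Fourier transform into L2 of the frequency space N, a
  the symbol, v the potential. Properties of the resolvents are thus proved once for both.\<close>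

definition schroedinger ::
  "(('a \<Rightarrow> complex) \<times> ('b \<Rightarrow> complex)) set \<Rightarrow> 'a measure \<Rightarrow> 'b measure \<Rightarrow> ('b \<Rightarrow> real) \<Rightarrow> ('a \<Rightarrow> real) \<Rightarrow> 'a operator" where
  "schroedinger U M N a v = op_plus (U O mult_op N (\<lambda>\<xi>. complex_of_real (a \<xi>)) O U\<inverse>) (mult_op M (\<lambda>x. complex_of_real (v x)))"

lemma H_op_schroedinger: "H_op G V = schroedinger fourier lborel lborel G V"
  by (simp add: H_op_def H0_op_def schroedinger_def)

lemma Hh_op_schroedinger:
  "Hh_op G V h = schroedinger (discrete_fourier h) (grid_measure h) (torus_measure h) (discrete_symbol G h) (\<lambda>k. V (h *\<^sub>R vec_of_int k))"
  by (simp add: Hh_op_def H0h_op_def schroedinger_def)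

lemma op_plusE:
  assumes "(f, g) \<in> op_plus S T"
  obtains g1 k where "g = (\<lambda>x. g1 x + k x)" "(f, g1) \<in> S" "(f, k) \<in> T"
  using assms unfolding op_plus_def by blast

text \<open>Fixes the notation of the estimates: applied to u, the operator plus mu gives w, which
  splits into the kinetic part w0 and the potential part k. A and B are the transforms of u and w0,
  linked by the symbol.\<close>

lemma shifted_inverseE:
  assumes "(w, u) \<in> shifted_inverse M (schroedinger U M N a v) \<mu>"
  obtains A B w0 k where "(u, A) \<in> U" "(w0, B) \<in> U" "A \<in> L2 N" "B \<in> L2 N" "AE \<xi> in N. B \<xi> = complex_of_real (a \<xi>) * A \<xi>"
    "u \<in> L2 M" "k \<in> L2 M" "AE x in M. k x = complex_of_real (v x + \<mu>) * u x" "w = (\<lambda>x. w0 x + k x)"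
proof -
  have "(u, w) \<in> op_plus (schroedinger U M N a v) (mult_op M (\<lambda>_. complex_of_real \<mu>))"
    using assms by (simp add: shifted_inverse_def)
  then obtain s k2 where s: "w = (\<lambda>x. s x + k2 x)" "(u, s) \<in> schroedinger U M N a v"
    and k2: "(u, k2) \<in> mult_op M (\<lambda>_. complex_of_real \<mu>)"
    by (rule op_plusE)
  from s(2) obtain w0 k1 where "s = (\<lambda>x. w0 x + k1 x)"
    and w0: "(u, w0) \<in> U O mult_op N (\<lambda>\<xi>. complex_of_real (a \<xi>)) O U\<inverse>"
    and k1: "(u, k1) \<in> mult_op M (\<lambda>x. complex_of_real (v x))"
    unfolding schroedinger_def by (rule op_plusE)
  with s(1) have w: "w = (\<lambda>x. (w0 x + k1 x) + k2 x)" by simp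
  obtain A B where AB: "(u, A) \<in> U" "(w0, B) \<in> U" "(A, B) \<in> mult_op N (\<lambda>\<xi>. complex_of_real (a \<xi>))"
    using w0 by auto
  show thesis
  proof (rule that[of A w0 B "\<lambda>x. k1 x + k2 x"])
    show "AE x in M. k1 x + k2 x = complex_of_real (v x + \<mu>) * u x"
    proof -
      have "AE x in M. k1 x = complex_of_real (v x) * u x" "AE x in M. k2 x = complex_of_real \<mu> * u x"
        using k1 k2 by (auto simp: mult_op_def)
      then show ?thesis by eventually_elim (simp add: distrib_right)
    qed
    show "w = (\<lambda>x. w0 x + (k1 x + k2 x))" by (simp add: w add.assoc)
  qed (use AB k1 k2 in \<open>auto simp: mult_op_def L2_add\<close>)
qed

lemma shifted_inverseI:
  assumes "(u, A) \<in> U" "(w0, B) \<in> U" "A \<in> L2 N" "B \<in> L2 N" "AE \<xi> in N. B \<xi> = complex_of_real (a \<xi>) * A \<xi>"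
    "u \<in> L2 M" "k \<in> L2 M" "AE x in M. k x = complex_of_real (v x + \<mu>) * u x"
  shows "(\<lambda>x. w0 x + k x, u) \<in> shifted_inverse M (schroedinger U M N a v) \<mu>"
proof -
  let ?k2 = "\<lambda>x. complex_of_real \<mu> * u x" and ?k1 = "\<lambda>x. k x - complex_of_real \<mu> * u x"
  have 1: "(u, w0) \<in> U O mult_op N (\<lambda>\<xi>. complex_of_real (a \<xi>)) O U\<inverse>"
    using assms by (auto simp: mult_op_def)
  have "AE x in M. ?k1 x = complex_of_real (v x) * u x"
    using assms(8) by eventually_elim (simp add: algebra_simps)
  then have 2: "(u, ?k1) \<in> mult_op M (\<lambda>x. complex_of_real (v x))"
    using assms by (simp add: mult_op_def L2_diff L2_scale)
  have 3: "(u, ?k2) \<in> mult_op M (\<lambda>_. complex_of_real \<mu>)"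
    using assms by (simp add: mult_op_def L2_scale)
  have "(u, \<lambda>x. w0 x + ?k1 x) \<in> schroedinger U M N a v"
    unfolding schroedinger_def op_plus_def using 1 2
    by (intro CollectI exI[of _ u] exI[of _ w0] exI[of _ ?k1] conjI) auto
  then have "(u, \<lambda>x. (w0 x + ?k1 x) + ?k2 x) \<in> op_plus (schroedinger U M N a v) (mult_op M (\<lambda>_. complex_of_real \<mu>))"
    unfolding op_plus_def[of "schroedinger U M N a v"] using 3
    by (intro CollectI exI[of _ u] exI[of _ "\<lambda>x. w0 x + ?k1 x"] exI[of _ ?k2] conjI) auto
  then show ?thesis by (simp add: shifted_inverse_def)
qed

lemma L2_inner_cong_right:
  assumes "f \<in> L2 M" "g \<in> L2 M" "g' \<in> L2 M" "AE x in M. g x = g' x"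
  shows "L2_inner M f g = L2_inner M f g'"
  by (rule L2_inner_cong_AE) (use assms in \<open>auto simp: L2_def\<close>)

lemma inner_real_mult_commute:
  assumes "AE x in M. k x = complex_of_real (a x) * f x" "AE x in M. k' x = complex_of_real (a x) * f' x"
    and "f \<in> L2 M" "k \<in> L2 M" "f' \<in> L2 M" "k' \<in> L2 M"
  shows "L2_inner M f k' = L2_inner M k f'"
  unfolding L2_inner_def
proof (rule integral_cong_AE)
  have [measurable]: "f \<in> borel_measurable M" "k \<in> borel_measurable M" "f' \<in> borel_measurable M" "k' \<in> borel_measurable M"
    using assms by (auto simp: L2_def)
  show "(\<lambda>x. cnj (f x) * k' x) \<in> borel_measurable M" "(\<lambda>x. cnj (k x) * f' x) \<in> borel_measurable M"
    by measurable
  show "AE x in M. cnj (f x) * k' x = cnj (k x) * f' x"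
    using assms(1,2) by eventually_elim simp
qed

text \<open>Boundedness is the assumption on the resolvent set. Symmetry comes from the symbol and
  the potential being real, the former carried over by the isometry.\<close>

lemma bounded_symmetric_graph_shifted_inverse:
  assumes U: "L2_isometry M N U" and res: "complex_of_real (- \<mu>) \<in> resolvent_set M (schroedinger U M N a v)"
  shows "bounded_symmetric_graph M (shifted_inverse M (schroedinger U M N a v) \<mu>)"
  unfolding bounded_symmetric_graph_def
proof (intro conjI)
  let ?R = "shifted_inverse M (schroedinger U M N a v) \<mu>"
  show "?R \<subseteq> L2 M \<times> L2 M"
  proof clarify
    fix w u assume "(w, u) \<in> ?R"
    then show "w \<in> L2 M \<and> u \<in> L2 M"
      by (rule shifted_inverseE) (use isometry_L2(1)[OF U] in \<open>auto intro: L2_add\<close>)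
  qed
  show "bounded_everywhere M ?R" using res by (simp add: resolvent_set_def shifted_inverse_def)
  show "\<forall>(w, u)\<in>?R. \<forall>(w', u')\<in>?R. L2_inner M w u' = L2_inner M u w'"
  proof clarify
    fix w u w' u' assume "(w, u) \<in> ?R" "(w', u') \<in> ?R"
    then obtain A B w0 k A' B' w0' k' where
      1: "(u, A) \<in> U" "(w0, B) \<in> U" "A \<in> L2 N" "B \<in> L2 N" "AE \<xi> in N. B \<xi> = complex_of_real (a \<xi>) * A \<xi>"
        "u \<in> L2 M" "k \<in> L2 M" "AE x in M. k x = complex_of_real (v x + \<mu>) * u x" "w = (\<lambda>x. w0 x + k x)" and
      2: "(u', A') \<in> U" "(w0', B') \<in> U" "A' \<in> L2 N" "B' \<in> L2 N" "AE \<xi> in N. B' \<xi> = complex_of_real (a \<xi>) * A' \<xi>"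
        "u' \<in> L2 M" "k' \<in> L2 M" "AE x in M. k' x = complex_of_real (v x + \<mu>) * u' x" "w' = (\<lambda>x. w0' x + k' x)"
      by (elim shifted_inverseE) blast
    note L = isometry_L2(1)[OF U 1(2)] isometry_L2(1)[OF U 2(2)]
    have "L2_inner M u w0' = L2_inner M w0 u'"
      using inner_real_mult_commute[OF 1(5) 2(5) 1(3,4) 2(3,4)]
        isometry_inner[OF U 1(1) 2(2)] isometry_inner[OF U 1(2) 2(1)] by simp
    moreover have "L2_inner M u k' = L2_inner M k u'"
      by (rule inner_real_mult_commute[OF 1(8) 2(8) 1(6,7) 2(6,7)])
    ultimately show "L2_inner M w u' = L2_inner M u w'"
      unfolding 1(9) 2(9) using L 1 2 by (simp add: L2_inner_add_left L2_inner_add_right)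
  qed
qed

section \<open>Comparison of the spectra for a fixed mesh size\<close>

text \<open>One number \<delta> measures all errors: of the symbol, of the frequencies beyond the
  torus, of the mass lost by J and of the sampled potential. m is the Fourier multiplier of J on the
  torus, b a test function at high frequencies, K a bound of the resolvent of H. The constants built
  below depend only on vb, mu, K and m0, which makes the final estimate uniform in h.\<close>

locale discretization =
  fixes G V :: "real ^ 'n \<Rightarrow> real" and \<mu> h \<delta> vb m0 K :: real
    and J :: "((int ^ 'n \<Rightarrow> complex) \<times> (real ^ 'n \<Rightarrow> complex)) set" and m :: "real ^ 'n \<Rightarrow> real"
    and b :: "real ^ 'n \<Rightarrow> complex"
  assumes h: "h > 0" and \<delta>: "\<delta> > 0" and \<mu>: "\<mu> > 0" and m0: "0 < m0" and vb: "0 \<le> vb" and K: "0 \<le> K"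
    and G_nonneg: "\<And>\<xi>. 0 \<le> G \<xi>"
    and consistency: "\<And>\<xi>. \<xi> \<in> torus h \<Longrightarrow> \<bar>G \<xi> - discrete_symbol G h \<xi>\<bar> \<le> \<delta> * ((1 + G \<xi>) * (1 + discrete_symbol G h \<xi>))"
    and high_freq: "\<And>\<xi>. \<xi> \<notin> torus h \<Longrightarrow> 1 \<le> \<delta> * (1 + G \<xi>)"
    and m_bounds: "\<And>\<xi>. \<xi> \<in> torus h \<Longrightarrow> m0 \<le> m \<xi>" "\<And>\<xi>. \<xi> \<in> torus h \<Longrightarrow> m \<xi> \<le> 1"
      "\<And>\<xi>. \<xi> \<in> torus h \<Longrightarrow> 1 - (m \<xi>)\<^sup>2 \<le> (\<delta> * (1 + discrete_symbol G h \<xi>))\<^sup>2"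
    and V_meas: "V \<in> borel_measurable borel" and V_bound: "\<And>x. \<bar>V x\<bar> \<le> vb"
    and J_iso: "L2_isometry (grid_measure h) lborel J"
    and J_fourier: "\<And>u p P Q. (u, p) \<in> J \<Longrightarrow> (p, P) \<in> fourier \<Longrightarrow> (u, Q) \<in> discrete_fourier h \<Longrightarrow>
        AE \<xi> in lborel. \<xi> \<in> torus h \<longrightarrow> P \<xi> = complex_of_real (m \<xi>) * Q \<xi>"
    and J_potential: "\<And>u p q. (u, p) \<in> J \<Longrightarrow> (\<lambda>k. complex_of_real (V (h *\<^sub>R vec_of_int k)) * u k, q) \<in> J \<Longrightarrow>
        L2_norm lborel (\<lambda>x. complex_of_real (V x) * p x - q x) \<le> \<delta> * L2_norm (grid_measure h) u"
    and b: "b \<in> L2 (torus_measure h)" "0 < L2_norm (torus_measure h) b"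
      "(\<lambda>\<xi>. complex_of_real (discrete_symbol G h \<xi>) * b \<xi>) \<in> L2 (torus_measure h)"
      "\<And>\<xi>. \<xi> \<in> torus h \<Longrightarrow> b \<xi> \<noteq> 0 \<Longrightarrow> 1 \<le> \<delta> * (1 + discrete_symbol G h \<xi>)"
    and res: "complex_of_real (- \<mu>) \<in> resolvent_set lborel (H_op G V)"
      "complex_of_real (- \<mu>) \<in> resolvent_set (grid_measure h) (Hh_op G V h)"
    and K_bound: "\<And>g \<phi>. (g, \<phi>) \<in> shifted_inverse lborel (H_op G V) \<mu> \<Longrightarrow> L2_norm lborel \<phi> \<le> K * L2_norm lborel g"
begin

abbreviation "R \<equiv> shifted_inverse lborel (H_op G V) \<mu>"
abbreviation "Rh \<equiv> shifted_inverse (grid_measure h) (Hh_op G V h) \<mu>"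
abbreviation "Gh \<equiv> discrete_symbol G h"
abbreviation "ind \<equiv> \<lambda>f \<xi>. indicator (torus h) \<xi> * f \<xi> :: complex"
abbreviation "out \<equiv> \<lambda>f \<xi>. f \<xi> - indicator (torus h) \<xi> * f \<xi> :: complex"

lemmas F_iso = L2_isometry_fourier
lemmas Fh_iso = L2_isometry_discrete_fourier[OF h]

lemma Gh_nonneg: "0 \<le> Gh \<xi>"
  by (simp add: discrete_symbol_sine_point G_nonneg)

lemma R_sym: "bounded_symmetric_graph lborel R"
  using res(1) unfolding H_op_schroedinger by (rule bounded_symmetric_graph_shifted_inverse[OF F_iso])

lemma Rh_sym: "bounded_symmetric_graph (grid_measure h) Rh"
  using res(2) unfolding Hh_op_schroedinger by (rule bounded_symmetric_graph_shifted_inverse[OF Fh_iso])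

lemma L2_ind: "f \<in> L2 (torus_measure h) \<Longrightarrow> ind f \<in> L2 lborel"
  by (simp add: L2_torus)

lemma L2_out: "f \<in> L2 lborel \<Longrightarrow> out f \<in> L2 lborel"
  by (intro L2_diff L2_ind L2_restrict_torus)

lemma norm_split_sq:
  assumes f: "f \<in> L2 lborel"
  shows "(L2_norm lborel f)\<^sup>2 = (L2_norm lborel (ind f))\<^sup>2 + (L2_norm lborel (out f))\<^sup>2"
proof -
  have "(cmod (f \<xi>))\<^sup>2 = (cmod (ind f \<xi>))\<^sup>2 + (cmod (out f \<xi>))\<^sup>2" for \<xi>
    by (simp add: indicator_def)
  then show ?thesis
    unfolding L2_norm_sq
    using L2_D(2)[OF L2_ind[OF L2_restrict_torus[OF f]]] L2_D(2)[OF L2_out[OF f]] by simp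
qed

lemma norm_out_le:
  assumes "f \<in> L2 lborel"
  shows "L2_norm lborel (out f) \<le> L2_norm lborel f"
proof (rule power2_le_imp_le)
  have "0 \<le> (L2_norm lborel (ind f))\<^sup>2" by simp
  with norm_split_sq[OF assms] show "(L2_norm lborel (out f))\<^sup>2 \<le> (L2_norm lborel f)\<^sup>2" by linarith
qed simp

text \<open>Conservation of mass: J and both Fourier transforms are isometric, so what P has outside
  the torus is what it lacks inside, namely (1 - m^2) |A|^2 at each frequency. The weight 1 + G_h in
  A + B pays for it.\<close>

lemma out_embedding_le:
  assumes u: "(u, p) \<in> J" "(p, P) \<in> fourier" "(u, A) \<in> discrete_fourier h"
    and w: "B \<in> L2 (torus_measure h)" "AE \<xi> in torus_measure h. B \<xi> = complex_of_real (Gh \<xi>) * A \<xi>"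
  shows "L2_norm lborel (out P) \<le> \<delta> * L2_norm lborel (ind (\<lambda>\<xi>. A \<xi> + B \<xi>))"
proof (rule power2_le_imp_le)
  note AL = isometry_L2(2)[OF Fh_iso u(3)] and PL = isometry_L2(2)[OF F_iso u(2)]
  have Y: "ind (\<lambda>\<xi>. A \<xi> + B \<xi>) \<in> L2 lborel" by (intro L2_ind L2_add AL w)
  have "(L2_norm lborel P)\<^sup>2 = (L2_norm lborel (ind A))\<^sup>2"
    using isometry_norm[OF F_iso u(2)] isometry_norm[OF J_iso u(1)] isometry_norm[OF Fh_iso u(3)]
    by (simp add: L2_torus)
  then have "(L2_norm lborel (out P))\<^sup>2 = (L2_norm lborel (ind A))\<^sup>2 - (L2_norm lborel (ind P))\<^sup>2"
    using norm_split_sq[OF PL] by simp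
  also have "\<dots> = (\<integral>\<xi>. (cmod (ind A \<xi>))\<^sup>2 - (cmod (ind P \<xi>))\<^sup>2 \<partial>lborel)"
    unfolding L2_norm_sq
    using L2_D(2)[OF L2_ind[OF AL]] L2_D(2)[OF L2_ind[OF L2_restrict_torus[OF PL]]] by simp
  also have "\<dots> \<le> (\<integral>\<xi>. \<delta>\<^sup>2 * (cmod (ind (\<lambda>\<xi>. A \<xi> + B \<xi>) \<xi>))\<^sup>2 \<partial>lborel)"
  proof (rule integral_mono_AE)
    show "integrable lborel (\<lambda>\<xi>. (cmod (ind A \<xi>))\<^sup>2 - (cmod (ind P \<xi>))\<^sup>2)"
      using L2_D(2)[OF L2_ind[OF AL]] L2_D(2)[OF L2_ind[OF L2_restrict_torus[OF PL]]] by simp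
    show "integrable lborel (\<lambda>\<xi>. \<delta>\<^sup>2 * (cmod (ind (\<lambda>\<xi>. A \<xi> + B \<xi>) \<xi>))\<^sup>2)"
      using L2_D(2)[OF Y] by simp
    show "AE \<xi> in lborel. (cmod (ind A \<xi>))\<^sup>2 - (cmod (ind P \<xi>))\<^sup>2 \<le> \<delta>\<^sup>2 * (cmod (ind (\<lambda>\<xi>. A \<xi> + B \<xi>) \<xi>))\<^sup>2"
      using J_fourier[OF u] w(2)[unfolded AE_torus]
    proof eventually_elim
      case (elim \<xi>)
      show ?case
      proof (cases "\<xi> \<in> torus h")
        case True
        have "A \<xi> + B \<xi> = complex_of_real (1 + Gh \<xi>) * A \<xi>" using elim True by (simp add: algebra_simps)
        then have ab: "cmod (A \<xi> + B \<xi>) = (1 + Gh \<xi>) * cmod (A \<xi>)"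
          using Gh_nonneg[of \<xi>] by (simp add: norm_mult del: of_real_add)
        have "(cmod (A \<xi>))\<^sup>2 - (cmod (P \<xi>))\<^sup>2 = (1 - (m \<xi>)\<^sup>2) * (cmod (A \<xi>))\<^sup>2"
          using elim True by (simp add: norm_mult power_mult_distrib algebra_simps)
        also have "\<dots> \<le> (\<delta> * (1 + Gh \<xi>))\<^sup>2 * (cmod (A \<xi>))\<^sup>2"
          by (intro mult_right_mono m_bounds True) simp
        also have "\<dots> = \<delta>\<^sup>2 * (cmod (A \<xi> + B \<xi>))\<^sup>2" unfolding ab by (simp add: power_mult_distrib)
        finally show ?thesis using True by simp
      qed simp
    qed
  qed
  also have "\<dots> = (\<delta> * L2_norm lborel (ind (\<lambda>\<xi>. A \<xi> + B \<xi>)))\<^sup>2"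
    by (simp add: L2_norm_sq power_mult_distrib)
  finally show "(L2_norm lborel (out P))\<^sup>2 \<le> (\<delta> * L2_norm lborel (ind (\<lambda>\<xi>. A \<xi> + B \<xi>)))\<^sup>2" .
qed (use \<delta> in simp)

text \<open>Inside the torus the integrand on the Fourier side is m (G - G_h) times A' and the
  conjugate of A, absorbed by the weights 1 + G in A + B and 1 + G_h in A' + B'. Outside, P is small
  by \<open>out_embedding_le\<close>, and A is small against A + B because 1 + G is large. Each of
  these three contributions costs one \<delta>.\<close>

lemma kinetic_estimate:
  assumes \<phi>: "(\<phi>, A) \<in> fourier" "(g0, B) \<in> fourier" "AE \<xi> in lborel. B \<xi> = complex_of_real (G \<xi>) * A \<xi>"
    and u: "(u, A') \<in> discrete_fourier h" "(w0, B') \<in> discrete_fourier h"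
      "AE \<xi> in torus_measure h. B' \<xi> = complex_of_real (Gh \<xi>) * A' \<xi>"
    and p: "(u, p) \<in> J" "(w0, q) \<in> J"
  shows "cmod (L2_inner lborel g0 p - L2_inner lborel \<phi> q) \<le>
    3 * \<delta> * ((L2_norm lborel \<phi> + L2_norm lborel g0) * (L2_norm (grid_measure h) u + L2_norm (grid_measure h) w0))"
proof -
  obtain P where P: "(p, P) \<in> fourier" using isometry_total[OF F_iso isometry_L2(2)[OF J_iso p(1)]] by blast
  obtain Q where Q: "(q, Q) \<in> fourier" using isometry_total[OF F_iso isometry_L2(2)[OF J_iso p(2)]] by blast
  note L = isometry_L2(2)[OF F_iso \<phi>(1)] isometry_L2(2)[OF F_iso \<phi>(2)] isometry_L2(2)[OF F_iso P] isometry_L2(2)[OF F_iso Q]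
    isometry_L2(2)[OF Fh_iso u(1)] isometry_L2(2)[OF Fh_iso u(2)]
  let ?X = "\<lambda>\<xi>. A \<xi> + B \<xi>" and ?Y = "ind (\<lambda>\<xi>. A' \<xi> + B' \<xi>)"
  have X: "?X \<in> L2 lborel" by (intro L2_add L)
  have Y: "?Y \<in> L2 lborel" by (intro L2_ind L2_add L)
  define NX where "NX = L2_norm lborel \<phi> + L2_norm lborel g0"
  define NY where "NY = L2_norm (grid_measure h) u + L2_norm (grid_measure h) w0"
  have N0: "0 \<le> NX" "0 \<le> NY" by (simp_all add: NX_def NY_def)
  have nX: "L2_norm lborel ?X \<le> NX"
    using L2_norm_triangle[OF L(1,2)] isometry_norm[OF F_iso \<phi>(1)] isometry_norm[OF F_iso \<phi>(2)] by (simp add: NX_def)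
  have "L2_norm (torus_measure h) (\<lambda>\<xi>. A' \<xi> + B' \<xi>) \<le> NY"
    using L2_norm_triangle[OF L(5,6)] isometry_norm[OF Fh_iso u(1)] isometry_norm[OF Fh_iso u(2)] by (simp add: NY_def)
  then have nY: "L2_norm lborel ?Y \<le> NY" by (simp only: L2_torus)
  have nP: "L2_norm lborel (out P) \<le> \<delta> * NY"
    using out_embedding_le[OF p(1) P u(1) L(6) u(3)] mult_left_mono[OF nY, of \<delta>] \<delta> by linarith
  have nQ: "L2_norm lborel (out Q) \<le> NY"
    using norm_out_le[OF L(4)] isometry_norm[OF F_iso Q] isometry_norm[OF J_iso p(2)]
      L2_norm_nonneg[of "grid_measure h" u] unfolding NY_def by linarith
  have oP: "out P \<in> L2 lborel" and oQ: "out Q \<in> L2 lborel" by (intro L2_out L)+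
  have ii: "integrable lborel (\<lambda>\<xi>. cmod (f \<xi>) * cmod (g \<xi>))" if "f \<in> L2 lborel" "g \<in> L2 lborel" for f g :: "real ^ 'n \<Rightarrow> complex"
    using integrable_norm[OF integrable_L2_mult[OF that]] by (simp add: norm_mult)
  have "L2_inner lborel g0 p - L2_inner lborel \<phi> q = L2_inner lborel B P - L2_inner lborel A Q"
    using isometry_inner[OF F_iso \<phi>(2) P] isometry_inner[OF F_iso \<phi>(1) Q] by simp
  also have "\<dots> = (\<integral>\<xi>. cnj (B \<xi>) * P \<xi> - cnj (A \<xi>) * Q \<xi> \<partial>lborel)"
    unfolding L2_inner_def using integrable_cnj_L2_mult[OF L(2,3)] integrable_cnj_L2_mult[OF L(1,4)] by simp
  finally have "cmod (L2_inner lborel g0 p - L2_inner lborel \<phi> q) \<le> (\<integral>\<xi>. cmod (cnj (B \<xi>) * P \<xi> - cnj (A \<xi>) * Q \<xi>) \<partial>lborel)"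
    by (simp add: integral_norm_bound)
  also have "\<dots> \<le> (\<integral>\<xi>. \<delta> * (cmod (?X \<xi>) * cmod (?Y \<xi>)) + cmod (?X \<xi>) * cmod (out P \<xi>) + \<delta> * (cmod (?X \<xi>) * cmod (out Q \<xi>)) \<partial>lborel)"
  proof (rule integral_mono_AE)
    show "integrable lborel (\<lambda>\<xi>. cmod (cnj (B \<xi>) * P \<xi> - cnj (A \<xi>) * Q \<xi>))"
      using integrable_cnj_L2_mult[OF L(2,3)] integrable_cnj_L2_mult[OF L(1,4)] by simp
    show "integrable lborel (\<lambda>\<xi>. \<delta> * (cmod (?X \<xi>) * cmod (?Y \<xi>)) + cmod (?X \<xi>) * cmod (out P \<xi>) + \<delta> * (cmod (?X \<xi>) * cmod (out Q \<xi>)))"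
      by (intro Bochner_Integration.integrable_add integrable_mult_right ii X Y oP oQ)
    show "AE \<xi> in lborel. cmod (cnj (B \<xi>) * P \<xi> - cnj (A \<xi>) * Q \<xi>) \<le>
        \<delta> * (cmod (?X \<xi>) * cmod (?Y \<xi>)) + cmod (?X \<xi>) * cmod (out P \<xi>) + \<delta> * (cmod (?X \<xi>) * cmod (out Q \<xi>))"
      using J_fourier[OF p(1) P u(1)] J_fourier[OF p(2) Q u(2)] u(3)[unfolded AE_torus] \<phi>(3)
    proof eventually_elim
      case (elim \<xi>)
      have "?X \<xi> = complex_of_real (1 + G \<xi>) * A \<xi>" using elim(4) by (simp add: algebra_simps)
      then have x: "cmod (?X \<xi>) = (1 + G \<xi>) * cmod (A \<xi>)"
        using G_nonneg[of \<xi>] by (simp add: norm_mult del: of_real_add)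
      show ?case
      proof (cases "\<xi> \<in> torus h")
        case True
        have e: "P \<xi> = complex_of_real (m \<xi>) * A' \<xi>" "Q \<xi> = complex_of_real (m \<xi>) * (complex_of_real (Gh \<xi>) * A' \<xi>)"
          "B' \<xi> = complex_of_real (Gh \<xi>) * A' \<xi>" using elim True by auto
        have "A' \<xi> + B' \<xi> = complex_of_real (1 + Gh \<xi>) * A' \<xi>" using e by (simp add: algebra_simps)
        then have y: "cmod (A' \<xi> + B' \<xi>) = (1 + Gh \<xi>) * cmod (A' \<xi>)"
          using Gh_nonneg[of \<xi>] by (simp add: norm_mult del: of_real_add)
        have "cnj (B \<xi>) * P \<xi> - cnj (A \<xi>) * Q \<xi> = complex_of_real (m \<xi> * (G \<xi> - Gh \<xi>)) * (cnj (A \<xi>) * A' \<xi>)"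
          unfolding e elim(4) by (simp add: algebra_simps)
        then have "cmod (cnj (B \<xi>) * P \<xi> - cnj (A \<xi>) * Q \<xi>) = (\<bar>m \<xi>\<bar> * \<bar>G \<xi> - Gh \<xi>\<bar>) * (cmod (A \<xi>) * cmod (A' \<xi>))"
          by (simp only: norm_mult norm_of_real abs_mult complex_mod_cnj)
        also have "\<dots> \<le> (1 * (\<delta> * ((1 + G \<xi>) * (1 + Gh \<xi>)))) * (cmod (A \<xi>) * cmod (A' \<xi>))"
          using m_bounds(1,2)[OF True] m0 consistency[OF True] by (intro mult_right_mono mult_mono) auto
        also have "\<dots> = \<delta> * (cmod (?X \<xi>) * cmod (A' \<xi> + B' \<xi>))" unfolding x y by (simp add: mult_ac)
        finally show ?thesis using True by simp
      next
        case False
        have a: "cmod (A \<xi>) \<le> \<delta> * cmod (?X \<xi>)"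
          using mult_right_mono[OF high_freq[OF False], of "cmod (A \<xi>)"] unfolding x by (simp add: mult_ac)
        have b: "cmod (B \<xi>) \<le> cmod (?X \<xi>)"
        proof -
          have "cmod (B \<xi>) = G \<xi> * cmod (A \<xi>)" unfolding elim(4) using G_nonneg[of \<xi>] by (simp add: norm_mult)
          also have "\<dots> \<le> (1 + G \<xi>) * cmod (A \<xi>)" by (intro mult_right_mono) auto
          finally show ?thesis unfolding x .
        qed
        have "cmod (cnj (B \<xi>) * P \<xi> - cnj (A \<xi>) * Q \<xi>) \<le> cmod (B \<xi>) * cmod (P \<xi>) + cmod (A \<xi>) * cmod (Q \<xi>)"
          using norm_triangle_ineq4[of "cnj (B \<xi>) * P \<xi>" "cnj (A \<xi>) * Q \<xi>"] by (simp add: norm_mult)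
        also have "\<dots> \<le> cmod (?X \<xi>) * cmod (P \<xi>) + (\<delta> * cmod (?X \<xi>)) * cmod (Q \<xi>)"
          by (intro add_mono mult_right_mono a b) auto
        finally show ?thesis using False by (simp add: mult.assoc)
      qed
    qed
  qed
  also have "\<dots> = \<delta> * (\<integral>\<xi>. cmod (?X \<xi>) * cmod (?Y \<xi>) \<partial>lborel) + (\<integral>\<xi>. cmod (?X \<xi>) * cmod (out P \<xi>) \<partial>lborel) +
      \<delta> * (\<integral>\<xi>. cmod (?X \<xi>) * cmod (out Q \<xi>) \<partial>lborel)"
    using ii[OF X Y] ii[OF X oP] ii[OF X oQ] by simp
  also have "\<dots> \<le> \<delta> * (NX * NY) + NX * (\<delta> * NY) + \<delta> * (NX * NY)"
  proof (intro add_mono mult_left_mono)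
    show "(\<integral>\<xi>. cmod (?X \<xi>) * cmod (?Y \<xi>) \<partial>lborel) \<le> NX * NY"
      by (rule order_trans[OF integral_mult_le_sqrt[OF X Y]]) (intro mult_mono nX nY N0 L2_norm_nonneg)
    show "(\<integral>\<xi>. cmod (?X \<xi>) * cmod (out P \<xi>) \<partial>lborel) \<le> NX * (\<delta> * NY)"
      by (rule order_trans[OF integral_mult_le_sqrt[OF X oP]]) (intro mult_mono nX nP N0 L2_norm_nonneg)
    show "(\<integral>\<xi>. cmod (?X \<xi>) * cmod (out Q \<xi>) \<partial>lborel) \<le> NX * NY"
      by (rule order_trans[OF integral_mult_le_sqrt[OF X oQ]]) (intro mult_mono nX nQ N0 L2_norm_nonneg)
  qed (use \<delta> in auto)
  also have "\<dots> = 3 * \<delta> * (NX * NY)" by simp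
  finally show ?thesis unfolding NX_def NY_def .
qed

text \<open>Chosen so that |\<phi>| + |g0| <= |g| + M1 |\<phi>|: recovering the kinetic part g0 = g
  - k costs vb + mu, and \<phi> itself costs 1.\<close>

definition "M1 = vb + \<mu> + 1"

lemma M1: "M1 \<ge> 1"
  using vb \<mu> by (simp add: M1_def)

lemma potential_bound:
  assumes "f \<in> L2 M" "k \<in> L2 M" "AE x in M. k x = complex_of_real (v x + \<mu>) * f x" "\<And>x. \<bar>v x\<bar> \<le> vb"
  shows "L2_norm M k \<le> (vb + \<mu>) * L2_norm M f"
proof -
  have b: "\<bar>v x + \<mu>\<bar> \<le> vb + \<mu>" for x using assms(4)[of x] \<mu> by linarith
  have "L2_norm M k \<le> L2_norm M (\<lambda>x. complex_of_real (vb + \<mu>) * f x)"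
  proof (rule L2_norm_mono_AE)
    show "AE x in M. cmod (k x) \<le> cmod (complex_of_real (vb + \<mu>) * f x)"
      using assms(3)
    proof eventually_elim
      case (elim x)
      have "\<bar>v x + \<mu>\<bar> * cmod (f x) \<le> \<bar>vb + \<mu>\<bar> * cmod (f x)" using b[of x] by (intro mult_right_mono) auto
      then show ?case unfolding elim norm_mult norm_of_real .
    qed
    show "k \<in> borel_measurable M" by (rule L2_D(1)[OF assms(2)])
    show "(\<lambda>x. complex_of_real (vb + \<mu>) * f x) \<in> L2 M" by (rule L2_scale[OF assms(1)])
  qed
  also have "\<dots> = (vb + \<mu>) * L2_norm M f"
    using vb \<mu> by (simp del: of_real_add)
  finally show ?thesis .
qed

text \<open>The contributions of mu cancel since J is linear, and the potential leaves only its
  commutator with J, bounded by \<open>J_potential\<close>. This adds one \<delta> to the three of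
  \<open>kinetic_estimate\<close>.\<close>

lemma core_estimate:
  assumes R: "(g, \<phi>) \<in> R" and Rh: "(w, u) \<in> Rh" and p: "(u, p) \<in> J" and q: "(w, q) \<in> J"
  shows "cmod (L2_inner lborel g p - L2_inner lborel \<phi> q) \<le>
    4 * \<delta> * ((L2_norm lborel g + M1 * L2_norm lborel \<phi>) * (L2_norm (grid_measure h) w + M1 * L2_norm (grid_measure h) u))"
proof -
  let ?Vh = "\<lambda>n. V (h *\<^sub>R vec_of_int n)"
  from R obtain A B g0 k where
    1: "(\<phi>, A) \<in> fourier" "(g0, B) \<in> fourier" "A \<in> L2 lborel" "B \<in> L2 lborel" "AE \<xi> in lborel. B \<xi> = complex_of_real (G \<xi>) * A \<xi>"
      "\<phi> \<in> L2 lborel" "k \<in> L2 lborel" "AE x in lborel. k x = complex_of_real (V x + \<mu>) * \<phi> x" "g = (\<lambda>x. g0 x + k x)"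
    unfolding H_op_schroedinger by (rule shifted_inverseE)
  from Rh obtain A' B' w0 k' where
    2: "(u, A') \<in> discrete_fourier h" "(w0, B') \<in> discrete_fourier h" "A' \<in> L2 (torus_measure h)" "B' \<in> L2 (torus_measure h)"
      "AE \<xi> in torus_measure h. B' \<xi> = complex_of_real (Gh \<xi>) * A' \<xi>"
      "u \<in> L2 (grid_measure h)" "k' \<in> L2 (grid_measure h)" "AE n in grid_measure h. k' n = complex_of_real (?Vh n + \<mu>) * u n"
      "w = (\<lambda>n. w0 n + k' n)"
    unfolding Hh_op_schroedinger by (rule shifted_inverseE)
  have g0L: "g0 \<in> L2 lborel" by (rule isometry_L2(1)[OF F_iso 1(2)])
  have w0L: "w0 \<in> L2 (grid_measure h)" by (rule isometry_L2(1)[OF Fh_iso 2(2)])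
  have pL: "p \<in> L2 lborel" and qL: "q \<in> L2 lborel" by (rule isometry_L2(2)[OF J_iso p] isometry_L2(2)[OF J_iso q])+
  define kv where "kv n = complex_of_real (?Vh n) * u n" for n
  have kvL: "kv \<in> L2 (grid_measure h)"
    by (rule L2_bound[OF 2(6), where K = vb]) (auto simp: kv_def norm_mult V_bound mult_right_mono grid_measure_def)
  obtain q0 where q0: "(w0, q0) \<in> J" using isometry_total[OF J_iso w0L] by blast
  obtain qv where qv: "(kv, qv) \<in> J" using isometry_total[OF J_iso kvL] by blast
  have q0L: "q0 \<in> L2 lborel" and qvL: "qv \<in> L2 lborel" by (rule isometry_L2(2)[OF J_iso q0] isometry_L2(2)[OF J_iso qv])+
  \<comment> \<open>q is an arbitrary image of w; linearity of J splits it, almost everywhere, into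
    the images of the kinetic, the potential and the mu part.\<close>
  have sum: "(\<lambda>n. w0 n + (kv n + complex_of_real \<mu> * u n), \<lambda>x. q0 x + (qv x + complex_of_real \<mu> * p x)) \<in> J"
    by (intro isometry_add[OF J_iso] isometry_scale[OF J_iso] q0 qv p)
  have "AE n in grid_measure h. w n = w0 n + (kv n + complex_of_real \<mu> * u n)"
    using 2(8) by eventually_elim (simp add: 2(9) kv_def algebra_simps)
  from isometry_cong_AE[OF J_iso q sum this]
  have qe: "AE x in lborel. q x = q0 x + (qv x + complex_of_real \<mu> * p x)" .
  have "L2_inner lborel \<phi> q = L2_inner lborel \<phi> (\<lambda>x. q0 x + (qv x + complex_of_real \<mu> * p x))"
    by (intro L2_inner_cong_right qe 1(6) qL L2_add L2_scale q0L qvL pL)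
  also have "\<dots> = L2_inner lborel \<phi> q0 + (L2_inner lborel \<phi> qv + complex_of_real \<mu> * L2_inner lborel \<phi> p)"
    by (simp add: L2_inner_add_right 1(6) q0L qvL pL L2_add L2_scale)
  finally have iq: "L2_inner lborel \<phi> q = L2_inner lborel \<phi> q0 + (L2_inner lborel \<phi> qv + complex_of_real \<mu> * L2_inner lborel \<phi> p)" .
  have VpL: "(\<lambda>x. complex_of_real (V x) * p x) \<in> L2 lborel"
    by (rule L2_bound[OF pL, where K = vb]) (use V_meas L2_D(1)[OF pL] in \<open>auto simp: norm_mult V_bound mult_right_mono\<close>)
  have "L2_inner lborel k p = L2_inner lborel \<phi> (\<lambda>x. complex_of_real (V x) * p x + complex_of_real \<mu> * p x)"
  proof (rule inner_real_mult_commute[OF 1(8) _ 1(6,7) pL, symmetric])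
    show "AE x in lborel. complex_of_real (V x) * p x + complex_of_real \<mu> * p x = complex_of_real (V x + \<mu>) * p x"
      by (simp add: distrib_right)
    show "(\<lambda>x. complex_of_real (V x) * p x + complex_of_real \<mu> * p x) \<in> L2 lborel"
      by (intro L2_add VpL L2_scale pL)
  qed
  also have "\<dots> = L2_inner lborel \<phi> (\<lambda>x. complex_of_real (V x) * p x) + complex_of_real \<mu> * L2_inner lborel \<phi> p"
    by (simp add: L2_inner_add_right 1(6) VpL pL L2_scale)
  finally have ik: "L2_inner lborel k p = L2_inner lborel \<phi> (\<lambda>x. complex_of_real (V x) * p x) + complex_of_real \<mu> * L2_inner lborel \<phi> p" .
  have "L2_inner lborel g p - L2_inner lborel \<phi> q =
      (L2_inner lborel g0 p - L2_inner lborel \<phi> q0) + L2_inner lborel \<phi> (\<lambda>x. complex_of_real (V x) * p x - qv x)"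
    unfolding 1(9) iq by (simp add: L2_inner_add_left g0L 1(7) pL ik L2_inner_diff_right 1(6) VpL qvL)
  then have "cmod (L2_inner lborel g p - L2_inner lborel \<phi> q) \<le>
      cmod (L2_inner lborel g0 p - L2_inner lborel \<phi> q0) + cmod (L2_inner lborel \<phi> (\<lambda>x. complex_of_real (V x) * p x - qv x))"
    by (simp only: norm_triangle_ineq)
  also have "\<dots> \<le> 3 * \<delta> * ((L2_norm lborel \<phi> + L2_norm lborel g0) * (L2_norm (grid_measure h) u + L2_norm (grid_measure h) w0)) +
      L2_norm lborel \<phi> * (\<delta> * L2_norm (grid_measure h) u)"
  proof (rule add_mono)
    show "cmod (L2_inner lborel g0 p - L2_inner lborel \<phi> q0) \<le>
        3 * \<delta> * ((L2_norm lborel \<phi> + L2_norm lborel g0) * (L2_norm (grid_measure h) u + L2_norm (grid_measure h) w0))"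
      by (rule kinetic_estimate[OF 1(1,2,5) 2(1,2,5) p q0])
    have "L2_norm lborel (\<lambda>x. complex_of_real (V x) * p x - qv x) \<le> \<delta> * L2_norm (grid_measure h) u"
      using J_potential[OF p, of qv] qv by (simp add: kv_def[abs_def])
    then show "cmod (L2_inner lborel \<phi> (\<lambda>x. complex_of_real (V x) * p x - qv x)) \<le> L2_norm lborel \<phi> * (\<delta> * L2_norm (grid_measure h) u)"
      by (intro order_trans[OF L2_cauchy_schwarz] mult_left_mono 1(6) L2_diff VpL qvL) auto
  qed
  also have "\<dots> \<le> 3 * \<delta> * ((L2_norm lborel g + M1 * L2_norm lborel \<phi>) * (L2_norm (grid_measure h) w + M1 * L2_norm (grid_measure h) u)) +
      \<delta> * ((L2_norm lborel g + M1 * L2_norm lborel \<phi>) * (L2_norm (grid_measure h) w + M1 * L2_norm (grid_measure h) u))"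
  proof -
    have kb: "L2_norm lborel k \<le> (vb + \<mu>) * L2_norm lborel \<phi>"
      by (rule potential_bound[OF 1(6,7,8) V_bound])
    have kb': "L2_norm (grid_measure h) k' \<le> (vb + \<mu>) * L2_norm (grid_measure h) u"
      by (rule potential_bound[where v = "\<lambda>n. V (h *\<^sub>R vec_of_int n)", OF 2(6,7,8) V_bound])
    have "L2_norm lborel g0 \<le> L2_norm lborel g + L2_norm lborel k"
      using L2_norm_triangle_diff[of g lborel k] L2_add[OF g0L 1(7)] 1(7) by (simp add: 1(9))
    then have a: "L2_norm lborel \<phi> + L2_norm lborel g0 \<le> L2_norm lborel g + M1 * L2_norm lborel \<phi>"
      using kb by (simp add: M1_def algebra_simps)
    have "L2_norm (grid_measure h) w0 \<le> L2_norm (grid_measure h) w + L2_norm (grid_measure h) k'"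
      using L2_norm_triangle_diff[of w "grid_measure h" k'] L2_add[OF w0L 2(7)] 2(7) by (simp add: 2(9))
    then have b: "L2_norm (grid_measure h) u + L2_norm (grid_measure h) w0 \<le> L2_norm (grid_measure h) w + M1 * L2_norm (grid_measure h) u"
      using kb' by (simp add: M1_def algebra_simps)
    have nn: "0 \<le> L2_norm lborel g0" "0 \<le> L2_norm (grid_measure h) w0" by simp_all
    have c: "L2_norm lborel \<phi> * L2_norm (grid_measure h) u \<le>
        (L2_norm lborel g + M1 * L2_norm lborel \<phi>) * (L2_norm (grid_measure h) w + M1 * L2_norm (grid_measure h) u)"
      using a b nn by (intro mult_mono) (auto intro: order_trans[OF _ a] order_trans[OF _ b])
    have d: "(L2_norm lborel \<phi> + L2_norm lborel g0) * (L2_norm (grid_measure h) u + L2_norm (grid_measure h) w0) \<le>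
        (L2_norm lborel g + M1 * L2_norm lborel \<phi>) * (L2_norm (grid_measure h) w + M1 * L2_norm (grid_measure h) u)"
      using a b nn by (intro mult_mono) (auto intro: order_trans[OF _ a] order_trans[OF _ b])
    show ?thesis
    proof (rule add_mono)
      show "L2_norm lborel \<phi> * (\<delta> * L2_norm (grid_measure h) u) \<le>
          \<delta> * ((L2_norm lborel g + M1 * L2_norm lborel \<phi>) * (L2_norm (grid_measure h) w + M1 * L2_norm (grid_measure h) u))"
        using mult_left_mono[OF c, of \<delta>] \<delta> by (simp only: mult.left_commute[of "L2_norm lborel \<phi>" \<delta>] less_imp_le)
    qed (rule mult_left_mono[OF d], use \<delta> in simp)
  qed
  finally show ?thesis by simp
qed

text \<open>From here on \<open>\<delta>\<close> is small, which makes the discrete resolvent bounded independently of \<open>h\<close>.\<close>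

definition "L = 1 + M1 * K"
definition "Kh = 2 * (K + 1)"
definition "Lh = 1 + M1 * Kh"

lemma constants: "L \<ge> 1" "Kh \<ge> 1" "Lh \<ge> 1"
  using M1 K by (auto simp: L_def Kh_def Lh_def)

lemma norm_R_graph:
  assumes "(g, \<phi>) \<in> R"
  shows "L2_norm lborel g + M1 * L2_norm lborel \<phi> \<le> L * L2_norm lborel g"
proof -
  have "M1 * L2_norm lborel \<phi> \<le> M1 * (K * L2_norm lborel g)"
    using M1 K_bound[OF assms] by (intro mult_left_mono) auto
  then show ?thesis by (simp add: L_def algebra_simps)
qed

text \<open>Test with g = J u itself: |u|^2 is at most |<R J u, J w>| <= K |u| |w| plus the error of
  \<open>core_estimate\<close>. The part of this error that is quadratic in |u| has coefficient 4
  \<delta> L M1 <= 1/2 and is absorbed.\<close>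

lemma Rh_bound:
  assumes small: "8 * \<delta> * L * M1 \<le> 1" and wu: "(w, u) \<in> Rh"
  shows "L2_norm (grid_measure h) u \<le> Kh * L2_norm (grid_measure h) w"
proof (cases "L2_norm (grid_measure h) u = 0")
  case False
  define x where "x = L2_norm (grid_measure h) u"
  define y where "y = L2_norm (grid_measure h) w"
  have x: "x > 0" and y: "y \<ge> 0" using False L2_norm_nonneg[of "grid_measure h" u] by (auto simp: x_def y_def less_le)
  have uL: "u \<in> L2 (grid_measure h)" and wL: "w \<in> L2 (grid_measure h)" using graph_L2[OF Rh_sym wu] by auto
  obtain p where p: "(u, p) \<in> J" using isometry_total[OF J_iso uL] by blast
  obtain q where q: "(w, q) \<in> J" using isometry_total[OF J_iso wL] by blast
  have pL: "p \<in> L2 lborel" and qL: "q \<in> L2 lborel" by (rule isometry_L2(2)[OF J_iso p] isometry_L2(2)[OF J_iso q])+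
  note np = isometry_norm[OF J_iso p, folded x_def] and nq = isometry_norm[OF J_iso q, folded y_def]
  define \<phi> where "\<phi> = graph_fun R p"
  have \<phi>: "(p, \<phi>) \<in> R" unfolding \<phi>_def by (rule graph_fun[OF R_sym pL])
  have \<phi>L: "\<phi> \<in> L2 lborel" by (rule graph_L2(2)[OF R_sym \<phi>])
  have "x\<^sup>2 = Re (L2_inner lborel p p)" using np by (simp add: L2_inner_self)
  also have "\<dots> \<le> cmod (L2_inner lborel p p - L2_inner lborel \<phi> q) + cmod (L2_inner lborel \<phi> q)"
    using complex_Re_le_cmod[of "L2_inner lborel p p"] norm_triangle_sub[of "L2_inner lborel p p" "L2_inner lborel \<phi> q"]
    by linarith
  also have "cmod (L2_inner lborel \<phi> q) \<le> (K * x) * y"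
    using L2_cauchy_schwarz[OF \<phi>L qL] mult_right_mono[OF K_bound[OF \<phi>], of y] y np nq by simp
  also have "cmod (L2_inner lborel p p - L2_inner lborel \<phi> q) \<le> 4 * \<delta> * ((L * x) * (y + M1 * x))"
  proof -
    have "(L2_norm lborel p + M1 * L2_norm lborel \<phi>) * (y + M1 * x) \<le> (L * x) * (y + M1 * x)"
      using norm_R_graph[OF \<phi>] np M1 x y by (intro mult_right_mono) auto
    then have "4 * \<delta> * ((L2_norm lborel p + M1 * L2_norm lborel \<phi>) * (y + M1 * x)) \<le> 4 * \<delta> * ((L * x) * (y + M1 * x))"
      using \<delta> by (intro mult_left_mono) auto
    then show ?thesis using core_estimate[OF \<phi> wu p q] by (simp add: x_def y_def)
  qed
  finally have "x * x \<le> x * (4 * \<delta> * L * y + 4 * \<delta> * L * M1 * x + K * y)"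
    by (simp add: power2_eq_square algebra_simps)
  then have a1: "x \<le> 4 * \<delta> * L * y + 4 * \<delta> * L * M1 * x + K * y" using x by simp
  have a2: "4 * \<delta> * L * M1 * x \<le> 1 / 2 * x"
    by (rule mult_right_mono) (use small x in auto)
  have a3: "4 * \<delta> * L * y \<le> 1 * y"
  proof (rule mult_right_mono[OF _ y])
    have "4 * \<delta> * L * 1 \<le> 4 * \<delta> * L * M1" using \<delta> constants M1 by (intro mult_left_mono) auto
    then show "4 * \<delta> * L \<le> 1" using small by linarith
  qed
  have "x \<le> 2 * y + 2 * k" if "x \<le> s + t + k" "t \<le> 1 / 2 * x" "s \<le> 1 * y" for s t k
    using that by linarith
  from this[OF a1 a2 a3] have "x \<le> 2 * y + 2 * (K * y)" .
  then show ?thesis by (simp add: x_def y_def Kh_def algebra_simps)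
next
  case True
  then show ?thesis using constants(2) by simp
qed

text \<open>With g = J u - R J w, symmetry of R gives <g, R J w> = <R g, J w>. So |g|^2 is exactly
  the quantity of \<open>core_estimate\<close>, whose bound is linear in |g|, and one factor |g|
  cancels.\<close>

lemma intertwining:
  assumes small: "8 * \<delta> * L * M1 \<le> 1" and wu: "(w, u) \<in> Rh" and p: "(u, p) \<in> J" and q: "(w, q) \<in> J" and \<phi>: "(q, \<phi>) \<in> R"
  shows "L2_norm lborel (\<lambda>x. p x - \<phi> x) \<le> 4 * L * Lh * \<delta> * L2_norm (grid_measure h) w"
proof -
  have pL: "p \<in> L2 lborel" and qL: "q \<in> L2 lborel" by (rule isometry_L2(2)[OF J_iso p] isometry_L2(2)[OF J_iso q])+
  have \<phi>L: "\<phi> \<in> L2 lborel" by (rule graph_L2(2)[OF R_sym \<phi>])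
  define g where "g x = p x - \<phi> x" for x
  have gL: "g \<in> L2 lborel" unfolding g_def[abs_def] by (intro L2_diff pL \<phi>L)
  define \<psi> where "\<psi> = graph_fun R g"
  have \<psi>: "(g, \<psi>) \<in> R" unfolding \<psi>_def by (rule graph_fun[OF R_sym gL])
  have sym: "L2_inner lborel g \<phi> = L2_inner lborel \<psi> q"
    using R_sym \<psi> \<phi> unfolding bounded_symmetric_graph_def by blast
  define y where "y = L2_norm (grid_measure h) w"
  define N where "N = L2_norm lborel g"
  have y: "y \<ge> 0" and N: "N \<ge> 0" by (simp_all add: y_def N_def)
  have "L2_inner lborel g g = L2_inner lborel g p - L2_inner lborel \<psi> q"
    by (subst (2) g_def[abs_def]) (simp add: L2_inner_diff_right gL pL \<phi>L sym)
  moreover have "cmod (L2_inner lborel g g) = N\<^sup>2"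
    by (simp add: N_def L2_inner_self norm_power)
  ultimately have "N\<^sup>2 = cmod (L2_inner lborel g p - L2_inner lborel \<psi> q)" by simp
  also have "\<dots> \<le> 4 * \<delta> * ((L2_norm lborel g + M1 * L2_norm lborel \<psi>) * (L2_norm (grid_measure h) w + M1 * L2_norm (grid_measure h) u))"
    by (rule core_estimate[OF \<psi> wu p q])
  also have "\<dots> \<le> 4 * \<delta> * ((L * N) * (Lh * y))"
  proof -
    have 1: "L2_norm lborel g + M1 * L2_norm lborel \<psi> \<le> L * N" using norm_R_graph[OF \<psi>] by (simp add: N_def)
    have "M1 * L2_norm (grid_measure h) u \<le> M1 * (Kh * y)"
      using Rh_bound[OF small wu] M1 by (intro mult_left_mono) (auto simp: y_def)
    then have 2: "L2_norm (grid_measure h) w + M1 * L2_norm (grid_measure h) u \<le> Lh * y" by (simp add: Lh_def y_def algebra_simps)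
    show ?thesis using \<delta> M1 constants N by (intro mult_left_mono mult_mono 1 2) auto
  qed
  finally have "N * N \<le> N * (4 * L * Lh * \<delta> * y)" by (simp add: power2_eq_square mult_ac)
  moreover have "0 \<le> 4 * L * Lh * \<delta> * y" using constants \<delta> y by simp
  ultimately have "N \<le> 4 * L * Lh * \<delta> * y" using N by (cases "N = 0") auto
  then show ?thesis by (simp add: N_def y_def g_def[abs_def])
qed

section \<open>Spectral points of each resolvent near those of the other\<close>

lemma spectrum_Rh_near_R:
  assumes small: "8 * \<delta> * L * M1 \<le> 1" and z: "z \<in> spectrum (grid_measure h) Rh"
  shows "\<exists>x. complex_of_real x \<in> spectrum lborel R \<and> dist z (complex_of_real x) \<le> 8 * L * Lh * \<delta>"
proof -
  \<comment> \<open>The intertwining error, taken also as the tolerance of the approximate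
    eigenvector; the two add up to 2 e.\<close>
  define e where "e = 4 * L * Lh * \<delta>"
  have e: "e > 0" using constants \<delta> by (simp add: e_def)
  define l where "l = Re z"
  have zl: "z = complex_of_real l" using spectrum_approx_eigenvalue(1)[OF Rh_sym z] by (simp add: l_def complex_eq_iff)
  obtain w where w: "w \<in> L2 (grid_measure h)" "0 < L2_norm (grid_measure h) w"
    "L2_norm (grid_measure h) (shift (graph_fun Rh) z w) \<le> e * L2_norm (grid_measure h) w"
    using spectrum_approx_eigenvalue(2)[OF Rh_sym z e] by blast
  define u where "u = graph_fun Rh w"
  have wu: "(w, u) \<in> Rh" unfolding u_def by (rule graph_fun[OF Rh_sym w(1)])
  have uL: "u \<in> L2 (grid_measure h)" by (rule graph_L2(2)[OF Rh_sym wu])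
  obtain p where p: "(u, p) \<in> J" using isometry_total[OF J_iso uL] by blast
  obtain q where q: "(w, q) \<in> J" using isometry_total[OF J_iso w(1)] by blast
  have pL: "p \<in> L2 lborel" and qL: "q \<in> L2 lborel" by (rule isometry_L2(2)[OF J_iso p] isometry_L2(2)[OF J_iso q])+
  define \<phi> where "\<phi> = graph_fun R q"
  have \<phi>: "(q, \<phi>) \<in> R" unfolding \<phi>_def by (rule graph_fun[OF R_sym qL])
  have \<phi>L: "\<phi> \<in> L2 lborel" by (rule graph_L2(2)[OF R_sym \<phi>])
  have "(\<lambda>x. \<phi> x - z * q x) = (\<lambda>x. (p x - z * q x) - (p x - \<phi> x))" by auto
  then have "L2_norm lborel (\<lambda>x. \<phi> x - z * q x) \<le> L2_norm lborel (\<lambda>x. p x - z * q x) + L2_norm lborel (\<lambda>x. p x - \<phi> x)"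
    using L2_norm_triangle_diff[OF L2_diff[OF pL L2_scale[OF qL]] L2_diff[OF pL \<phi>L], of z] by simp
  also have "L2_norm lborel (\<lambda>x. p x - z * q x) = L2_norm (grid_measure h) (\<lambda>n. u n - z * w n)"
    by (rule isometry_norm[OF J_iso isometry_diff[OF J_iso p isometry_scale[OF J_iso q]]])
  also have "\<dots> \<le> e * L2_norm (grid_measure h) w" using w(3) by (simp add: shift_def u_def)
  also have "L2_norm lborel (\<lambda>x. p x - \<phi> x) \<le> e * L2_norm (grid_measure h) w"
    unfolding e_def by (rule intertwining[OF small wu p q \<phi>])
  finally have "L2_norm lborel (shift (graph_fun R) (complex_of_real l) q) \<le> (2 * e) * L2_norm lborel q"
    using isometry_norm[OF J_iso q] by (simp add: shift_def \<phi>_def zl)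
  moreover have "0 < L2_norm lborel q" using w(2) isometry_norm[OF J_iso q] by simp
  ultimately obtain x where "complex_of_real x \<in> spectrum lborel R" "\<bar>x - l\<bar> \<le> 2 * e"
    using spectrum_near[OF R_sym qL] by blast
  then show ?thesis
    by (intro exI[of _ x]) (auto simp: zl e_def dist_norm norm_minus_commute simp flip: of_real_diff)
qed

text \<open>The test function has transform \<open>b\<close>, which lives at high frequencies.\<close>

lemma spectrum_Rh_near_zero:
  assumes small: "8 * \<delta> * L * M1 \<le> 1"
  shows "\<exists>x. complex_of_real x \<in> spectrum (grid_measure h) Rh \<and> \<bar>x\<bar> \<le> 2 * \<delta>"
proof -
  let ?B = "\<lambda>\<xi>. complex_of_real (Gh \<xi>) * b \<xi>"
  obtain u where u: "(u, b) \<in> discrete_fourier h" using discrete_fourier_onto[OF h b(1)] by blast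
  obtain w0 where w0: "(w0, ?B) \<in> discrete_fourier h" using discrete_fourier_onto[OF h b(3)] by blast
  have uL: "u \<in> L2 (grid_measure h)" and w0L: "w0 \<in> L2 (grid_measure h)"
    by (rule isometry_L2(1)[OF Fh_iso u] isometry_L2(1)[OF Fh_iso w0])+
  define k where "k n = complex_of_real (V (h *\<^sub>R vec_of_int n) + \<mu>) * u n" for n
  have kL: "k \<in> L2 (grid_measure h)"
  proof (rule L2_bound[OF uL, where K = "vb + \<mu>"])
    have "\<bar>V x + \<mu>\<bar> \<le> vb + \<mu>" for x using V_bound[of x] \<mu> by linarith
    then show "AE n in grid_measure h. cmod (k n) \<le> (vb + \<mu>) * cmod (u n)"
      unfolding k_def norm_mult norm_of_real by (intro AE_I2 mult_right_mono) auto
  qed (simp add: grid_measure_def)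
  define w where "w n = w0 n + k n" for n
  have wL: "w \<in> L2 (grid_measure h)" unfolding w_def[abs_def] by (intro L2_add w0L kL)
  have wu: "(w, u) \<in> Rh"
    unfolding Hh_op_schroedinger w_def[abs_def]
    by (rule shifted_inverseI[OF u w0 b(1) b(3) _ uL kL]) (auto simp: k_def)
  define x where "x = L2_norm (grid_measure h) u"
  have x: "x = L2_norm (torus_measure h) b" "x > 0" using isometry_norm[OF Fh_iso u] b(2) by (simp_all add: x_def)
  have kn: "L2_norm (grid_measure h) k \<le> (vb + \<mu>) * x"
    unfolding x_def by (rule potential_bound[where v = "\<lambda>n. V (h *\<^sub>R vec_of_int n)", OF uL kL _ V_bound]) (simp add: k_def)
  \<comment> \<open>On the support of b the factor 1 + G_h is at least 1 / \<delta>, so the kinetic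
    part, and with it w, is large compared with u.\<close>
  have "x / \<delta> \<le> L2_norm (torus_measure h) (\<lambda>\<xi>. b \<xi> + ?B \<xi>)"
  proof -
    have "L2_norm (torus_measure h) (\<lambda>\<xi>. complex_of_real (1 / \<delta>) * b \<xi>) \<le> L2_norm (torus_measure h) (\<lambda>\<xi>. b \<xi> + ?B \<xi>)"
    proof (rule L2_norm_mono_AE)
      show "(\<lambda>\<xi>. complex_of_real (1 / \<delta>) * b \<xi>) \<in> borel_measurable (torus_measure h)"
        by (rule L2_D(1)[OF L2_scale[OF b(1)]])
      show "(\<lambda>\<xi>. b \<xi> + ?B \<xi>) \<in> L2 (torus_measure h)" by (intro L2_add b)
      have "cmod (complex_of_real (1 / \<delta>) * b \<xi>) \<le> cmod (b \<xi> + ?B \<xi>)" if "\<xi> \<in> torus h" for \<xi>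
      proof (cases "b \<xi> = 0")
        case False
        have "b \<xi> + ?B \<xi> = complex_of_real (1 + Gh \<xi>) * b \<xi>" by (simp add: algebra_simps)
        then have "cmod (b \<xi> + ?B \<xi>) = (1 + Gh \<xi>) * cmod (b \<xi>)"
          using Gh_nonneg[of \<xi>] by (simp add: norm_mult del: of_real_add)
        moreover have "1 / \<delta> \<le> 1 + Gh \<xi>" using b(4)[OF that False] \<delta> by (simp add: field_simps)
        ultimately show ?thesis using \<delta> by (simp add: norm_mult norm_divide mult_right_mono[of "1 / \<delta>" "1 + Gh \<xi>" "cmod (b \<xi>)", simplified])
      qed simp
      then show "AE \<xi> in torus_measure h. cmod (complex_of_real (1 / \<delta>) * b \<xi>) \<le> cmod (b \<xi> + ?B \<xi>)"
        unfolding AE_torus by auto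
    qed
    then show ?thesis using \<delta> unfolding L2_norm_scale norm_of_real x(1) by simp
  qed
  also have "\<dots> \<le> x + L2_norm (grid_measure h) w0"
    using L2_norm_triangle[OF b(1) b(3)] isometry_norm[OF Fh_iso w0] x(1) by simp
  also have "L2_norm (grid_measure h) w0 \<le> L2_norm (grid_measure h) w + L2_norm (grid_measure h) k"
    using L2_norm_triangle_diff[OF wL kL] by (simp add: w_def)
  finally have "x / \<delta> \<le> M1 * x + L2_norm (grid_measure h) w" using kn by (simp add: M1_def algebra_simps)
  then have "x \<le> \<delta> * M1 * x + \<delta> * L2_norm (grid_measure h) w" using \<delta> by (simp add: field_simps)
  \<comment> \<open>The contribution of the potential is absorbed into the left-hand side.\<close>
  moreover have "\<delta> * M1 * x \<le> 1 / 2 * x"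
  proof (rule mult_right_mono)
    have "\<delta> * M1 * 1 \<le> \<delta> * M1 * L" using \<delta> M1 constants by (intro mult_left_mono) auto
    moreover have "0 \<le> \<delta> * M1" using \<delta> M1 by simp
    ultimately show "\<delta> * M1 \<le> 1 / 2" using small by (simp add: mult_ac)
  qed (use x in simp)
  ultimately have xw: "x \<le> 2 * \<delta> * L2_norm (grid_measure h) w" by simp
  then have w0: "0 < L2_norm (grid_measure h) w"
    using x(2) \<delta> by (meson less_le_trans zero_less_mult_pos mult_pos_pos zero_less_numeral)
  have "shift (graph_fun Rh) (complex_of_real 0) w = graph_fun Rh w" by (simp add: shift_def)
  moreover have "L2_norm (grid_measure h) (graph_fun Rh w) = x"
    unfolding x_def using graph_fun_AE[OF Rh_sym wu] graph_L2(2)[OF Rh_sym graph_fun[OF Rh_sym wL]] uL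
    by (intro L2_norm_cong_L2) auto
  ultimately have "L2_norm (grid_measure h) (shift (graph_fun Rh) (complex_of_real 0) w) \<le> (2 * \<delta>) * L2_norm (grid_measure h) w"
    using xw by simp
  from spectrum_near[OF Rh_sym wL w0 this] show ?thesis by auto
qed

text \<open>u is the sequence whose discrete transform is F on the torus, so J u has transform m F
  there, with m >= m0. The pairing is thus at least m0 times the squared mass of F in the torus,
  minus a product that is small because F has little mass outside.\<close>

lemma low_freq_overlap:
  assumes f: "f \<in> L2 lborel" "(f, F) \<in> fourier" and o: "L2_norm lborel (out F) \<le> m0 / 4 * L2_norm lborel f" and m01: "m0 \<le> 1"
  shows "\<exists>u p. (u, p) \<in> J \<and> L2_norm (grid_measure h) u \<le> L2_norm lborel f \<and>
    m0 / 4 * (L2_norm lborel f)\<^sup>2 \<le> cmod (L2_inner lborel p f)"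
proof -
  have FL: "F \<in> L2 lborel" by (rule isometry_L2(2)[OF F_iso f(2)])
  have FT: "F \<in> L2 (torus_measure h)" by (rule L2_restrict_torus[OF FL])
  obtain u where u: "(u, F) \<in> discrete_fourier h" using discrete_fourier_onto[OF h FT] by blast
  obtain p where p: "(u, p) \<in> J" using isometry_total[OF J_iso isometry_L2(1)[OF Fh_iso u]] by blast
  obtain P where P: "(p, P) \<in> fourier" using isometry_total[OF F_iso isometry_L2(2)[OF J_iso p]] by blast
  have PL: "P \<in> L2 lborel" by (rule isometry_L2(2)[OF F_iso P])
  define a where "a = L2_norm lborel f"
  define s where "s = L2_norm lborel (ind F)"
  define t where "t = L2_norm lborel (out F)"
  have st: "0 \<le> s" "0 \<le> t" "0 \<le> a" "t \<le> m0 / 4 * a" using o by (simp_all add: s_def t_def a_def)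
  have un: "L2_norm (grid_measure h) u = s" using isometry_norm[OF Fh_iso u] by (simp add: s_def L2_torus)
  have Pn: "L2_norm lborel P = s" using isometry_norm[OF F_iso P] isometry_norm[OF J_iso p] un by simp
  have sq: "a\<^sup>2 = s\<^sup>2 + t\<^sup>2" using norm_split_sq[OF FL] isometry_norm[OF F_iso f(2)] by (simp add: a_def s_def t_def)
  have sa: "s \<le> a" by (rule power2_le_imp_le) (use sq st in auto)
  have "m0 * s\<^sup>2 - t * s \<le> Re (L2_inner lborel P F)"
  proof -
    have ii: "integrable lborel (\<lambda>\<xi>. cmod (out F \<xi>) * cmod (P \<xi>))"
      using integrable_norm[OF integrable_L2_mult[OF L2_out[OF FL] PL]] by (simp add: norm_mult)
    have i2: "integrable lborel (\<lambda>\<xi>. m0 * (cmod (ind F \<xi>))\<^sup>2)" using L2_D(2)[OF L2_ind[OF FT]] by simp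
    have "m0 * s\<^sup>2 - t * s \<le> m0 * s\<^sup>2 - (\<integral>\<xi>. cmod (out F \<xi>) * cmod (P \<xi>) \<partial>lborel)"
      using integral_mult_le_sqrt[OF L2_out[OF FL] PL] by (simp add: t_def Pn)
    also have "\<dots> = (\<integral>\<xi>. m0 * (cmod (ind F \<xi>))\<^sup>2 - cmod (out F \<xi>) * cmod (P \<xi>) \<partial>lborel)"
      using ii i2 by (simp add: s_def L2_norm_sq)
    also have "\<dots> \<le> (\<integral>\<xi>. Re (cnj (P \<xi>) * F \<xi>) \<partial>lborel)"
    proof (rule integral_mono_AE)
      show "integrable lborel (\<lambda>\<xi>. m0 * (cmod (ind F \<xi>))\<^sup>2 - cmod (out F \<xi>) * cmod (P \<xi>))" using ii i2 by simp
      show "integrable lborel (\<lambda>\<xi>. Re (cnj (P \<xi>) * F \<xi>))" by (intro integrable_Re integrable_cnj_L2_mult PL FL)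
      show "AE \<xi> in lborel. m0 * (cmod (ind F \<xi>))\<^sup>2 - cmod (out F \<xi>) * cmod (P \<xi>) \<le> Re (cnj (P \<xi>) * F \<xi>)"
        using J_fourier[OF p P u]
      proof eventually_elim
        case (elim \<xi>)
        show ?case
        proof (cases "\<xi> \<in> torus h")
          case True
          then have "cnj (P \<xi>) * F \<xi> = complex_of_real (m \<xi> * (cmod (F \<xi>))\<^sup>2)"
            using elim by (simp add: complex_norm_square mult_ac del: of_real_power)
          moreover have "m0 * (cmod (F \<xi>))\<^sup>2 \<le> m \<xi> * (cmod (F \<xi>))\<^sup>2" by (intro mult_right_mono m_bounds True) simp
          ultimately show ?thesis using True by (simp del: of_real_mult of_real_power)
        next
          case False
          have "- (cmod (F \<xi>) * cmod (P \<xi>)) \<le> Re (cnj (P \<xi>) * F \<xi>)"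
            using abs_Re_le_cmod[of "cnj (P \<xi>) * F \<xi>"] by (simp add: norm_mult mult.commute abs_le_iff minus_le_iff)
          then show ?thesis using False by simp
        qed
      qed
    qed
    also have "\<dots> = Re (L2_inner lborel P F)"
      unfolding L2_inner_def by (rule integral_Re[OF integrable_cnj_L2_mult[OF PL FL]])
    finally show ?thesis .
  qed
  also have "\<dots> \<le> cmod (L2_inner lborel p f)"
    using isometry_inner[OF F_iso P f(2)] complex_Re_le_cmod by simp
  finally have 1: "m0 * s\<^sup>2 - t * s \<le> cmod (L2_inner lborel p f)" .
  \<comment> \<open>Since m0 <= 1, at least 15/16 of the squared norm lies in the torus, and 15/16
    m0 - m0 / 4 exceeds m0 / 4.\<close>
  have "t \<le> 1 / 4 * a" using st(3,4) m01 mult_right_mono[of "m0 / 4" "1 / 4" a] by linarith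
  then have "t\<^sup>2 \<le> (1 / 4 * a)\<^sup>2" using st by (intro power_mono) auto
  then have "t\<^sup>2 \<le> a\<^sup>2 / 16" by (simp add: power_divide)
  then have s2: "15 / 16 * a\<^sup>2 \<le> s\<^sup>2" using sq by simp
  have "t * s \<le> (m0 / 4 * a) * a" using st sa m0 by (intro mult_mono) auto
  then have "t * s \<le> m0 / 4 * a\<^sup>2" by (simp add: power2_eq_square)
  moreover have "m0 * (15 / 16 * a\<^sup>2) \<le> m0 * s\<^sup>2" using s2 m0 by (intro mult_left_mono) auto
  moreover have "0 \<le> m0 * a\<^sup>2" using m0 by simp
  ultimately have "m0 / 4 * a\<^sup>2 \<le> m0 * s\<^sup>2 - t * s" by linarith
  with 1 show ?thesis using p un sa unfolding a_def by (intro exI[of _ u] exI[of _ p]) auto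
qed

text \<open>The first entry serves eigenvalues below the threshold \<tau> \<delta>, with 2 \<delta>
  added by \<open>spectrum_Rh_near_zero\<close>; the second is D / \<delta> for the distance D used
  above the threshold.\<close>

definition "C\<^sub>2 = max (4 * (L + 1) / m0 + 2) (4 * (4 * L * Lh + 1) / m0 + 1)"

text \<open>The range of J is not all of L2, so an approximate eigenvector f cannot be pulled back
  to the grid. It is paired with some J u instead, and the size of l decides whether this pairing is
  large enough.\<close>

lemma spectrum_R_near_Rh:
  assumes small: "8 * \<delta> * L * M1 \<le> 1" and z: "z \<in> spectrum lborel R" and m01: "m0 \<le> 1"
  shows "\<exists>x. complex_of_real x \<in> spectrum (grid_measure h) Rh \<and> dist z (complex_of_real x) \<le> C\<^sub>2 * \<delta>"
proof -
  define l where "l = Re z"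
  have zl: "z = complex_of_real l" using spectrum_approx_eigenvalue(1)[OF R_sym z] by (simp add: l_def complex_eq_iff)
  \<comment> \<open>The threshold at which \<open>outF\<close> yields |out F| <= m0 / 4 |f|, as
    \<open>low_freq_overlap\<close> demands.\<close>
  define \<tau> where "\<tau> = 4 * (L + 1) / m0"
  have \<tau>: "\<tau> > 0" using constants m0 by (simp add: \<tau>_def)
  have dz: "dist z (complex_of_real x) = \<bar>x - l\<bar>" for x
    by (simp add: zl dist_norm norm_minus_commute flip: of_real_diff)
  show ?thesis
  proof (cases "\<bar>l\<bar> < \<tau> * \<delta>")
    case True
    obtain x where x: "complex_of_real x \<in> spectrum (grid_measure h) Rh" "\<bar>x\<bar> \<le> 2 * \<delta>"
      using spectrum_Rh_near_zero[OF small] by blast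
    have "\<bar>x - l\<bar> \<le> (\<tau> + 2) * \<delta>" using x True by (simp add: distrib_right)
    also have "\<dots> \<le> C\<^sub>2 * \<delta>" using \<delta> by (intro mult_right_mono) (auto simp: C\<^sub>2_def \<tau>_def)
    finally show ?thesis using x dz by auto
  next
    case False
    \<comment> \<open>The first summand balances the upper bounds of the pairing against its lower
      bound m0 / 4 |f|^2; the additional 1 makes the contradiction strict.\<close>
    define D where "D = (4 * (4 * L * Lh + 1) / m0 + 1) * \<delta>"
    have c1: "0 < 4 * L * Lh + 1" using constants by (simp add: add_nonneg_pos)
    have "0 < 4 * (4 * L * Lh + 1) / m0" using c1 m0 by simp
    then have D: "D > 0" "D \<le> C\<^sub>2 * \<delta>" using \<delta>
      unfolding D_def C\<^sub>2_def by (auto intro: mult_right_mono simp del: zero_less_divide_iff)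
    have "\<exists>x. complex_of_real x \<in> spectrum (grid_measure h) Rh \<and> \<bar>x - l\<bar> \<le> D"
    proof (rule ccontr)
      assume no: "\<not> ?thesis"
      \<comment> \<open>Contraposition of \<open>spectrum_near\<close>: a vector violating this
        would produce a spectral point within D of l.\<close>
      have far: "D * L2_norm (grid_measure h) w \<le> L2_norm (grid_measure h) (shift (graph_fun Rh) z w)"
        if w: "w \<in> L2 (grid_measure h)" for w
      proof (rule ccontr)
        assume c: "\<not> ?thesis"
        have "0 \<le> L2_norm (grid_measure h) (shift (graph_fun Rh) z w)" by simp
        with c have "0 < D * L2_norm (grid_measure h) w" by linarith
        then have "0 < L2_norm (grid_measure h) w" using D(1) by (simp add: zero_less_mult_iff)
        from spectrum_near[OF Rh_sym w this, of l D] c no zl show False by auto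
      qed
      obtain f where f: "f \<in> L2 lborel" "0 < L2_norm lborel f"
        "L2_norm lborel (shift (graph_fun R) z f) \<le> \<delta> * L2_norm lborel f"
        using spectrum_approx_eigenvalue(2)[OF R_sym z \<delta>] by blast
      define a where "a = L2_norm lborel f"
      define \<phi> where "\<phi> = graph_fun R f"
      have \<phi>: "(f, \<phi>) \<in> R" unfolding \<phi>_def by (rule graph_fun[OF R_sym f(1)])
      have \<phi>L: "\<phi> \<in> L2 lborel" by (rule graph_L2(2)[OF R_sym \<phi>])
      define r where "r x = \<phi> x - z * f x" for x
      have rL: "r \<in> L2 lborel" unfolding r_def[abs_def] by (intro L2_diff \<phi>L L2_scale f)
      have rn: "L2_norm lborel r \<le> \<delta> * a" using f(3) by (simp add: r_def[abs_def] shift_def \<phi>_def a_def)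
      obtain F where F: "(f, F) \<in> fourier" using isometry_total[OF F_iso f(1)] by blast
      have FL: "F \<in> L2 lborel" by (rule isometry_L2(2)[OF F_iso F])
      \<comment> \<open>l F is the transform A of \<phi> = R f minus the transform of the residual
        r, and outside the torus A is at most \<delta> times A + B in absolute value.\<close>
      have outF: "\<bar>l\<bar> * L2_norm lborel (out F) \<le> (L + 1) * \<delta> * a"
      proof -
        from \<phi> obtain A B g0 k where
          1: "(\<phi>, A) \<in> fourier" "(g0, B) \<in> fourier" "A \<in> L2 lborel" "B \<in> L2 lborel" "AE \<xi> in lborel. B \<xi> = complex_of_real (G \<xi>) * A \<xi>"
            "\<phi> \<in> L2 lborel" "k \<in> L2 lborel" "AE x in lborel. k x = complex_of_real (V x + \<mu>) * \<phi> x" "f = (\<lambda>x. g0 x + k x)"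
          unfolding H_op_schroedinger by (rule shifted_inverseE)
        have g0L: "g0 \<in> L2 lborel" by (rule isometry_L2(1)[OF F_iso 1(2)])
        have kb: "L2_norm lborel k \<le> (vb + \<mu>) * L2_norm lborel \<phi>" by (rule potential_bound[OF 1(6,7,8) V_bound])
        have "L2_norm lborel g0 \<le> L2_norm lborel f + L2_norm lborel k"
          using L2_norm_triangle_diff[of f lborel k] f(1) 1(7) by (simp add: 1(9))
        then have "L2_norm lborel \<phi> + L2_norm lborel g0 \<le> L * a"
          using kb norm_R_graph[OF \<phi>] by (simp add: M1_def a_def algebra_simps)
        moreover have "L2_norm lborel (\<lambda>\<xi>. A \<xi> + B \<xi>) \<le> L2_norm lborel \<phi> + L2_norm lborel g0"
          using L2_norm_triangle[OF 1(3,4)] isometry_norm[OF F_iso 1(1)] isometry_norm[OF F_iso 1(2)] by simp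
        ultimately have X: "L2_norm lborel (\<lambda>\<xi>. A \<xi> + B \<xi>) \<le> L * a" by linarith
        have "L2_norm lborel (out A) \<le> L2_norm lborel (\<lambda>\<xi>. complex_of_real \<delta> * (A \<xi> + B \<xi>))"
        proof (rule L2_norm_mono_AE)
          show "out A \<in> borel_measurable lborel" by (rule L2_D(1)[OF L2_out[OF 1(3)]])
          show "(\<lambda>\<xi>. complex_of_real \<delta> * (A \<xi> + B \<xi>)) \<in> L2 lborel" by (intro L2_scale L2_add 1)
          show "AE \<xi> in lborel. cmod (out A \<xi>) \<le> cmod (complex_of_real \<delta> * (A \<xi> + B \<xi>))"
            using 1(5)
          proof eventually_elim
            case (elim \<xi>)
            show ?case
            proof (cases "\<xi> \<in> torus h")
              case False
              have "A \<xi> + B \<xi> = complex_of_real (1 + G \<xi>) * A \<xi>" using elim by (simp add: algebra_simps)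
              then have x: "cmod (A \<xi> + B \<xi>) = (1 + G \<xi>) * cmod (A \<xi>)"
                using G_nonneg[of \<xi>] by (simp add: norm_mult del: of_real_add)
              have "cmod (A \<xi>) \<le> \<delta> * cmod (A \<xi> + B \<xi>)"
                using mult_right_mono[OF high_freq[OF False], of "cmod (A \<xi>)"] unfolding x by (simp add: mult_ac)
              then show ?thesis using False \<delta> by (simp add: norm_mult)
            qed simp
          qed
        qed
        also have "\<dots> \<le> \<delta> * (L * a)" using X \<delta> by (simp add: mult_left_mono)
        finally have oA: "L2_norm lborel (out A) \<le> \<delta> * (L * a)" .
        have rF: "(r, \<lambda>\<xi>. A \<xi> - z * F \<xi>) \<in> fourier"
          unfolding r_def[abs_def] by (intro isometry_diff[OF F_iso] isometry_scale[OF F_iso] 1(1) F)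
        define S where "S \<xi> = A \<xi> - z * F \<xi>" for \<xi>
        have SL: "S \<in> L2 lborel" unfolding S_def[abs_def] by (intro L2_diff L2_scale 1(3) FL)
        have Sn: "L2_norm lborel S \<le> \<delta> * a" using isometry_norm[OF F_iso rF] rn by (simp add: S_def[abs_def])
        have "(\<lambda>\<xi>. z * out F \<xi>) = (\<lambda>\<xi>. out A \<xi> - out S \<xi>)" by (auto simp: S_def algebra_simps)
        then have "L2_norm lborel (\<lambda>\<xi>. z * out F \<xi>) \<le> L2_norm lborel (out A) + L2_norm lborel (out S)"
          using L2_norm_triangle_diff[OF L2_out[OF 1(3)] L2_out[OF SL]] by simp
        also have "\<dots> \<le> \<delta> * (L * a) + \<delta> * a" using oA norm_out_le[OF SL] Sn by linarith
        finally show ?thesis unfolding L2_norm_scale zl norm_of_real by (simp add: algebra_simps)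
      qed
      have ls: "\<tau> * \<delta> \<le> \<bar>l\<bar>" using False by simp
      have "\<tau> * \<delta> * L2_norm lborel (out F) \<le> \<bar>l\<bar> * L2_norm lborel (out F)" by (intro mult_right_mono ls) simp
      then have "\<delta> * (\<tau> * L2_norm lborel (out F)) \<le> \<delta> * ((L + 1) * a)" using outF by (simp add: mult_ac)
      then have "\<tau> * L2_norm lborel (out F) \<le> (L + 1) * a" using \<delta> by simp
      then have "(4 * (L + 1)) * L2_norm lborel (out F) \<le> (L + 1) * a * m0"
        using m0 by (simp add: \<tau>_def field_simps)
      then have "(L + 1) * (4 * L2_norm lborel (out F)) \<le> (L + 1) * (m0 * a)" by (simp only: mult_ac)
      then have "4 * L2_norm lborel (out F) \<le> m0 * a" using constants by simp
      then have oF: "L2_norm lborel (out F) \<le> m0 / 4 * L2_norm lborel f" by (simp add: a_def)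
      obtain u p where up: "(u, p) \<in> J" "L2_norm (grid_measure h) u \<le> a" "m0 / 4 * a\<^sup>2 \<le> cmod (L2_inner lborel p f)"
        using low_freq_overlap[OF f(1) F oF m01] unfolding a_def by blast
      have uL: "u \<in> L2 (grid_measure h)" by (rule isometry_L2(1)[OF J_iso up(1)])
      have pL: "p \<in> L2 lborel" by (rule isometry_L2(2)[OF J_iso up(1)])
      interpret rh: bounded_symmetric "grid_measure h" "graph_fun Rh" "graph_norm (grid_measure h) Rh"
        by (rule bounded_symmetric_graph_fun[OF Rh_sym])
      obtain w where w: "w \<in> L2 (grid_measure h)" "AE n in grid_measure h. shift (graph_fun Rh) z w n = u n"
        using rh.shift_surj[OF D(1) far uL] by blast
      define y where "y = L2_norm (grid_measure h) w"
      have "L2_norm (grid_measure h) (shift (graph_fun Rh) z w) = L2_norm (grid_measure h) u"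
        using w uL by (intro L2_norm_cong_L2 rh.L2_shift)
      then have y: "D * y \<le> a" "0 \<le> y" using far[OF w(1)] up(2) by (simp_all add: y_def)
      define v where "v = graph_fun Rh w"
      have wv: "(w, v) \<in> Rh" unfolding v_def by (rule graph_fun[OF Rh_sym w(1)])
      have vL: "v \<in> L2 (grid_measure h)" by (rule graph_L2(2)[OF Rh_sym wv])
      obtain pv where pv: "(v, pv) \<in> J" using isometry_total[OF J_iso vL] by blast
      obtain pw where pw: "(w, pw) \<in> J" using isometry_total[OF J_iso w(1)] by blast
      have pvL: "pv \<in> L2 lborel" and pwL: "pw \<in> L2 lborel" by (rule isometry_L2(2)[OF J_iso pv] isometry_L2(2)[OF J_iso pw])+
      define \<psi> where "\<psi> = graph_fun R pw"
      have \<psi>: "(pw, \<psi>) \<in> R" unfolding \<psi>_def by (rule graph_fun[OF R_sym pwL])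
      have \<psi>L: "\<psi> \<in> L2 lborel" by (rule graph_L2(2)[OF R_sym \<psi>])
      have "(\<lambda>n. v n - z * w n, \<lambda>x. pv x - z * pw x) \<in> J"
        by (intro isometry_diff[OF J_iso] isometry_scale[OF J_iso] pv pw)
      moreover have "AE n in grid_measure h. u n = v n - z * w n"
        using w(2) by eventually_elim (simp add: shift_def v_def)
      ultimately have pe: "AE x in lborel. p x = pv x - z * pw x"
        by (rule isometry_cong_AE[OF J_iso up(1)])
      have sym: "L2_inner lborel pw \<phi> = L2_inner lborel \<psi> f"
        using R_sym \<psi> \<phi> unfolding bounded_symmetric_graph_def by blast
      have "L2_inner lborel p f = L2_inner lborel (\<lambda>x. pv x - z * pw x) f"
        using pe pL pvL pwL f(1) L2_D(1)[OF L2_diff[OF pvL L2_scale[OF pwL, of z]]] by (intro L2_inner_cong_AE) (auto dest: L2_D)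
      also have "\<dots> = L2_inner lborel pv f - z * L2_inner lborel pw f"
        by (simp add: L2_inner_diff_left pvL pwL L2_scale f(1) zl)
      \<comment> \<open>Symmetry of R moves it from J w to f, and z, being real, passes to the
        second factor unchanged.\<close>
      also have "\<dots> = L2_inner lborel (\<lambda>x. pv x - \<psi> x) f + L2_inner lborel pw r"
        unfolding r_def[abs_def] by (simp add: L2_inner_diff_left L2_inner_diff_right pvL pwL \<psi>L \<phi>L L2_scale f(1) sym)
      finally have "cmod (L2_inner lborel p f) \<le> cmod (L2_inner lborel (\<lambda>x. pv x - \<psi> x) f) + cmod (L2_inner lborel pw r)"
        by (simp only: norm_triangle_ineq)
      also have "cmod (L2_inner lborel (\<lambda>x. pv x - \<psi> x) f) \<le> (4 * L * Lh * \<delta> * y) * a"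
        using intertwining[OF small wv pv pw \<psi>]
        by (intro order_trans[OF L2_cauchy_schwarz] L2_diff pvL \<psi>L f(1)) (auto simp: a_def y_def intro: mult_right_mono)
      also have "cmod (L2_inner lborel pw r) \<le> y * (\<delta> * a)"
        using isometry_norm[OF J_iso pw] rn
        by (intro order_trans[OF L2_cauchy_schwarz] pwL rL) (auto simp: y_def intro: mult_left_mono)
      finally have "m0 / 4 * a\<^sup>2 \<le> (4 * L * Lh + 1) * \<delta> * y * a" using up(3) by (simp add: algebra_simps)
      then have "a * (m0 * a) \<le> a * (4 * ((4 * L * Lh + 1) * \<delta> * y))" by (simp add: power2_eq_square algebra_simps)
      then have "m0 * a \<le> 4 * ((4 * L * Lh + 1) * \<delta> * y)" using f(2) by (simp add: a_def)
      moreover have "m0 * D * y \<le> m0 * a" using y(1) m0 by (simp add: mult.assoc)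
      moreover have "m0 * D = 4 * ((4 * L * Lh + 1) * \<delta>) + m0 * \<delta>" using m0 by (simp add: D_def field_simps)
      ultimately have "m0 * \<delta> * y \<le> 0" by (simp add: distrib_right)
      then have "y = 0" using y(2) m0 \<delta> by (simp add: mult_le_0_iff)
      then have "m0 * a \<le> 0" using \<open>m0 * a \<le> 4 * ((4 * L * Lh + 1) * \<delta> * y)\<close> by simp
      then show False using m0 f(2) by (simp add: a_def mult_le_0_iff)
    qed
    then obtain x where "complex_of_real x \<in> spectrum (grid_measure h) Rh" "\<bar>x - l\<bar> \<le> D" by blast
    then show ?thesis using D(2) dz by auto
  qed
qed

theorem hausdorff_estimate:
  assumes small: "8 * \<delta> * L * M1 \<le> 1" and m01: "m0 \<le> 1"
  shows "hausdorff_dist (spectrum (grid_measure h) Rh) (spectrum lborel R) \<le> max (8 * L * Lh) C\<^sub>2 * \<delta>"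
proof -
  let ?X = "spectrum (grid_measure h) Rh" and ?Y = "spectrum lborel R"
  \<comment> \<open>Both spectra must be non-empty for the suprema: high frequencies give a point of
    the first, and then the inclusion gives one of the second.\<close>
  have X: "?X \<noteq> {}" using spectrum_Rh_near_zero[OF small] by auto
  then have Y: "?Y \<noteq> {}" using spectrum_Rh_near_R[OF small] by auto
  have "infdist z ?Y \<le> 8 * L * Lh * \<delta>" if "z \<in> ?X" for z
    using spectrum_Rh_near_R[OF small that] infdist_le2 by blast
  then have 1: "(SUP z\<in>?X. infdist z ?Y) \<le> 8 * L * Lh * \<delta>" using X by (intro cSUP_least) auto
  have "infdist z ?X \<le> C\<^sub>2 * \<delta>" if "z \<in> ?Y" for z
    using spectrum_R_near_Rh[OF small that m01] infdist_le2 by blast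
  then have 2: "(SUP z\<in>?Y. infdist z ?X) \<le> C\<^sub>2 * \<delta>" using Y by (intro cSUP_least) auto
  have "8 * L * Lh * \<delta> \<le> max (8 * L * Lh) C\<^sub>2 * \<delta>" "C\<^sub>2 * \<delta> \<le> max (8 * L * Lh) C\<^sub>2 * \<delta>"
    using \<delta> by (auto intro: mult_right_mono)
  with 1 2 show ?thesis unfolding hausdorff_dist_def by simp
qed

end

section \<open>Embeddings of the grid into the continuum\<close>

text \<open>The net of partial sums is constant once the finite set contains A.\<close>

lemma discrete_fourier_finite_support:
  fixes u :: "int ^ 'n \<Rightarrow> complex" and h :: real
  assumes h: "h > 0" and A: "finite A" "\<And>n. n \<notin> A \<Longrightarrow> u n = 0"
  shows "(u, \<lambda>\<xi>. \<Sum>n\<in>A. u n * dft_basis h n \<xi>) \<in> discrete_fourier h"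
  unfolding discrete_fourier_iff L2_has_sum_def L2_tendsto_def
proof (intro conjI)
  interpret orthogonal_system "torus_measure h" "dft_basis h :: int ^ 'n \<Rightarrow> _" "h ^ CARD('n)"
    by (rule orthogonal_dft_basis[OF h])
  show "u \<in> L2 (grid_measure h)"
    using L2_step_fun_finite[where u = u, OF h A] L2_step_fun(1)[OF h] by blast
  show "(\<lambda>\<xi>. \<Sum>n\<in>A. u n * dft_basis h n \<xi>) \<in> L2 (torus_measure h)"
    "\<forall>\<^sub>F B in finite_subsets_at_top UNIV. (\<lambda>\<xi>. \<Sum>n\<in>B. u n * dft_basis h n \<xi>) \<in> L2 (torus_measure h)"
    by (simp_all add: L2_finite_sum)
  have "\<forall>\<^sub>F B in finite_subsets_at_top UNIV. finite B \<and> A \<subseteq> B"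
    using A(1) by (auto simp: eventually_finite_subsets_at_top)
  then have "\<forall>\<^sub>F B in finite_subsets_at_top UNIV.
      L2_norm (torus_measure h) (\<lambda>\<xi>. (\<Sum>n\<in>B. u n * dft_basis h n \<xi>) - (\<Sum>n\<in>A. u n * dft_basis h n \<xi>)) = 0"
  proof eventually_elim
    case (elim B)
    then have "(\<Sum>n\<in>B. u n * dft_basis h n \<xi>) = (\<Sum>n\<in>A. u n * dft_basis h n \<xi>)" for \<xi>
      using A by (intro sum.mono_neutral_right) auto
    then show ?case by simp
  qed
  then show "((\<lambda>B. L2_norm (torus_measure h) (\<lambda>\<xi>. (\<Sum>n\<in>B. u n * dft_basis h n \<xi>) - (\<Sum>n\<in>A. u n * dft_basis h n \<xi>)))
      \<longlongrightarrow> 0) (finite_subsets_at_top UNIV)"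
    by (rule tendsto_eventually)
qed

definition haar_embedding :: "real \<Rightarrow> ((int ^ 'n \<Rightarrow> complex) \<times> (real ^ 'n \<Rightarrow> complex)) set" where
  "haar_embedding h = {(u, p). u \<in> L2 (grid_measure h) \<and> p \<in> borel_measurable lborel \<and>
     (AE x in lborel. p x = step_fun h u x)}"

lemma haar_embeddingI:
  assumes "h > 0" "u \<in> L2 (grid_measure h)"
  shows "(u, step_fun h u) \<in> haar_embedding h"
  using assms borel_measurable_step_fun[OF assms(1), of u] by (simp add: haar_embedding_def)

lemma L2_isometry_haar_embedding:
  assumes h: "h > 0"
  shows "L2_isometry (grid_measure h) lborel (haar_embedding h)"
  unfolding L2_isometry_def
proof (intro conjI allI impI ballI)
  have 1: "p \<in> L2 lborel \<and> L2_norm lborel p = L2_norm (grid_measure h) u" if "(u, p) \<in> haar_embedding h" for u p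
  proof -
    have u: "u \<in> L2 (grid_measure h)" and p: "p \<in> borel_measurable lborel" "AE x in lborel. p x = step_fun h u x"
      using that by (auto simp: haar_embedding_def)
    have s: "step_fun h u \<in> L2 lborel" using u L2_step_fun(1)[OF h] by blast
    have "p \<in> L2 lborel" by (rule L2_cong_AE[OF s p])
    then show ?thesis using L2_norm_cong_L2[OF _ s p(2)] L2_step_fun(2)[OF h, of u] by simp
  qed
  show "haar_embedding h \<subseteq> L2 (grid_measure h) \<times> L2 lborel"
    using 1 by (auto simp: haar_embedding_def)
  show "\<exists>p. (u, p) \<in> haar_embedding h" if "u \<in> L2 (grid_measure h)" for u
    using haar_embeddingI[OF h that] by blast
  show "L2_norm lborel p = L2_norm (grid_measure h) u" if "(u, p) \<in> haar_embedding h" for u p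
    using 1[OF that] by simp
  show "(\<lambda>n. u n + c * u' n, \<lambda>x. p x + c * p' x) \<in> haar_embedding h"
    if "(u, p) \<in> haar_embedding h" "(u', p') \<in> haar_embedding h" for u p u' p' c
  proof -
    have m: "p \<in> borel_measurable lborel" "p' \<in> borel_measurable lborel"
      and u: "u \<in> L2 (grid_measure h)" "u' \<in> L2 (grid_measure h)"
      and ae: "AE x in lborel. p x = step_fun h u x" "AE x in lborel. p' x = step_fun h u' x"
      using that by (auto simp: haar_embedding_def)
    have "AE x in lborel. p x + c * p' x = step_fun h (\<lambda>n. u n + c * u' n) x"
      using ae by eventually_elim (simp add: step_fun_def)
    then show ?thesis using m u by (simp add: haar_embedding_def L2_add L2_scale)
  qed
  show "(u, p') \<in> haar_embedding h"
    if "(u, p) \<in> haar_embedding h" "p' \<in> borel_measurable lborel" "AE x in lborel. p' x = p x" for u p p'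
  proof -
    have "AE x in lborel. p x = step_fun h u x" using that(1) by (simp add: haar_embedding_def)
    with that(3) have "AE x in lborel. p' x = step_fun h u x" by eventually_elim simp
    then show ?thesis using that by (simp add: haar_embedding_def)
  qed
qed

text \<open>For finitely supported u this is the formula for the transform of a cell. Truncations of
  u converge, and both sides depend continuously on u: P through isometries, the right-hand side
  because \<open>cell_mult\<close> lies between 0 and 1 on the torus.\<close>

lemma haar_embedding_fourier:
  fixes p :: "real ^ 'n \<Rightarrow> complex"
  assumes h: "h > 0" and up: "(u, p) \<in> haar_embedding h" and P: "(p, P) \<in> fourier" and Q: "(u, Q) \<in> discrete_fourier h"
  shows "AE \<xi> in lborel. \<xi> \<in> torus h \<longrightarrow> P \<xi> = complex_of_real (cell_mult h \<xi>) * Q \<xi>"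
proof -
  interpret orthogonal_system "torus_measure h" "dft_basis h :: int ^ 'n \<Rightarrow> _" "h ^ CARD('n)"
    by (rule orthogonal_dft_basis[OF h])
  note F = L2_isometry_fourier and J = L2_isometry_haar_embedding[OF h] and D = L2_isometry_discrete_fourier[OF h]
  let ?D = "\<lambda>\<xi>. indicator (torus h) \<xi> * (P \<xi> - complex_of_real (cell_mult h \<xi>) * Q \<xi>)"
  have PL: "P \<in> L2 lborel" by (rule isometry_L2(2)[OF F P])
  have QL: "Q \<in> L2 (torus_measure h)" by (rule isometry_L2(2)[OF D Q])
  have [measurable]: "P \<in> borel_measurable lborel" using PL by (simp add: L2_def)
  have mult_le: "L2_norm lborel (\<lambda>\<xi>. indicator (torus h) \<xi> * (complex_of_real (cell_mult h \<xi>) * f \<xi>)) \<le> L2_norm (torus_measure h) f"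
    "(\<lambda>\<xi>. indicator (torus h) \<xi> * (complex_of_real (cell_mult h \<xi>) * f \<xi>)) \<in> L2 lborel"
    if f: "f \<in> L2 (torus_measure h)" for f :: "real ^ 'n \<Rightarrow> complex"
  proof -
    have fL: "(\<lambda>\<xi>. indicator (torus h) \<xi> * f \<xi>) \<in> L2 lborel" using f by (simp add: L2_torus)
    have eq: "(\<lambda>\<xi>. indicator (torus h) \<xi> * (complex_of_real (cell_mult h \<xi>) * f \<xi>)) =
        (\<lambda>\<xi>. complex_of_real (cell_mult h \<xi>) * (indicator (torus h) \<xi> * f \<xi>))" by auto
    have m: "(\<lambda>\<xi>. indicator (torus h) \<xi> * (complex_of_real (cell_mult h \<xi>) * f \<xi>)) \<in> borel_measurable lborel"
      unfolding eq using L2_D(1)[OF fL] by measurable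
    have le: "cmod (indicator (torus h) \<xi> * (complex_of_real (cell_mult h \<xi>) * f \<xi>)) \<le> cmod (indicator (torus h) \<xi> * f \<xi>)" for \<xi>
    proof (cases "\<xi> \<in> torus h")
      case True
      have "0 \<le> cell_mult h \<xi>" using cell_mult_bounds(1)[OF h True] by (rule order_trans[rotated]) simp
      then show ?thesis using cell_mult_bounds(2)[OF h True] True by (simp add: norm_mult mult_left_le_one_le)
    qed simp
    show "L2_norm lborel (\<lambda>\<xi>. indicator (torus h) \<xi> * (complex_of_real (cell_mult h \<xi>) * f \<xi>)) \<le> L2_norm (torus_measure h) f"
      unfolding L2_torus using le by (intro L2_norm_mono_AE m fL AE_I2)
    show "(\<lambda>\<xi>. indicator (torus h) \<xi> * (complex_of_real (cell_mult h \<xi>) * f \<xi>)) \<in> L2 lborel"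
      by (rule L2_bound[OF fL m, where K = 1]) (use le in simp)
  qed
  have DL: "?D \<in> L2 lborel"
  proof -
    have "?D = (\<lambda>\<xi>. indicator (torus h) \<xi> * P \<xi> - indicator (torus h) \<xi> * (complex_of_real (cell_mult h \<xi>) * Q \<xi>))"
      by (auto simp: algebra_simps)
    then show ?thesis
      using L2_diff[OF L2_restrict_torus[OF PL, unfolded L2_torus] mult_le(2)[OF QL]] by simp
  qed
  have small: "L2_norm lborel ?D \<le> 2 * e" if e: "e > 0" for e
  proof -
    have "L2_has_sum (torus_measure h) (\<lambda>n \<xi>. u n * dft_basis h n \<xi>) Q"
      using Q by (simp add: discrete_fourier_iff)
    then have "((\<lambda>A. L2_norm (torus_measure h) (\<lambda>\<xi>. (\<Sum>n\<in>A. u n * dft_basis h n \<xi>) - Q \<xi>)) \<longlongrightarrow> 0) (finite_subsets_at_top UNIV)"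
      by (simp add: L2_has_sum_def L2_tendsto_def)
    then have "\<forall>\<^sub>F A in finite_subsets_at_top UNIV. L2_norm (torus_measure h) (\<lambda>\<xi>. (\<Sum>n\<in>A. u n * dft_basis h n \<xi>) - Q \<xi>) < e"
      using e by (auto dest: order_tendstoD(2))
    moreover have "\<forall>\<^sub>F A in finite_subsets_at_top (UNIV :: (int ^ 'n) set). finite A"
      by (auto simp: eventually_finite_subsets_at_top)
    ultimately obtain A where A: "finite A" "L2_norm (torus_measure h) (\<lambda>\<xi>. (\<Sum>n\<in>A. u n * dft_basis h n \<xi>) - Q \<xi>) < e"
      using eventually_happens'[OF finite_subsets_at_top_neq_bot eventually_conj] by blast
    define uA where "uA n = (if n \<in> A then u n else 0)" for n
    define S where "S \<xi> = (\<Sum>n\<in>A. uA n * dft_basis h n \<xi>)" for \<xi>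
    have S: "S = (\<lambda>\<xi>. \<Sum>n\<in>A. u n * dft_basis h n \<xi>)" by (rule ext) (auto simp: S_def uA_def)
    have uA0: "\<And>n. n \<notin> A \<Longrightarrow> uA n = 0" by (simp add: uA_def)
    have dA: "(uA, S) \<in> discrete_fourier h"
      unfolding S_def[abs_def] by (rule discrete_fourier_finite_support[where u = uA, OF h A(1) uA0])
    have SL: "S \<in> L2 (torus_measure h)" by (rule isometry_L2(2)[OF D dA])
    have "(step_fun h uA, fourier_integral (step_fun h uA)) \<in> fourier"
      by (intro fourier_L1_L2 integrable_step_fun[where u = uA, OF h A(1) uA0] L2_step_fun_finite[where u = uA, OF h A(1) uA0])
    moreover have "fourier_integral (step_fun h uA) = (\<lambda>\<xi>. complex_of_real (cell_mult h \<xi>) * S \<xi>)"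
      by (rule ext) (simp add: fourier_integral_step_fun[where u = uA, OF h A(1) uA0] S_def sum_distrib_left mult_ac)
    ultimately have FA: "(step_fun h uA, \<lambda>\<xi>. complex_of_real (cell_mult h \<xi>) * S \<xi>) \<in> fourier" by simp
    have hA: "(uA, step_fun h uA) \<in> haar_embedding h" by (intro haar_embeddingI h isometry_L2(1)[OF D dA])
    let ?E = "\<lambda>\<xi>. P \<xi> - complex_of_real (cell_mult h \<xi>) * S \<xi>"
    note dF = isometry_diff[OF F P FA]
    have EL: "?E \<in> L2 lborel" by (rule isometry_L2(2)[OF F dF])
    have "L2_norm lborel ?E = L2_norm (grid_measure h) (\<lambda>n. u n - uA n)"
      using isometry_norm[OF F dF] isometry_norm[OF J isometry_diff[OF J up hA]] by simp
    also have "\<dots> = L2_norm (torus_measure h) (\<lambda>\<xi>. Q \<xi> - S \<xi>)"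
      using isometry_norm[OF D isometry_diff[OF D Q dA]] by simp
    also have QS: "\<dots> < e" using A(2) by (subst L2_norm_minus_commute) (simp add: S)
    finally have 1: "L2_norm lborel ?E < e" .
    have 2: "L2_norm lborel (\<lambda>\<xi>. indicator (torus h) \<xi> * ?E \<xi>) \<le> L2_norm lborel ?E"
      by (rule L2_norm_mono_AE[OF L2_D(1)[OF L2_restrict_torus[OF EL, unfolded L2_torus(1)]] EL])
        (auto simp: norm_mult indicator_def)
    have 3: "L2_norm lborel (\<lambda>\<xi>. indicator (torus h) \<xi> * (complex_of_real (cell_mult h \<xi>) * (Q \<xi> - S \<xi>))) < e"
      using mult_le(1)[OF L2_diff[OF QL SL]] QS by simp
    have "?D = (\<lambda>\<xi>. indicator (torus h) \<xi> * ?E \<xi> - indicator (torus h) \<xi> * (complex_of_real (cell_mult h \<xi>) * (Q \<xi> - S \<xi>)))"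
      by (auto simp: algebra_simps)
    then have "L2_norm lborel ?D \<le> L2_norm lborel (\<lambda>\<xi>. indicator (torus h) \<xi> * ?E \<xi>) +
        L2_norm lborel (\<lambda>\<xi>. indicator (torus h) \<xi> * (complex_of_real (cell_mult h \<xi>) * (Q \<xi> - S \<xi>)))"
      using L2_norm_triangle_diff[OF L2_restrict_torus[OF EL, unfolded L2_torus(1)] mult_le(2)[OF L2_diff[OF QL SL]]] by simp
    then show ?thesis using 1 2 3 by linarith
  qed
  have "L2_norm lborel ?D \<le> 0"
  proof (rule field_le_epsilon)
    fix e :: real assume "e > 0"
    then show "L2_norm lborel ?D \<le> 0 + e" using small[of "e / 2"] by simp
  qed
  then have "L2_norm lborel ?D = 0" by (rule antisym) simp
  then have "AE \<xi> in lborel. ?D \<xi> = 0" using L2_norm_eq_0[OF DL] by simp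
  then show ?thesis by eventually_elim (auto simp: indicator_def split: if_splits)
qed

lemma grid_index_grid_point: "h > 0 \<Longrightarrow> grid_index h (h *\<^sub>R vec_of_int n) = n"
  by (simp add: grid_index_eq_iff vec_of_int_def)

text \<open>On a cell the sampled potential is the value of V at its grid point y. So the commutator
  is multiplication by V x - V y, where |x - y| is at most the dimension times h.\<close>

lemma haar_embedding_potential:
  fixes V :: "real ^ 'n \<Rightarrow> real"
  assumes h: "h > 0" and V: "V \<in> borel_measurable borel" "\<And>x. \<bar>V x\<bar> \<le> vb"
    and holder: "\<And>x y. \<bar>V x - V y\<bar> \<le> k * norm (x - y) powr \<theta>" "0 \<le> k" "0 < \<theta>"
    and up: "(u, p) \<in> haar_embedding h" and q: "(\<lambda>n. complex_of_real (V (h *\<^sub>R vec_of_int n)) * u n, q) \<in> haar_embedding h"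
  shows "L2_norm lborel (\<lambda>x. complex_of_real (V x) * p x - q x) \<le>
    (k * (real CARD('n) * h) powr \<theta>) * L2_norm (grid_measure h) u"
proof -
  note J = L2_isometry_haar_embedding[OF h]
  have pL: "p \<in> L2 lborel" and qL: "q \<in> L2 lborel" by (rule isometry_L2(2)[OF J up] isometry_L2(2)[OF J q])+
  have ae: "AE x in lborel. p x = step_fun h u x"
    "AE x in lborel. q x = step_fun h (\<lambda>n. complex_of_real (V (h *\<^sub>R vec_of_int n)) * u n) x"
    using up q by (auto simp: haar_embedding_def)
  let ?C = "k * (real CARD('n) * h) powr \<theta>"
  have "L2_norm lborel (\<lambda>x. complex_of_real (V x) * p x - q x) \<le> L2_norm lborel (\<lambda>x. complex_of_real ?C * p x)"
  proof (rule L2_norm_mono_AE)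
    show "(\<lambda>x. complex_of_real (V x) * p x - q x) \<in> borel_measurable lborel"
      using L2_D(1)[OF pL] L2_D(1)[OF qL] V(1) by measurable
    show "(\<lambda>x. complex_of_real ?C * p x) \<in> L2 lborel" by (rule L2_scale[OF pL])
    show "AE x in lborel. cmod (complex_of_real (V x) * p x - q x) \<le> cmod (complex_of_real ?C * p x)"
      using ae
    proof eventually_elim
      case (elim x)
      define y where "y = h *\<^sub>R vec_of_int (grid_index h x)"
      have "grid_index h x = grid_index h y" by (simp add: y_def grid_index_grid_point h)
      from same_cell_dist[OF h this] have d: "norm (x - y) \<le> real CARD('n) * h" .
      have "\<bar>V x - V y\<bar> \<le> k * norm (x - y) powr \<theta>" by (rule holder)
      also have "\<dots> \<le> ?C" using d holder by (intro mult_left_mono powr_mono2) auto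
      finally have le: "\<bar>V x - V y\<bar> \<le> \<bar>?C\<bar>" by simp
      have "complex_of_real (V x) * p x - q x = complex_of_real (V x - V y) * p x"
        by (simp add: elim step_fun_def y_def algebra_simps)
      then have "cmod (complex_of_real (V x) * p x - q x) = \<bar>V x - V y\<bar> * cmod (p x)"
        by (simp only: norm_mult norm_of_real)
      also have "\<dots> \<le> \<bar>?C\<bar> * cmod (p x)" by (rule mult_right_mono[OF le]) simp
      finally show ?case unfolding norm_mult norm_of_real .
    qed
  qed
  also have "\<dots> = ?C * L2_norm (grid_measure h) u"
    using isometry_norm[OF J up] holder unfolding L2_norm_scale norm_of_real by simp
  finally show ?thesis .
qed

definition cutoff_embedding :: "real \<Rightarrow> ((int ^ 'n \<Rightarrow> complex) \<times> (real ^ 'n \<Rightarrow> complex)) set" where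
  "cutoff_embedding h = {(u, p). \<exists>U. (u, U) \<in> discrete_fourier h \<and> (p, \<lambda>\<xi>. indicator (torus h) \<xi> * U \<xi>) \<in> fourier}"

text \<open>Existence of an image is the surjectivity of the Fourier transform: some function must
  have the extension by zero as its transform.\<close>

lemma L2_isometry_cutoff_embedding:
  assumes h: "h > 0"
  shows "L2_isometry (grid_measure h) lborel (cutoff_embedding h)"
  unfolding L2_isometry_def
proof (intro conjI allI impI ballI)
  note F = L2_isometry_fourier and D = L2_isometry_discrete_fourier[OF h]
  show "cutoff_embedding h \<subseteq> L2 (grid_measure h) \<times> L2 lborel"
    using isometry_L2(1)[OF F] isometry_L2(1)[OF D] by (fastforce simp: cutoff_embedding_def)
  show "\<exists>p. (u, p) \<in> cutoff_embedding h" if "u \<in> L2 (grid_measure h)" for u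
  proof -
    obtain U where U: "(u, U) \<in> discrete_fourier h" using isometry_total[OF D \<open>u \<in> _\<close>] by blast
    have "(\<lambda>\<xi>. indicator (torus h) \<xi> * U \<xi>) \<in> L2 lborel" using isometry_L2(2)[OF D U] by (simp add: L2_torus)
    from fourier_onto[OF this] U show ?thesis by (auto simp: cutoff_embedding_def)
  qed
  show "L2_norm lborel p = L2_norm (grid_measure h) u" if up: "(u, p) \<in> cutoff_embedding h" for u p
  proof -
    from up obtain U where U: "(u, U) \<in> discrete_fourier h" "(p, \<lambda>\<xi>. indicator (torus h) \<xi> * U \<xi>) \<in> fourier"
      by (auto simp: cutoff_embedding_def)
    show ?thesis using isometry_norm[OF F U(2)] isometry_norm[OF D U(1)] by (simp add: L2_torus)
  qed
  show "(\<lambda>n. u n + c * u' n, \<lambda>x. p x + c * p' x) \<in> cutoff_embedding h"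
    if up: "(u, p) \<in> cutoff_embedding h" "(u', p') \<in> cutoff_embedding h" for u p u' p' c
  proof -
    from up obtain U U' where U: "(u, U) \<in> discrete_fourier h" "(p, \<lambda>\<xi>. indicator (torus h) \<xi> * U \<xi>) \<in> fourier"
      "(u', U') \<in> discrete_fourier h" "(p', \<lambda>\<xi>. indicator (torus h) \<xi> * U' \<xi>) \<in> fourier"
      by (auto simp: cutoff_embedding_def)
    have "(\<lambda>\<xi>. indicator (torus h) \<xi> * U \<xi> + c * (indicator (torus h) \<xi> * U' \<xi>)) = (\<lambda>\<xi>. indicator (torus h) \<xi> * (U \<xi> + c * U' \<xi>))"
      by (auto simp: algebra_simps)
    then show ?thesis
      using isometry_linear[OF D U(1,3), of c] isometry_linear[OF F U(2,4), of c]
      by (auto simp: cutoff_embedding_def intro!: exI[of _ "\<lambda>\<xi>. U \<xi> + c * U' \<xi>"])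
  qed
  show "(u, p') \<in> cutoff_embedding h"
    if up: "(u, p) \<in> cutoff_embedding h" "p' \<in> borel_measurable lborel" "AE x in lborel. p' x = p x" for u p p'
  proof -
    from up obtain U where U: "(u, U) \<in> discrete_fourier h" "(p, \<lambda>\<xi>. indicator (torus h) \<xi> * U \<xi>) \<in> fourier"
      by (auto simp: cutoff_embedding_def)
    have "p' \<in> L2 lborel" by (rule L2_cong_AE[OF isometry_L2(1)[OF F U(2)] up(2,3)])
    moreover have "AE x in lborel. p x = p' x" using up(3) by eventually_elim simp
    ultimately have "(p', \<lambda>\<xi>. indicator (torus h) \<xi> * U \<xi>) \<in> fourier" by (rule isometry_cong_AE_left[OF F U(2)])
    then show ?thesis using U(1) by (auto simp: cutoff_embedding_def)
  qed
qed

lemma cutoff_embedding_fourier: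
  fixes p :: "real ^ 'n \<Rightarrow> complex"
  assumes h: "h > 0" and up: "(u, p) \<in> cutoff_embedding h" and P: "(p, P) \<in> fourier" and Q: "(u, Q) \<in> discrete_fourier h"
  shows "AE \<xi> in lborel. \<xi> \<in> torus h \<longrightarrow> P \<xi> = Q \<xi>"
proof -
  from up obtain U where U: "(u, U) \<in> discrete_fourier h" "(p, \<lambda>\<xi>. indicator (torus h) \<xi> * U \<xi>) \<in> fourier"
    by (auto simp: cutoff_embedding_def)
  have "AE \<xi> in lborel. \<xi> \<in> torus h \<longrightarrow> U \<xi> = Q \<xi>"
    using isometry_cong_AE[OF L2_isometry_discrete_fourier[OF h] U(1) Q] by (simp add: AE_torus)
  moreover have "AE \<xi> in lborel. P \<xi> = indicator (torus h) \<xi> * U \<xi>"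
    by (rule isometry_cong_AE[OF L2_isometry_fourier P U(2)]) simp
  ultimately show ?thesis by eventually_elim auto
qed

section \<open>Rates\<close>

lemma norm_ge_outside_torus:
  assumes h: "h > 0" and \<xi>: "\<xi> \<notin> torus h"
  shows "1 \<le> h * norm \<xi>"
proof -
  obtain i where i: "pi / h < \<bar>\<xi> $ i\<bar>" using \<xi> by (auto simp: mem_cube not_le)
  have "1 \<le> pi" using pi_ge_two by linarith
  then have "1 / h \<le> pi / h" using h by (intro divide_right_mono) auto
  also have "\<dots> \<le> norm \<xi>" using i component_le_norm_cart[of \<xi> i] by linarith
  finally show ?thesis using h by (simp add: field_simps)
qed

text \<open>The weight 1 + |xi|^\<alpha> of \<open>consistent_symbol\<close> is exchanged for 1 + G
  and, since the sine point has at least half the norm of xi, for 1 + G_h. The exponent \<rho>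
  leaves room for a rate lowered by the potential.\<close>

lemma consistent_symbol_bounds:
  fixes G :: "real ^ 'n \<Rightarrow> real"
  assumes "consistent_symbol G \<alpha> \<gamma> c C" and \<rho>: "0 < \<rho>" "\<rho> \<le> \<gamma>"
  obtains k where "k > 0"
    "\<And>h \<xi>. 0 < h \<Longrightarrow> h \<le> 1 \<Longrightarrow> \<xi> \<in> torus h \<Longrightarrow>
       \<bar>G \<xi> - discrete_symbol G h \<xi>\<bar> \<le> (k * h powr \<rho>) * ((1 + G \<xi>) * (1 + discrete_symbol G h \<xi>))"
    "\<And>h \<xi>. 0 < h \<Longrightarrow> h \<le> 1 \<Longrightarrow> 1 \<le> h * norm \<xi> \<Longrightarrow> 1 \<le> (k * h powr \<rho>) * (1 + G \<xi>)"
    "\<And>h \<xi>. 0 < h \<Longrightarrow> h \<le> 1 \<Longrightarrow> \<xi> \<in> torus h \<Longrightarrow> 1 \<le> h * norm \<xi> \<Longrightarrow>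
       1 \<le> (k * h powr \<rho>) * (1 + discrete_symbol G h \<xi>)"
    "\<And>h \<xi>. 0 < h \<Longrightarrow> h \<le> 1 \<Longrightarrow> \<xi> \<in> torus h \<Longrightarrow> \<rho> \<le> 1 \<Longrightarrow>
       1 - (cell_mult h \<xi>)\<^sup>2 \<le> ((k * h powr \<rho>) * (1 + discrete_symbol G h \<xi>))\<^sup>2"
proof -
  have s: "\<gamma> \<le> \<alpha>" "0 < c" "0 < C" and G0: "\<And>\<xi>. 0 \<le> G \<xi>"
    and grow: "\<And>\<xi>. c * (1 + norm \<xi> powr \<alpha>) \<le> 1 + G \<xi>"
    and cons: "\<And>h \<xi>. 0 < h \<Longrightarrow> h \<le> 1 \<Longrightarrow> \<xi> \<in> torus h \<Longrightarrow>
        \<bar>G \<xi> - discrete_symbol G h \<xi>\<bar> \<le> C * (h powr \<gamma> * (1 + norm \<xi> powr \<alpha>)\<^sup>2)"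
    using assms(1) by (auto simp: consistent_symbol_def)
  have \<alpha>: "0 < \<alpha>" "\<rho> \<le> \<alpha>" using s \<rho> by linarith+
  define c1 where "c1 = c * 2 powr (- \<alpha>)"
  have c1: "0 < c1" using s by (simp add: c1_def)
  define d where "d = real CARD('n)"
  have d: "1 \<le> d" by (simp add: d_def Suc_le_eq)
  define X where "X = pi * d"
  have X: "1 \<le> X" using mult_mono[of 1 pi 1 d] pi_ge_two d by (simp add: X_def)
  \<comment> \<open>One summand for each of the four conclusions, in their order.\<close>
  define k where "k = C / (c * c1) + 1 / c + 1 / c1 + d * X / c1"
  have "0 < d * X" using d X by (intro mult_pos_pos) auto
  then have kp: "0 < C / (c * c1)" "0 < 1 / c" "0 < 1 / c1" "0 < d * X / c1"
    using s c1 by (auto intro!: divide_pos_pos)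
  have k: "k > 0" "C / (c * c1) \<le> k" "1 / c \<le> k" "1 / c1 \<le> k" "d * X / c1 \<le> k"
    using kp unfolding k_def by linarith+
  have Gh0: "0 \<le> discrete_symbol G h \<xi>" for h \<xi> by (simp add: discrete_symbol_sine_point G0)
  have growh: "c1 * (1 + norm \<xi> powr \<alpha>) \<le> 1 + discrete_symbol G h \<xi>" if "0 < h" "\<xi> \<in> torus h" for h and \<xi> :: "real ^ 'n"
  proof -
    have "2 powr (- \<alpha>) * norm \<xi> powr \<alpha> = (norm \<xi> / 2) powr \<alpha>"
      by (simp add: powr_divide powr_minus field_simps)
    also have "\<dots> \<le> norm (sine_point h \<xi>) powr \<alpha>" using norm_sine_point(1)[OF that] \<alpha> by (intro powr_mono2) auto
    finally have 1: "2 powr (- \<alpha>) * norm \<xi> powr \<alpha> \<le> norm (sine_point h \<xi>) powr \<alpha>" .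
    have "2 powr (- \<alpha>) \<le> (2::real) powr 0" using \<alpha> by (intro powr_mono) auto
    then have "c * (2 powr (- \<alpha>) * (1 + norm \<xi> powr \<alpha>)) \<le> c * (1 + norm (sine_point h \<xi>) powr \<alpha>)"
      using 1 s by (intro mult_left_mono) (auto simp: distrib_left)
    also have "\<dots> \<le> 1 + discrete_symbol G h \<xi>" using grow by (simp add: discrete_symbol_sine_point)
    finally show ?thesis by (simp add: c1_def mult.assoc)
  qed
  have up: "1 + norm \<xi> powr \<alpha> \<le> (1 + G \<xi>) / c" for \<xi>
    using grow[of \<xi>] s by (simp add: field_simps)
  have uph: "1 + norm \<xi> powr \<alpha> \<le> (1 + discrete_symbol G h \<xi>) / c1" if "0 < h" "\<xi> \<in> torus h" for h \<xi>
    using growh[OF that] c1 by (simp add: field_simps)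
  have hp: "h powr q \<le> h powr \<rho>" if "0 < h" "h \<le> 1" "\<rho> \<le> q" for h q
    using that by (intro powr_mono') auto
  have high: "1 \<le> h powr \<rho> * (1 + norm \<xi> powr \<alpha>)" if "0 < h" "h \<le> 1" "1 \<le> h * norm \<xi>" for h and \<xi> :: "real ^ 'n"
  proof -
    have "1 \<le> (h * norm \<xi>) powr \<alpha>" using that \<alpha> by (intro ge_one_powr_ge_zero) auto
    also have "\<dots> = h powr \<alpha> * norm \<xi> powr \<alpha>" using that by (simp add: powr_mult)
    also have "\<dots> \<le> h powr \<rho> * (1 + norm \<xi> powr \<alpha>)" using hp[OF that(1,2) \<alpha>(2)] by (intro mult_mono) auto
    finally show ?thesis .
  qed
  show thesis
  proof (rule that[OF k(1)])
    fix h :: real and \<xi> :: "real ^ 'n" assume h: "0 < h" "h \<le> 1"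
    let ?g = "1 + G \<xi>" and ?gh = "1 + discrete_symbol G h \<xi>"
    have g0: "0 \<le> ?g" "0 \<le> ?gh" using G0[of \<xi>] Gh0[of h \<xi>] by linarith+
    have h0: "0 \<le> h powr \<rho>" by simp
    have scale: "h powr \<rho> * (x / y) \<le> (k * h powr \<rho>) * x" if "1 / y \<le> k" "0 \<le> x" for x y
    proof -
      have "(1 / y) * (h powr \<rho> * x) \<le> k * (h powr \<rho> * x)" using that by (intro mult_right_mono) auto
      then show ?thesis by (simp add: mult_ac)
    qed
    show "1 \<le> (k * h powr \<rho>) * ?g" if "1 \<le> h * norm \<xi>"
    proof -
      have "1 \<le> h powr \<rho> * (1 + norm \<xi> powr \<alpha>)" by (rule high[OF h that])
      also have "\<dots> \<le> h powr \<rho> * (?g / c)" using up by (intro mult_left_mono) auto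
      also have "\<dots> \<le> (k * h powr \<rho>) * ?g" by (rule scale[OF k(3) g0(1)])
      finally show ?thesis .
    qed
    assume \<xi>: "\<xi> \<in> torus h"
    show "1 \<le> (k * h powr \<rho>) * ?gh" if "1 \<le> h * norm \<xi>"
    proof -
      have "1 \<le> h powr \<rho> * (1 + norm \<xi> powr \<alpha>)" by (rule high[OF h that])
      also have "\<dots> \<le> h powr \<rho> * (?gh / c1)" using uph[OF h(1) \<xi>] by (intro mult_left_mono) auto
      also have "\<dots> \<le> (k * h powr \<rho>) * ?gh" by (rule scale[OF k(4) g0(2)])
      finally show ?thesis .
    qed
    show "\<bar>G \<xi> - discrete_symbol G h \<xi>\<bar> \<le> (k * h powr \<rho>) * (?g * ?gh)"
    proof -
      have "\<bar>G \<xi> - discrete_symbol G h \<xi>\<bar> \<le> C * (h powr \<gamma> * (1 + norm \<xi> powr \<alpha>)\<^sup>2)" by (rule cons[OF h \<xi>])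
      also have "\<dots> \<le> C * (h powr \<rho> * ((?g / c) * (?gh / c1)))"
        unfolding power2_eq_square using up uph[OF h(1) \<xi>] hp[OF h \<rho>(2)] s g0
        by (intro mult_left_mono mult_mono) auto
      also have "\<dots> = C / (c * c1) * (h powr \<rho> * (?g * ?gh))" by simp
      also have "\<dots> \<le> k * (h powr \<rho> * (?g * ?gh))" using k(2) g0 by (intro mult_right_mono) auto
      finally show ?thesis by (simp only: mult.assoc)
    qed
    show "1 - (cell_mult h \<xi>)\<^sup>2 \<le> ((k * h powr \<rho>) * ?gh)\<^sup>2" if \<rho>1: "\<rho> \<le> 1"
    proof -
      define r where "r = norm \<xi>"
      have r: "0 \<le> r" by (simp add: r_def)
      have hr: "h * r \<le> X" using norm_torus_le[OF h(1) \<xi>] by (simp add: r_def X_def d_def)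
      \<comment> \<open>Only the power \<rho> of h r is kept, the rest being bounded by X. This
        takes \<rho> <= 1, the limit on the rate of step functions.\<close>
      have "h * r = (h * r) powr \<rho> * (h * r) powr (1 - \<rho>)"
        using h r by (cases "r = 0") (simp_all add: powr_add[symmetric])
      also have "\<dots> \<le> (h * r) powr \<rho> * X powr (1 - \<rho>)"
        using hr h r \<rho>1 by (intro mult_left_mono powr_mono2) auto
      also have "X powr (1 - \<rho>) \<le> X" using X \<rho> powr_mono[of "1 - \<rho>" 1 X] by simp
      finally have "h * r \<le> (h * r) powr \<rho> * X" by (simp add: mult_left_mono)
      also have "(h * r) powr \<rho> = h powr \<rho> * r powr \<rho>" using h r by (simp add: powr_mult)
      also have "r powr \<rho> \<le> 1 + r powr \<alpha>"
      proof (cases "r \<le> 1")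
        case True
        then have "r powr \<rho> \<le> 1 powr \<rho>" using r \<rho> by (intro powr_mono2) auto
        then show ?thesis by (simp add: add_increasing2)
      next
        case False
        then have "r powr \<rho> \<le> r powr \<alpha>" using \<alpha> by (intro powr_mono) auto
        then show ?thesis by simp
      qed
      finally have 1: "h * r \<le> h powr \<rho> * (1 + r powr \<alpha>) * X" using X by (simp add: mult_left_mono mult_right_mono)
      have "1 - (cell_mult h \<xi>)\<^sup>2 \<le> d * (h * r)\<^sup>2" using cell_mult_bounds(3)[OF h(1) \<xi>] by (simp add: d_def r_def)
      also have "\<dots> \<le> (d * (h * r))\<^sup>2"
      proof -
        have "d * 1 \<le> d * d" using d by (intro mult_left_mono) auto
        then have "d * (h * r)\<^sup>2 \<le> d\<^sup>2 * (h * r)\<^sup>2" by (intro mult_right_mono) (simp_all add: power2_eq_square)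
        then show ?thesis by (simp only: power_mult_distrib)
      qed
      also have "\<dots> \<le> ((k * h powr \<rho>) * ?gh)\<^sup>2"
      proof (rule power_mono)
        have "d * (h * r) \<le> d * (h powr \<rho> * (?gh / c1) * X)"
          using 1 uph[OF h(1) \<xi>] X d unfolding r_def[symmetric]
          by (intro mult_left_mono order_trans[OF 1] mult_right_mono) auto
        also have "\<dots> = d * X / c1 * (h powr \<rho> * ?gh)" by simp
        also have "\<dots> \<le> k * (h powr \<rho> * ?gh)" using k(5) g0 by (intro mult_right_mono) auto
        finally show "d * (h * r) \<le> k * h powr \<rho> * ?gh" by (simp only: mult.assoc)
        show "0 \<le> d * (h * r)" using d h r by simp
      qed
      finally show ?thesis .
    qed
  qed
qed

text \<open>b is the indicator of a box at a corner of the torus where every coordinate exceeds pi /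
  (2 h), hence h |xi| > pi / 2 >= 1. The discrete symbol is bounded on the compact torus, so its
  product with b stays in L2.\<close>

lemma high_frequency_function:
  fixes G :: "real ^ 'n \<Rightarrow> real"
  assumes h: "h > 0" and G: "continuous_on UNIV G"
  obtains b :: "real ^ 'n \<Rightarrow> complex" where "b \<in> L2 (torus_measure h)" "0 < L2_norm (torus_measure h) b"
    "(\<lambda>\<xi>. complex_of_real (discrete_symbol G h \<xi>) * b \<xi>) \<in> L2 (torus_measure h)"
    "\<And>\<xi>. b \<xi> \<noteq> 0 \<Longrightarrow> 1 \<le> h * norm \<xi>"
proof -
  define S :: "(real ^ 'n) set" where "S = box (\<chi> i. pi / (2 * h)) (\<chi> i. pi / h)"
  define b :: "real ^ 'n \<Rightarrow> complex" where "b = indicator S"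
  have S: "\<xi> \<in> S \<longleftrightarrow> (\<forall>i. pi / (2 * h) < \<xi> $ i \<and> \<xi> $ i < pi / h)" for \<xi> by (simp add: S_def mem_box_cart)
  have lt: "0 < pi / (2 * h)" "pi / (2 * h) < pi / h" using h by (auto simp: field_simps)
  have ST: "S \<subseteq> torus h"
  proof
    fix \<xi> assume \<xi>: "\<xi> \<in> S"
    have "\<bar>\<xi> $ i\<bar> \<le> pi / h" for i
    proof -
      have "pi / (2 * h) < \<xi> $ i" "\<xi> $ i < pi / h" using \<xi> by (auto simp: S)
      then show ?thesis using lt by linarith
    qed
    then show "\<xi> \<in> torus h" by (simp add: mem_cube)
  qed
  have Sm [measurable]: "S \<in> sets borel" by (simp add: S_def)
  have eq: "(\<lambda>\<xi>. indicator (torus h) \<xi> * b \<xi>) = b" using ST by (intro ext) (auto simp: b_def indicator_def)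
  have bL: "b \<in> L2 lborel"
    by (rule L2_bound[OF L2_indicator_cube[of "pi / h"], where K = 1]) (use ST in \<open>auto simp: b_def indicator_def\<close>)
  then have bT: "b \<in> L2 (torus_measure h)" by (rule L2_restrict_torus)
  have pos: "0 < L2_norm (torus_measure h) b"
  proof (rule ccontr)
    assume "\<not> ?thesis"
    then have "L2_norm lborel b = 0" using L2_norm_nonneg[of lborel b] by (simp add: L2_torus eq)
    then have "AE \<xi> in lborel. b \<xi> = 0" using L2_norm_eq_0[OF bL] by simp
    then have "AE \<xi> in lborel. \<xi> \<notin> S" by eventually_elim (auto simp: b_def indicator_def split: if_splits)
    then have "S \<in> null_sets lborel" using AE_iff_null_sets[of S lborel] by simp
    then have "negligible S" by (simp add: negligible_iff_null_sets null_sets_completionI)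
    moreover have "S \<noteq> {}"
    proof -
      have "(\<chi> i. 3 / 4 * (pi / h)) \<in> S" using h by (simp add: S field_simps)
      then show ?thesis by blast
    qed
    moreover have "open S" unfolding S_def by (rule open_box)
    ultimately show False using open_not_negligible by blast
  qed
  have cont: "continuous_on UNIV (\<lambda>\<xi>. discrete_symbol G h \<xi>)"
    unfolding discrete_symbol_sine_point sine_point_def
    by (rule continuous_on_compose2[OF G]) (use h in \<open>auto intro!: continuous_intros\<close>)
  then have [measurable]: "discrete_symbol G h \<in> borel_measurable borel"
    by (rule borel_measurable_continuous_onI)
  have "compact (discrete_symbol G h ` torus h)"
    unfolding cube_def by (intro compact_continuous_image continuous_on_subset[OF cont] compact_cbox) auto
  then obtain M where M: "\<And>\<xi>. \<xi> \<in> torus h \<Longrightarrow> \<bar>discrete_symbol G h \<xi>\<bar> \<le> M"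
    using compact_imp_bounded bounded_iff by (metis imageI real_norm_def)
  have "(\<lambda>\<xi>. complex_of_real (discrete_symbol G h \<xi>) * b \<xi>) \<in> L2 lborel"
  proof (rule L2_bound[OF bL, where K = M])
    show "AE \<xi> in lborel. cmod (complex_of_real (discrete_symbol G h \<xi>) * b \<xi>) \<le> M * cmod (b \<xi>)"
      using M ST by (auto simp: b_def indicator_def)
  qed (simp add: b_def)
  then have 3: "(\<lambda>\<xi>. complex_of_real (discrete_symbol G h \<xi>) * b \<xi>) \<in> L2 (torus_measure h)" by (rule L2_restrict_torus)
  have 4: "1 \<le> h * norm \<xi>" if "b \<xi> \<noteq> 0" for \<xi>
  proof -
    \<comment> \<open>\<open>undefined\<close> stands for an arbitrary coordinate; index types are
      inhabited.\<close>
    have "pi / (2 * h) < \<xi> $ undefined" using that by (auto simp: b_def indicator_def S split: if_splits)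
    also have "\<dots> \<le> norm \<xi>" using component_le_norm_cart[of \<xi> undefined] by linarith
    finally have "pi < 2 * h * norm \<xi>" using h by (simp add: field_simps)
    then show ?thesis using pi_ge_two by linarith
  qed
  show thesis by (rule that[OF bT pos 3 4])
qed

text \<open>All constants have to be found before h. They repeat those of
  \<open>discretization\<close> and involve the bound K of the resolvent of H alone; with \<delta> =
  t h^\<rho> the locale then applies to every h up to h0.\<close>

lemma hausdorff_rate:
  fixes G V :: "real ^ 'n \<Rightarrow> real" and J :: "real \<Rightarrow> ((int ^ 'n \<Rightarrow> complex) \<times> (real ^ 'n \<Rightarrow> complex)) set"
    and m :: "real \<Rightarrow> real ^ 'n \<Rightarrow> real"
  assumes G: "consistent_symbol G \<alpha> \<gamma> c C" and \<rho>: "0 < \<rho>" "\<rho> \<le> \<gamma>"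
    and const: "0 < \<mu>" "0 < mb" "mb \<le> 1" "0 \<le> vb" "0 \<le> km" "0 \<le> kp"
    and V: "V \<in> borel_measurable borel" "\<And>x. \<bar>V x\<bar> \<le> vb"
    and res: "complex_of_real (- \<mu>) \<in> resolvent_set lborel (H_op G V)"
      "\<And>h. 0 < h \<Longrightarrow> complex_of_real (- \<mu>) \<in> resolvent_set (grid_measure h) (Hh_op G V h)"
    and m_bounds: "\<And>h \<xi>. 0 < h \<Longrightarrow> h \<le> 1 \<Longrightarrow> \<xi> \<in> torus h \<Longrightarrow> mb \<le> m h \<xi>"
      "\<And>h \<xi>. 0 < h \<Longrightarrow> h \<le> 1 \<Longrightarrow> \<xi> \<in> torus h \<Longrightarrow> m h \<xi> \<le> 1"
      "\<And>h \<xi>. 0 < h \<Longrightarrow> h \<le> 1 \<Longrightarrow> \<xi> \<in> torus h \<Longrightarrow>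
         1 - (m h \<xi>)\<^sup>2 \<le> ((km * h powr \<rho>) * (1 + discrete_symbol G h \<xi>))\<^sup>2"
    and J_iso: "\<And>h. 0 < h \<Longrightarrow> L2_isometry (grid_measure h) lborel (J h)"
    and J_fourier: "\<And>h u p P Q. 0 < h \<Longrightarrow> (u, p) \<in> J h \<Longrightarrow> (p, P) \<in> fourier \<Longrightarrow> (u, Q) \<in> discrete_fourier h \<Longrightarrow>
        AE \<xi> in lborel. \<xi> \<in> torus h \<longrightarrow> P \<xi> = complex_of_real (m h \<xi>) * Q \<xi>"
    and J_potential: "\<And>h u p q. 0 < h \<Longrightarrow> h \<le> 1 \<Longrightarrow> (u, p) \<in> J h \<Longrightarrow>
        (\<lambda>k. complex_of_real (V (h *\<^sub>R vec_of_int k)) * u k, q) \<in> J h \<Longrightarrow>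
        L2_norm lborel (\<lambda>x. complex_of_real (V x) * p x - q x) \<le> (kp * h powr \<rho>) * L2_norm (grid_measure h) u"
  shows "\<exists>C>0. \<exists>h0>0. \<forall>h. 0 < h \<and> h \<le> h0 \<longrightarrow>
      hausdorff_dist (spectrum (grid_measure h) (shifted_inverse (grid_measure h) (Hh_op G V h) \<mu>))
        (spectrum lborel (shifted_inverse lborel (H_op G V) \<mu>)) \<le> C * h powr \<rho>"
proof -
  obtain k where k: "k > 0"
    "\<And>h \<xi>. 0 < h \<Longrightarrow> h \<le> 1 \<Longrightarrow> \<xi> \<in> torus h \<Longrightarrow>
       \<bar>G \<xi> - discrete_symbol G h \<xi>\<bar> \<le> (k * h powr \<rho>) * ((1 + G \<xi>) * (1 + discrete_symbol G h \<xi>))"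
    "\<And>h \<xi>. 0 < h \<Longrightarrow> h \<le> 1 \<Longrightarrow> 1 \<le> h * norm \<xi> \<Longrightarrow> 1 \<le> (k * h powr \<rho>) * (1 + G \<xi>)"
    "\<And>h \<xi>. 0 < h \<Longrightarrow> h \<le> 1 \<Longrightarrow> \<xi> \<in> torus h \<Longrightarrow> 1 \<le> h * norm \<xi> \<Longrightarrow>
       1 \<le> (k * h powr \<rho>) * (1 + discrete_symbol G h \<xi>)"
    by (rule consistent_symbol_bounds[OF G \<rho>]) (rule that)
  have G0: "\<And>\<xi>. 0 \<le> G \<xi>" and cont: "continuous_on UNIV G" using G by (auto simp: consistent_symbol_def)
  have Gh0: "0 \<le> discrete_symbol G h \<xi>" for h \<xi> by (simp add: discrete_symbol_sine_point G0)
  have "\<exists>K. \<forall>(g, \<phi>) \<in> shifted_inverse lborel (H_op G V) \<mu>. L2_norm lborel \<phi> \<le> K * L2_norm lborel g"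
    using res(1) by (simp add: resolvent_set_def shifted_inverse_def bounded_everywhere_def)
  then obtain K0 where K0: "\<And>g \<phi>. (g, \<phi>) \<in> shifted_inverse lborel (H_op G V) \<mu> \<Longrightarrow> L2_norm lborel \<phi> \<le> K0 * L2_norm lborel g"
    by blast
  \<comment> \<open>\<open>discretization\<close> asks for a non-negative bound, and K0 comes
    without a sign.\<close>
  define K where "K = max 0 K0"
  have K: "0 \<le> K" "L2_norm lborel \<phi> \<le> K * L2_norm lborel g" if "(g, \<phi>) \<in> shifted_inverse lborel (H_op G V) \<mu>" for g \<phi>
  proof -
    have "K0 * L2_norm lborel g \<le> K * L2_norm lborel g" by (intro mult_right_mono) (auto simp: K_def)
    with K0[OF that] show "0 \<le> K" "L2_norm lborel \<phi> \<le> K * L2_norm lborel g" by (auto simp: K_def)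
  qed
  define M where "M = vb + \<mu> + 1"
  define L where "L = 1 + M * K"
  define Lh where "Lh = 1 + M * (2 * (K + 1))"
  define A where "A = max (8 * L * Lh) (max (4 * (L + 1) / mb + 2) (4 * (4 * L * Lh + 1) / mb + 1))"
  have pos: "M \<ge> 1" "L \<ge> 1" "Lh \<ge> 1" using const by (auto simp: M_def L_def Lh_def K_def)
  have A: "A > 0"
  proof -
    have "0 < 4 * (L + 1) / mb" using pos const by simp
    then show ?thesis by (auto simp: A_def less_max_iff_disj)
  qed
  \<comment> \<open>A common factor for the three kinds of error: k for the symbols, km for the
    multiplier, kp for the potential.\<close>
  define t where "t = k + km + kp"
  have t: "t > 0" "k \<le> t" "km \<le> t" "kp \<le> t" using k const by (auto simp: t_def)
  \<comment> \<open>The second entry solves 8 t h^\<rho> L M = 1, the smallness demanded by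
    \<open>hausdorff_estimate\<close>; the first is the range of h in which the symbol is
    consistent.\<close>
  define h0 where "h0 = min 1 ((1 / (8 * t * L * M)) powr (1 / \<rho>))"
  have Q: "0 < 8 * t * L * M" using t pos by simp
  have h0: "h0 > 0" using Q by (auto simp: h0_def)
  have "hausdorff_dist (spectrum (grid_measure h) (shifted_inverse (grid_measure h) (Hh_op G V h) \<mu>))
        (spectrum lborel (shifted_inverse lborel (H_op G V) \<mu>)) \<le> (A * t) * h powr \<rho>" if h: "0 < h" "h \<le> h0" for h
  proof -
    have h1: "h \<le> 1" using h by (simp add: h0_def)
    define \<delta> where "\<delta> = t * h powr \<rho>"
    have "h powr \<rho> \<le> ((1 / (8 * t * L * M)) powr (1 / \<rho>)) powr \<rho>"
      using h \<rho> by (intro powr_mono2) (auto simp: h0_def)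
    also have "\<dots> = 1 / (8 * t * L * M)" using Q \<rho> by (simp add: powr_powr)
    finally have small: "8 * \<delta> * L * M \<le> 1" using Q by (simp add: \<delta>_def field_simps)
    have le: "s * h powr \<rho> \<le> \<delta>" if "s \<le> t" for s using that by (simp add: \<delta>_def mult_right_mono)
    obtain b :: "real ^ 'n \<Rightarrow> complex" where b: "b \<in> L2 (torus_measure h)" "0 < L2_norm (torus_measure h) b"
      "(\<lambda>\<xi>. complex_of_real (discrete_symbol G h \<xi>) * b \<xi>) \<in> L2 (torus_measure h)"
      "\<And>\<xi>. b \<xi> \<noteq> 0 \<Longrightarrow> 1 \<le> h * norm \<xi>"
      using high_frequency_function[OF h(1) cont] by metis
    have D: "discretization G V \<mu> h \<delta> vb mb K (J h) (m h) b"
    proof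
      show "0 < h" "0 < \<mu>" "0 < mb" "0 \<le> vb" "\<And>\<xi>. 0 \<le> G \<xi>" "\<And>x. \<bar>V x\<bar> \<le> vb" by fact+
      show "0 < \<delta>" using t h by (simp add: \<delta>_def)
      show "0 \<le> K" by (simp add: K_def)
      show "\<bar>G \<xi> - discrete_symbol G h \<xi>\<bar> \<le> \<delta> * ((1 + G \<xi>) * (1 + discrete_symbol G h \<xi>))" if "\<xi> \<in> torus h" for \<xi>
        by (rule order_trans[OF k(2)[OF h(1) h1 that] mult_right_mono[OF le[OF t(2)]]]) (simp add: G0 Gh0)
      show "1 \<le> \<delta> * (1 + G \<xi>)" if "\<xi> \<notin> torus h" for \<xi>
        by (rule order_trans[OF k(3)[OF h(1) h1 norm_ge_outside_torus[OF h(1) that]] mult_right_mono[OF le[OF t(2)]]])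
          (simp add: G0)
      show "mb \<le> m h \<xi>" "m h \<xi> \<le> 1" if "\<xi> \<in> torus h" for \<xi> using m_bounds(1,2) h(1) h1 that by auto
      show "1 - (m h \<xi>)\<^sup>2 \<le> (\<delta> * (1 + discrete_symbol G h \<xi>))\<^sup>2" if "\<xi> \<in> torus h" for \<xi>
      proof (rule order_trans[OF m_bounds(3)[OF h(1) h1 that]], rule power_mono)
        show "km * h powr \<rho> * (1 + discrete_symbol G h \<xi>) \<le> \<delta> * (1 + discrete_symbol G h \<xi>)"
          by (rule mult_right_mono[OF le[OF t(3)]]) (simp add: Gh0)
        show "0 \<le> km * h powr \<rho> * (1 + discrete_symbol G h \<xi>)" using const by (simp add: Gh0)
      qed
      show "L2_isometry (grid_measure h) lborel (J h)" by (rule J_iso[OF h(1)])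
      show "AE \<xi> in lborel. \<xi> \<in> torus h \<longrightarrow> P \<xi> = complex_of_real (m h \<xi>) * Q \<xi>"
        if "(u, p) \<in> J h" "(p, P) \<in> fourier" "(u, Q) \<in> discrete_fourier h" for u p P Q
        by (rule J_fourier[OF h(1) that])
      show "L2_norm lborel (\<lambda>x. complex_of_real (V x) * p x - q x) \<le> \<delta> * L2_norm (grid_measure h) u"
        if "(u, p) \<in> J h" "(\<lambda>k. complex_of_real (V (h *\<^sub>R vec_of_int k)) * u k, q) \<in> J h" for u p q
        by (rule order_trans[OF J_potential[OF h(1) h1 that] mult_right_mono[OF le[OF t(4)]]]) simp
      show "1 \<le> \<delta> * (1 + discrete_symbol G h \<xi>)" if "\<xi> \<in> torus h" "b \<xi> \<noteq> 0" for \<xi>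
        by (rule order_trans[OF k(4)[OF h(1) h1 that(1) b(4)[OF that(2)]] mult_right_mono[OF le[OF t(2)]]]) (simp add: Gh0)
      show "complex_of_real (- \<mu>) \<in> resolvent_set (grid_measure h) (Hh_op G V h)" by (rule res(2)[OF h(1)])
    qed (fact V(1) b(1-3) res(1) K(2))+
    note defs = discretization.M1_def[OF D] discretization.L_def[OF D] discretization.Lh_def[OF D]
      discretization.Kh_def[OF D] discretization.C\<^sub>2_def[OF D]
    have small': "8 * \<delta> * discretization.L \<mu> vb K * discretization.M1 \<mu> vb \<le> 1"
      using small unfolding defs L_def M_def .
    have "hausdorff_dist (spectrum (grid_measure h) (shifted_inverse (grid_measure h) (Hh_op G V h) \<mu>))
        (spectrum lborel (shifted_inverse lborel (H_op G V) \<mu>)) \<le> A * \<delta>"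
      using discretization.hausdorff_estimate[OF D small' const(3)]
      unfolding defs A_def L_def Lh_def M_def .
    then show ?thesis by (simp add: \<delta>_def mult_ac)
  qed
  moreover have "0 < A * t" using A t by simp
  ultimately show ?thesis using h0 by blast
qed

text \<open>Supplies the measurability of V.\<close>

lemma hoelder_imp_continuous:
  fixes f :: "'a::real_normed_vector \<Rightarrow> real"
  assumes "\<And>x y. \<bar>f x - f y\<bar> \<le> k * norm (x - y) powr \<theta>" "0 < \<theta>"
  shows "continuous_on UNIV f"
proof (rule continuous_at_imp_continuous_on, intro ballI)
  fix x :: 'a
  have "((\<lambda>y. norm (y - x)) \<longlongrightarrow> 0) (at x)" by (intro tendsto_norm_zero LIM_zero tendsto_ident_at)
  then have "((\<lambda>y. k * norm (y - x) powr \<theta>) \<longlongrightarrow> 0) (at x)"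
    using assms(2) by (intro tendsto_mult_right_zero tendsto_zero_powrI[where b = \<theta>]) auto
  then have "((\<lambda>y. f y - f x) \<longlongrightarrow> 0) (at x)"
    by (rule Lim_null_comparison[rotated]) (use assms(1) in auto)
  then show "isCont f x" unfolding isCont_def by (rule LIM_zero_cancel)
qed

theorem theorem5p2:
  fixes \<phi>0 \<psi>0 :: "real ^ 'n \<Rightarrow> complex"
    and V G0 :: "real ^ 'n \<Rightarrow> real"
    and p :: symbol_class
    and \<theta> \<tau> \<mu> :: real
  assumes "admissible_data p \<theta> \<tau> \<phi>0 \<psi>0 V G0"
    and "\<mu> > 0"
    and "complex_of_real ` {..- \<mu>} \<subseteq> resolvent_set lborel (H_op G0 V)"
    and "\<And>h. h > 0 \<Longrightarrow>
           complex_of_real ` {..- \<mu>} \<subseteq> resolvent_set (grid_measure h) (Hh_op G0 V h)"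
  shows "\<exists>C>0. \<exists>h0>0. \<forall>h. 0 < h \<and> h \<le> h0 \<longrightarrow>
           hausdorff_dist
             (spectrum (grid_measure h) (shifted_inverse (grid_measure h) (Hh_op G0 V h) \<mu>))
             (spectrum lborel (shifted_inverse lborel (H_op G0 V) \<mu>))
           \<le> C * h powr rate_exponent p \<theta> \<tau> V"
proof -
  have pot: "admissible_potential \<theta> \<tau> \<psi>0 V" and sym: "admissible_symbol p G0"
    using assms(1) by (auto simp: admissible_data_def)
  obtain \<alpha> c C where G: "consistent_symbol G0 \<alpha> (symbol_exponent p) c C"
    using admissible_symbol_consistent[OF sym] by blast
  then have \<gamma>: "0 < symbol_exponent p" by (simp add: consistent_symbol_def)
  have "complex_of_real (- \<mu>) \<in> complex_of_real ` {..- \<mu>}" by (rule imageI) simp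
  then have res: "complex_of_real (- \<mu>) \<in> resolvent_set lborel (H_op G0 V)"
    "\<And>h. 0 < h \<Longrightarrow> complex_of_real (- \<mu>) \<in> resolvent_set (grid_measure h) (Hh_op G0 V h)"
    using assms(3,4) by blast+
  show ?thesis
  proof (cases "V = (\<lambda>_. 0)")
    case True
    then have \<rho>: "rate_exponent p \<theta> \<tau> V = symbol_exponent p" by (simp add: rate_exponent_def)
    show ?thesis
      unfolding \<rho>
    \<comment> \<open>The cutoff has multiplier 1 and the potential vanishes, so both of their
      errors are 0 and the full rate of the symbol remains.\<close>
    proof (rule hausdorff_rate[where J = cutoff_embedding and m = "\<lambda>_ _. 1" and mb = 1 and vb = 0 and km = 0 and kp = 0,
          OF G \<gamma> order_refl assms(2) _ _ _ _ _ _ _ res])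
      show "L2_norm lborel (\<lambda>x. complex_of_real (V x) * f x - q x) \<le> 0 * h powr symbol_exponent p * L2_norm (grid_measure h) u"
        if "0 < h" "(\<lambda>k. complex_of_real (V (h *\<^sub>R vec_of_int k)) * u k, q) \<in> cutoff_embedding h" for h u f q
        using isometry_norm[OF L2_isometry_cutoff_embedding that(2)] that(1) True by simp
    qed (use True L2_isometry_cutoff_embedding cutoff_embedding_fourier in auto)
  next
    case False
    define \<rho> where "\<rho> = rate_exponent p \<theta> \<tau> V"
    obtain k0 where k0: "\<And>x y. \<bar>V x - V y\<bar> \<le> k0 * norm (x - y) powr \<theta>" using pot by (auto simp: admissible_potential_def)
    have \<theta>: "0 < \<theta>" "\<theta> \<le> 1" and \<tau>: "real CARD('n) < \<tau>" and bV: "bounded (range V)"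
      using pot False by (auto simp: admissible_potential_def)
    obtain vb where vb: "\<And>x. \<bar>V x\<bar> \<le> vb" using bV by (auto simp: bounded_iff)
    have vb0: "0 \<le> vb" using vb[of 0] by linarith
    define k where "k = max 0 k0"
    have k: "0 \<le> k" "\<bar>V x - V y\<bar> \<le> k * norm (x - y) powr \<theta>" for x y
    proof -
      have "k0 * norm (x - y) powr \<theta> \<le> k * norm (x - y) powr \<theta>" by (intro mult_right_mono) (auto simp: k_def)
      with k0[of x y] show "\<bar>V x - V y\<bar> \<le> k * norm (x - y) powr \<theta>" by linarith
    qed (simp add: k_def)
    have Vm: "V \<in> borel_measurable borel"
      by (rule borel_measurable_continuous_onI[OF hoelder_imp_continuous[OF k0 \<theta>(1)]])
    have "0 < 1 / \<theta>" "0 < 1 / (\<tau> - real CARD('n))" using \<theta> \<tau> by auto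
    then have "0 < potential_exponent CARD('n) \<theta> \<tau>"
      unfolding potential_exponent_def by (intro divide_pos_pos add_pos_pos) auto
    \<comment> \<open>1 / \<theta>' is 1 / \<theta> plus a positive number, so \<theta>' <= \<theta>
      <= 1, within the reach of step functions.\<close>
    moreover have "potential_exponent CARD('n) \<theta> \<tau> \<le> 1 / (1 / \<theta>)"
      unfolding potential_exponent_def
      by (rule frac_le) (use \<open>0 < 1 / \<theta>\<close> \<open>0 < 1 / (\<tau> - real CARD('n))\<close> in linarith)+
    ultimately have \<rho>: "0 < \<rho>" "\<rho> \<le> symbol_exponent p" "\<rho> \<le> \<theta>" "\<rho> \<le> 1"
      using False \<gamma> \<theta> by (auto simp: \<rho>_def rate_exponent_def)
    obtain km where km: "km > 0"
      "\<And>h \<xi>. 0 < h \<Longrightarrow> h \<le> 1 \<Longrightarrow> \<xi> \<in> torus h \<Longrightarrow>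
         1 - (cell_mult h \<xi>)\<^sup>2 \<le> ((km * h powr \<rho>) * (1 + discrete_symbol G0 h \<xi>))\<^sup>2"
    proof (rule consistent_symbol_bounds[OF G \<rho>(1,2)])
      fix k assume "k > 0" "\<And>h \<xi>. 0 < h \<Longrightarrow> h \<le> 1 \<Longrightarrow> \<xi> \<in> torus h \<Longrightarrow> \<rho> \<le> 1 \<Longrightarrow>
         1 - (cell_mult h \<xi>)\<^sup>2 \<le> ((k * h powr \<rho>) * (1 + discrete_symbol G0 h \<xi>))\<^sup>2"
      then show thesis using that \<rho>(4) by blast
    qed
    define d where "d = real CARD('n)"
    show ?thesis
      unfolding \<rho>_def[symmetric]
    proof (rule hausdorff_rate[where J = haar_embedding and m = cell_mult and mb = "(1 / 2) ^ CARD('n)" and kp = "k * d powr \<theta>",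
          OF G \<rho>(1,2) assms(2) _ _ vb0 less_imp_le[OF km(1)] _ Vm vb res])
      fix h :: real assume h: "0 < h"
      show "L2_isometry (grid_measure h) lborel (haar_embedding h)" by (rule L2_isometry_haar_embedding[OF h])
      show "AE \<xi> in lborel. \<xi> \<in> torus h \<longrightarrow> P \<xi> = complex_of_real (cell_mult h \<xi>) * Q \<xi>"
        if "(u, p) \<in> haar_embedding h" "(p, P) \<in> fourier" "(u, Q) \<in> discrete_fourier h" for u p and P Q :: "real ^ 'n \<Rightarrow> complex"
        by (rule haar_embedding_fourier[OF h that])
      assume h1: "h \<le> 1"
      show "1 - (cell_mult h \<xi>)\<^sup>2 \<le> ((km * h powr \<rho>) * (1 + discrete_symbol G0 h \<xi>))\<^sup>2" if "\<xi> \<in> torus h" for \<xi>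
        by (rule km(2)[OF h h1 that])
      show "(1 / 2) ^ CARD('n) \<le> cell_mult h \<xi>" "cell_mult h \<xi> \<le> 1" if "\<xi> \<in> torus h" for \<xi> :: "real ^ 'n"
        by (rule cell_mult_bounds(1,2)[OF h that])+
      show "L2_norm lborel (\<lambda>x. complex_of_real (V x) * p x - q x) \<le> (k * d powr \<theta> * h powr \<rho>) * L2_norm (grid_measure h) u"
        if "(u, p) \<in> haar_embedding h" "(\<lambda>k. complex_of_real (V (h *\<^sub>R vec_of_int k)) * u k, q) \<in> haar_embedding h" for u p q
      proof -
        \<comment> \<open>Sampling the potential costs h^\<theta>, which for h <= 1 is at most
          h^\<rho> because \<rho> <= \<theta>.\<close>
        have "h powr \<theta> \<le> h powr \<rho>" using h h1 \<rho> by (intro powr_mono') auto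
        then have "k * (d * h) powr \<theta> \<le> k * d powr \<theta> * h powr \<rho>"
          using k(1) h by (simp add: powr_mult d_def mult.assoc mult_left_mono)
        then show ?thesis
          by (rule order_trans[OF haar_embedding_potential[OF h Vm vb k(2,1) \<theta>(1) that, folded d_def] mult_right_mono]) simp
      qed
    qed (use k(1) in \<open>auto simp: power_le_one\<close>)
  qed
qed

end
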